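(* Let $k$ be a field, let $m\ge 0$ and $n>0$ be integers, let $r$ be the number of distinct partitions of $m$, and let $\mu^1>\cdots>\mu^r$ be the partitions of $m$ in decreasing lexicographic order. Let $\underline{\lambda}=(\lambda^1,\ldots,\lambda^r)$ be an $r$-multipartition of $n$, and let $S^{\underline{\lambda}}$ be the associated Specht module for $k(S_m\wr S_n)$. Then the $k(S_m\wr S_{n-1})$-module obtained by restricting $S^{\underline{\lambda}}$ from $k(S_m\wr S_n)$ to $k(S_m\wr S_{n-1})$ has a filtration by the Specht modules $S^{\underline{\delta}}$ of $k(S_m\wr S_{n-1})$, for $\underline{\delta}$ ranging over the $r$-multipartitions of $n-1$, in which the multiplicities are as follows: if $\underline{\delta}$ may be obtained from $\underline{\lambda}$ by removing a single box from the partition $\lambda^i$ for some $i$ (while leaving all other partitions $\lambda^j$ unchanged), then $S^{\underline{\delta}}$ has multiplicity $\dim_k(S^{\mu^i})$; otherwise $S^{\underline{\delta}}$ has multiplicity zero.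
   Context: **Conventions.** All modules are right modules of finite $k$-dimension; $\otimes=\otimes_k$; permutations act on the right, written $(i)\sigma$, and are composed left to right. A partition of $n$ is a non-increasing tuple of positive integers with sum $n$ (the only partition of $0$ is the empty one); $|\lambda|$ denotes the size of $\lambda$. An $r$-multipartition of $n$ is a tuple $\underline{\eta}=(\eta^1,\ldots,\eta^r)$ of partitions whose sizes add up to $n$, and $|\underline{\eta}|$ denotes the composition $(|\eta^1|,\ldots,|\eta^r|)$ of $n$. Removing a box from a partition means removing one box from its Young diagram so that the result is again the Young diagram of a partition. For a composition $\gamma=(\gamma_1,\ldots,\gamma_r)$ of $n$ (zero parts allowed), $S_\gamma\cong S_{\gamma_1}\times\cdots\times S_{\gamma_r}$ is the corresponding Young subgroup of $S_n$ (the $i$-th factor permutes the $i$-th block of consecutive integers, of size $\gamma_i$). For $\lambda$ a partition of $n$, $S^\lambda$ denotes the usual Specht module of $kS_n$ (in James's convention: the submodule of the permutation module on $\lambda$-tabloids spanned by the polytabloids, so $S^{(n)}$ is trivial; for $n=0$ it is $k$). **Wreath products.** $S_m\wr S_n$ is the set of tuples $(\sigma;\alpha_1,\ldots,\alpha_n)$ with $\sigma\in S_n$, $\alpha_i\in S_m$, with multiplication $$(\sigma;\alpha_1,\ldots,\alpha_n)(\pi;\beta_1,\ldots,\beta_n)=(\sigma\pi;\alpha_{(1)\pi^{-1}}\beta_1,\ldots,\alpha_{(n)\pi^{-1}}\beta_n).$$ For a subgroup $H\le S_n$, $S_m\wr H$ is the subgroup of elements with $\sigma\in H$. Regarding $S_{n-1}$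 as the subgroup of $S_n$ fixing $n$, the group $S_m\wr S_{n-1}$ is regarded as a subgroup of $S_m\wr S_n$ via the embedding $(\sigma;\alpha_1,\ldots,\alpha_{n-1})\mapsto(\sigma;\alpha_1,\ldots,\alpha_{n-1},e)$. **Wreath product Specht modules.** For an $r$-multipartition $\underline{\lambda}$ of $n$ put $\gamma=|\underline{\lambda}|$ and let $T^{\underline{\lambda}}$ be the $k(S_m\wr S_\gamma)$-module with underlying space $$(S^{\mu^1})^{\otimes\gamma_1}\otimes\cdots\otimes(S^{\mu^r})^{\otimes\gamma_r}\otimes Y,\qquad Y=S^{\lambda^1}\boxtimes\cdots\boxtimes S^{\lambda^r}$$ ($Y$ being viewed as a $kS_\gamma$-module via $S_\gamma\cong S_{\gamma_1}\times\cdots\times S_{\gamma_r}$), and action $$(x_1\otimes\cdots\otimes x_n\otimes y)(\sigma;\alpha_1,\ldots,\alpha_n)=(x_{(1)\sigma^{-1}}\alpha_1)\otimes\cdots\otimes(x_{(n)\sigma^{-1}}\alpha_n)\otimes(y\sigma).$$ The Specht module $S^{\underline{\lambda}}$ for $k(S_m\wr S_n)$ is the module induced from $T^{\underline{\lambda}}$ from $k(S_m\wr S_\gamma)$ to $k(S_m\wr S_n)$. The Specht modules $S^{\underline{\delta}}$ for $k(S_m\wr S_{n-1})$, with $\underline{\delta}$ an $r$-multipartition of $n-1$, are defined in the same way with $n-1$ in place of $n$ (and the same enumeration $\mu^1,\ldots,\mu^r$). **Filtrations.** A module $M$ has a filtration by modules $X_1,\ldots,X_s$ in which $X_i$ has multiplicity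 $a_i$ if there are a chain of submodules $M=M_N\supseteq M_{N-1}\supseteq\cdots\supseteq M_0=0$ and a function $f:\{1,\ldots,N\}\to\{1,\ldots,s\}$ such that $M_l/M_{l-1}\cong X_{f(l)}$ for every $l$ and $|f^{-1}(i)|=a_i$ for every $i$. (The $X_i$ are not assumed pairwise non-isomorphic.) *)

theory Defs
  imports
    "HOL-Algebra.Algebraic_Closure_Type"
    "HOL-Combinatorics.Permutations"
    "HOL-Library.Function_Algebras"
begin

section \<open>Modules over group algebras\<close>

text \<open>
  A right \<open>kG\<close>-module, for \<open>k\<close> the field given by the type \<^typ>\<open>'k\<close>, is a \<open>k\<close>-vector space with a
  linear right action of \<open>G\<close>.  The group acting is a field of the record, so that restriction
  to a subgroup is an operation on records. The fields \<open>mult\<close> and \<open>one\<close>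
  inherited from the library record \<open>module\<close> carry no information.
\<close>

record ('k, 'v, 'g) gmod = "('k, 'v) module" +
  grp :: "'g monoid"
  act :: "'v \<Rightarrow> 'g \<Rightarrow> 'v"

abbreviation scalars :: "'k::field ring" where
  "scalars \<equiv> ring_of_type_algebra"

locale gmodule = G?: group "grp M" + M?: module scalars M
  for M :: "('k::field, 'v, 'g) gmod" (structure) +
  assumes act_closed: "\<lbrakk>v \<in> carrier M; g \<in> carrier (grp M)\<rbrakk> \<Longrightarrow> act M v g \<in> carrier M"
    and act_add: "\<lbrakk>v \<in> carrier M; w \<in> carrier M; g \<in> carrier (grp M)\<rbrakk>
      \<Longrightarrow> act M (v \<oplus>\<^bsub>M\<^esub> w) g = act M v g \<oplus>\<^bsub>M\<^esub> act M w g"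
    and act_smult: "\<lbrakk>v \<in> carrier M; g \<in> carrier (grp M)\<rbrakk>
      \<Longrightarrow> act M (c \<odot>\<^bsub>M\<^esub> v) g = c \<odot>\<^bsub>M\<^esub> act M v g"
    and act_one: "v \<in> carrier M \<Longrightarrow> act M v \<one>\<^bsub>grp M\<^esub> = v"
    and act_mult: "\<lbrakk>v \<in> carrier M; g \<in> carrier (grp M); h \<in> carrier (grp M)\<rbrakk>
      \<Longrightarrow> act M v (g \<otimes>\<^bsub>grp M\<^esub> h) = act M (act M v g) h"

definition res :: "'g monoid \<Rightarrow> ('k, 'v, 'g) gmod \<Rightarrow> ('k, 'v, 'g) gmod" where
  "res H M = M\<lparr>grp := H\<rparr>"

definition gsubmodule :: "('k::field, 'v, 'g) gmod \<Rightarrow> 'v set \<Rightarrow> bool" where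
  "gsubmodule M N \<longleftrightarrow> submodule N scalars M \<and> (\<forall>v\<in>N. \<forall>g\<in>carrier (grp M). act M v g \<in> N)"

definition sub :: "('k, 'v, 'g) gmod \<Rightarrow> 'v set \<Rightarrow> ('k, 'v, 'g) gmod" where
  "sub M N = M\<lparr>carrier := N\<rparr>"

text \<open>
  The quotient module \<open>M/N\<close>, whose elements are the cosets of \<open>N\<close>. Scalars and group elements act
  on representatives; the unions are unions of equal cosets, as in \<^const>\<open>rcoset_mult\<close>.
\<close>

definition quot :: "('k, 'v, 'g) gmod \<Rightarrow> 'v set \<Rightarrow> ('k, 'v set, 'g) gmod" where
  "quot M N =
    \<lparr>carrier = a_rcosets\<^bsub>M\<^esub> N, monoid.mult = undefined, one = undefined,
     zero = N, add = set_add M,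
     module.smult = (\<lambda>c A. \<Union>a\<in>A. N +>\<^bsub>M\<^esub> (c \<odot>\<^bsub>M\<^esub> a)),
     grp = grp M, act = (\<lambda>A g. \<Union>a\<in>A. N +>\<^bsub>M\<^esub> act M a g)\<rparr>"

definition gmod_iso :: "('k::field, 'v, 'g) gmod \<Rightarrow> ('k, 'w, 'g) gmod \<Rightarrow> bool" where
  "gmod_iso M N \<longleftrightarrow> grp M = grp N \<and>
    (\<exists>\<theta>. bij_betw \<theta> (carrier M) (carrier N) \<and>
      (\<forall>v\<in>carrier M. \<forall>w\<in>carrier M. \<theta> (v \<oplus>\<^bsub>M\<^esub> w) = \<theta> v \<oplus>\<^bsub>N\<^esub> \<theta> w) \<and>
      (\<forall>v\<in>carrier M. \<forall>c. \<theta> (c \<odot>\<^bsub>M\<^esub> v) = c \<odot>\<^bsub>N\<^esub> \<theta> v) \<and>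
      (\<forall>v\<in>carrier M. \<forall>g\<in>carrier (grp M). \<theta> (act M v g) = act N (\<theta> v) g))"

definition has_filtration ::
    "('k::field, 'v, 'g) gmod \<Rightarrow> 'i set \<Rightarrow> ('i \<Rightarrow> ('k, 'w, 'g) gmod) \<Rightarrow> ('i \<Rightarrow> nat) \<Rightarrow> bool" where
  "has_filtration M I S a \<longleftrightarrow>
    (\<exists>(N::nat) C f. C 0 = {\<zero>\<^bsub>M\<^esub>} \<and> C N = carrier M \<and>
      (\<forall>l\<le>N. gsubmodule M (C l)) \<and>
      (\<forall>l\<in>{1..N}. C (l - 1) \<subseteq> C l \<and> f l \<in> I \<and>
        gmod_iso (quot (sub M (C l)) (C (l - 1))) (S (f l))) \<and>
      (\<forall>i\<in>I. card {l\<in>{1..N}. f l = i} = a i))"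

text \<open>
  Induction from a subgroup \<open>H\<close> of a finite group \<open>G\<close>: the tensor product of \<open>T\<close> with \<open>kG\<close> over
  \<open>kH\<close>. As \<open>G\<close> is finite, the tensor product of \<open>T\<close> with \<open>kG\<close> over \<open>k\<close> is the space of functions
  from \<open>G\<close> to \<open>T\<close> (extended by zero to the type), the pure tensor of \<open>t\<close> and \<open>g\<close>
  being the function with value \<open>t\<close> at \<open>g\<close> and zero elsewhere, and \<open>G\<close> acting by right
  multiplication on \<open>kG\<close>.  The tensor product over \<open>kH\<close> is its quotient by the
  subspace spanned by all \<open>th \<otimes> g - t \<otimes> hg\<close>.
\<close>

definition pure_kG :: "('k, 'v, 'g) gmod \<Rightarrow> 'v \<Rightarrow> 'g \<Rightarrow> ('g \<Rightarrow> 'v)" where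
  "pure_kG T t g = (\<lambda>x. if x = g then t else \<zero>\<^bsub>T\<^esub>)"

definition tensor_kG :: "'g monoid \<Rightarrow> ('k, 'v, 'g) gmod \<Rightarrow> ('k, 'g \<Rightarrow> 'v, 'g) gmod" where
  "tensor_kG G T =
    \<lparr>carrier = {F. (\<forall>g\<in>carrier G. F g \<in> carrier T) \<and> (\<forall>g. g \<notin> carrier G \<longrightarrow> F g = \<zero>\<^bsub>T\<^esub>)},
     monoid.mult = undefined, one = undefined,
     zero = (\<lambda>_. \<zero>\<^bsub>T\<^esub>), add = (\<lambda>F F' g. F g \<oplus>\<^bsub>T\<^esub> F' g),
     module.smult = (\<lambda>c F g. c \<odot>\<^bsub>T\<^esub> F g),
     grp = G,
     act = (\<lambda>F g x. if x \<in> carrier G then F (x \<otimes>\<^bsub>G\<^esub> inv\<^bsub>G\<^esub> g) else \<zero>\<^bsub>T\<^esub>)\<rparr>"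

definition ind_rels :: "'g monoid \<Rightarrow> ('k::field, 'v, 'g) gmod \<Rightarrow> ('g \<Rightarrow> 'v) set" where
  "ind_rels G T =
    \<Inter>{N. submodule N scalars (tensor_kG G T) \<and>
      {pure_kG T (act T t h) g \<ominus>\<^bsub>tensor_kG G T\<^esub> pure_kG T t (h \<otimes>\<^bsub>G\<^esub> g) | t h g.
        t \<in> carrier T \<and> h \<in> carrier (grp T) \<and> g \<in> carrier G} \<subseteq> N}"

definition ind :: "'g monoid \<Rightarrow> ('k::field, 'v, 'g) gmod \<Rightarrow> ('k, ('g \<Rightarrow> 'v) set, 'g) gmod" where
  "ind G T = quot (tensor_kG G T) (ind_rels G T)"


section \<open>Spaces of functions and tensor products\<close>

definition fscale :: "'k::field \<Rightarrow> ('x \<Rightarrow> 'k) \<Rightarrow> ('x \<Rightarrow> 'k)" where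
  "fscale c f = (\<lambda>x. c * f x)"

interpretation fun_vs: vector_space "fscale :: 'k::field \<Rightarrow> ('x \<Rightarrow> 'k) \<Rightarrow> _"
  by unfold_locales (auto simp: fscale_def fun_eq_iff algebra_simps)

definition fun_module ::
    "'g monoid \<Rightarrow> ('x \<Rightarrow> 'k::field) set \<Rightarrow> (('x \<Rightarrow> 'k) \<Rightarrow> 'g \<Rightarrow> ('x \<Rightarrow> 'k)) \<Rightarrow> ('k, 'x \<Rightarrow> 'k, 'g) gmod" where
  "fun_module G V a =
    \<lparr>carrier = V, monoid.mult = undefined, one = undefined, zero = 0, add = (+),
     module.smult = fscale, grp = G, act = a\<rparr>"

text \<open>
  Tensor products over \<open>k\<close> of spaces of \<open>k\<close>-valued functions are realised as spaces of functions
  on the product, where the pure tensor of \<open>f\<^sub>0, \<dots>, f\<^sub>p\<close> is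
  \<open>(x\<^sub>0, \<dots>, x\<^sub>p) \<mapsto> f\<^sub>0 x\<^sub>0 * \<dots> * f\<^sub>p x\<^sub>p\<close>. That these spaces are tensor products is confirmed by
  \<open>tensors_independent\<close> and \<open>tensor2_independent\<close> below: the pure tensors of linearly independent
  families are linearly independent.
\<close>

definition tensors :: "('x \<Rightarrow> 'k::field) list \<Rightarrow> ('x list \<Rightarrow> 'k)" where
  "tensors fs = (\<lambda>xs. if length xs = length fs then \<Prod>i<length fs. (fs ! i) (xs ! i) else 0)"

definition tensor_space :: "('x \<Rightarrow> 'k::field) set list \<Rightarrow> ('x list \<Rightarrow> 'k) set" where
  "tensor_space Vs = fun_vs.span (tensors ` listset Vs)"

definition tensor2 :: "('x \<Rightarrow> 'k::field) \<Rightarrow> ('y \<Rightarrow> 'k) \<Rightarrow> ('x \<times> 'y \<Rightarrow> 'k)" where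
  "tensor2 f g = (\<lambda>(x, y). f x * g y)"

definition tensor2_space ::
    "('x \<Rightarrow> 'k::field) set \<Rightarrow> ('y \<Rightarrow> 'k) set \<Rightarrow> ('x \<times> 'y \<Rightarrow> 'k) set" where
  "tensor2_space V W = fun_vs.span {tensor2 f g | f g. f \<in> V \<and> g \<in> W}"


section \<open>Partitions and Specht modules of symmetric groups\<close>

text \<open>
  \<open>S\<^sub>n\<close> acts on \<open>{0, \<dots>, n - 1}\<close>, and rows, columns, blocks and positions are numbered
  from 0.  Permutations act on the right, so the product \<open>\<sigma>\<pi>\<close> is the function \<open>\<pi> \<circ> \<sigma>\<close>.
\<close>

type_synonym perm = "nat \<Rightarrow> nat"
type_synonym tabloid = "nat set list"

definition perms :: "nat \<Rightarrow> perm set" where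
  "perms n = {\<sigma>. \<sigma> permutes {..<n}}"

definition partitions :: "nat \<Rightarrow> nat list set" where
  "partitions n = {\<nu>. sorted_wrt (\<ge>) \<nu> \<and> (\<forall>x\<in>set \<nu>. 0 < x) \<and> sum_list \<nu> = n}"

definition diagram :: "nat list \<Rightarrow> (nat \<times> nat) set" where
  "diagram \<nu> = {(i, j). i < length \<nu> \<and> j < \<nu> ! i}"

definition removes_box :: "nat list \<Rightarrow> nat list \<Rightarrow> bool" where
  "removes_box \<nu> \<kappa> \<longleftrightarrow> (\<exists>N. \<kappa> \<in> partitions N) \<and> (\<exists>b\<in>diagram \<nu>. diagram \<kappa> = diagram \<nu> - {b})"

text \<open>A tableau is the list of its rows, and a tabloid the list of the sets of entries of its rows.\<close>

definition tableaux :: "nat list \<Rightarrow> nat list list set" where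
  "tableaux \<nu> = {t. map length t = \<nu> \<and> distinct (concat t) \<and> set (concat t) = {..<sum_list \<nu>}}"

definition tabloid_of :: "nat list list \<Rightarrow> tabloid" where
  "tabloid_of t = map set t"

definition tabloid_perm :: "tabloid \<Rightarrow> perm \<Rightarrow> tabloid" where
  "tabloid_perm U \<sigma> = map (\<lambda>R. \<sigma> ` R) U"

definition column :: "nat list list \<Rightarrow> nat \<Rightarrow> nat set" where
  "column t j = {R ! j | R. R \<in> set t \<and> j < length R}"

definition column_stabilizer :: "nat list list \<Rightarrow> perm set" where
  "column_stabilizer t =
    {\<pi>. \<pi> permutes set (concat t) \<and> (\<forall>j. \<pi> ` column t j = column t j)}"

text \<open>
  Vectors of the permutation module are functions on tabloids, a tabloid \<open>U\<close> being identified with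
  its indicator function; as the action takes the basis vector \<open>U\<close> to the basis vector \<open>U\<sigma>\<close>, it takes
  \<open>f\<close> to the function \<open>U \<mapsto> f (U\<sigma>\<inverse>)\<close>.
\<close>

definition tabloid_act :: "(tabloid \<Rightarrow> 'k::field) \<Rightarrow> perm \<Rightarrow> (tabloid \<Rightarrow> 'k)" where
  "tabloid_act f \<sigma> = (\<lambda>U. f (tabloid_perm U (Hilbert_Choice.inv \<sigma>)))"

definition polytabloid :: "nat list list \<Rightarrow> (tabloid \<Rightarrow> 'k::field)" where
  "polytabloid t = (\<lambda>U. \<Sum>\<pi>\<in>column_stabilizer t.
     if U = tabloid_perm (tabloid_of t) \<pi> then of_int (sign \<pi>) else 0)"

definition specht :: "nat list \<Rightarrow> (tabloid \<Rightarrow> 'k::field) set" where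
  "specht \<nu> = fun_vs.span (polytabloid ` tableaux \<nu>)"


section \<open>Young subgroups and wreath products\<close>

definition offset :: "nat list \<Rightarrow> nat \<Rightarrow> nat" where
  "offset \<gamma> i = sum_list (take i \<gamma>)"

definition block :: "nat list \<Rightarrow> nat \<Rightarrow> nat set" where
  "block \<gamma> i = {offset \<gamma> i ..< offset \<gamma> i + \<gamma> ! i}"

definition young :: "nat list \<Rightarrow> perm set" where
  "young \<gamma> = {\<sigma>. \<sigma> permutes {..<sum_list \<gamma>} \<and> (\<forall>i<length \<gamma>. \<sigma> ` block \<gamma> i = block \<gamma> i)}"

text \<open>The component in the \<open>i\<close>-th factor of the product of symmetric groups.\<close>

definition young_component :: "nat list \<Rightarrow> perm \<Rightarrow> nat \<Rightarrow> perm" where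
  "young_component \<gamma> \<sigma> i = (\<lambda>x. if x < \<gamma> ! i then \<sigma> (x + offset \<gamma> i) - offset \<gamma> i else x)"

text \<open>
  The elements \<open>(\<sigma>; \<alpha>\<^sub>0, \<dots>, \<alpha>\<^sub>n\<^sub>-\<^sub>1)\<close> are pairs of \<open>\<sigma>\<close> and the family \<open>\<alpha>\<close> continued by the identity; the
  embedding for \<open>n - 1\<close> into that for \<open>n\<close> is then an inclusion.
\<close>

type_synonym wreath_elem = "perm \<times> (nat \<Rightarrow> perm)"

definition wreath :: "nat \<Rightarrow> nat \<Rightarrow> perm set \<Rightarrow> wreath_elem monoid" where
  "wreath m n H =
    \<lparr>carrier = {(\<sigma>, \<alpha>). \<sigma> \<in> H \<and> (\<forall>i<n. \<alpha> i \<in> perms m) \<and> (\<forall>i\<ge>n. \<alpha> i = id)},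
     monoid.mult = (\<lambda>(\<sigma>, \<alpha>) (\<pi>, \<beta>). (\<pi> \<circ> \<sigma>, \<lambda>i. \<beta> i \<circ> \<alpha> (Hilbert_Choice.inv \<pi> i))),
     one = (id, \<lambda>_. id)\<rparr>"


section \<open>Specht modules of wreath products\<close>

definition multipartitions :: "nat \<Rightarrow> nat \<Rightarrow> nat list list set" where
  "multipartitions r n =
    {\<eta>. length \<eta> = r \<and> (\<forall>\<nu>\<in>set \<eta>. \<exists>N. \<nu> \<in> partitions N) \<and> sum_list (map sum_list \<eta>) = n}"

definition shape :: "nat list list \<Rightarrow> nat list" where
  "shape \<eta> = map sum_list \<eta>"

definition outer_act ::
    "nat list \<Rightarrow> (tabloid list \<Rightarrow> 'k::field) \<Rightarrow> perm \<Rightarrow> (tabloid list \<Rightarrow> 'k)" where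
  "outer_act \<gamma> y \<sigma> = (\<lambda>Us. y
    (map (\<lambda>i. tabloid_perm (Us ! i) (Hilbert_Choice.inv (young_component \<gamma> \<sigma> i))) [0..<length Us]))"

definition outer_specht :: "nat list list \<Rightarrow> (tabloid list \<Rightarrow> 'k::field) set" where
  "outer_specht \<eta> = tensor_space (map specht \<eta>)"

text \<open>
  The action on \<open>T\<close>, for functions on the product of the sets of tabloids;
  \<open>wreath_act_tensor\<close> below gives its effect on pure tensors.
\<close>

definition wreath_act ::
    "nat list \<Rightarrow> (tabloid list \<times> tabloid list \<Rightarrow> 'k::field) \<Rightarrow> wreath_elem \<Rightarrow>
      (tabloid list \<times> tabloid list \<Rightarrow> 'k)" where
  "wreath_act \<gamma> F = (\<lambda>(\<sigma>, \<alpha>) (Ts, Us). outer_act \<gamma> (\<lambda>Us'. F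
     (map (\<lambda>i. tabloid_perm (Ts ! \<sigma> i) (Hilbert_Choice.inv (\<alpha> (\<sigma> i)))) [0..<length Ts], Us')) \<sigma> Us)"

type_synonym 'k T_vec = "tabloid list \<times> tabloid list \<Rightarrow> 'k"

definition T_module ::
    "nat \<Rightarrow> nat list list \<Rightarrow> nat list list \<Rightarrow> ('k::field, 'k T_vec, wreath_elem) gmod" where
  "T_module m \<mu> \<eta> =
    fun_module (wreath m (sum_list (shape \<eta>)) (young (shape \<eta>)))
      (tensor2_space
        (tensor_space (concat (map2 (\<lambda>g \<nu>. replicate g (specht \<nu>)) (shape \<eta>) \<mu>)))
        (outer_specht \<eta>))
      (wreath_act (shape \<eta>))"

definition wreath_specht ::
    "nat \<Rightarrow> nat list list \<Rightarrow> nat list list \<Rightarrow>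
      ('k::field, (wreath_elem \<Rightarrow> 'k T_vec) set, wreath_elem) gmod" where
  "wreath_specht m \<mu> \<eta> =
    ind (wreath m (sum_list (shape \<eta>)) (perms (sum_list (shape \<eta>)))) (T_module m \<mu> \<eta>)"


section \<open>Effect of the actions on pure tensors\<close>

lemma outer_act_tensors:
  "outer_act \<gamma> (tensors ys) \<sigma> =
    tensors (map (\<lambda>i. tabloid_act (ys ! i) (young_component \<gamma> \<sigma> i)) [0..<length ys])"
  by (rule ext) (simp add: outer_act_def tensors_def tabloid_act_def)

lemma wreath_act_tensor:
  assumes "(\<sigma>, \<alpha>) \<in> carrier (wreath m (sum_list \<gamma>) (young \<gamma>))" "length xs = sum_list \<gamma>"
  shows "wreath_act \<gamma> (tensor2 (tensors xs) y) (\<sigma>, \<alpha>) =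
    tensor2
      (tensors (map (\<lambda>i. tabloid_act (xs ! Hilbert_Choice.inv \<sigma> i) (\<alpha> i)) [0..<sum_list \<gamma>]))
      (outer_act \<gamma> y \<sigma>)"
proof -
  let ?n = "sum_list \<gamma>"
  have p: "\<sigma> permutes {..<?n}" using assms by (simp add: wreath_def young_def)
  have lt: "\<sigma> i < ?n" "Hilbert_Choice.inv \<sigma> i < ?n" if "i < ?n" for i
    using permutes_in_image[OF p, of i] permutes_in_image[OF permutes_inv[OF p], of i] that by auto
  have *: "(\<Prod>i<?n. (xs ! i) (tabloid_perm (Ts ! \<sigma> i) (Hilbert_Choice.inv (\<alpha> (\<sigma> i))))) =
      (\<Prod>i<?n. (xs ! Hilbert_Choice.inv \<sigma> i) (tabloid_perm (Ts ! i) (Hilbert_Choice.inv (\<alpha> i))))" for Ts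
    by (rule prod.reindex_bij_witness[where i = "Hilbert_Choice.inv \<sigma>" and j = \<sigma>])
      (simp_all add: permutes_inverses[OF p] lt)
  show ?thesis
  proof (rule ext)
    fix z :: "tabloid list \<times> tabloid list"
    obtain Ts Us where z: "z = (Ts, Us)" by fastforce
    show "wreath_act \<gamma> (tensor2 (tensors xs) y) (\<sigma>, \<alpha>) z = tensor2
      (tensors (map (\<lambda>i. tabloid_act (xs ! Hilbert_Choice.inv \<sigma> i) (\<alpha> i)) [0..<sum_list \<gamma>]))
      (outer_act \<gamma> y \<sigma>) z"
      using assms(2) *[of Ts]
      by (cases "length Ts = ?n")
        (simp_all add: z wreath_act_def outer_act_def tensor2_def tensors_def tabloid_act_def)
  qed
qed


section \<open>Pure tensors of linearly independent families are linearly independent\<close>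

definition fam_indep :: "'i set \<Rightarrow> ('i \<Rightarrow> 'x \<Rightarrow> 'k::field) \<Rightarrow> bool" where
  "fam_indep I h \<longleftrightarrow> (\<forall>S c. finite S \<longrightarrow> S \<subseteq> I \<longrightarrow> (\<forall>x. (\<Sum>i\<in>S. c i * h i x) = 0) \<longrightarrow> (\<forall>i\<in>S. c i = 0))"

lemma fam_indepD:
  "\<lbrakk>fam_indep I h; finite S; S \<subseteq> I; \<And>x. (\<Sum>i\<in>S. c i * h i x) = 0; i \<in> S\<rbrakk> \<Longrightarrow> c i = 0"
  unfolding fam_indep_def by blast

lemma sum_fun_apply: "(\<Sum>i\<in>S. (f i :: 'x \<Rightarrow> 'k::field)) x = (\<Sum>i\<in>S. f i x)"
  by (induction S rule: infinite_finite_induct) auto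

lemma fam_indep_id_iff: "fam_indep B (\<lambda>f. f) \<longleftrightarrow> fun_vs.independent B"
  unfolding fam_indep_def fun_vs.dependent_explicit
  by (auto simp: fun_eq_iff sum_fun_apply fscale_def) 

lemma fam_indep_iff:
  fixes h :: "'i \<Rightarrow> 'x \<Rightarrow> 'k::field"
  shows "fam_indep I h \<longleftrightarrow> inj_on h I \<and> fun_vs.independent (h ` I)"
proof
  assume h: "fam_indep I h"
  have inj: "inj_on h I"
  proof (rule inj_onI, rule ccontr)
    fix i j assume ij: "i \<in> I" "j \<in> I" "h i = h j" "i \<noteq> j"
    have "(if i = i then 1 else - 1) = (0::'k)"
      by (rule fam_indepD[OF h, where S = "{i, j}" and c = "\<lambda>l. if l = i then 1 else - 1"])
        (use ij in auto)
    thus False by simp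
  qed
  have "fam_indep (h ` I) (\<lambda>f. f)"
    unfolding fam_indep_def
  proof (intro allI impI ballI)
    fix S c f assume S: "finite S" "S \<subseteq> h ` I" "\<forall>x. (\<Sum>f\<in>S. c f * f x) = 0" "f \<in> S"
    obtain J where J: "J \<subseteq> I" "S = h ` J" using S(2) by (meson subset_imageE)
    have injJ: "inj_on h J" using inj J inj_on_subset by blast
    obtain i where i: "i \<in> J" "f = h i" using S J by blast
    have "c (h i) = 0"
      by (rule fam_indepD[OF h, where S = J and c = "\<lambda>i. c (h i)"])
        (use S J injJ i finite_imageD[of h J] in \<open>auto simp: sum.reindex\<close>)
    thus "c f = 0" using i by simp
  qed
  thus "inj_on h I \<and> fun_vs.independent (h ` I)" using inj fam_indep_id_iff by blast
next
  assume h: "inj_on h I \<and> fun_vs.independent (h ` I)"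
  hence B: "fam_indep (h ` I) (\<lambda>f. f)" using fam_indep_id_iff by blast
  show "fam_indep I h" unfolding fam_indep_def
  proof (intro allI impI ballI)
    fix S c i assume S: "finite S" "S \<subseteq> I" "\<forall>x. (\<Sum>i\<in>S. c i * h i x) = 0" "i \<in> S"
    have injS: "inj_on h S" using h S inj_on_subset by blast
    have "c (inv_into S h (h i)) = 0"
      by (rule fam_indepD[OF B, where S = "h ` S" and c = "\<lambda>f. c (inv_into S h f)"])
        (use S injS in \<open>auto simp: sum.reindex inv_into_f_f\<close>)
    thus "c i = 0" using injS S by simp
  qed
qed

lemma fam_indep_prod:
  assumes "fam_indep A u" "fam_indep B v"
  shows "fam_indep (A \<times> B) (\<lambda>(a, b) (x, y). u a x * v b y)"
  unfolding fam_indep_def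
proof (intro allI impI ballI)
  fix S c p
  assume S: "finite S" "S \<subseteq> A \<times> B"
    "\<forall>z. (\<Sum>p\<in>S. c p * (case p of (a, b) \<Rightarrow> \<lambda>(x, y). u a x * v b y) z) = 0" "p \<in> S"
  define c' where "c' q = (if q \<in> S then c q else 0)" for q
  have sum: "(\<Sum>a\<in>fst ` S. \<Sum>b\<in>snd ` S. c' (a, b) * (u a x * v b y)) = 0" for x y
  proof -
    have "(\<Sum>a\<in>fst ` S. \<Sum>b\<in>snd ` S. c' (a, b) * (u a x * v b y)) =
      (\<Sum>(a, b)\<in>fst ` S \<times> snd ` S. c' (a, b) * (u a x * v b y))"
      by (rule sum.cartesian_product)
    also have "\<dots> = (\<Sum>(a, b)\<in>S. c' (a, b) * (u a x * v b y))"
      using S(1) by (intro sum.mono_neutral_right) (force simp: c'_def)+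
    also have "\<dots> = (\<Sum>p\<in>S. c p * (case p of (a, b) \<Rightarrow> \<lambda>(x, y). u a x * v b y) (x, y))"
      by (rule sum.cong) (auto simp: c'_def)
    finally show ?thesis using S(3) by simp
  qed
  obtain a b where p: "p = (a, b)" by fastforce
  have sub: "fst ` S \<subseteq> A" "snd ` S \<subseteq> B" "a \<in> fst ` S" "b \<in> snd ` S"
    using S p by force+
  have sum': "(\<Sum>a\<in>fst ` S. (\<Sum>b\<in>snd ` S. c' (a, b) * v b y) * u a x) = 0" for x y
    using sum[of x y] by (simp add: sum_distrib_left sum_distrib_right mult_ac)
  have "(\<Sum>b\<in>snd ` S. c' (a, b) * v b y) = 0" for y
    by (rule fam_indepD[OF assms(1) finite_imageI[OF S(1)] sub(1) sum' sub(3)])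
  hence "c' (a, b) = 0"
    by (rule fam_indepD[OF assms(2) finite_imageI[OF S(1)] sub(2) _ sub(4),
          where c = "\<lambda>b. c' (a, b)"])
  thus "c p = 0" using S p by (simp add: c'_def)
qed

lemma tensor2_independent:
  assumes "fun_vs.independent A" "fun_vs.independent B"
  shows "inj_on (\<lambda>(f, g). tensor2 f g) (A \<times> B)"
    and "fun_vs.independent ((\<lambda>(f, g). tensor2 f g) ` (A \<times> B))"
  using fam_indep_prod[OF assms[folded fam_indep_id_iff]]
  unfolding fam_indep_iff tensor2_def by blast+

lemma fam_indep_tensors:
  assumes "\<forall>B\<in>set Bs. fun_vs.independent B"
  shows "fam_indep (listset Bs) tensors"
  using assms
proof (induction Bs)
  case Nil
  show ?case
    by (auto simp: fam_indep_def tensors_def subset_singleton_iff)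
next
  case (Cons B Bs)
  have *: "fam_indep (B \<times> listset Bs) (\<lambda>(f, fs) (x, xs). f x * tensors fs xs)"
    by (rule fam_indep_prod) (use Cons fam_indep_id_iff in auto)
  show ?case unfolding fam_indep_def
  proof (intro allI impI ballI)
    fix S c fs
    assume S: "finite S" "S \<subseteq> listset (B # Bs)" "\<forall>x. (\<Sum>i\<in>S. c i * tensors i x) = 0" "fs \<in> S"
    let ?u = "\<lambda>fs :: ('a \<Rightarrow> 'b) list. (hd fs, tl fs)"
    have ne: "gs \<noteq> []" if "gs \<in> S" for gs using S(2) that by (auto simp: set_Cons_def)
    have inj: "inj_on ?u S" by (rule inj_onI) (metis ne list.collapse prod.inject)
    have tc: "tensors gs (x # xs) = hd gs x * tensors (tl gs) xs" if "gs \<in> S" for gs x xs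
      using ne[OF that] by (cases gs)
        (auto simp: tensors_def lessThan_Suc_eq_insert_0 prod.reindex simp del: prod.lessThan_Suc)
    have "(\<lambda>(f, fs). c (f # fs)) (?u fs) = 0"
    proof (rule fam_indepD[OF *, where S = "?u ` S"])
      show "?u ` S \<subseteq> B \<times> listset Bs" using S(2) by (force simp: set_Cons_def)
      fix z :: "'a \<times> 'a list"
      obtain x xs where z: "z = (x, xs)" by fastforce
      have "(\<Sum>p\<in>?u ` S. (\<lambda>(f, fs). c (f # fs)) p *
          (case p of (f, fs) \<Rightarrow> \<lambda>(x, xs). f x * tensors fs xs) z) =
        (\<Sum>gs\<in>S. c gs * tensors gs (x # xs))"
        by (subst sum.reindex[OF inj], rule sum.cong) (auto simp: z tc ne)
      thus "(\<Sum>p\<in>?u ` S. (\<lambda>(f, fs). c (f # fs)) p *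
          (case p of (f, fs) \<Rightarrow> \<lambda>(x, xs). f x * tensors fs xs) z) = 0"
        using S(3) by simp
    qed (use S in auto)
    thus "c fs = 0" using ne S(4) by simp
  qed
qed

lemma tensors_independent:
  assumes "\<forall>B\<in>set Bs. fun_vs.independent B"
  shows "inj_on tensors (listset Bs)" and "fun_vs.independent (tensors ` listset Bs)"
  using fam_indep_tensors[OF assms] unfolding fam_indep_iff by simp_all


section \<open>The Specht modules of wreath products are modules\<close>

lemma wreath_group:
  assumes "H \<subseteq> perms n" "id \<in> H"
    and "\<And>\<sigma> \<pi>. \<lbrakk>\<sigma> \<in> H; \<pi> \<in> H\<rbrakk> \<Longrightarrow> \<pi> \<circ> \<sigma> \<in> H"
    and "\<And>\<sigma>. \<sigma> \<in> H \<Longrightarrow> Hilbert_Choice.inv \<sigma> \<in> H"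
  shows "group (wreath m n H)"
proof (rule groupI)
  have perm: "\<sigma> permutes {..<n}" if "\<sigma> \<in> H" for \<sigma>
    using assms(1) that by (auto simp: perms_def)
  have lt: "Hilbert_Choice.inv \<sigma> i < n \<longleftrightarrow> i < n" if "\<sigma> \<in> H" for \<sigma> i
    using permutes_in_image[OF permutes_inv[OF perm[OF that]], of i] by simp
  fix x y assume xy: "x \<in> carrier (wreath m n H)" "y \<in> carrier (wreath m n H)"
  show "x \<otimes>\<^bsub>wreath m n H\<^esub> y \<in> carrier (wreath m n H)"
  proof -
    obtain \<sigma> \<alpha> \<pi> \<beta> where [simp]: "x = (\<sigma>, \<alpha>)" "y = (\<pi>, \<beta>)" by fastforce
    have "Hilbert_Choice.inv \<pi> i = i" if "i \<ge> n" for i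
      using xy that permutes_not_in[OF permutes_inv[OF perm], of \<pi> i] by (auto simp: wreath_def)
    thus ?thesis using xy assms(3) lt
      by (auto simp: wreath_def perms_def intro!: permutes_compose)
  qed
  fix z assume z: "z \<in> carrier (wreath m n H)"
  show "x \<otimes>\<^bsub>wreath m n H\<^esub> y \<otimes>\<^bsub>wreath m n H\<^esub> z =
      x \<otimes>\<^bsub>wreath m n H\<^esub> (y \<otimes>\<^bsub>wreath m n H\<^esub> z)"
  proof -
    obtain \<sigma> \<alpha> \<pi> \<beta> \<rho> \<gamma> where [simp]: "x = (\<sigma>, \<alpha>)" "y = (\<pi>, \<beta>)" "z = (\<rho>, \<gamma>)"
      by (metis surj_pair)
    have "bij \<pi>" "bij \<rho>" using xy z perm permutes_bij by (auto simp: wreath_def)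
    thus ?thesis by (simp add: wreath_def o_assoc o_inv_distrib fun_eq_iff)
  qed
next
  show "\<one>\<^bsub>wreath m n H\<^esub> \<in> carrier (wreath m n H)"
    using assms(2) by (auto simp: wreath_def perms_def permutes_id)
next
  fix x assume "x \<in> carrier (wreath m n H)"
  thus "\<one>\<^bsub>wreath m n H\<^esub> \<otimes>\<^bsub>wreath m n H\<^esub> x = x"
    by (auto simp: wreath_def)
next
  fix x assume x: "x \<in> carrier (wreath m n H)"
  obtain \<sigma> \<alpha> where [simp]: "x = (\<sigma>, \<alpha>)" by fastforce
  have \<sigma>: "\<sigma> \<in> H" using x by (simp add: wreath_def)
  hence p: "\<sigma> permutes {..<n}" using assms(1) by (auto simp: perms_def)
  have sg: "\<sigma> i < n \<longleftrightarrow> i < n" "i \<ge> n \<Longrightarrow> \<sigma> i = i" for i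
    using permutes_in_image[OF p, of i] permutes_not_in[OF p, of i] by auto
  have \<alpha>: "bij (\<alpha> i)" for i
    using x permutes_bij by (cases "i < n") (auto simp: wreath_def perms_def)
  let ?y = "(Hilbert_Choice.inv \<sigma>, \<lambda>i. Hilbert_Choice.inv (\<alpha> (\<sigma> i)))"
  have "?y \<in> carrier (wreath m n H)"
    using x assms(4)[OF \<sigma>] sg by (auto simp: wreath_def perms_def intro!: permutes_inv)
  moreover have "?y \<otimes>\<^bsub>wreath m n H\<^esub> x = \<one>\<^bsub>wreath m n H\<^esub>"
  proof -
    have "\<sigma> (Hilbert_Choice.inv \<sigma> i) = i" for i
      using permutes_inverses(1)[OF p] .
    thus ?thesis using \<alpha> by (auto simp: wreath_def fun_eq_iff bij_is_surj surj_f_inv_f)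
  qed
  ultimately show "\<exists>y\<in>carrier (wreath m n H). y \<otimes>\<^bsub>wreath m n H\<^esub> x = \<one>\<^bsub>wreath m n H\<^esub>"
    by blast
qed

lemma wreath_group_perms: "group (wreath m n (perms n))"
  by (rule wreath_group) (auto simp: perms_def permutes_id permutes_compose permutes_inv)

lemma wreath_group_young: "group (wreath m (sum_list \<gamma>) (young \<gamma>))"
proof (rule wreath_group)
  fix \<sigma> assume \<sigma>: "\<sigma> \<in> young \<gamma>"
  hence p: "\<sigma> permutes {..<sum_list \<gamma>}" by (simp add: young_def)
  have "Hilbert_Choice.inv \<sigma> ` block \<gamma> i = block \<gamma> i" if "i < length \<gamma>" for i
  proof -
    have "\<sigma> ` block \<gamma> i = block \<gamma> i" using \<sigma> that by (simp add: young_def)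
    hence "Hilbert_Choice.inv \<sigma> ` (\<sigma> ` block \<gamma> i) = Hilbert_Choice.inv \<sigma> ` block \<gamma> i" by simp
    thus ?thesis using permutes_inj[OF p] by (simp add: image_image)
  qed
  thus "Hilbert_Choice.inv \<sigma> \<in> young \<gamma>" using p by (auto simp: young_def permutes_inv)
next
  fix \<sigma> \<pi> assume "\<sigma> \<in> young \<gamma>" "\<pi> \<in> young \<gamma>"
  thus "\<pi> \<circ> \<sigma> \<in> young \<gamma>"
    unfolding young_def mem_Collect_eq by (metis image_comp permutes_compose)
qed (auto simp: young_def perms_def permutes_id)

lemma wreath_young_subset: "carrier (wreath m (sum_list \<gamma>) (young \<gamma>)) \<subseteq>
    carrier (wreath m (sum_list \<gamma>) (perms (sum_list \<gamma>)))"
  by (auto simp: wreath_def young_def perms_def)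

lemma wreath_pred_subset:
  assumes "k \<le> n"
  shows "carrier (wreath m k (perms k)) \<subseteq> carrier (wreath m n (perms n))"
proof
  fix x assume x: "x \<in> carrier (wreath m k (perms k))"
  obtain \<sigma> \<alpha> where [simp]: "x = (\<sigma>, \<alpha>)" by fastforce
  have "\<sigma> permutes {..<k}"
    using x by (simp add: wreath_def perms_def)
  hence "\<sigma> permutes {..<n}"
    by (rule permutes_subset) (use assms in auto)
  moreover have "\<alpha> i permutes {..<m}" for i
    using x by (cases "i < k") (simp_all add: wreath_def perms_def permutes_id)
  ultimately show "x \<in> carrier (wreath m n (perms n))"
    using x assms by (simp add: wreath_def perms_def)
qed

lemma submodule_scalarsI:
  assumes "gmodule M" "N \<subseteq> carrier M" "\<zero>\<^bsub>M\<^esub> \<in> N"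
    and "\<And>a b. \<lbrakk>a \<in> N; b \<in> N\<rbrakk> \<Longrightarrow> a \<oplus>\<^bsub>M\<^esub> b \<in> N" "\<And>c a. a \<in> N \<Longrightarrow> c \<odot>\<^bsub>M\<^esub> a \<in> N"
  shows "submodule N scalars M"
proof -
  interpret gmodule M by fact
  have "\<ominus>\<^bsub>M\<^esub> a \<in> N" if "a \<in> N" for a
  proof -
    have "(\<ominus>\<^bsub>scalars\<^esub> \<one>\<^bsub>scalars\<^esub>) \<odot>\<^bsub>M\<^esub> a = \<ominus>\<^bsub>M\<^esub> a"
      using assms(2) that by (simp add: smult_l_minus subsetD)
    thus ?thesis using assms(5)[OF that] by metis
  qed
  thus ?thesis using assms by (intro M.submoduleI) auto
qed

lemma quot_gmodule:
  assumes "gmodule M" "gsubmodule M N"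
  shows "gmodule (quot M N)"
proof -
  interpret gmodule M by fact
  interpret N: submodule N scalars M using assms(2) by (simp add: gsubmodule_def)
  interpret N: abelian_subgroup N M
    by (rule abelian_subgroupI3[OF additive_subgroup.intro]) (unfold_locales)
  let ?Q = "quot M N"
  have N_sub: "N \<subseteq> carrier M" using N.subset by simp
  have cadd: "(N +>\<^bsub>M\<^esub> a) \<oplus>\<^bsub>?Q\<^esub> (N +>\<^bsub>M\<^esub> b) = N +>\<^bsub>M\<^esub> (a \<oplus>\<^bsub>M\<^esub> b)"
    if "a \<in> carrier M" "b \<in> carrier M" for a b
    using N.a_rcos_sum[OF that] by (simp add: quot_def)
  have op: "(\<Union>a'\<in>N +>\<^bsub>M\<^esub> a. N +>\<^bsub>M\<^esub> \<psi> a') = N +>\<^bsub>M\<^esub> \<psi> a"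
    if "a \<in> carrier M" and N: "\<And>x. x \<in> N \<Longrightarrow> \<psi> x \<in> N" and cl: "\<And>x. x \<in> carrier M \<Longrightarrow> \<psi> x \<in> carrier M"
      and add: "\<And>x y. \<lbrakk>x \<in> carrier M; y \<in> carrier M\<rbrakk> \<Longrightarrow> \<psi> (x \<oplus>\<^bsub>M\<^esub> y) = \<psi> x \<oplus>\<^bsub>M\<^esub> \<psi> y" for \<psi> a
  proof -
    have "N +>\<^bsub>M\<^esub> \<psi> a' = N +>\<^bsub>M\<^esub> \<psi> a" if "a' \<in> N +>\<^bsub>M\<^esub> a" for a'
    proof -
      obtain x where x: "x \<in> N" "a' = x \<oplus>\<^bsub>M\<^esub> a"
        using \<open>a' \<in> _\<close> by (auto simp: a_r_coset_def r_coset_def)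
      have "\<psi> a' = \<psi> x \<oplus>\<^bsub>M\<^esub> \<psi> a" using x N_sub add \<open>a \<in> carrier M\<close> by blast
      hence "\<psi> a' \<in> N +>\<^bsub>M\<^esub> \<psi> a" using N[OF x(1)] by (auto simp: a_r_coset_def r_coset_def)
      thus ?thesis using M.a_repr_independence[OF _ cl[OF \<open>a \<in> carrier M\<close>] N.a_subgroup] by metis
    qed
    moreover have "a \<in> N +>\<^bsub>M\<^esub> a" using N.a_rcos_self[OF \<open>a \<in> carrier M\<close>] .
    ultimately show ?thesis by blast
  qed
  have csmult: "c \<odot>\<^bsub>?Q\<^esub> (N +>\<^bsub>M\<^esub> a) = N +>\<^bsub>M\<^esub> (c \<odot>\<^bsub>M\<^esub> a)" if "a \<in> carrier M" for c a
    using that op[of a "\<lambda>x. c \<odot>\<^bsub>M\<^esub> x"]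
    by (simp add: quot_def smult_r_distr ring_of_type_algebra_def)
  have cact: "act ?Q (N +>\<^bsub>M\<^esub> a) g = N +>\<^bsub>M\<^esub> act M a g"
    if "a \<in> carrier M" "g \<in> carrier (grp M)" for a g
    using that op[of a "\<lambda>x. act M x g"] assms(2)
    by (simp add: quot_def act_closed act_add gsubmodule_def)
  have car: "carrier ?Q = (\<lambda>a. N +>\<^bsub>M\<^esub> a) ` carrier M"
    by (auto simp: quot_def A_RCOSETS_def' image_def)
  have zero: "\<zero>\<^bsub>?Q\<^esub> = N +>\<^bsub>M\<^esub> \<zero>\<^bsub>M\<^esub>"
    using N_sub by (simp add: quot_def)
  have grp: "grp ?Q = grp M" by (simp add: quot_def)
  have UN: "carrier scalars = UNIV" by (simp add: ring_of_type_algebra_def)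
  have ab: "abelian_group ?Q"
  proof (rule abelian_groupI)
    fix x assume "x \<in> carrier ?Q"
    then obtain a where a: "a \<in> carrier M" "x = N +>\<^bsub>M\<^esub> a" by (auto simp: car)
    have "(N +>\<^bsub>M\<^esub> (\<ominus>\<^bsub>M\<^esub> a)) \<oplus>\<^bsub>?Q\<^esub> x = \<zero>\<^bsub>?Q\<^esub>"
      using a by (simp add: cadd zero M.l_neg)
    thus "\<exists>y\<in>carrier ?Q. y \<oplus>\<^bsub>?Q\<^esub> x = \<zero>\<^bsub>?Q\<^esub>" using a by (force simp: car)
  qed (auto simp: car cadd zero M.a_ac)
  show ?thesis
  proof (intro gmodule.intro gmodule_axioms.intro)
    show "module scalars ?Q"
    proof (rule moduleI[OF _ ab])
      show "cring scalars" by (rule cring_from_type_algebra)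
    qed (auto simp: car cadd csmult smult_l_distr smult_r_distr smult_assoc1 UN)
  qed (auto simp: car cadd csmult cact grp act_closed act_add act_smult act_one act_mult UN
      intro: G.is_group)
qed

lemma tensor_kG_gmodule:
  assumes "group G" "gmodule T"
  shows "gmodule (tensor_kG G T)"
proof -
  interpret G: group G by fact
  interpret T: gmodule T by fact
  let ?K = "tensor_kG G T"
  have UN: "carrier scalars = UNIV" by (simp add: ring_of_type_algebra_def)
  have car: "F \<in> carrier ?K \<longleftrightarrow> (\<forall>g. F g \<in> carrier T) \<and> (\<forall>g. g \<notin> carrier G \<longrightarrow> F g = \<zero>\<^bsub>T\<^esub>)" for F
    by (auto simp: tensor_kG_def)
  have zero: "\<zero>\<^bsub>?K\<^esub> = (\<lambda>_. \<zero>\<^bsub>T\<^esub>)" and add: "F \<oplus>\<^bsub>?K\<^esub> F' = (\<lambda>g. F g \<oplus>\<^bsub>T\<^esub> F' g)"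
    and smult: "c \<odot>\<^bsub>?K\<^esub> F = (\<lambda>g. c \<odot>\<^bsub>T\<^esub> F g)" and grp: "grp ?K = G"
    and act: "act ?K F g = (\<lambda>x. if x \<in> carrier G then F (x \<otimes>\<^bsub>G\<^esub> inv\<^bsub>G\<^esub> g) else \<zero>\<^bsub>T\<^esub>)" for F F' c g
    by (simp_all add: tensor_kG_def)
  have smult_zero: "c \<odot>\<^bsub>T\<^esub> \<zero>\<^bsub>T\<^esub> = \<zero>\<^bsub>T\<^esub>" for c
    by (rule T.smult_r_null) (simp add: UN)
  have scl: "c \<odot>\<^bsub>T\<^esub> a \<in> carrier T" if "a \<in> carrier T" for a c
    by (rule T.smult_closed) (simp_all add: UN that)
  have ab: "abelian_group ?K"
  proof (rule abelian_groupI)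
    fix F assume F: "F \<in> carrier ?K"
    have "(\<lambda>g. \<ominus>\<^bsub>T\<^esub> F g) \<in> carrier ?K" using F by (simp add: car)
    moreover have "(\<lambda>g. \<ominus>\<^bsub>T\<^esub> F g) \<oplus>\<^bsub>?K\<^esub> F = \<zero>\<^bsub>?K\<^esub>"
      using F by (simp add: add zero car T.M.l_neg)
    ultimately show "\<exists>F'\<in>carrier ?K. F' \<oplus>\<^bsub>?K\<^esub> F = \<zero>\<^bsub>?K\<^esub>" by blast
    show "\<zero>\<^bsub>?K\<^esub> \<oplus>\<^bsub>?K\<^esub> F = F" using F by (simp add: car zero add)
    fix F' assume F': "F' \<in> carrier ?K"
    show "F \<oplus>\<^bsub>?K\<^esub> F' \<in> carrier ?K" using F F' by (simp add: car add)
    show "F \<oplus>\<^bsub>?K\<^esub> F' = F' \<oplus>\<^bsub>?K\<^esub> F"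
      using F F' by (auto simp: car add intro!: ext T.M.a_comm)
    fix F'' assume F'': "F'' \<in> carrier ?K"
    show "F \<oplus>\<^bsub>?K\<^esub> F' \<oplus>\<^bsub>?K\<^esub> F'' = F \<oplus>\<^bsub>?K\<^esub> (F' \<oplus>\<^bsub>?K\<^esub> F'')"
      using F F' F'' by (auto simp: car add intro!: ext T.M.a_assoc)
  qed (simp add: car zero)
  show ?thesis
  proof (intro gmodule.intro gmodule_axioms.intro)
    show "group (grp ?K)" using assms(1) by (simp add: grp)
    show "module scalars ?K"
    proof (rule moduleI[OF cring_from_type_algebra ab])
      fix F c assume F: "F \<in> carrier ?K"
      show "c \<odot>\<^bsub>?K\<^esub> F \<in> carrier ?K" using F by (simp add: car smult smult_zero scl)
      show "\<one>\<^bsub>scalars\<^esub> \<odot>\<^bsub>?K\<^esub> F = F" using F by (simp add: car smult)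
      fix d
      show "(c \<oplus>\<^bsub>scalars\<^esub> d) \<odot>\<^bsub>?K\<^esub> F = c \<odot>\<^bsub>?K\<^esub> F \<oplus>\<^bsub>?K\<^esub> d \<odot>\<^bsub>?K\<^esub> F"
        using F by (simp add: car smult add T.smult_l_distr UN)
      show "(c \<otimes>\<^bsub>scalars\<^esub> d) \<odot>\<^bsub>?K\<^esub> F = c \<odot>\<^bsub>?K\<^esub> (d \<odot>\<^bsub>?K\<^esub> F)"
        using F by (simp add: car smult T.smult_assoc1 UN)
      fix F' assume "F' \<in> carrier ?K"
      thus "c \<odot>\<^bsub>?K\<^esub> (F \<oplus>\<^bsub>?K\<^esub> F') = c \<odot>\<^bsub>?K\<^esub> F \<oplus>\<^bsub>?K\<^esub> c \<odot>\<^bsub>?K\<^esub> F'"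
        using F by (simp add: car smult add T.smult_r_distr UN)
    qed
    fix F assume F: "F \<in> carrier ?K"
    show "act ?K F \<one>\<^bsub>grp ?K\<^esub> = F"
      using F by (auto simp: act grp car)
    fix g assume g: "g \<in> carrier (grp ?K)"
    show "act ?K F g \<in> carrier ?K"
      using F by (simp add: car act)
    show "act ?K (c \<odot>\<^bsub>?K\<^esub> F) g = c \<odot>\<^bsub>?K\<^esub> act ?K F g" for c
      by (rule ext) (simp add: act smult smult_zero)
    show "act ?K (F \<oplus>\<^bsub>?K\<^esub> F') g = act ?K F g \<oplus>\<^bsub>?K\<^esub> act ?K F' g" for F'
      by (rule ext) (simp add: act add)
    fix h assume h: "h \<in> carrier (grp ?K)"
    show "act ?K F (g \<otimes>\<^bsub>grp ?K\<^esub> h) = act ?K (act ?K F g) h"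
      using g h by (intro ext) (simp add: act grp G.inv_mult_group G.m_assoc)
  qed
qed

lemma gmodule_spanned_gsubmodule:
  assumes "gmodule M" "S \<subseteq> carrier M"
    and "\<And>s g. \<lbrakk>s \<in> S; g \<in> carrier (grp M)\<rbrakk> \<Longrightarrow> act M s g \<in> S"
  shows "gsubmodule M (\<Inter>{N. submodule N scalars M \<and> S \<subseteq> N})" (is "gsubmodule M ?I")
proof -
  interpret gmodule M by fact
  have UN: "carrier scalars = UNIV" by (simp add: ring_of_type_algebra_def)
  have all: "submodule (carrier M) scalars M" by (rule M.carrier_is_submodule)
  have closed: "N \<subseteq> carrier M" "\<zero>\<^bsub>M\<^esub> \<in> N" "\<lbrakk>a \<in> N; b \<in> N\<rbrakk> \<Longrightarrow> a \<oplus>\<^bsub>M\<^esub> b \<in> N"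
    "a \<in> N \<Longrightarrow> c \<odot>\<^bsub>M\<^esub> a \<in> N" if "submodule N scalars M" for N a b c
    using M.submoduleE[OF that] submodule.axioms(1)[OF that, THEN subgroup.one_closed]
    by (auto simp: UN)
  have sub: "submodule ?I scalars M"
    by (rule submodule_scalarsI[OF assms(1)]) (use all assms(2) closed in auto)
  have "act M v g \<in> ?I" if v: "v \<in> ?I" and g: "g \<in> carrier (grp M)" for v g
  proof -
    have zero: "act M \<zero>\<^bsub>M\<^esub> g = \<zero>\<^bsub>M\<^esub>"
      using act_add[of "\<zero>\<^bsub>M\<^esub>" "\<zero>\<^bsub>M\<^esub>" g] act_closed[OF _ g, of "\<zero>\<^bsub>M\<^esub>"] g
      by (metis M.M.add.l_cancel_one' M.M.l_zero M.M.zero_closed)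
    have "submodule {w \<in> carrier M. act M w g \<in> ?I} scalars M"
    proof (rule submodule_scalarsI[OF assms(1)])
      show "\<zero>\<^bsub>M\<^esub> \<in> {w \<in> carrier M. act M w g \<in> ?I}"
        using closed(2)[OF sub] zero by simp
      fix a assume a: "a \<in> {w \<in> carrier M. act M w g \<in> ?I}"
      have "act M (c \<odot>\<^bsub>M\<^esub> a) g \<in> ?I" for c
        using a g closed(4)[OF sub] by (simp only: act_smult mem_Collect_eq)
      moreover have "c \<odot>\<^bsub>M\<^esub> a \<in> carrier M" for c
        using a by (intro M.smult_closed) (simp_all add: UN)
      ultimately show "c \<odot>\<^bsub>M\<^esub> a \<in> {w \<in> carrier M. act M w g \<in> ?I}" for c by blast
      fix b assume b: "b \<in> {w \<in> carrier M. act M w g \<in> ?I}"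
      have "act M (a \<oplus>\<^bsub>M\<^esub> b) g \<in> ?I"
        using a b g closed(3)[OF sub] by (simp only: act_add mem_Collect_eq)
      thus "a \<oplus>\<^bsub>M\<^esub> b \<in> {w \<in> carrier M. act M w g \<in> ?I}" using a b by blast
    qed blast
    moreover have "S \<subseteq> {w \<in> carrier M. act M w g \<in> ?I}"
      using assms(2,3) g by blast
    ultimately show ?thesis using v by blast
  qed
  thus ?thesis using sub by (simp add: gsubmodule_def)
qed

lemma (in gmodule) act_minus:
  assumes "v \<in> carrier M" "w \<in> carrier M" "g \<in> carrier (grp M)"
  shows "act M (v \<ominus>\<^bsub>M\<^esub> w) g = act M v g \<ominus>\<^bsub>M\<^esub> act M w g"
proof -
  have "act M (v \<ominus>\<^bsub>M\<^esub> w) g \<oplus>\<^bsub>M\<^esub> act M w g = act M v g"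
    using assms act_add[of "v \<ominus>\<^bsub>M\<^esub> w" w g]
    by (simp add: M.M.minus_eq M.M.a_assoc M.M.l_neg)
  thus ?thesis
    using assms act_closed by (metis M.M.add.inv_solve_right M.M.minus_closed M.M.minus_eq)
qed

lemma ind_rels_gsubmodule:
  assumes "group G" "gmodule T" "carrier (grp T) \<subseteq> carrier G"
  shows "gsubmodule (tensor_kG G T) (ind_rels G T)"
  unfolding ind_rels_def
proof (rule gmodule_spanned_gsubmodule)
  interpret G: group G by fact
  interpret T: gmodule T by fact
  show K: "gmodule (tensor_kG G T)" by (rule tensor_kG_gmodule[OF assms(1,2)])
  then interpret K: gmodule "tensor_kG G T" .
  have pure: "pure_kG T t g \<in> carrier (tensor_kG G T)" if "t \<in> carrier T" "g \<in> carrier G" for t g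
    using that by (auto simp: pure_kG_def tensor_kG_def)
  have act: "act (tensor_kG G T) (pure_kG T t g) g' = pure_kG T t (g \<otimes>\<^bsub>G\<^esub> g')"
    if "g \<in> carrier G" "g' \<in> carrier G" for t g g'
    using that by (auto simp: pure_kG_def tensor_kG_def fun_eq_iff G.m_assoc)
  have grp: "grp (tensor_kG G T) = G" by (simp add: tensor_kG_def)
  let ?S = "{pure_kG T (act T t h) g \<ominus>\<^bsub>tensor_kG G T\<^esub> pure_kG T t (h \<otimes>\<^bsub>G\<^esub> g) | t h g.
    t \<in> carrier T \<and> h \<in> carrier (grp T) \<and> g \<in> carrier G}"
  show "?S \<subseteq> carrier (tensor_kG G T)"
    using assms(3) by (auto intro!: K.M.M.minus_closed pure T.act_closed)
  fix s g' assume "s \<in> ?S" and g': "g' \<in> carrier (grp (tensor_kG G T))"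
  then obtain t h g where s: "t \<in> carrier T" "h \<in> carrier (grp T)" "g \<in> carrier G"
    "s = pure_kG T (act T t h) g \<ominus>\<^bsub>tensor_kG G T\<^esub> pure_kG T t (h \<otimes>\<^bsub>G\<^esub> g)" by blast
  have h: "h \<in> carrier G" using s(2) assms(3) by blast
  have "act (tensor_kG G T) s g' =
      pure_kG T (act T t h) (g \<otimes>\<^bsub>G\<^esub> g') \<ominus>\<^bsub>tensor_kG G T\<^esub> pure_kG T t (h \<otimes>\<^bsub>G\<^esub> (g \<otimes>\<^bsub>G\<^esub> g'))"
    unfolding s(4) using s g' h
    by (subst K.act_minus) (simp_all add: act grp pure T.act_closed G.m_assoc)
  thus "act (tensor_kG G T) s g' \<in> ?S" using s g' grp by force
qed

lemma ind_gmodule: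
  assumes "group G" "gmodule T" "carrier (grp T) \<subseteq> carrier G"
  shows "gmodule (ind G T)"
  unfolding ind_def
  by (intro quot_gmodule tensor_kG_gmodule ind_rels_gsubmodule assms)

lemma fun_module_gmodule:
  assumes "group G" "fun_vs.subspace V"
    and "\<And>f g. \<lbrakk>f \<in> V; g \<in> carrier G\<rbrakk> \<Longrightarrow> a f g \<in> V"
    and "\<And>f f' g. a (f + f') g = a f g + a f' g" "\<And>c f g. a (fscale c f) g = fscale c (a f g)"
    and "\<And>f. f \<in> V \<Longrightarrow> a f \<one>\<^bsub>G\<^esub> = f"
    and "\<And>f g h. \<lbrakk>f \<in> V; g \<in> carrier G; h \<in> carrier G\<rbrakk> \<Longrightarrow> a f (g \<otimes>\<^bsub>G\<^esub> h) = a (a f g) h"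
  shows "gmodule (fun_module G V a)"
proof -
  have ab: "abelian_group (fun_module G V a)"
  proof (rule abelian_groupI)
    fix f assume "f \<in> carrier (fun_module G V a)"
    hence "- f \<in> carrier (fun_module G V a)"
      using assms(2) by (simp add: fun_module_def fun_vs.subspace_neg)
    thus "\<exists>f'\<in>carrier (fun_module G V a). f' \<oplus>\<^bsub>fun_module G V a\<^esub> f = \<zero>\<^bsub>fun_module G V a\<^esub>"
      by (rule bexI[rotated]) (simp add: fun_module_def)
  qed (use assms(2) in \<open>simp_all add: fun_module_def fun_vs.subspace_add fun_vs.subspace_0 add.assoc add.commute\<close>)
  show ?thesis
  proof (intro gmodule.intro gmodule_axioms.intro)
    show "module scalars (fun_module G V a)"
      by (rule moduleI[OF cring_from_type_algebra ab])
        (use assms(2) in \<open>simp_all add: fun_module_def ring_of_type_algebra_def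
          fun_vs.subspace_scale fun_vs.scale_left_distrib fun_vs.scale_right_distrib\<close>)
  qed (simp_all add: fun_module_def assms)
qed

lemma span_closed:
  assumes "\<And>f f'. a (f + f') = a f + a f'" "\<And>c f. a (fscale c f) = fscale c (a f)"
    and "\<And>s. s \<in> S \<Longrightarrow> a s \<in> fun_vs.span S'" "f \<in> fun_vs.span S"
  shows "a f \<in> fun_vs.span S'"
  using assms(4)
proof (induction rule: fun_vs.span_induct_alt)
  case base
  have "a (fscale 0 0) = fscale 0 (a 0)" by (rule assms(2))
  hence "a 0 = 0" by (simp only: fun_vs.scale_zero_left)
  thus ?case by (simp only: fun_vs.span_zero)
next
  case (step c x y)
  show ?case unfolding assms(1,2)
    by (intro fun_vs.span_add fun_vs.span_scale assms(3) step)
qed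

lemma listset_iff: "xs \<in> listset Vs \<longleftrightarrow> length xs = length Vs \<and> (\<forall>i<length Vs. xs ! i \<in> Vs ! i)"
proof (induction Vs arbitrary: xs)
  case (Cons V Vs)
  show ?case by (cases xs) (auto simp: set_Cons_def Cons.IH nth_Cons split: nat.splits)
qed auto

lemma column_map: "column (map (map \<sigma>) t) j = \<sigma> ` column t j"
  by (force simp: column_def image_iff)

lemma tabloid_perm_comp: "tabloid_perm (tabloid_perm U \<sigma>) \<pi> = tabloid_perm U (\<pi> \<circ> \<sigma>)"
  by (simp add: tabloid_perm_def image_comp)

lemma tabloid_perm_id: "tabloid_perm U id = U" "tabloid_perm U (\<lambda>x. x) = U"
  by (simp_all add: tabloid_perm_def)

lemma tabloid_of_map: "tabloid_of (map (map \<sigma>) t) = tabloid_perm (tabloid_of t) \<sigma>"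
  by (simp add: tabloid_of_def tabloid_perm_def)

lemma tableaux_map:
  assumes "t \<in> tableaux \<nu>" "\<sigma> permutes {..<sum_list \<nu>}"
  shows "map (map \<sigma>) t \<in> tableaux \<nu>"
  using assms permutes_inj_on[OF assms(2), of "{..<sum_list \<nu>}"] permutes_image[OF assms(2)]
  by (simp add: tableaux_def map_concat[symmetric] distinct_map comp_def del: set_concat)

lemma tabloid_act_polytabloid:
  assumes t: "t \<in> tableaux \<nu>" and p: "\<sigma> permutes {..<sum_list \<nu>}"
  shows "tabloid_act (polytabloid t) \<sigma> = polytabloid (map (map \<sigma>) t)"
proof (rule ext)
  fix U
  let ?i = "Hilbert_Choice.inv \<sigma>" and ?X = "{..<sum_list \<nu>}"
  have X: "set (concat t) = ?X" "set (concat (map (map \<sigma>) t)) = ?X"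
    using t tableaux_map[OF t p] by (simp_all only: tableaux_def mem_Collect_eq)
  have pi: "?i permutes ?X" by (rule permutes_inv[OF p])
  have inv: "\<sigma> \<circ> ?i = id" "?i \<circ> \<sigma> = id" using permutes_inv_o[OF p] by auto
  have comps: "\<sigma> \<circ> (?i \<circ> f) = f" "?i \<circ> (\<sigma> \<circ> f) = f" for f :: perm
    using inv by (simp_all add: o_assoc)
  have st: "\<sigma> \<circ> \<pi> \<circ> ?i \<in> column_stabilizer (map (map \<sigma>) t)"
    if "\<pi> \<in> column_stabilizer t" for \<pi>
  proof -
    have "(\<sigma> \<circ> \<pi> \<circ> ?i) ` (\<sigma> ` column t j) = \<sigma> ` \<pi> ` column t j" for j
      by (simp add: image_image permutes_inverses(2)[OF p])
    thus ?thesis using that X p pi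
      by (simp add: column_stabilizer_def column_map permutes_compose del: set_concat)
  qed
  have st': "?i \<circ> \<pi> \<circ> \<sigma> \<in> column_stabilizer t"
    if "\<pi> \<in> column_stabilizer (map (map \<sigma>) t)" for \<pi>
  proof -
    have "(?i \<circ> \<pi> \<circ> \<sigma>) ` column t j = ?i ` \<pi> ` \<sigma> ` column t j" for j
      by (simp add: image_comp o_assoc)
    moreover have "\<pi> ` \<sigma> ` column t j = \<sigma> ` column t j" for j
      using that by (simp add: column_stabilizer_def column_map)
    moreover have "?i ` \<sigma> ` column t j = column t j" for j
      by (simp add: image_comp inv)
    ultimately show ?thesis using that X p pi
      by (simp add: column_stabilizer_def permutes_compose del: set_concat)
  qed
  have "(\<Sum>\<pi>\<in>column_stabilizer t. if tabloid_perm U ?i = tabloid_perm (tabloid_of t) \<pi>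
          then of_int (sign \<pi>) else (0 :: 'a)) =
    (\<Sum>\<pi>\<in>column_stabilizer (map (map \<sigma>) t).
       if U = tabloid_perm (tabloid_of (map (map \<sigma>) t)) \<pi> then of_int (sign \<pi>) else 0)"
  proof (rule sum.reindex_bij_witness[where i = "\<lambda>\<pi>. ?i \<circ> \<pi> \<circ> \<sigma>" and j = "\<lambda>\<pi>. \<sigma> \<circ> \<pi> \<circ> ?i"])
    fix \<pi> assume \<pi>: "\<pi> \<in> column_stabilizer t"
    show "?i \<circ> (\<sigma> \<circ> \<pi> \<circ> ?i) \<circ> \<sigma> = \<pi>" using inv by (simp add: o_assoc[symmetric] comps)
    show "\<sigma> \<circ> \<pi> \<circ> ?i \<in> column_stabilizer (map (map \<sigma>) t)" by (rule st[OF \<pi>])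
    have eq: "U = tabloid_perm (tabloid_of (map (map \<sigma>) t)) (\<sigma> \<circ> \<pi> \<circ> ?i) \<longleftrightarrow>
      tabloid_perm U ?i = tabloid_perm (tabloid_of t) \<pi>"
    proof -
      have "tabloid_perm (tabloid_of (map (map \<sigma>) t)) (\<sigma> \<circ> \<pi> \<circ> ?i) =
        tabloid_perm (tabloid_perm (tabloid_of t) \<pi>) \<sigma>"
        by (simp add: tabloid_of_map tabloid_perm_comp o_assoc[symmetric] inv)
      moreover have "tabloid_perm (tabloid_perm V \<sigma>) ?i = V" "tabloid_perm (tabloid_perm V ?i) \<sigma> = V" for V
        by (simp_all add: tabloid_perm_comp inv tabloid_perm_id)
      ultimately show ?thesis by metis
    qed
    have perms: "permutation \<sigma>" "permutation \<pi>" "permutation ?i"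
      using p pi \<pi> unfolding permutation_permutes column_stabilizer_def by (auto intro: finite_lessThan)
    have "sign (\<sigma> \<circ> \<pi> \<circ> ?i) = sign \<pi>"
      using perms by (simp add: sign_compose permutation_compose sign_inverse)
    thus "(if U = tabloid_perm (tabloid_of (map (map \<sigma>) t)) (\<sigma> \<circ> \<pi> \<circ> ?i)
        then of_int (sign (\<sigma> \<circ> \<pi> \<circ> ?i)) else 0) =
      (if tabloid_perm U ?i = tabloid_perm (tabloid_of t) \<pi> then of_int (sign \<pi>) else (0 :: 'a))"
      using eq by simp
  next
    fix \<pi> assume \<pi>: "\<pi> \<in> column_stabilizer (map (map \<sigma>) t)"
    show "\<sigma> \<circ> (?i \<circ> \<pi> \<circ> \<sigma>) \<circ> ?i = \<pi>" using inv by (simp add: o_assoc[symmetric] comps)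
    show "?i \<circ> \<pi> \<circ> \<sigma> \<in> column_stabilizer t" by (rule st'[OF \<pi>])
  qed
  thus "tabloid_act (polytabloid t) \<sigma> U = (polytabloid (map (map \<sigma>) t) U :: 'a)"
    by (simp add: tabloid_act_def polytabloid_def)
qed

lemma specht_closed:
  assumes "f \<in> specht \<nu>" "\<sigma> permutes {..<sum_list \<nu>}"
  shows "tabloid_act f \<sigma> \<in> specht \<nu>"
  using assms(1) unfolding specht_def
proof (rule span_closed[where a = "\<lambda>f. tabloid_act f \<sigma>", rotated 3])
  fix s :: "tabloid \<Rightarrow> 'a" assume "s \<in> polytabloid ` tableaux \<nu>"
  then obtain t where t: "t \<in> tableaux \<nu>" "s = polytabloid t" by blast
  show "tabloid_act s \<sigma> \<in> fun_vs.span (polytabloid ` tableaux \<nu>)"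
    unfolding t(2) tabloid_act_polytabloid[OF t(1) assms(2)]
    by (intro fun_vs.span_base imageI tableaux_map t(1) assms(2))
qed (simp_all add: tabloid_act_def fscale_def fun_eq_iff)

lemma offset_Suc: "i < length \<gamma> \<Longrightarrow> offset \<gamma> (Suc i) = offset \<gamma> i + \<gamma> ! i"
  by (simp add: offset_def take_Suc_conv_app_nth)

lemma offset_mono: "i \<le> j \<Longrightarrow> offset \<gamma> i \<le> offset \<gamma> j"
  unfolding offset_def by (metis le_add1 le_iff_add sum_list.append take_add)

lemma offset_le: "offset \<gamma> i \<le> sum_list \<gamma>"
  unfolding offset_def by (metis append_take_drop_id le_add1 sum_list.append)

lemma block_le: "\<lbrakk>i < length \<gamma>; x \<in> block \<gamma> i\<rbrakk> \<Longrightarrow> x < sum_list \<gamma>"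
  using offset_Suc[of i \<gamma>] offset_le[of \<gamma> "Suc i"] by (simp add: block_def)

lemma block_exists: "x < sum_list \<gamma> \<Longrightarrow> \<exists>i<length \<gamma>. x \<in> block \<gamma> i"
proof (induction \<gamma> rule: rev_induct)
  case (snoc a \<gamma>)
  show ?case
  proof (cases "x < sum_list \<gamma>")
    case True
    then obtain i where "i < length \<gamma>" "x \<in> block \<gamma> i" using snoc.IH by blast
    thus ?thesis by (intro exI[of _ i]) (simp add: block_def offset_def nth_append)
  next
    case False
    thus ?thesis using snoc.prems
      by (intro exI[of _ "length \<gamma>"]) (simp add: block_def offset_def)
  qed
qed simp

lemma factors_nth:
  assumes "length \<mu> = length \<gamma>" "i < length \<gamma>" "x \<in> block \<gamma> i"
  shows "concat (map2 (\<lambda>g \<nu>. replicate g (h \<nu>)) \<gamma> \<mu>) ! x = h (\<mu> ! i)"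
  using assms
proof (induction \<gamma> \<mu> arbitrary: i x rule: list_induct2')
  case (4 a \<gamma> b \<mu>)
  show ?case
  proof (cases i)
    case 0
    thus ?thesis using 4 by (simp add: block_def offset_def nth_append)
  next
    case (Suc j)
    have "x \<ge> a" "x - a \<in> block \<gamma> j" using 4 Suc by (auto simp: block_def offset_def)
    thus ?thesis using 4 Suc by (simp add: nth_append)
  qed
qed auto

lemma factors_length:
  "length \<mu> = length \<gamma> \<Longrightarrow> length (concat (map2 (\<lambda>g \<nu>. replicate g (h \<nu>)) \<gamma> \<mu>)) = sum_list \<gamma>"
  by (induction \<gamma> \<mu> rule: list_induct2') auto

lemma young_component_permutes:
  assumes "\<sigma> \<in> young \<gamma>" "i < length \<gamma>"
  shows "young_component \<gamma> \<sigma> i permutes {..<\<gamma> ! i}"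
proof (rule bij_imp_permutes)
  have "bij_betw (\<lambda>x. x + offset \<gamma> i) {..<\<gamma> ! i} (block \<gamma> i)"
    by (rule bij_betw_byWitness[where f' = "\<lambda>x. x - offset \<gamma> i"]) (auto simp: block_def)
  moreover have "bij_betw \<sigma> (block \<gamma> i) (block \<gamma> i)"
    using assms permutes_inj_on[of \<sigma> "{..<sum_list \<gamma>}" "block \<gamma> i"] by (simp add: young_def bij_betw_def)
  moreover have "bij_betw (\<lambda>x. x - offset \<gamma> i) (block \<gamma> i) {..<\<gamma> ! i}"
    by (rule bij_betw_byWitness[where f' = "\<lambda>x. x + offset \<gamma> i"]) (auto simp: block_def)
  ultimately have "bij_betw ((\<lambda>x. x - offset \<gamma> i) \<circ> (\<sigma> \<circ> (\<lambda>x. x + offset \<gamma> i))) {..<\<gamma> ! i} {..<\<gamma> ! i}"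
    by (blast intro: bij_betw_trans)
  thus "bij_betw (young_component \<gamma> \<sigma> i) {..<\<gamma> ! i} {..<\<gamma> ! i}"
    by (rule bij_betw_cong[THEN iffD1, rotated]) (simp add: young_component_def)
qed (simp add: young_component_def)

lemma young_component_comp:
  assumes "\<sigma> \<in> young \<gamma>" "i < length \<gamma>"
  shows "young_component \<gamma> (\<pi> \<circ> \<sigma>) i = young_component \<gamma> \<pi> i \<circ> young_component \<gamma> \<sigma> i"
proof (rule ext)
  fix x
  have "\<sigma> (x + offset \<gamma> i) \<in> block \<gamma> i" if "x < \<gamma> ! i"
  proof -
    have "x + offset \<gamma> i \<in> block \<gamma> i" using that by (simp add: block_def)
    thus ?thesis using assms unfolding young_def by blast
  qed
  thus "young_component \<gamma> (\<pi> \<circ> \<sigma>) i x = (young_component \<gamma> \<pi> i \<circ> young_component \<gamma> \<sigma> i) x"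
    by (cases "x < \<gamma> ! i") (auto simp: young_component_def block_def)
qed

lemma young_component_id: "young_component \<gamma> id i = id"
  by (auto simp: young_component_def)

lemma outer_act_add: "outer_act \<gamma> (f + f') \<sigma> = outer_act \<gamma> f \<sigma> + outer_act \<gamma> f' \<sigma>"
  and outer_act_scale: "outer_act \<gamma> (fscale c f) \<sigma> = fscale c (outer_act \<gamma> f \<sigma>)"
  by (simp_all add: outer_act_def fscale_def fun_eq_iff)

lemma wreath_act_add: "wreath_act \<gamma> (f + f') g = wreath_act \<gamma> f g + wreath_act \<gamma> f' g"
  and wreath_act_scale: "wreath_act \<gamma> (fscale c f) g = fscale c (wreath_act \<gamma> f g)"
  by (simp_all add: wreath_act_def outer_act_def fscale_def fun_eq_iff split: prod.splits)

lemma outer_specht_closed: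
  assumes "y \<in> outer_specht \<eta>" "\<sigma> \<in> young (shape \<eta>)"
  shows "outer_act (shape \<eta>) y \<sigma> \<in> outer_specht \<eta>"
  using assms(1) unfolding outer_specht_def tensor_space_def
proof (rule span_closed[where a = "\<lambda>y. outer_act (shape \<eta>) y \<sigma>", OF outer_act_add outer_act_scale, rotated])
  fix s :: "tabloid list \<Rightarrow> 'a" assume "s \<in> tensors ` listset (map specht \<eta>)"
  then obtain ys where ys: "ys \<in> listset (map specht \<eta>)" "s = tensors ys" by blast
  have "tabloid_act (ys ! i) (young_component (shape \<eta>) \<sigma> i) \<in> specht (\<eta> ! i)" if "i < length \<eta>" for i
    using that ys(1) young_component_permutes[OF assms(2), of i]
    by (intro specht_closed) (simp_all add: listset_iff shape_def)
  hence "map (\<lambda>i. tabloid_act (ys ! i) (young_component (shape \<eta>) \<sigma> i)) [0..<length ys]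
      \<in> listset (map specht \<eta>)"
    using ys(1) by (simp add: listset_iff)
  thus "outer_act (shape \<eta>) s \<sigma> \<in> fun_vs.span (tensors ` listset (map specht \<eta>))"
    unfolding ys(2) outer_act_tensors by (intro fun_vs.span_base imageI)
qed

lemma T_module_gmodule:
  assumes \<mu>: "length \<mu> = length \<eta>" "set \<mu> \<subseteq> partitions m"
  shows "gmodule (T_module m \<mu> \<eta> :: ('k::field, 'k T_vec, wreath_elem) gmod)"
proof -
  let ?\<gamma> = "shape \<eta>" let ?n = "sum_list ?\<gamma>"
  let ?G = "wreath m ?n (young ?\<gamma>)"
  let ?Fs = "concat (map2 (\<lambda>g \<nu>. replicate g (specht \<nu>)) ?\<gamma> \<mu>) :: (tabloid \<Rightarrow> 'k) set list"
  let ?V = "tensor2_space (tensor_space ?Fs) (outer_specht \<eta>)"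
  have len: "length \<mu> = length ?\<gamma>" using \<mu> by (simp add: shape_def)
  have lenF: "length ?Fs = ?n" by (rule factors_length[OF len])
  have closed: "wreath_act ?\<gamma> F g \<in> ?V" if F: "F \<in> ?V" and g: "g \<in> carrier ?G" for F g
    using F unfolding tensor2_space_def
  proof (rule span_closed[where a = "\<lambda>F. wreath_act ?\<gamma> F g", OF wreath_act_add wreath_act_scale, rotated])
    obtain \<sigma> \<alpha> where ga: "g = (\<sigma>, \<alpha>)" by fastforce
    have \<sigma>: "\<sigma> \<in> young ?\<gamma>" and \<alpha>: "\<And>i. i < ?n \<Longrightarrow> \<alpha> i permutes {..<m}"
      using g by (simp_all add: ga wreath_def perms_def)
    have p: "\<sigma> permutes {..<?n}" using \<sigma> by (simp add: young_def)
    have pos: "tensors (map (\<lambda>i. tabloid_act (xs ! Hilbert_Choice.inv \<sigma> i) (\<alpha> i)) [0..<?n])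
        \<in> tensor_space ?Fs" if xs: "xs \<in> listset ?Fs" for xs
    proof -
      have "tabloid_act (xs ! Hilbert_Choice.inv \<sigma> x) (\<alpha> x) \<in> ?Fs ! x" if x: "x < ?n" for x
      proof -
        obtain i where i: "i < length ?\<gamma>" "x \<in> block ?\<gamma> i" using block_exists[OF x] by blast
        have "x \<in> \<sigma> ` block ?\<gamma> i" using \<sigma> i by (simp add: young_def)
        then obtain x' where x': "x' \<in> block ?\<gamma> i" "\<sigma> x' = x" by blast
        have ix: "Hilbert_Choice.inv \<sigma> x = x'" using x'(2) permutes_inverses(2)[OF p] by metis
        have "x' < ?n" using block_le[OF i(1) x'(1)] .
        hence "xs ! x' \<in> ?Fs ! x'"
          using xs[unfolded listset_iff lenF] by blast
        hence "xs ! x' \<in> specht (\<mu> ! i)"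
          unfolding factors_nth[OF len i(1) x'(1)] .
        moreover have "\<mu> ! i \<in> partitions m"
          using \<mu>(2) i(1) len nth_mem[of i \<mu>] by (simp only: subset_eq)
        hence "\<alpha> x permutes {..<sum_list (\<mu> ! i)}"
          using \<alpha>[OF x] by (simp add: partitions_def)
        ultimately show ?thesis
          unfolding ix factors_nth[OF len i(1) i(2)] by (rule specht_closed)
      qed
      hence "map (\<lambda>i. tabloid_act (xs ! Hilbert_Choice.inv \<sigma> i) (\<alpha> i)) [0..<?n] \<in> listset ?Fs"
        unfolding listset_iff lenF length_map length_upt diff_zero
        by (intro conjI refl allI impI) (simp only: nth_map_upt diff_zero add_0)
      thus ?thesis unfolding tensor_space_def by (intro fun_vs.span_base imageI)
    qed
    fix s :: "'k T_vec"
    assume "s \<in> {tensor2 f y | f y. f \<in> tensor_space ?Fs \<and> y \<in> outer_specht \<eta>}"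
    then obtain f y where s: "f \<in> tensor_space ?Fs" "y \<in> outer_specht \<eta>" "s = tensor2 f y" by blast
    show "wreath_act ?\<gamma> s g \<in>
        fun_vs.span {tensor2 f y | f y. f \<in> tensor_space ?Fs \<and> y \<in> outer_specht \<eta>}"
      unfolding s(3)
    proof (rule span_closed[where a = "\<lambda>f. wreath_act ?\<gamma> (tensor2 f y) g"])
      show "f \<in> fun_vs.span (tensors ` listset ?Fs)" using s(1) by (simp add: tensor_space_def)
      fix h :: "tabloid list \<Rightarrow> 'k" assume "h \<in> tensors ` listset ?Fs"
      then obtain xs where xs: "xs \<in> listset ?Fs" "h = tensors xs" by blast
      have "length xs = ?n" using xs(1) lenF by (simp only: listset_iff)
      show "wreath_act ?\<gamma> (tensor2 h y) g \<in>
          fun_vs.span {tensor2 f y | f y. f \<in> tensor_space ?Fs \<and> y \<in> outer_specht \<eta>}"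
        unfolding xs(2) ga wreath_act_tensor[OF g[unfolded ga] \<open>length xs = ?n\<close>]
        by (intro fun_vs.span_base CollectI exI conjI)
          (rule refl, rule pos[OF xs(1)], rule outer_specht_closed[OF s(2) \<sigma>])
    next
      fix f f' :: "tabloid list \<Rightarrow> 'k" and c
      have "tensor2 (f + f') y = tensor2 f y + tensor2 f' y"
        by (rule ext) (simp add: tensor2_def distrib_right split: prod.splits)
      moreover have "tensor2 (fscale c f) y = fscale c (tensor2 f y)"
        by (rule ext) (simp add: tensor2_def fscale_def split: prod.splits)
      ultimately show "wreath_act ?\<gamma> (tensor2 (f + f') y) g =
            wreath_act ?\<gamma> (tensor2 f y) g + wreath_act ?\<gamma> (tensor2 f' y) g"
        "wreath_act ?\<gamma> (tensor2 (fscale c f) y) g = fscale c (wreath_act ?\<gamma> (tensor2 f y) g)"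
        by (simp_all only: wreath_act_add wreath_act_scale)
    qed
  qed
  have supp: "F (Ts, Us) = 0" if F: "F \<in> ?V" and l: "length Ts \<noteq> ?n \<or> length Us \<noteq> length \<eta>" for F Ts Us
  proof -
    have 1: "f xs = 0" if "f \<in> tensor_space Vs" "length xs \<noteq> length Vs"
      for f xs and Vs :: "(tabloid \<Rightarrow> 'k) set list"
      using that(1) unfolding tensor_space_def
      by (induction rule: fun_vs.span_induct_alt)
        (use that(2) in \<open>auto simp: fscale_def tensors_def listset_iff\<close>)
    have "f Ts * y Us = 0" if "f \<in> tensor_space ?Fs" "y \<in> outer_specht \<eta>" for f y
      using l 1[OF that(1), of Ts] 1[OF that(2)[unfolded outer_specht_def], of Us] lenF by auto
    hence gen: "tensor2 f y (Ts, Us) = 0" if "f \<in> tensor_space ?Fs" "y \<in> outer_specht \<eta>" for f y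
      using that by (simp add: tensor2_def)
    show ?thesis using F unfolding tensor2_space_def
      by (induction rule: fun_vs.span_induct_alt) (use gen in \<open>auto simp: fscale_def\<close>)
  qed
  have mult: "wreath_act ?\<gamma> F (g \<otimes>\<^bsub>?G\<^esub> h) = wreath_act ?\<gamma> (wreath_act ?\<gamma> F g) h"
    if F: "F \<in> ?V" and g: "g \<in> carrier ?G" and h: "h \<in> carrier ?G" for F g h
  proof (rule ext)
    fix z :: "tabloid list \<times> tabloid list"
    obtain Ts Us where z: "z = (Ts, Us)" by fastforce
    obtain \<sigma> \<alpha> \<pi> \<beta> where gh: "g = (\<sigma>, \<alpha>)" "h = (\<pi>, \<beta>)" by (metis surj_pair)
    have \<sigma>: "\<sigma> \<in> young ?\<gamma>" "\<pi> \<in> young ?\<gamma>" using g h by (simp_all add: gh wreath_def)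
    have perm: "\<sigma> permutes {..<?n}" "\<pi> permutes {..<?n}" using \<sigma> by (simp_all add: young_def)
    have bij: "bij (\<alpha> i)" "bij (\<beta> i)" for i
      using g h permutes_bij by (cases "i < ?n"; simp add: gh wreath_def perms_def; blast)+
    show "wreath_act ?\<gamma> F (g \<otimes>\<^bsub>?G\<^esub> h) z = wreath_act ?\<gamma> (wreath_act ?\<gamma> F g) h z"
    proof (cases "length Ts = ?n \<and> length Us = length \<eta>")
      case True
      have l: "\<sigma> i < ?n" if "i < ?n" for i using that permutes_in_image[OF perm(1), of i] by simp
      have \<pi>\<sigma>: "Hilbert_Choice.inv \<pi> (\<pi> x) = x" for x
        by (rule permutes_inverses(2)[OF perm(2)])
      have T: "tabloid_perm (Ts ! \<pi> (\<sigma> i)) (Hilbert_Choice.inv (\<beta> (\<pi> (\<sigma> i)) \<circ> \<alpha> (\<sigma> i))) =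
          tabloid_perm (tabloid_perm (Ts ! \<pi> (\<sigma> i)) (Hilbert_Choice.inv (\<beta> (\<pi> (\<sigma> i)))))
            (Hilbert_Choice.inv (\<alpha> (\<sigma> i)))" for i
        by (simp only: o_inv_distrib[OF bij(2,1)] tabloid_perm_comp)
      have U: "tabloid_perm (Us ! i) (Hilbert_Choice.inv (young_component ?\<gamma> (\<pi> \<circ> \<sigma>) i)) =
          tabloid_perm (tabloid_perm (Us ! i) (Hilbert_Choice.inv (young_component ?\<gamma> \<pi> i)))
            (Hilbert_Choice.inv (young_component ?\<gamma> \<sigma> i))" if "i < length \<eta>" for i
      proof -
        have i: "i < length ?\<gamma>" using that by (simp add: shape_def)
        show ?thesis
          by (simp only: young_component_comp[OF \<sigma>(1) i] tabloid_perm_comp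
            o_inv_distrib[OF permutes_bij[OF young_component_permutes[OF \<sigma>(2) i]]
              permutes_bij[OF young_component_permutes[OF \<sigma>(1) i]]])
      qed
      have Ts: "map (\<lambda>i. tabloid_perm (Ts ! (\<pi> \<circ> \<sigma>) i)
            (Hilbert_Choice.inv (\<beta> ((\<pi> \<circ> \<sigma>) i) \<circ> \<alpha> (Hilbert_Choice.inv \<pi> ((\<pi> \<circ> \<sigma>) i))))) [0..<?n] =
          map (\<lambda>i. tabloid_perm (map (\<lambda>i. tabloid_perm (Ts ! \<pi> i) (Hilbert_Choice.inv (\<beta> (\<pi> i)))) [0..<?n] ! \<sigma> i)
            (Hilbert_Choice.inv (\<alpha> (\<sigma> i)))) [0..<?n]"
        by (rule map_cong[OF refl]) (simp only: o_apply \<pi>\<sigma> T, simp add: l)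
      have Us: "map (\<lambda>i. tabloid_perm (Us ! i) (Hilbert_Choice.inv (young_component ?\<gamma> (\<pi> \<circ> \<sigma>) i))) [0..<length \<eta>] =
          map (\<lambda>i. tabloid_perm (map (\<lambda>i. tabloid_perm (Us ! i)
              (Hilbert_Choice.inv (young_component ?\<gamma> \<pi> i))) [0..<length \<eta>] ! i)
            (Hilbert_Choice.inv (young_component ?\<gamma> \<sigma> i))) [0..<length \<eta>]"
        by (rule map_cong[OF refl]) (simp add: U)
      show ?thesis
        using True Ts Us
        by (simp only: z gh wreath_def monoid.simps case_prod_conv wreath_act_def outer_act_def
            length_map length_upt diff_zero)
    next
      case False
      have "wreath_act ?\<gamma> F' k z = 0" if "F' \<in> ?V" for F' :: "'k T_vec" and k
        unfolding z wreath_act_def outer_act_def using False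
        by (cases k, simp only: case_prod_conv) (rule supp[OF that], simp only: length_map length_upt diff_zero, blast)
      thus ?thesis using F closed[OF F g] by (simp only:)
    qed
  qed
  have one: "wreath_act ?\<gamma> F \<one>\<^bsub>?G\<^esub> = F" for F :: "'k T_vec"
  proof (rule ext)
    fix z :: "tabloid list \<times> tabloid list"
    obtain Ts Us where z: "z = (Ts, Us)" by fastforce
    show "wreath_act ?\<gamma> F \<one>\<^bsub>?G\<^esub> z = F z"
      by (simp add: z wreath_def wreath_act_def outer_act_def young_component_id tabloid_perm_id map_nth)
  qed
  show ?thesis unfolding T_module_def
  proof (rule fun_module_gmodule)
    show "fun_vs.subspace ?V" unfolding tensor2_space_def by (rule fun_vs.subspace_span)
  qed (simp_all only: wreath_group_young closed mult one wreath_act_add wreath_act_scale)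
qed

lemma wreath_specht_gmodule:
  assumes "length \<mu> = length \<eta>" "set \<mu> \<subseteq> partitions m"
  shows "gmodule (wreath_specht m \<mu> \<eta> :: ('k::field, (wreath_elem \<Rightarrow> 'k T_vec) set, wreath_elem) gmod)"
  unfolding wreath_specht_def
  by (intro ind_gmodule wreath_group_perms T_module_gmodule assms)
    (use wreath_young_subset in \<open>simp add: T_module_def fun_module_def\<close>)

end

theory Submission
  imports Defs
begin

text \<open>
  The Specht module of the wreath product is modelled without induction. A word of length \<open>n\<close> over the
  components of \<open>\<eta>\<close> says which component contains each letter; it stands for a coset of the Young subgroup,
  and the model is spanned by tensors of one vector of \<open>S\<^bsup>\<mu>\<^sub>i\<^esup>\<close> for each letter \<open>i\<close> of the word with one
  vector, for each component \<open>\<eta>\<^sub>i\<close>, of the Specht module of tableaux whose entries are the positions of \<open>i\<close>.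

  Restriction singles out the last letter. For a component \<open>i\<close>, a basis vector of \<open>S\<^bsup>\<mu>\<^sub>i\<^esup>\<close> and a removable box of
  \<open>\<eta>\<^sub>i\<close> in row \<open>a\<close>, there is an equivariant evaluation map: take the coefficient of the basis vector in the tensor
  factor at the last letter, and the part of the function on which this letter lies in row \<open>a\<close> of the \<open>i\<close>-th tabloid.
  Ordered by \<open>a\<close>, the vanishing sets of the later evaluation maps form the filtration, and each step is
  mapped onto the model for the smaller multipartition.

  This reduces the theorem to three facts about a Specht module \<open>S\<^bsup>\<nu>\<^esup>\<close> of a symmetric group. If the parts of \<open>f\<close> with
  \<open>x\<close> in later removable rows vanish, then the part with \<open>x\<close> in row \<open>a\<close> lies in the Specht module for the
  smaller partition; all its vectors arise in this way; and \<open>f\<close> vanishes if all its parts do.  They follow from the fact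
  that the functions on tableaux subject to the Garnir relations are exactly the pairings of
  polytabloids with a vector of the permutation module, which is proved by removing one letter at a time.
\<close>

section \<open>Garnir relations\<close>

text \<open>The field is arbitrary, so the restriction need not split, and the proof constructs no
  basis of standard tableaux; duality takes its place. A functional on a Specht module, read off on
  polytabloids, is a function on tableaux satisfying the Garnir relations. Representing it by a
  vector of the permutation module shows which polytabloids span the part of a Specht module whose
  vectors vanish when a letter lies in prescribed rows. The letter is controlled through its column:
  a column permutation moves it only to rows reaching that column, and the removable rows after one
  of length \<open>Suc q\<close> are exactly those of length at most \<open>q\<close>. So vanishing
  on the later rows amounts to lying in the span of polytabloids with the letter in column
  \<open>q\<close> or beyond. The smaller wreath product acts trivially on the tensor factor at the
  last letter, so each coordinate of that factor accounts for one copy of a smaller Specht module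
  per removable box; a basis dual to evaluation at tabloids turns coordinates into function values.
  Components need no mutual order, as a vector lifted for one component has the last letter there
  and in no other.\<close>

definition tabs :: "nat list \<Rightarrow> nat set \<Rightarrow> nat list list set" where
  "tabs \<nu> A = {t. map length t = \<nu> \<and> distinct (concat t) \<and> set (concat t) = A}"

abbreviation relabel :: "perm \<Rightarrow> nat list list \<Rightarrow> nat list list" where
  "relabel \<sigma> t \<equiv> map (map \<sigma>) t"

text \<open>The standard bilinear form of \<open>m\<close> with the polytabloid of \<open>t\<close>,
  written over column permutations so that no summation over the infinite type of tabloids
  arises.\<close>

definition pairing :: "(tabloid \<Rightarrow> 'k::field) \<Rightarrow> nat list list \<Rightarrow> 'k" where
  "pairing m t = (\<Sum>\<pi>\<in>column_stabilizer t. of_int (sign \<pi>) * m (tabloid_perm (tabloid_of t) \<pi>))"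

lemma tabsD:
  assumes "t \<in> tabs \<nu> A"
  shows "length t = length \<nu>" "i < length \<nu> \<Longrightarrow> length (t ! i) = \<nu> ! i" "distinct (concat t)"
    "set (concat t) = A" "finite A"
  using assms unfolding tabs_def by (auto simp del: set_concat)

lemma tableaux_tabs: "tableaux \<nu> = tabs \<nu> {..<sum_list \<nu>}"
  by (simp add: tableaux_def tabs_def)

lemma tabs_relabel:
  assumes "t \<in> tabs \<nu> A" "inj_on \<sigma> A"
  shows "relabel \<sigma> t \<in> tabs \<nu> (\<sigma> ` A)"
  using assms by (simp add: tabs_def map_concat[symmetric] distinct_map comp_def del: set_concat)

lemma tabs_permute:
  assumes "t \<in> tabs \<nu> A" "\<sigma> permutes A"
  shows "relabel \<sigma> t \<in> tabs \<nu> A"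
  using tabs_relabel[OF assms(1) permutes_inj_on[OF assms(2)]] permutes_image[OF assms(2)] by simp

lemma finite_tabs: "finite A \<Longrightarrow> finite (tabs \<nu> A)"
proof (rule finite_subset)
  assume A: "finite A"
  show "tabs \<nu> A \<subseteq> {t. set t \<subseteq> {r. set r \<subseteq> A \<and> length r \<le> sum_list \<nu>} \<and> length t = length \<nu>}"
    by (auto simp: tabs_def in_set_conv_nth intro!: member_le_sum_list)
  show "finite {t. set t \<subseteq> {r. set r \<subseteq> A \<and> length r \<le> sum_list \<nu>} \<and> length t = length \<nu>}"
    by (intro finite_lists_length_eq finite_lists_length_le A)
qed

lemma position_unique:
  "\<lbrakk>distinct (concat t); i < length t; j < length (t ! i); i' < length t; j' < length (t ! i');
    t ! i ! j = t ! i' ! j'\<rbrakk> \<Longrightarrow> i = i' \<and> j = j'"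
proof (induction t arbitrary: i i')
  case (Cons r t)
  have sub: "t ! k ! l \<in> \<Union> (set ` set t)" if "k < length t" "l < length (t ! k)" for k l
    using that by (auto intro!: bexI[of _ "t ! k"])
  have dis: "set r \<inter> \<Union> (set ` set t) = {}" using Cons.prems(1) by simp
  show ?case
  proof (cases i; cases i')
    fix k assume k: "i = 0" "i' = Suc k"
    hence "t ! k ! j' \<in> set r" using Cons.prems by (metis nth_Cons_0 nth_Cons_Suc nth_mem)
    moreover have "t ! k ! j' \<in> \<Union> (set ` set t)" using sub[of k j'] Cons.prems k by simp
    ultimately show ?thesis using dis by blast
  next
    fix k assume k: "i = Suc k" "i' = 0"
    hence "t ! k ! j \<in> set r" using Cons.prems by (metis nth_Cons_0 nth_Cons_Suc nth_mem)
    moreover have "t ! k ! j \<in> \<Union> (set ` set t)" using sub[of k j] Cons.prems k by simp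
    ultimately show ?thesis using dis by blast
  qed (use Cons in \<open>auto simp: nth_eq_iff_index_eq\<close>)
qed simp

section \<open>Columns of a tableau and their stabilizer\<close>

lemma column_iff: "z \<in> column t j \<longleftrightarrow> (\<exists>i<length t. j < length (t ! i) \<and> z = t ! i ! j)"
  by (auto simp: column_def in_set_conv_nth)

lemma column_subset: "column t j \<subseteq> set (concat t)"
  by (force simp: column_def)

lemma finite_column: "finite (column t j)"
  by (rule finite_subset[OF column_subset]) simp

lemma column_exists: "z \<in> set (concat t) \<Longrightarrow> \<exists>j. z \<in> column t j"
  by (force simp: column_def in_set_conv_nth)

lemma column_unique:
  assumes "distinct (concat t)" "z \<in> column t j" "z \<in> column t j'"
  shows "j = j'"
  using assms position_unique[OF assms(1)] unfolding column_iff by metis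

lemma row_column_unique:
  assumes "distinct (concat t)" "i < length t" "z \<in> set (t ! i)" "z \<in> column t j"
  shows "j < length (t ! i)" "z = t ! i ! j"
proof -
  obtain j' where j': "j' < length (t ! i)" "z = t ! i ! j'"
    using assms(3) by (auto simp: in_set_conv_nth)
  hence "z \<in> column t j'" using assms(2) by (auto simp: column_iff)
  hence "j' = j" using column_unique[OF assms(1)] assms(4) by blast
  thus "j < length (t ! i)" "z = t ! i ! j" using j' by auto
qed

lemma column_stabilizerD:
  assumes "\<pi> \<in> column_stabilizer t"
  shows "\<pi> permutes set (concat t)" "\<pi> ` column t j = column t j" "permutation \<pi>"
  using assms finite_set[of "concat t"] unfolding column_stabilizer_def permutation_permutes by blast+

lemma finite_column_stabilizer: "finite (column_stabilizer t)"
  by (rule finite_subset[OF _ finite_permutations[OF finite_set[of "concat t"]]])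
    (auto simp: column_stabilizer_def)

lemma column_stabilizer_comp:
  "\<lbrakk>\<pi> \<in> column_stabilizer t; \<rho> \<in> column_stabilizer t\<rbrakk> \<Longrightarrow> \<pi> \<circ> \<rho> \<in> column_stabilizer t"
  by (simp add: column_stabilizer_def permutes_compose image_comp[symmetric] del: o_apply)

lemma column_stabilizer_inv:
  assumes "\<pi> \<in> column_stabilizer t"
  shows "Hilbert_Choice.inv \<pi> \<in> column_stabilizer t"
proof -
  have "Hilbert_Choice.inv \<pi> ` column t j = column t j" for j
    using column_stabilizerD(2)[OF assms, of j] permutes_inj[OF column_stabilizerD(1)[OF assms]]
    by (metis image_inv_f_f)
  thus ?thesis using permutes_inv[OF column_stabilizerD(1)[OF assms]]
    by (simp add: column_stabilizer_def)
qed

lemma of_int_sign_mult: "(of_int (sign \<pi>) :: 'k::field) * (of_int (sign \<pi>) * c) = c"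
  by (simp add: sign_def)

text \<open>Conjugation carries columns to columns. As \<sigma> need not preserve the set of
  entries, the conjugate has to be shown to permute the image of that set.\<close>

lemma column_stabilizer_relabel:
  assumes "permutation \<sigma>" "\<pi> \<in> column_stabilizer t"
  shows "\<sigma> \<circ> \<pi> \<circ> Hilbert_Choice.inv \<sigma> \<in> column_stabilizer (relabel \<sigma> t)"
proof -
  have bij: "bij \<sigma>" by (rule permutation_bijective[OF assms(1)])
  have "\<sigma> \<circ> \<pi> \<circ> Hilbert_Choice.inv \<sigma> permutes \<sigma> ` set (concat t)"
  proof (rule bij_imp_permutes)
    have "bij_betw (Hilbert_Choice.inv \<sigma>) (\<sigma> ` set (concat t)) (set (concat t))"
      using bij by (intro bij_betw_byWitness[where f' = \<sigma>])
        (auto simp: bij_is_inj bij_is_surj surj_f_inv_f simp del: set_concat)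
    moreover have "bij_betw \<pi> (set (concat t)) (set (concat t))"
      by (rule permutes_imp_bij[OF column_stabilizerD(1)[OF assms(2)]])
    moreover have "bij_betw \<sigma> (set (concat t)) (\<sigma> ` set (concat t))"
      using bij inj_on_subset[OF bij_is_inj[OF bij] subset_UNIV] by (simp add: bij_betw_def del: set_concat)
    ultimately show "bij_betw (\<sigma> \<circ> \<pi> \<circ> Hilbert_Choice.inv \<sigma>) (\<sigma> ` set (concat t)) (\<sigma> ` set (concat t))"
      by (blast intro: bij_betw_trans)
    fix x assume "x \<notin> \<sigma> ` set (concat t)"
    hence "Hilbert_Choice.inv \<sigma> x \<notin> set (concat t)"
      using bij by (metis bij_inv_eq_iff image_eqI)
    thus "(\<sigma> \<circ> \<pi> \<circ> Hilbert_Choice.inv \<sigma>) x = x"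
      using permutes_not_in[OF column_stabilizerD(1)[OF assms(2)]] bij
      by (simp add: bij_is_surj surj_f_inv_f)
  qed
  moreover have "(\<sigma> \<circ> \<pi> \<circ> Hilbert_Choice.inv \<sigma>) ` \<sigma> ` column t j = \<sigma> ` column t j" for j
  proof -
    have "(\<sigma> \<circ> \<pi> \<circ> Hilbert_Choice.inv \<sigma>) ` \<sigma> ` column t j = \<sigma> ` \<pi> ` column t j"
      by (simp add: image_image bij_is_inj[OF bij])
    thus ?thesis by (simp only: column_stabilizerD(2)[OF assms(2)])
  qed
  moreover have "set (concat (relabel \<sigma> t)) = \<sigma> ` set (concat t)"
    by (metis image_set map_concat)
  ultimately show ?thesis by (simp add: column_stabilizer_def column_map del: set_concat)
qed

text \<open>Conjugation by \<sigma> identifies the two column stabilizers and keeps signs; the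
  inverse of \<sigma> in the conjugate is absorbed by the relabelled tabloid.\<close>

lemma pairing_relabel:
  assumes \<sigma>: "permutation \<sigma>"
  shows "pairing m (relabel \<sigma> t) =
    (\<Sum>\<pi>\<in>column_stabilizer t. of_int (sign \<pi>) * m (tabloid_perm (tabloid_of t) (\<sigma> \<circ> \<pi>)))"
proof -
  let ?i = "Hilbert_Choice.inv \<sigma>"
  have bij: "bij \<sigma>" by (rule permutation_bijective[OF \<sigma>])
  have i: "permutation ?i" by (rule permutation_inverse[OF \<sigma>])
  have id: "?i \<circ> \<sigma> = id" "\<sigma> \<circ> ?i = id"
    using bij_is_inj[OF bij] bij_is_surj[OF bij] by (simp_all add: fun_eq_iff surj_f_inv_f)
  have ii: "Hilbert_Choice.inv ?i = \<sigma>" by (rule inv_inv_eq[OF bij])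
  have undo: "relabel ?i (relabel \<sigma> t) = t" by (simp add: id)
  show ?thesis unfolding pairing_def
  proof (rule sum.reindex_bij_witness[where i = "\<lambda>\<pi>. \<sigma> \<circ> \<pi> \<circ> ?i" and j = "\<lambda>\<pi>. ?i \<circ> \<pi> \<circ> \<sigma>"])
    fix \<pi> assume \<pi>: "\<pi> \<in> column_stabilizer (relabel \<sigma> t)"
    show "\<sigma> \<circ> (?i \<circ> \<pi> \<circ> \<sigma>) \<circ> ?i = \<pi>"
      by (simp add: fun_eq_iff bij_is_surj[OF bij] surj_f_inv_f)
    show "?i \<circ> \<pi> \<circ> \<sigma> \<in> column_stabilizer t"
      using column_stabilizer_relabel[OF i \<pi>] unfolding undo ii .
    have "sign (?i \<circ> \<pi> \<circ> \<sigma>) = sign \<pi>"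
      using i \<sigma> column_stabilizerD(3)[OF \<pi>]
      by (simp add: sign_compose permutation_compose sign_inverse)
    moreover have "tabloid_perm (tabloid_of t) (\<sigma> \<circ> (?i \<circ> \<pi> \<circ> \<sigma>)) =
        tabloid_perm (tabloid_of (relabel \<sigma> t)) \<pi>"
      by (simp add: tabloid_of_map tabloid_perm_comp o_assoc id)
    ultimately show "of_int (sign (?i \<circ> \<pi> \<circ> \<sigma>)) *
        m (tabloid_perm (tabloid_of t) (\<sigma> \<circ> (?i \<circ> \<pi> \<circ> \<sigma>))) =
      of_int (sign \<pi>) * m (tabloid_perm (tabloid_of (relabel \<sigma> t)) \<pi>)" by simp
  next
    fix \<pi> assume \<pi>: "\<pi> \<in> column_stabilizer t"
    show "?i \<circ> (\<sigma> \<circ> \<pi> \<circ> ?i) \<circ> \<sigma> = \<pi>"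
      by (simp add: fun_eq_iff bij_is_inj[OF bij])
    show "\<sigma> \<circ> \<pi> \<circ> ?i \<in> column_stabilizer (relabel \<sigma> t)"
      by (rule column_stabilizer_relabel[OF \<sigma> \<pi>])
  qed
qed

text \<open>Left multiplication by \<rho> permutes the column stabilizer and multiplies all signs by
  that of \<rho>.\<close>

lemma pairing_antisym:
  assumes "\<rho> \<in> column_stabilizer t"
  shows "pairing m (relabel \<rho> t) = of_int (sign \<rho>) * pairing m t"
proof -
  note \<rho> = column_stabilizerD[OF assms]
  have id: "Hilbert_Choice.inv \<rho> \<circ> \<rho> = id" "\<rho> \<circ> Hilbert_Choice.inv \<rho> = id"
    using permutes_inv_o[OF \<rho>(1)] by auto
  have "pairing m (relabel \<rho> t) =
    (\<Sum>\<pi>\<in>column_stabilizer t. of_int (sign \<pi>) * m (tabloid_perm (tabloid_of t) (\<rho> \<circ> \<pi>)))"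
    by (rule pairing_relabel[OF \<rho>(3)])
  also have "\<dots> = (\<Sum>\<pi>\<in>column_stabilizer t.
      of_int (sign \<rho>) * (of_int (sign \<pi>) * m (tabloid_perm (tabloid_of t) \<pi>)))"
  proof (rule sum.reindex_bij_witness[where i = "\<lambda>\<pi>. Hilbert_Choice.inv \<rho> \<circ> \<pi>" and j = "\<lambda>\<pi>. \<rho> \<circ> \<pi>"])
    fix \<pi> assume \<pi>: "\<pi> \<in> column_stabilizer t"
    show "\<rho> \<circ> \<pi> \<in> column_stabilizer t" "Hilbert_Choice.inv \<rho> \<circ> \<pi> \<in> column_stabilizer t"
      using \<pi> assms by (auto intro: column_stabilizer_comp column_stabilizer_inv)
    show "Hilbert_Choice.inv \<rho> \<circ> (\<rho> \<circ> \<pi>) = \<pi>" "\<rho> \<circ> (Hilbert_Choice.inv \<rho> \<circ> \<pi>) = \<pi>"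
      using id by (simp_all add: o_assoc)
    have "sign (\<rho> \<circ> \<pi>) = sign \<rho> * sign \<pi>"
      using \<rho>(3) column_stabilizerD(3)[OF \<pi>] by (rule sign_compose)
    thus "of_int (sign \<rho>) * (of_int (sign (\<rho> \<circ> \<pi>)) * m (tabloid_perm (tabloid_of t) (\<rho> \<circ> \<pi>))) =
        of_int (sign \<pi>) * m (tabloid_perm (tabloid_of t) (\<rho> \<circ> \<pi>))"
      by (simp add: of_int_sign_mult mult.assoc)
  qed
  finally show ?thesis unfolding pairing_def by (simp add: sum_distrib_left)
qed

text \<open>On each fibre of \<open>h\<close> a sign-reversing involution shows that the sum of the
  signs equals its own negative. Taking this sum in the integers before mapping it to the field is
  what makes the cancellation valid in characteristic two.\<close>

lemma cancelling_sum:
  fixes s :: "'a \<Rightarrow> int" and m :: "'b \<Rightarrow> 'k::field"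
  assumes "finite Q"
    and "\<And>\<rho>. \<rho> \<in> Q \<Longrightarrow> \<exists>\<tau>. \<forall>\<rho>'\<in>Q. h \<rho>' = h \<rho> \<longrightarrow>
      \<tau> \<rho>' \<in> Q \<and> h (\<tau> \<rho>') = h \<rho> \<and> s (\<tau> \<rho>') = - s \<rho>' \<and> \<tau> (\<tau> \<rho>') = \<rho>'"
  shows "(\<Sum>\<rho>\<in>Q. of_int (s \<rho>) * m (h \<rho>)) = 0"
proof -
  have "(\<Sum>\<rho>\<in>Q. of_int (s \<rho>) * m (h \<rho>)) = (\<Sum>U\<in>h ` Q. \<Sum>\<rho>\<in>{\<rho>\<in>Q. h \<rho> = U}. of_int (s \<rho>) * m (h \<rho>))"
    by (rule sum.image_gen[OF assms(1)])
  also have "\<dots> = (\<Sum>U\<in>h ` Q. of_int (\<Sum>\<rho>\<in>{\<rho>\<in>Q. h \<rho> = U}. s \<rho>) * m U)"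
    by (intro sum.cong refl) (simp add: sum_distrib_right)
  also have "\<dots> = 0"
  proof (rule sum.neutral, rule ballI)
    fix U assume "U \<in> h ` Q"
    then obtain \<rho> where "\<rho> \<in> Q" "h \<rho> = U" by blast
    then obtain \<tau> where \<tau>: "\<forall>\<rho>'\<in>Q. h \<rho>' = U \<longrightarrow>
      \<tau> \<rho>' \<in> Q \<and> h (\<tau> \<rho>') = U \<and> s (\<tau> \<rho>') = - s \<rho>' \<and> \<tau> (\<tau> \<rho>') = \<rho>'"
      using assms(2) by metis
    have "(\<Sum>\<rho>\<in>{\<rho>\<in>Q. h \<rho> = U}. s \<rho>) = (\<Sum>\<rho>\<in>{\<rho>\<in>Q. h \<rho> = U}. - s \<rho>)"
      by (rule sum.reindex_bij_witness[where i = \<tau> and j = \<tau>]) (use \<tau> in auto)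
    hence "(\<Sum>\<rho>\<in>{\<rho>\<in>Q. h \<rho> = U}. s \<rho>) = 0" by (simp add: sum_negf)
    thus "of_int (\<Sum>\<rho>\<in>{\<rho>\<in>Q. h \<rho> = U}. s \<rho>) * m U = 0" by simp
  qed
  finally show ?thesis .
qed

text \<open>\<open>S\<close> represents the left cosets of the stabilizer of \<open>Y\<close> in the symmetric group on \<open>D \<union> Y\<close>.\<close>

definition garnir_reps :: "nat set \<Rightarrow> nat set \<Rightarrow> perm set \<Rightarrow> bool" where
  "garnir_reps D Y S \<longleftrightarrow> (\<forall>\<sigma>\<in>S. \<sigma> permutes D \<union> Y) \<and>
    bij_betw (\<lambda>\<sigma>. \<sigma> ` Y) S {Y'. Y' \<subseteq> D \<union> Y \<and> card Y' = card Y}"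

text \<open>The relations are imposed for every transversal \<open>S\<close>. The strict inequality
  is the pigeonhole condition: the chosen letters outnumber the rows that meet column
  \<open>j\<close>.\<close>

definition garnir :: "nat list \<Rightarrow> nat set \<Rightarrow> (nat list list \<Rightarrow> 'k::field) \<Rightarrow> bool" where
  "garnir \<nu> A \<psi> \<longleftrightarrow> (\<forall>t\<in>tabs \<nu> A.
    (\<forall>\<pi>\<in>column_stabilizer t. \<psi> (relabel \<pi> t) = of_int (sign \<pi>) * \<psi> t) \<and>
    (\<forall>j j' D Y S. j < j' \<and> D \<subseteq> column t j \<and> Y \<subseteq> column t j' \<and>
      card (column t j) < card D + card Y \<and> garnir_reps D Y S \<longrightarrow>
      (\<Sum>\<sigma>\<in>S. of_int (sign \<sigma>) * \<psi> (relabel \<sigma> t)) = 0))"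

lemma garnirD:
  assumes "garnir \<nu> A \<psi>" "t \<in> tabs \<nu> A"
  shows "\<pi> \<in> column_stabilizer t \<Longrightarrow> \<psi> (relabel \<pi> t) = of_int (sign \<pi>) * \<psi> t"
    and "\<lbrakk>j < j'; D \<subseteq> column t j; Y \<subseteq> column t j'; card (column t j) < card D + card Y;
      garnir_reps D Y S\<rbrakk> \<Longrightarrow> (\<Sum>\<sigma>\<in>S. of_int (sign \<sigma>) * \<psi> (relabel \<sigma> t)) = 0"
  using assms unfolding garnir_def by blast+

text \<open>A permutation of \<open>D \<union> Y\<close> that keeps \<open>Y\<close> also keeps its
  complement \<open>D\<close>, and each of the two sets lies in a single column.\<close>

lemma stabilizing_perm_in_column_stabilizer:
  assumes "distinct (concat t)" "D \<subseteq> column t j" "Y \<subseteq> column t j'" "j \<noteq> j'"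
    and "\<zeta> permutes D \<union> Y" "\<zeta> ` Y = Y"
  shows "\<zeta> \<in> column_stabilizer t"
proof -
  have disj: "D \<inter> Y = {}" using column_unique[OF assms(1)] assms(2-4) by blast
  have D: "\<zeta> ` D = D"
  proof -
    have "\<zeta> ` (D \<union> Y - Y) = \<zeta> ` (D \<union> Y) - \<zeta> ` Y"
      by (rule image_set_diff[OF permutes_inj[OF assms(5)]])
    thus ?thesis using disj permutes_image[OF assms(5)] assms(6)
      by (metis Diff_triv Un_Diff Un_Diff_cancel2 Un_commute Diff_cancel Un_empty_right)
  qed
  have "\<zeta> ` column t l = column t l" for l
  proof -
    let ?C = "column t l"
    have sub: "\<zeta> ` (?C \<inter> (D \<union> Y)) = ?C \<inter> (D \<union> Y)"
    proof -
      have "?C \<inter> (D \<union> Y) = (if l = j then D else if l = j' then Y else {})"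
        using assms(2-4) column_unique[OF assms(1)] by auto
      thus ?thesis using D assms(6) by simp
    qed
    have "\<zeta> ` (?C - (D \<union> Y)) = ?C - (D \<union> Y)"
      using permutes_not_in[OF assms(5)] by (auto simp: image_iff)
    moreover have "?C = (?C \<inter> (D \<union> Y)) \<union> (?C - (D \<union> Y))" by blast
    ultimately show ?thesis using sub by (metis image_Un)
  qed
  moreover have "\<zeta> permutes set (concat t)"
    using assms(2,3) column_subset by (blast intro: permutes_subset[OF assms(5)])
  ultimately show ?thesis by (simp add: column_stabilizer_def)
qed

text \<open>Rows are weakly decreasing, so a row reaching column \<open>j'\<close> and all rows
  above it reach column \<open>j\<close>; hence column \<open>j\<close> has more entries than the
  index of that row.\<close>

lemma row_bound:
  assumes "t \<in> tabs \<nu> A" "sorted_wrt (\<ge>) \<nu>" "y \<in> column t j'" "j \<le> j'"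
  shows "\<exists>i<card (column t j). i < length t \<and> y \<in> set (t ! i)"
proof -
  note t = tabsD[OF assms(1)]
  obtain i where i: "i < length t" "j' < length (t ! i)" "y = t ! i ! j'"
    using assms(3) unfolding column_iff by blast
  have len: "j < length (t ! l)" if "l \<le> i" for l
    using that i assms(2,4) t(1) t(2)[of l] t(2)[of i] sorted_wrt_nth_less[OF assms(2), of l i]
    by (cases "l = i") auto
  have "card ((\<lambda>l. t ! l ! j) ` {..i}) = card {..i}"
  proof (rule card_image, rule inj_onI)
    fix l l' assume "l \<in> {..i}" "l' \<in> {..i}" "t ! l ! j = t ! l' ! j"
    thus "l = l'" using position_unique[OF t(3), of l j l' j] len i(1) by auto
  qed
  moreover have "(\<lambda>l. t ! l ! j) ` {..i} \<subseteq> column t j"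
  proof clarify
    fix l assume "l \<le> i"
    thus "t ! l ! j \<in> column t j" unfolding column_iff using len[of l] i(1)
      by (intro exI[of _ l]) simp
  qed
  hence "card ((\<lambda>l. t ! l ! j) ` {..i}) \<le> card (column t j)"
    by (rule card_mono[OF finite_column])
  ultimately show ?thesis using i by (intro exI[of _ i]) auto
qed

text \<open>
  The permutations \<open>\<sigma>\<pi>\<close>, for \<open>\<sigma>\<close> a representative and \<open>\<pi>\<close> in the column stabilizer, form a set
  closed under multiplication by transpositions of \<open>D \<union> Y\<close>, and by the pigeonhole principle one such
  transposition stabilizes the tabloid.  This cancellation is valid in every characteristic.
\<close>

lemma garnir_pairing:
  assumes dec: "sorted_wrt (\<ge>) \<nu>"
  shows "garnir \<nu> A (pairing m)"
  unfolding garnir_def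
proof (intro ballI conjI allI impI)
  fix t j j' D Y S
  assume t: "t \<in> tabs \<nu> A" and asm: "j < j' \<and> D \<subseteq> column t j \<and> Y \<subseteq> column t j' \<and>
      card (column t j) < card D + card Y \<and> garnir_reps D Y S"
  let ?C = "column_stabilizer t" and ?Z = "D \<union> Y"
  define h where "h \<rho> = tabloid_perm (tabloid_of t) \<rho>" for \<rho>
  note tD = tabsD[OF t]
  have hnth: "h \<rho> ! i = \<rho> ` set (t ! i)" if "i < length t" for \<rho> i
    using that by (simp add: h_def tabloid_perm_def tabloid_of_def)
  have DY: "j < j'" "D \<subseteq> column t j" "Y \<subseteq> column t j'" "card (column t j) < card D + card Y"
    and S: "\<And>\<sigma>. \<sigma> \<in> S \<Longrightarrow> \<sigma> permutes ?Z"
    and bij: "bij_betw (\<lambda>\<sigma>. \<sigma> ` Y) S {Y'. Y' \<subseteq> ?Z \<and> card Y' = card Y}"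
    using asm unfolding garnir_reps_def by auto
  have finZ: "finite ?Z"
    using finite_subset[OF DY(2) finite_column] finite_subset[OF DY(3) finite_column] by simp
  have disj: "D \<inter> Y = {}" using column_unique[OF tD(3), of _ j j'] DY(1-3) by blast
  have finS: "finite S" by (rule finite_subset[OF _ finite_permutations[OF finZ]]) (use S in auto)
  have permS: "permutation \<sigma>" if "\<sigma> \<in> S" for \<sigma> using S[OF that] finZ permutation_permutes by blast
  have stab: "\<zeta> \<in> ?C" if "\<zeta> permutes ?Z" "\<zeta> ` Y = Y" for \<zeta>
    using stabilizing_perm_in_column_stabilizer[OF tD(3) DY(2,3) _ that] DY(1) by simp
  \<comment> \<open>If two products agree, the quotient of their representatives lies in the column
    stabilizer and preserves \<open>D \<union> Y\<close>, hence also \<open>Y\<close>, the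
    intersection of that set with column \<open>j'\<close>; so both represent the same
    coset.\<close>
  have inj: "inj_on (\<lambda>(\<sigma>, \<pi>). \<sigma> \<circ> \<pi>) (S \<times> ?C)"
  proof (rule inj_onI, clarify)
    fix \<sigma> \<pi> \<sigma>' \<pi>' assume a: "\<sigma> \<in> S" "\<sigma>' \<in> S" "\<pi> \<in> ?C" "\<pi>' \<in> ?C" "\<sigma> \<circ> \<pi> = \<sigma>' \<circ> \<pi>'"
    have eq: "Hilbert_Choice.inv \<sigma>' \<circ> \<sigma> = \<pi>' \<circ> Hilbert_Choice.inv \<pi>"
    proof -
      have "Hilbert_Choice.inv \<sigma>' \<circ> (\<sigma> \<circ> \<pi>) \<circ> Hilbert_Choice.inv \<pi> =
        Hilbert_Choice.inv \<sigma>' \<circ> (\<sigma>' \<circ> \<pi>') \<circ> Hilbert_Choice.inv \<pi>" using a by simp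
      moreover have "Hilbert_Choice.inv \<sigma>' \<circ> (\<sigma> \<circ> \<pi>) \<circ> Hilbert_Choice.inv \<pi> = Hilbert_Choice.inv \<sigma>' \<circ> \<sigma>"
        by (simp add: fun_eq_iff permutes_inverses[OF column_stabilizerD(1)[OF a(3)]])
      moreover have "Hilbert_Choice.inv \<sigma>' \<circ> (\<sigma>' \<circ> \<pi>') \<circ> Hilbert_Choice.inv \<pi> = \<pi>' \<circ> Hilbert_Choice.inv \<pi>"
        by (simp add: fun_eq_iff permutes_inverses[OF S[OF a(2)]])
      ultimately show ?thesis by simp
    qed
    have "(\<pi>' \<circ> Hilbert_Choice.inv \<pi>) ` column t j' = column t j'"
      by (simp only: image_comp[symmetric] column_stabilizerD(2)[OF a(4)]
        column_stabilizerD(2)[OF column_stabilizer_inv[OF a(3)]])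
    hence c: "(Hilbert_Choice.inv \<sigma>' \<circ> \<sigma>) ` column t j' = column t j'" by (simp add: eq)
    have pz: "Hilbert_Choice.inv \<sigma>' \<circ> \<sigma> permutes ?Z"
      by (intro permutes_compose permutes_inv S a)
    have "D \<inter> column t j' = {}" using DY(1,2) column_unique[OF tD(3), of _ j j'] by blast
    hence Yeq: "Y = ?Z \<inter> column t j'" using DY(3) by blast
    have "(Hilbert_Choice.inv \<sigma>' \<circ> \<sigma>) ` Y = Y"
      using image_Int[OF permutes_inj[OF pz], of ?Z "column t j'"]
      unfolding c permutes_image[OF pz] using Yeq by simp
    hence "\<sigma>' ` (Hilbert_Choice.inv \<sigma>' \<circ> \<sigma>) ` Y = \<sigma>' ` Y" by simp
    hence "\<sigma> ` Y = \<sigma>' ` Y"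
      by (simp add: image_image permutes_inverses[OF S[OF a(2)]])
    hence "\<sigma> = \<sigma>'" using inj_onD[OF bij_betw_imp_inj_on[OF bij] _ a(1,2)] by simp
    moreover have "\<pi> = \<pi>'"
    proof (rule ext)
      fix v
      have "\<sigma> (\<pi> v) = \<sigma> (\<pi>' v)" using fun_cong[OF a(5), of v] \<open>\<sigma> = \<sigma>'\<close> by simp
      thus "\<pi> v = \<pi>' v" by (rule injD[OF permutes_inj[OF S[OF a(1)]]])
    qed
    ultimately show "\<sigma> = \<sigma>' \<and> \<pi> = \<pi>'" by simp
  qed
  define Q where "Q = (\<lambda>(\<sigma>, \<pi>). \<sigma> \<circ> \<pi>) ` (S \<times> ?C)"
  have permQ: "permutation \<rho>" if "\<rho> \<in> Q" for \<rho>
    using that permS column_stabilizerD(3) by (auto simp: Q_def intro!: permutation_compose)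
  have "(\<Sum>\<sigma>\<in>S. of_int (sign \<sigma>) * pairing m (relabel \<sigma> t)) =
      (\<Sum>\<sigma>\<in>S. \<Sum>\<pi>\<in>?C. of_int (sign (\<sigma> \<circ> \<pi>)) * m (h (\<sigma> \<circ> \<pi>)))"
    by (intro sum.cong refl)
      (simp add: pairing_relabel[OF permS] sum_distrib_left h_def sign_compose permS column_stabilizerD(3) mult.assoc)
  also have "\<dots> = (\<Sum>(\<sigma>, \<pi>)\<in>S \<times> ?C. of_int (sign (\<sigma> \<circ> \<pi>)) * m (h (\<sigma> \<circ> \<pi>)))"
    by (rule sum.cartesian_product)
  also have "\<dots> = (\<Sum>\<rho>\<in>Q. of_int (sign \<rho>) * m (h \<rho>))"
    unfolding Q_def by (subst sum.reindex[OF inj]) (simp add: case_prod_unfold)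
  also have "\<dots> = 0"
  proof (rule cancelling_sum[where h = h and s = sign and m = m])
    show "finite Q" unfolding Q_def by (intro finite_imageI finite_cartesian_product finS finite_column_stabilizer)
    fix \<rho> assume "\<rho> \<in> Q"
    then obtain \<sigma> \<pi> where \<rho>: "\<sigma> \<in> S" "\<pi> \<in> ?C" "\<rho> = \<sigma> \<circ> \<pi>" by (auto simp: Q_def)
    \<comment> \<open>Undoing \<rho> brings \<open>z\<close> to a letter in column \<open>j\<close>
      or \<open>j'\<close> of \<open>t\<close>, so \<open>row_bound\<close> confines all of
      \<open>D \<union> Y\<close> to the first \<open>card (column t j)\<close> rows of the tabloid,
      too few for distinct ones.\<close>
    have row: "\<exists>i<card (column t j). i < length t \<and> z \<in> h \<rho> ! i" if z: "z \<in> ?Z" for z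
    proof -
      define y where "y = Hilbert_Choice.inv \<pi> (Hilbert_Choice.inv \<sigma> z)"
      have "Hilbert_Choice.inv \<sigma> z \<in> ?Z" using permutes_in_image[OF permutes_inv[OF S[OF \<rho>(1)]]] z by blast
      hence "Hilbert_Choice.inv \<sigma> z \<in> column t j \<or> Hilbert_Choice.inv \<sigma> z \<in> column t j'"
        using DY(2,3) by blast
      then obtain l where l: "j \<le> l" "Hilbert_Choice.inv \<sigma> z \<in> column t l"
        using DY(1) less_imp_le by blast
      have "y \<in> column t l"
        using l(2) column_stabilizerD(2)[OF column_stabilizer_inv[OF \<rho>(2)], of l] unfolding y_def by blast
      then obtain i where i: "i < card (column t j)" "i < length t" "y \<in> set (t ! i)"
        using row_bound[OF t dec _ l(1)] by blast
      have "\<rho> y = z"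
        by (simp add: \<rho>(3) y_def permutes_inverses[OF S[OF \<rho>(1)]]
          permutes_inverses[OF column_stabilizerD(1)[OF \<rho>(2)]])
      hence "z \<in> h \<rho> ! i" using i by (auto simp: h_def tabloid_perm_def tabloid_of_def)
      thus ?thesis using i by blast
    qed
    have "\<forall>z\<in>?Z. \<exists>i. i < card (column t j) \<and> i < length t \<and> z \<in> h \<rho> ! i" using row by blast
    then obtain R where R': "\<forall>z\<in>?Z. R z < card (column t j) \<and> R z < length t \<and> z \<in> h \<rho> ! R z"
      by (rule bchoice[THEN exE])
    have R: "R z < card (column t j)" "R z < length t" "z \<in> h \<rho> ! R z" if "z \<in> ?Z" for z
      using R' that by simp_all
    have "card ?Z = card D + card Y"
      using finZ by (intro card_Un_disjoint disj) auto
    moreover have "card (R ` ?Z) \<le> card {..<card (column t j)}"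
      by (rule card_mono) (use R in auto)
    ultimately have "card (R ` ?Z) < card ?Z" using DY(4) by simp
    hence "\<not> inj_on R ?Z" using card_image by fastforce
    then obtain z z' where z: "z \<in> ?Z" "z' \<in> ?Z" "z \<noteq> z'" "R z = R z'" by (auto simp: inj_on_def)
    let ?\<tau> = "transpose z z'"
    have \<tau>Z: "?\<tau> permutes ?Z" by (rule permutes_swap_id) (use z in auto)
    have rows: "?\<tau> ` (h \<rho> ! i) = h \<rho> ! i" if i: "i < length t" for i
    proof -
      have dist: "z \<in> h \<rho> ! i \<Longrightarrow> i = R z" "z' \<in> h \<rho> ! i \<Longrightarrow> i = R z"
      proof -
        have inj\<rho>: "inj \<rho>" using permQ[OF \<open>\<rho> \<in> Q\<close>] permutation_bijective bij_is_inj by blast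
        have "i = l" if u: "u \<in> h \<rho> ! i" "u \<in> h \<rho> ! l" "l < length t" for u l
        proof -
          obtain v w where vw: "v \<in> set (t ! i)" "w \<in> set (t ! l)" "\<rho> v = u" "\<rho> w = u"
            using u(1,2) unfolding hnth[OF i] hnth[OF u(3)] by auto
          hence "v = w" using inj\<rho> by (metis injD)
          obtain c where c: "c < length (t ! i)" "v = t ! i ! c" using vw(1) by (auto simp: in_set_conv_nth)
          obtain d where d: "d < length (t ! l)" "w = t ! l ! d" using vw(2) by (auto simp: in_set_conv_nth)
          show ?thesis using position_unique[OF tD(3) i c(1) u(3) d(1)] c(2) d(2) \<open>v = w\<close> by simp
        qed
        thus "z \<in> h \<rho> ! i \<Longrightarrow> i = R z" "z' \<in> h \<rho> ! i \<Longrightarrow> i = R z"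
          using R[OF z(1)] R[OF z(2)] z(4) by auto
      qed
      show ?thesis
      proof (cases "i = R z")
        case True
        hence "z \<in> h \<rho> ! i" "z' \<in> h \<rho> ! i" using R[OF z(1)] R[OF z(2)] z(4) by auto
        thus ?thesis by simp
      next
        case False
        hence "z \<notin> h \<rho> ! i" "z' \<notin> h \<rho> ! i" using dist by auto
        thus ?thesis by simp
      qed
    qed
    have fixU: "tabloid_perm (h \<rho>) ?\<tau> = h \<rho>"
      unfolding tabloid_perm_def by (rule nth_equalityI) (use rows in \<open>auto simp: h_def tabloid_perm_def tabloid_of_def\<close>)
    \<comment> \<open>One transposition serves the whole fibre, since it exchanges two letters in
      the same row of the common tabloid.\<close>
    show "\<exists>\<tau>. \<forall>\<rho>'\<in>Q. h \<rho>' = h \<rho> \<longrightarrow>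
        \<tau> \<rho>' \<in> Q \<and> h (\<tau> \<rho>') = h \<rho> \<and> sign (\<tau> \<rho>') = - sign \<rho>' \<and> \<tau> (\<tau> \<rho>') = \<rho>'"
    proof (intro exI[of _ "\<lambda>\<rho>'. ?\<tau> \<circ> \<rho>'"] ballI impI conjI)
      fix \<rho>' assume \<rho>': "\<rho>' \<in> Q" "h \<rho>' = h \<rho>"
      show "?\<tau> \<circ> (?\<tau> \<circ> \<rho>') = \<rho>'" by (simp add: o_assoc)
      show "h (?\<tau> \<circ> \<rho>') = h \<rho>" using fixU \<rho>'(2) by (metis h_def tabloid_perm_comp)
      show "sign (?\<tau> \<circ> \<rho>') = - sign \<rho>'"
        using z(3) by (simp add: sign_compose permutation_swap_id permQ[OF \<rho>'(1)] sign_swap_id)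
      obtain \<sigma>1 \<pi>1 where 1: "\<sigma>1 \<in> S" "\<pi>1 \<in> ?C" "\<rho>' = \<sigma>1 \<circ> \<pi>1" using \<rho>'(1) by (auto simp: Q_def)
      \<comment> \<open>Closure of \<open>Q\<close>: the transposition times
        \<open>\<sigma>1\<close> lies in the coset of some representative \<open>\<sigma>2\<close>,
        and the correction is absorbed by the column stabilizer.\<close>
      have p1: "?\<tau> \<circ> \<sigma>1 permutes ?Z" by (intro permutes_compose S 1 \<tau>Z)
      have "(?\<tau> \<circ> \<sigma>1) ` Y \<in> {Y'. Y' \<subseteq> ?Z \<and> card Y' = card Y}"
        using image_mono[of Y ?Z "?\<tau> \<circ> \<sigma>1"] card_image[OF permutes_inj_on[OF p1, of Y]]
        unfolding permutes_image[OF p1] by blast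
      then obtain \<sigma>2 where 2: "\<sigma>2 \<in> S" "\<sigma>2 ` Y = (?\<tau> \<circ> \<sigma>1) ` Y"
        unfolding bij_betw_imp_surj_on[OF bij, symmetric] by force
      have "Hilbert_Choice.inv \<sigma>2 ` \<sigma>2 ` Y = Y" using permutes_inj[OF S[OF 2(1)]] by simp
      hence "(Hilbert_Choice.inv \<sigma>2 \<circ> (?\<tau> \<circ> \<sigma>1)) ` Y = Y" using 2(2) by (metis image_comp)
      hence "Hilbert_Choice.inv \<sigma>2 \<circ> (?\<tau> \<circ> \<sigma>1) \<in> ?C"
        by (intro stab permutes_compose p1 permutes_inv S 2) 
      hence "Hilbert_Choice.inv \<sigma>2 \<circ> (?\<tau> \<circ> \<sigma>1) \<circ> \<pi>1 \<in> ?C" by (rule column_stabilizer_comp[OF _ 1(2)])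
      moreover have "\<sigma>2 \<circ> (Hilbert_Choice.inv \<sigma>2 \<circ> (?\<tau> \<circ> \<sigma>1) \<circ> \<pi>1) = ?\<tau> \<circ> \<rho>'"
        unfolding 1(3) by (simp add: fun_eq_iff permutes_inverses[OF S[OF 2(1)]])
      ultimately show "?\<tau> \<circ> \<rho>' \<in> Q" unfolding Q_def using 2(1)
        by (intro image_eqI[where x = "(\<sigma>2, Hilbert_Choice.inv \<sigma>2 \<circ> (?\<tau> \<circ> \<sigma>1) \<circ> \<pi>1)"]) simp_all
    qed
  qed
  finally show "(\<Sum>\<sigma>\<in>S. of_int (sign \<sigma>) * pairing m (relabel \<sigma> t)) = 0" .
qed (rule pairing_antisym)

section \<open>Every Garnir function is a pairing\<close>

lemma concat_update:
  assumes "a < length s"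
  shows "\<exists>u w. \<forall>r. concat (s[a := r]) = u @ r @ w"
  by (intro exI[of _ "concat (take a s)"] exI[of _ "concat (drop (Suc a) s)"])
    (use assms in \<open>simp add: upd_conv_take_nth_drop\<close>)

lemma tabs_addx:
  assumes "s \<in> tabs (\<nu>[a := q]) (A - {x})" "x \<in> A" "a < length \<nu>" "\<nu> ! a = Suc q"
  shows "s[a := s ! a @ [x]] \<in> tabs \<nu> A"
proof -
  note s = tabsD[OF assms(1)]
  have a: "a < length s" "length (s ! a) = q" using s(1) s(2)[of a] assms(3) by simp_all
  obtain u w where uw: "\<And>r. concat (s[a := r]) = u @ r @ w" using concat_update[OF a(1)] by blast
  have c: "concat s = u @ s ! a @ w" using uw[of "s ! a"] by simp
  have "map length (s[a := s ! a @ [x]]) = \<nu>"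
    by (rule nth_equalityI) (use s(1,2) a assms(3,4) in \<open>auto simp: nth_list_update\<close>)
  thus ?thesis using s(3,4) assms(2) c by (auto simp: tabs_def uw simp del: set_concat)
qed

lemma tabs_remove:
  assumes "t \<in> tabs \<nu> A" "a < length \<nu>" "\<nu> ! a = Suc q" "t ! a ! q = x"
  defines "s \<equiv> t[a := butlast (t ! a)]"
  shows "s \<in> tabs (\<nu>[a := q]) (A - {x})" "s[a := s ! a @ [x]] = t"
proof -
  note t = tabsD[OF assms(1)]
  have a: "a < length t" "length (t ! a) = Suc q" using t(1) t(2)[of a] assms(2,3) by simp_all
  have ta: "t ! a = butlast (t ! a) @ [x]"
    using a(2) assms(4) by (metis append_butlast_last_id diff_Suc_1 last_conv_nth length_0_conv nat.distinct(1))
  obtain u w where uw: "\<And>r. concat (t[a := r]) = u @ r @ w" using concat_update[OF a(1)] by blast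
  have c: "concat t = u @ (butlast (t ! a) @ [x]) @ w" using uw[of "t ! a"] ta by simp
  have "map length s = \<nu>[a := q]" unfolding s_def
    by (rule nth_equalityI) (use t(1,2) a assms(2,3) in \<open>auto simp: nth_list_update\<close>)
  thus "s \<in> tabs (\<nu>[a := q]) (A - {x})"
    using t(3,4) c by (auto simp: tabs_def s_def uw simp del: set_concat)
  show "s[a := s ! a @ [x]] = t" using a(1) ta by (simp add: s_def)
qed

lemma column_addx:
  assumes "a < length s" "length (s ! a) = q"
  shows "column (s[a := s ! a @ [x]]) j = (if j = q then insert x (column s q) else column s j)"
proof -
  have "z \<in> column (s[a := s ! a @ [x]]) j \<longleftrightarrow> (j = q \<and> z = x) \<or> z \<in> column s j" for z
  proof -
    have "z \<in> column (s[a := s ! a @ [x]]) j \<longleftrightarrow>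
      (j < Suc q \<and> z = (s ! a @ [x]) ! j) \<or> (\<exists>i<length s. i \<noteq> a \<and> j < length (s ! i) \<and> z = s ! i ! j)"
      unfolding column_iff using assms by (auto simp: nth_list_update split: if_splits)
    also have "\<dots> \<longleftrightarrow> (j = q \<and> z = x) \<or> (j < q \<and> z = s ! a ! j) \<or>
        (\<exists>i<length s. i \<noteq> a \<and> j < length (s ! i) \<and> z = s ! i ! j)"
      using assms(2) by (auto simp: nth_append less_Suc_eq)
    also have "\<dots> \<longleftrightarrow> (j = q \<and> z = x) \<or> z \<in> column s j"
      unfolding column_iff using assms by auto
    finally show ?thesis .
  qed
  thus ?thesis by auto
qed

lemma relabel_addx:
  assumes "\<sigma> x = x" "a < length s"
  shows "relabel \<sigma> (s[a := s ! a @ [x]]) = (relabel \<sigma> s)[a := relabel \<sigma> s ! a @ [x]]"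
  using assms by (simp add: map_update)

lemma set_concat_addx:
  assumes "a < length s"
  shows "set (concat (s[a := s ! a @ [x]])) = insert x (set (concat s))"
proof -
  obtain u w where uw: "\<And>r. concat (s[a := r]) = u @ r @ w" using concat_update[OF assms] by blast
  from uw[of "s ! a"] uw[of "s ! a @ [x]"] show ?thesis by (simp del: set_concat)
qed

lemma column_stabilizer_addx:
  assumes "a < length s" "x \<notin> set (concat s)"
  shows "column_stabilizer s = {\<pi> \<in> column_stabilizer (s[a := s ! a @ [x]]). \<pi> x = x}"
proof (intro Set.equalityI subsetI)
  fix \<pi> assume \<pi>: "\<pi> \<in> column_stabilizer s"
  have x: "\<pi> x = x" using permutes_not_in[OF column_stabilizerD(1)[OF \<pi>] assms(2)] .
  have "\<pi> permutes insert x (set (concat s))"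
    by (rule permutes_subset[OF column_stabilizerD(1)[OF \<pi>]]) blast
  thus "\<pi> \<in> {\<pi> \<in> column_stabilizer (s[a := s ! a @ [x]]). \<pi> x = x}"
    using x column_stabilizerD(2)[OF \<pi>]
    by (simp add: column_stabilizer_def column_addx[OF assms(1) refl] set_concat_addx[OF assms(1)] del: set_concat)
next
  fix \<pi> assume "\<pi> \<in> {\<pi> \<in> column_stabilizer (s[a := s ! a @ [x]]). \<pi> x = x}"
  hence p: "\<pi> permutes insert x (set (concat s))" and x: "\<pi> x = x"
    and c: "\<And>j. \<pi> ` column (s[a := s ! a @ [x]]) j = column (s[a := s ! a @ [x]]) j"
    by (simp_all add: column_stabilizer_def set_concat_addx[OF assms(1)] del: set_concat)
  have "\<pi> permutes set (concat s)"
    by (rule permutes_superset[OF p]) (use x in auto)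
  moreover have "\<pi> ` column s j = column s j" for j
  proof (cases "j = length (s ! a)")
    case True
    have "x \<notin> column s j" using column_subset assms(2) by blast
    hence C: "column s j = column (s[a := s ! a @ [x]]) j - {x}"
      using True by (simp add: column_addx[OF assms(1) refl])
    show ?thesis unfolding C image_set_diff[OF permutes_inj[OF p]] c using x by simp
  next
    case False
    thus ?thesis using c[of j] by (simp add: column_addx[OF assms(1) refl])
  qed
  ultimately show "\<pi> \<in> column_stabilizer s" by (simp add: column_stabilizer_def)
qed

text \<open>A bijection from \<open>Y\<close> to \<open>Y'\<close> is combined with one between the
  complements in \<open>Z\<close>, which have equal size.\<close>

lemma permutes_onto_subset:
  assumes "finite Z" "Y \<subseteq> Z" "Y' \<subseteq> Z" "card Y = card Y'"
  shows "\<exists>\<sigma>. \<sigma> permutes Z \<and> \<sigma> ` Y = Y'"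
proof -
  have fin: "finite Y" "finite Y'" using assms finite_subset by blast+
  from finite_same_card_bij[OF fin assms(4)] obtain f where f: "bij_betw f Y Y'" ..
  have "card (Z - Y) = card (Z - Y')" using assms fin by (simp add: card_Diff_subset)
  from finite_same_card_bij[OF _ _ this] obtain g where g: "bij_betw g (Z - Y) (Z - Y')"
    using assms(1) by auto
  define \<sigma> where "\<sigma> z = (if z \<in> Y then f z else if z \<in> Z then g z else z)" for z
  have 1: "bij_betw \<sigma> Y Y'" using f bij_betw_cong[of Y \<sigma> f Y'] by (simp add: \<sigma>_def)
  have 2: "bij_betw \<sigma> (Z - Y) (Z - Y')" using g bij_betw_cong[of "Z - Y" \<sigma> g "Z - Y'"] by (simp add: \<sigma>_def)
  have "bij_betw \<sigma> (Y \<union> (Z - Y)) (Y' \<union> (Z - Y'))" by (rule bij_betw_combine[OF 1 2]) blast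
  hence "bij_betw \<sigma> Z Z" using assms(2,3) by (simp add: Un_absorb1)
  hence "\<sigma> permutes Z" by (rule bij_imp_permutes) (use assms(2) in \<open>auto simp: \<sigma>_def\<close>)
  thus ?thesis using 1 by (auto simp: bij_betw_def)
qed

text \<open>The subsets of the enlarged set with the size of \<open>Y\<close> split into those
  avoiding \<open>x\<close>, already represented by \<open>S\<close>, and those containing
  \<open>x\<close>, for which permutations are chosen freely to form \<open>S'\<close>.\<close>

lemma garnir_reps_extend:
  assumes "garnir_reps D Y S" "finite D" "finite Y" "x \<notin> D \<union> Y"
  shows "\<exists>S'. garnir_reps (insert x D) Y (S \<union> S') \<and> S \<inter> S' = {} \<and> finite (S \<union> S') \<and> (\<forall>\<sigma>\<in>S'. x \<in> \<sigma> ` Y)"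
proof -
  let ?Z = "insert x D \<union> Y"
  define P where "P = {Y'. Y' \<subseteq> ?Z \<and> card Y' = card Y \<and> x \<in> Y'}"
  have finZ: "finite ?Z" using assms by simp
  have "\<forall>Y'\<in>P. \<exists>\<sigma>. \<sigma> permutes ?Z \<and> \<sigma> ` Y = Y'"
    unfolding P_def by (intro ballI permutes_onto_subset[OF finZ]) auto
  then obtain g where g: "\<forall>Y'\<in>P. g Y' permutes ?Z \<and> g Y' ` Y = Y'" by (rule bchoice[THEN exE])
  have S: "\<And>\<sigma>. \<sigma> \<in> S \<Longrightarrow> \<sigma> permutes D \<union> Y"
    and bij: "bij_betw (\<lambda>\<sigma>. \<sigma> ` Y) S {Y'. Y' \<subseteq> D \<union> Y \<and> card Y' = card Y}"
    using assms(1) unfolding garnir_reps_def by auto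
  have "bij_betw (\<lambda>\<sigma>. \<sigma> ` Y) (g ` P) P"
    by (rule bij_betw_byWitness[where f' = g]) (use g in auto)
  hence "bij_betw (\<lambda>\<sigma>. \<sigma> ` Y) (S \<union> g ` P) ({Y'. Y' \<subseteq> D \<union> Y \<and> card Y' = card Y} \<union> P)"
    by (intro bij_betw_combine[OF bij]) (use assms(4) in \<open>auto simp: P_def\<close>)
  moreover have "{Y'. Y' \<subseteq> D \<union> Y \<and> card Y' = card Y} \<union> P = {Y'. Y' \<subseteq> ?Z \<and> card Y' = card Y}"
    unfolding P_def by auto
  moreover have perm: "\<sigma> permutes ?Z" if "\<sigma> \<in> S \<union> g ` P" for \<sigma>
    using that g permutes_subset[OF S, of \<sigma> ?Z] by auto
  ultimately have "garnir_reps (insert x D) Y (S \<union> g ` P)" unfolding garnir_reps_def by simp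
  moreover have "\<sigma> ` Y \<subseteq> D \<union> Y" if "\<sigma> \<in> S" for \<sigma> using permutes_image[OF S[OF that]] by blast
  hence "S \<inter> g ` P = {}" using g assms(4) unfolding P_def by fastforce
  moreover have "finite (S \<union> g ` P)"
    by (rule finite_subset[OF _ finite_permutations[OF finZ]]) (use perm in auto)
  moreover have "\<forall>\<sigma>\<in>g ` P. x \<in> \<sigma> ` Y" using g by (auto simp: P_def)
  ultimately show ?thesis by blast
qed

text \<open>
  Adjoining \<open>x\<close> to \<open>D\<close> produces further terms, but in each of them \<open>x\<close> is moved to column \<open>j'\<close>.
\<close>

lemma garnir_vanishing_sum:
  assumes \<psi>: "garnir \<nu> A \<psi>" and van: "\<And>t j. \<lbrakk>t \<in> tabs \<nu> A; q < j; x \<in> column t j\<rbrakk> \<Longrightarrow> \<psi> t = 0"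
    and t: "t \<in> tabs \<nu> A" "x \<in> column t q" and j': "q < j'" "D \<subseteq> column t q - {x}" "Y \<subseteq> column t j'"
    and S: "garnir_reps D Y S" and card: "card (column t q) < Suc (card D) + card Y"
  shows "(\<Sum>\<sigma>\<in>S. of_int (sign \<sigma>) * \<psi> (relabel \<sigma> t)) = 0"
proof -
  have fin: "finite D" "finite Y"
    using finite_subset[OF _ finite_column] j'(2,3) by blast+
  have x: "x \<notin> D \<union> Y" using j' t(2) column_unique[OF tabsD(3)[OF t(1)], of x q j'] by blast
  obtain S' where S': "garnir_reps (insert x D) Y (S \<union> S')" "S \<inter> S' = {}" "finite (S \<union> S')"
    "\<And>\<sigma>. \<sigma> \<in> S' \<Longrightarrow> x \<in> \<sigma> ` Y"
    using garnir_reps_extend[OF S fin x] by blast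
  have DA: "insert x D \<union> Y \<subseteq> A"
    using j' t(2) column_subset[of t] tabsD(4)[OF t(1)] by blast
  have "\<psi> (relabel \<sigma> t) = 0" if \<sigma>: "\<sigma> \<in> S'" for \<sigma>
  proof (rule van[OF _ j'(1)])
    have "\<sigma> permutes insert x D \<union> Y" using S'(1) \<sigma> by (simp add: garnir_reps_def)
    thus "relabel \<sigma> t \<in> tabs \<nu> A" by (intro tabs_permute[OF t(1)] permutes_subset[OF _ DA])
    show "x \<in> column (relabel \<sigma> t) j'" unfolding column_map using S'(4)[OF \<sigma>] j'(3) by blast
  qed
  moreover have "(\<Sum>\<sigma>\<in>S \<union> S'. of_int (sign \<sigma>) * \<psi> (relabel \<sigma> t)) = 0"
    by (rule garnirD(2)[OF \<psi> t(1) j'(1) _ j'(3) _ S'(1)]) (use j'(2) t(2) card fin x in auto)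
  ultimately show ?thesis using S'(2,3) by (simp add: sum.union_disjoint)
qed

definition bottom :: "nat list \<Rightarrow> nat \<Rightarrow> nat \<Rightarrow> bool" where
  "bottom \<nu> q a \<longleftrightarrow> a < length \<nu> \<and> q < \<nu> ! a \<and> (\<forall>i<length \<nu>. q < \<nu> ! i \<longrightarrow> i \<le> a)"

text \<open>Row \<open>a\<close> ends in a removable box, phrased through row lengths: no later row
  is at least as long. This also makes sense for lists with zeros, which occur once a row has been
  emptied.\<close>

definition corner :: "nat list \<Rightarrow> nat \<Rightarrow> bool" where
  "corner \<nu> a \<longleftrightarrow> a < length \<nu> \<and> 0 < \<nu> ! a \<and> (\<forall>i<length \<nu>. \<nu> ! a \<le> \<nu> ! i \<longrightarrow> i \<le> a)"

lemma bottom_corner: "\<nu> ! a = Suc q \<Longrightarrow> bottom \<nu> q a \<longleftrightarrow> corner \<nu> a"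
  by (auto simp: bottom_def corner_def Suc_le_eq)

lemma bottom_exists:
  assumes "i < length \<nu>" "q < \<nu> ! i"
  shows "\<exists>a. bottom \<nu> q a"
proof -
  have "\<exists>a. (a < length \<nu> \<and> q < \<nu> ! a) \<and> (\<forall>i. i < length \<nu> \<and> q < \<nu> ! i \<longrightarrow> i \<le> a)"
    using Nat.ex_has_greatest_nat[of "\<lambda>i. i < length \<nu> \<and> q < \<nu> ! i" i "length \<nu>"] assms by auto
  thus ?thesis unfolding bottom_def by blast
qed

lemma garnir_diff:
  assumes "garnir \<nu> A \<psi>" "garnir \<nu> A \<psi>'"
  shows "garnir \<nu> A (\<lambda>t. \<psi> t - \<psi>' t)"
  unfolding garnir_def
proof (intro ballI conjI allI impI)
  fix t \<pi> assume "t \<in> tabs \<nu> A" "\<pi> \<in> column_stabilizer t"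
  thus "\<psi> (relabel \<pi> t) - \<psi>' (relabel \<pi> t) = of_int (sign \<pi>) * (\<psi> t - \<psi>' t)"
    using garnirD(1)[OF assms(1)] garnirD(1)[OF assms(2)] by (simp add: right_diff_distrib)
next
  fix t j j' D Y S
  assume t: "t \<in> tabs \<nu> A" and "j < j' \<and> D \<subseteq> column t j \<and> Y \<subseteq> column t j' \<and>
      card (column t j) < card D + card Y \<and> garnir_reps D Y S"
  thus "(\<Sum>\<sigma>\<in>S. of_int (sign \<sigma>) * (\<psi> (relabel \<sigma> t) - \<psi>' (relabel \<sigma> t))) = 0"
    using garnirD(2)[OF assms(1) t, of j j' D Y S] garnirD(2)[OF assms(2) t, of j j' D Y S]
    by (simp add: right_diff_distrib sum_subtractf)
qed

text \<open>Appending \<open>x\<close> lengthens column \<open>q\<close> by one, so a relation of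
  \<open>s\<close> with left column \<open>q\<close> falls one short of the bound for the larger
  tableau; \<open>garnir_vanishing_sum\<close> makes up for it. Any other left column keeps its
  length and the relation carries over.\<close>

lemma garnir_addx:
  assumes \<psi>: "garnir \<nu> A \<psi>" and van: "\<And>t j. \<lbrakk>t \<in> tabs \<nu> A; q < j; x \<in> column t j\<rbrakk> \<Longrightarrow> \<psi> t = 0"
    and x: "x \<in> A" and a: "a < length \<nu>" "\<nu> ! a = Suc q"
  shows "garnir (\<nu>[a := q]) (A - {x}) (\<lambda>s. \<psi> (s[a := s ! a @ [x]]))"
  unfolding garnir_def
proof (intro ballI conjI allI impI)
  fix s \<pi> assume s: "s \<in> tabs (\<nu>[a := q]) (A - {x})" and \<pi>: "\<pi> \<in> column_stabilizer s"
  have as: "a < length s" using tabsD(1)[OF s] a(1) by simp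
  have xs: "x \<notin> set (concat s)" using tabsD(4)[OF s] by blast
  have "\<pi> \<in> column_stabilizer (s[a := s ! a @ [x]])" "\<pi> x = x"
    using \<pi> column_stabilizer_addx[OF as xs] by blast+
  thus "\<psi> ((relabel \<pi> s)[a := relabel \<pi> s ! a @ [x]]) = of_int (sign \<pi>) * \<psi> (s[a := s ! a @ [x]])"
    using garnirD(1)[OF \<psi> tabs_addx[OF s x a], of \<pi>] relabel_addx[OF _ as, of \<pi> x] by simp
next
  fix s j j' D Y S
  assume s: "s \<in> tabs (\<nu>[a := q]) (A - {x})" and asm: "j < j' \<and> D \<subseteq> column s j \<and> Y \<subseteq> column s j' \<and>
      card (column s j) < card D + card Y \<and> garnir_reps D Y S"
  let ?t = "s[a := s ! a @ [x]]"
  have as: "a < length s" "length (s ! a) = q" using tabsD(1)[OF s] tabsD(2)[OF s, of a] a(1) by simp_all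
  have xs: "x \<notin> column s l" for l using tabsD(4)[OF s] column_subset by blast
  note c = column_addx[OF as, of x]
  note t = tabs_addx[OF s x a]
  have "(\<Sum>\<sigma>\<in>S. of_int (sign \<sigma>) * \<psi> (relabel \<sigma> ?t)) = 0"
  proof (cases "j = q")
    case True
    show ?thesis
      by (rule garnir_vanishing_sum[OF \<psi> van t _ _ _ _ conjunct2[OF conjunct2[OF conjunct2[OF conjunct2[OF asm]]]]])
        (use asm True xs finite_column in \<open>auto simp: c\<close>)
  next
    case False
    show ?thesis
      by (rule garnirD(2)[OF \<psi> t, where j = j and j' = j' and D = D and Y = Y])
        (use asm False in \<open>auto simp: c\<close>)
  qed
  moreover have "relabel \<sigma> ?t = (relabel \<sigma> s)[a := relabel \<sigma> s ! a @ [x]]" if "\<sigma> \<in> S" for \<sigma>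
  proof (rule relabel_addx[OF _ as(1)])
    have "\<sigma> permutes D \<union> Y" using asm that by (simp add: garnir_reps_def)
    moreover have "x \<notin> D \<union> Y" using asm xs by blast
    ultimately show "\<sigma> x = x" by (rule permutes_not_in)
  qed
  ultimately show "(\<Sum>\<sigma>\<in>S. of_int (sign \<sigma>) * \<psi> ((relabel \<sigma> s)[a := relabel \<sigma> s ! a @ [x]])) = 0"
    by simp
qed

lemma sorted_corner:
  assumes "sorted_wrt (\<ge>) \<nu>" "bottom \<nu> q a" "\<nu> ! a = Suc q"
  shows "sorted_wrt (\<ge>) (\<nu>[a := q])"
  unfolding sorted_wrt_iff_nth_less
proof (intro allI impI)
  fix i j assume ij: "i < j" "j < length (\<nu>[a := q])"
  have "\<nu> ! j \<le> \<nu> ! i" using sorted_wrt_nth_less[OF assms(1)] ij by simp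
  moreover have "\<nu> ! j \<le> q" if "a < j" using assms(2) that ij unfolding bottom_def by (metis leI length_list_update not_le)
  ultimately show "\<nu>[a := q] ! j \<le> \<nu>[a := q] ! i"
    using ij assms(3) by (cases "i = a"; cases "j = a") (simp_all add: nth_list_update)
qed

lemma bottom_entry:
  assumes "t \<in> tabs \<nu> A" "bottom \<nu> q a" "x \<in> column t q" "\<pi> = transpose x (t ! a ! q)"
  shows "\<pi> \<in> column_stabilizer t" "relabel \<pi> t ! a ! q = x"
proof -
  have a: "a < length t" "q < length (t ! a)"
    using assms(2) tabsD(1,2)[OF assms(1)] by (auto simp: bottom_def)
  have b: "t ! a ! q \<in> column t q" unfolding column_iff using a by blast
  show "relabel \<pi> t ! a ! q = x" using a assms(4) by simp
  show "\<pi> \<in> column_stabilizer t"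
  proof (rule stabilizing_perm_in_column_stabilizer)
    show "distinct (concat t)" by (rule tabsD(3)[OF assms(1)])
    show "column t q \<subseteq> column t q" "{} \<subseteq> column t (Suc q)" "q \<noteq> Suc q" "\<pi> ` {} = {}" by simp_all
    show "\<pi> permutes column t q \<union> {}" using assms(3,4) b permutes_swap_id by simp
  qed
qed

lemma of_int_sign_cancel: "(of_int (sign \<pi>) :: 'k::field) * c = of_int (sign \<pi>) * d \<longleftrightarrow> c = d"
  by (simp add: sign_def)

lemma column_row:
  assumes "distinct (concat t)" "a < length t" "x \<in> column t j" "\<pi> \<in> column_stabilizer t"
    and "y \<in> set (t ! a)" "\<pi> y = x"
  shows "y = t ! a ! j" "j < length (t ! a)"
proof -
  have "x \<in> \<pi> ` column t j" using assms(3) column_stabilizerD(2)[OF assms(4)] by simp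
  hence "y \<in> column t j"
    using assms(6) permutes_inj[OF column_stabilizerD(1)[OF assms(4)]] by (auto dest: injD)
  thus "y = t ! a ! j" "j < length (t ! a)" using row_column_unique[OF assms(1,2,5)] by simp_all
qed

lemma tabloid_perm_nth:
  "a < length t \<Longrightarrow> tabloid_perm (tabloid_of t) \<pi> ! a = \<pi> ` set (t ! a)"
  by (simp add: tabloid_perm_def tabloid_of_def)

text \<open>\<open>m\<close> sees only tabloids with \<open>x\<close> in row \<open>a\<close>. The
  one letter of row \<open>a\<close> in the column of \<open>x\<close> is \<open>x\<close> itself,
  so among the column permutations of the larger tableau just those fixing \<open>x\<close>
  contribute, and they form the column stabilizer of \<open>s\<close>.\<close>

lemma pairing_addx:
  fixes m' :: "tabloid \<Rightarrow> 'k::field"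
  assumes s: "s \<in> tabs (\<nu>[a := q]) (A - {x})" and x: "x \<in> A" and a: "a < length \<nu>" "\<nu> ! a = Suc q"
  defines "m U \<equiv> if x \<in> U ! a then m' (U[a := U ! a - {x}]) else 0"
  shows "pairing m (s[a := s ! a @ [x]]) = pairing m' s"
proof -
  define t where "t = s[a := s ! a @ [x]]"
  have t: "t \<in> tabs \<nu> A" unfolding t_def by (rule tabs_addx[OF s x a])
  note tD = tabsD[OF t]
  have as: "a < length s" using tabsD(1)[OF s] a by simp
  have at: "a < length t" using as by (simp add: t_def)
  have xs: "x \<notin> set (concat s)" using tabsD(4)[OF s] by blast
  have ta: "t ! a = s ! a @ [x]" "length (s ! a) = q" using as a tabsD(2)[OF s, of a] by (simp_all add: t_def)
  have taq: "t ! a ! q = x" using ta by (simp add: nth_append)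
  have xt: "x \<in> column t q" unfolding column_iff using at ta taq by (intro exI[of _ a]) simp
  have "pairing m t = (\<Sum>\<pi>\<in>column_stabilizer s. of_int (sign \<pi>) * m (tabloid_perm (tabloid_of t) \<pi>))"
    unfolding pairing_def column_stabilizer_addx[OF as xs, folded t_def]
  proof (rule sum.mono_neutral_right[OF finite_column_stabilizer])
    show "\<forall>\<pi>\<in>column_stabilizer t - {\<pi> \<in> column_stabilizer t. \<pi> x = x}.
        of_int (sign \<pi>) * m (tabloid_perm (tabloid_of t) \<pi>) = 0"
    proof
      fix \<rho> assume \<rho>: "\<rho> \<in> column_stabilizer t - {\<pi> \<in> column_stabilizer t. \<pi> x = x}"
      have "x \<notin> \<rho> ` set (t ! a)"
      proof
        assume "x \<in> \<rho> ` set (t ! a)"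
        then obtain y where y: "y \<in> set (t ! a)" "\<rho> y = x" by auto
        hence "y = x" using column_row(1)[OF tD(3) at xt, of \<rho> y] y \<rho> taq by simp
        thus False using y \<rho> by simp
      qed
      thus "of_int (sign \<rho>) * m (tabloid_perm (tabloid_of t) \<rho>) = 0"
        by (simp add: m_def tabloid_perm_nth[OF at])
    qed
  qed blast
  also have "\<dots> = pairing m' s" unfolding pairing_def
  proof (rule sum.cong[OF refl])
    fix \<rho> assume \<rho>: "\<rho> \<in> column_stabilizer s"
    have p: "\<rho> permutes set (concat s)" by (rule column_stabilizerD(1)[OF \<rho>])
    have \<rho>x: "\<rho> x = x" using permutes_not_in[OF p xs] .
    have row: "\<rho> ` set (t ! a) = insert x (\<rho> ` set (s ! a))" using \<rho>x ta by simp
    have "x \<notin> \<rho> ` set (s ! a)"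
    proof
      assume "x \<in> \<rho> ` set (s ! a)"
      then obtain y where y: "y \<in> set (s ! a)" "\<rho> y = \<rho> x" using \<rho>x by auto
      have "y = x" by (rule injD[OF permutes_inj[OF p] y(2)])
      thus False using xs as y(1) by auto
    qed
    hence "(tabloid_perm (tabloid_of t) \<rho>)[a := \<rho> ` set (t ! a) - {x}] = tabloid_perm (tabloid_of s) \<rho>"
      unfolding row using as
      by (intro nth_equalityI) (auto simp: t_def tabloid_perm_def tabloid_of_def nth_list_update)
    thus "of_int (sign \<rho>) * m (tabloid_perm (tabloid_of t) \<rho>) =
        of_int (sign \<rho>) * m' (tabloid_perm (tabloid_of s) \<rho>)"
      unfolding m_def tabloid_perm_nth[OF at] using row by simp
  qed
  finally show ?thesis by (simp add: t_def)
qed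

text \<open>Up to sign, \<open>x\<close> may be moved to the end of its column.\<close>

lemma obtain_addx:
  assumes t: "t \<in> tabs \<nu> A" and b: "bottom \<nu> q a" "\<nu> ! a = Suc q" and x: "x \<in> column t q"
  obtains \<pi> s where "\<pi> \<in> column_stabilizer t" "s \<in> tabs (\<nu>[a := q]) (A - {x})"
    "relabel \<pi> t = s[a := s ! a @ [x]]"
proof
  let ?\<pi> = "transpose x (t ! a ! q)"
  note be = bottom_entry[OF t b(1) x refl]
  show "?\<pi> \<in> column_stabilizer t" by (rule be(1))
  have a: "a < length \<nu>" using b(1) by (simp add: bottom_def)
  have t': "relabel ?\<pi> t \<in> tabs \<nu> A"
    using tabs_permute[OF t] column_stabilizerD(1)[OF be(1)] tabsD(4)[OF t] by simp
  let ?s = "(relabel ?\<pi> t)[a := butlast (relabel ?\<pi> t ! a)]"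
  show "?s \<in> tabs (\<nu>[a := q]) (A - {x})" "relabel ?\<pi> t = ?s[a := ?s ! a @ [x]]"
    using tabs_remove[OF t' a b(2) be(2)] by simp_all
qed

text \<open>If \<open>x\<close> lies beyond column \<open>q\<close>, row \<open>a\<close> is too
  short for a column permutation to bring \<open>x\<close> there, so the pairing vanishes along with
  \<open>\<psi>\<close>. In column \<open>q\<close>, antisymmetry reduces to the case of
  \<open>x\<close> at the end of row \<open>a\<close>, where \<open>pairing_addx\<close>
  applies.\<close>

lemma garnir_corner_step:
  assumes \<psi>: "garnir \<nu> A \<psi>"
    and van: "\<And>t j. \<lbrakk>t \<in> tabs \<nu> A; q < j; x \<in> column t j\<rbrakk> \<Longrightarrow> \<psi> t = 0"
    and x: "x \<in> A" and b: "bottom \<nu> q a" "\<nu> ! a = Suc q"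
    and m': "\<And>s. s \<in> tabs (\<nu>[a := q]) (A - {x}) \<Longrightarrow> \<psi> (s[a := s ! a @ [x]]) = pairing m' s"
  defines "m U \<equiv> if x \<in> U ! a then m' (U[a := U ! a - {x}]) else 0"
  assumes t: "t \<in> tabs \<nu> A" "x \<in> column t j" "q \<le> j"
  shows "\<psi> t = pairing m t"
proof -
  have a: "a < length \<nu>" using b(1) by (simp add: bottom_def)
  hence at: "a < length t" "length (t ! a) = Suc q" using tabsD(1,2)[OF t(1)] b(2) by simp_all
  show ?thesis
  proof (cases "j = q")
    case False
    hence "m (tabloid_perm (tabloid_of t) \<pi>) = 0" if "\<pi> \<in> column_stabilizer t" for \<pi>
      using column_row(2)[OF tabsD(3)[OF t(1)] at(1) t(2) that] at(2) t(3)
      unfolding m_def tabloid_perm_nth[OF at(1)] by force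
    thus ?thesis using van[OF t(1) _ t(2)] t(3) False by (simp add: pairing_def)
  next
    case True
    with t(2) have "x \<in> column t q" by simp
    then obtain \<pi> s where \<pi>: "\<pi> \<in> column_stabilizer t" and s: "s \<in> tabs (\<nu>[a := q]) (A - {x})"
      and eq: "relabel \<pi> t = s[a := s ! a @ [x]]"
      by (rule obtain_addx[OF t(1) b])
    have "pairing m (relabel \<pi> t) = \<psi> (relabel \<pi> t)"
      unfolding eq m'[OF s] m_def by (rule pairing_addx[OF s x a b(2)])
    hence "of_int (sign \<pi>) * pairing m t = of_int (sign \<pi>) * \<psi> t"
      using garnirD(1)[OF \<psi> t(1) \<pi>] pairing_antisym[OF \<pi>, of m] by simp
    thus ?thesis unfolding of_int_sign_cancel by simp
  qed
qed

text \<open>The last row reaching column \<open>q\<close> is longer than \<open>Suc q\<close>, so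
  column \<open>Suc q\<close> is at least as high as column \<open>q\<close>. With \<open>D\<close>
  empty and \<open>Y\<close> the whole of column \<open>Suc q\<close>, the relation of
  \<open>garnir_vanishing_sum\<close> has the single term \<open>\<psi> t\<close>.\<close>

lemma garnir_vanish_noncorner:
  assumes dec: "sorted_wrt (\<ge>) \<nu>" and \<psi>: "garnir \<nu> A \<psi>"
    and van: "\<And>t j. \<lbrakk>t \<in> tabs \<nu> A; q < j; x \<in> column t j\<rbrakk> \<Longrightarrow> \<psi> t = 0"
    and b: "bottom \<nu> q a" "\<nu> ! a \<noteq> Suc q" and t: "t \<in> tabs \<nu> A" "x \<in> column t q"
  shows "\<psi> t = 0"
proof -
  note tD = tabsD[OF t(1)]
  have "column t q \<subseteq> (\<lambda>i. t ! i ! q) ` {..a}"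
    using b(1) tD(1,2) by (auto simp: column_iff bottom_def)
  hence "card (column t q) \<le> Suc a"
    using card_mono[of "(\<lambda>i. t ! i ! q) ` {..a}" "column t q"] card_image_le[of "{..a}" "\<lambda>i. t ! i ! q"] by simp
  moreover have "Suc a \<le> card (column t (Suc q))"
  proof -
    have len: "Suc q < length (t ! i) \<and> i < length t" if "i \<le> a" for i
      using that b tD(1) tD(2)[of i] sorted_wrt_nth_less[OF dec, of i a]
      by (cases "i = a") (auto simp: bottom_def)
    have "inj_on (\<lambda>i. t ! i ! Suc q) {..a}"
    proof (rule inj_onI)
      fix i i' assume "i \<in> {..a}" "i' \<in> {..a}" "t ! i ! Suc q = t ! i' ! Suc q"
      thus "i = i'" using position_unique[OF tD(3), of i "Suc q" i' "Suc q"] len by auto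
    qed
    hence "card ((\<lambda>i. t ! i ! Suc q) ` {..a}) = Suc a" by (simp add: card_image)
    moreover have "(\<lambda>i. t ! i ! Suc q) ` {..a} \<subseteq> column t (Suc q)"
    proof clarify
      fix i assume "i \<le> a"
      thus "t ! i ! Suc q \<in> column t (Suc q)" unfolding column_iff using len by (intro exI[of _ i]) simp
    qed
    ultimately show ?thesis using card_mono[OF finite_column] by metis
  qed
  moreover have "garnir_reps {} (column t (Suc q)) {id}"
  proof -
    have "{Y'. Y' \<subseteq> {} \<union> column t (Suc q) \<and> card Y' = card (column t (Suc q))} = {column t (Suc q)}"
      using card_subset_eq[OF finite_column] by auto
    thus ?thesis by (simp add: garnir_reps_def bij_betw_def permutes_id)
  qed
  ultimately have "(\<Sum>\<sigma>\<in>{id}. of_int (sign \<sigma>) * \<psi> (relabel \<sigma> t)) = 0"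
    by (intro garnir_vanishing_sum[OF \<psi> van t, where j' = "Suc q" and D = "{}" and Y = "column t (Suc q)"]) auto
  thus ?thesis by simp
qed

text \<open>\<open>IH\<close> is an explicit hypothesis so that the step serves both inside the
  induction for \<open>garnir_is_pairing\<close> and afterwards, with that theorem in its place. The
  support of \<open>m\<close> is recorded for \<open>colspan_Suc\<close>, where a vector vanishing
  on it is tested.\<close>

lemma garnir_step:
  assumes dec: "sorted_wrt (\<ge>) \<nu>" and \<psi>: "garnir \<nu> A \<psi>"
    and van: "\<And>t j. \<lbrakk>t \<in> tabs \<nu> A; q < j; x \<in> column t j\<rbrakk> \<Longrightarrow> \<psi> t = 0" and x: "x \<in> A"
    and IH: "\<And>\<nu>' \<psi>' :: nat list list \<Rightarrow> 'k::field. \<lbrakk>sorted_wrt (\<ge>) \<nu>'; garnir \<nu>' (A - {x}) \<psi>'\<rbrakk> \<Longrightarrow>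
      \<exists>m. \<forall>s\<in>tabs \<nu>' (A - {x}). \<psi>' s = pairing m s"
  shows "\<exists>m :: tabloid \<Rightarrow> 'k. (\<forall>U. (\<forall>a. corner \<nu> a \<and> \<nu> ! a = Suc q \<longrightarrow> x \<notin> U ! a) \<longrightarrow> m U = 0) \<and>
    (\<forall>t\<in>tabs \<nu> A. \<forall>j\<ge>q. x \<in> column t j \<longrightarrow> \<psi> t = pairing m t)"
proof (cases "\<exists>a. bottom \<nu> q a \<and> \<nu> ! a = Suc q")
  case True
  then obtain a where b: "bottom \<nu> q a" "\<nu> ! a = Suc q" by blast
  have a: "a < length \<nu>" using b(1) by (simp add: bottom_def)
  obtain m' where m': "\<And>s. s \<in> tabs (\<nu>[a := q]) (A - {x}) \<Longrightarrow> \<psi> (s[a := s ! a @ [x]]) = pairing m' s"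
  proof -
    have "garnir (\<nu>[a := q]) (A - {x}) (\<lambda>s. \<psi> (s[a := s ! a @ [x]]))"
      by (rule garnir_addx[OF \<psi> _ x a b(2)]) (rule van)
    from IH[OF sorted_corner[OF dec b] this] show ?thesis using that by blast
  qed
  let ?m = "\<lambda>U. if x \<in> U ! a then m' (U[a := U ! a - {x}]) else 0"
  have "\<psi> t = pairing ?m t" if "t \<in> tabs \<nu> A" "x \<in> column t j" "q \<le> j" for t j
    by (rule garnir_corner_step[OF \<psi> _ x b _ that]) (erule (2) van, erule m')
  thus ?thesis using b bottom_corner[OF b(2)] by (intro exI[of _ ?m]) auto
next
  case False
  have "\<psi> t = 0" if t: "t \<in> tabs \<nu> A" "q \<le> j" "x \<in> column t j" for t j
  proof (cases "j = q")
    case True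
    then obtain i where "i < length \<nu>" "q < \<nu> ! i"
      using t(3) tabsD(1,2)[OF t(1)] by (auto simp: column_iff)
    then obtain a where "bottom \<nu> q a" using bottom_exists by blast
    with False have b: "bottom \<nu> q a" "\<nu> ! a \<noteq> Suc q" by auto
    show ?thesis
      by (rule garnir_vanish_noncorner[OF dec \<psi> _ b t(1)]) (use t(3) True van in auto)
  next
    case jq: False
    show ?thesis by (rule van[OF t(1) _ t(3)]) (use jq t(2) in simp)
  qed
  thus ?thesis by (intro exI[of _ "\<lambda>_. 0"]) (simp add: pairing_def)
qed

text \<open>Induction on the number of letters, and within it on the columns from right to left.
  Once a pairing agrees with \<open>\<psi>\<close> for \<open>x\<close> beyond column
  \<open>q\<close>, the difference is Garnir again by \<open>garnir_pairing\<close> and vanishes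
  there, so \<open>garnir_step\<close> corrects it in column \<open>q\<close> without spoiling the
  later columns.\<close>

theorem garnir_is_pairing:
  assumes "sorted_wrt (\<ge>) \<nu>" "garnir \<nu> A (\<psi> :: nat list list \<Rightarrow> 'k::field)" "finite A"
  shows "\<exists>m. \<forall>t\<in>tabs \<nu> A. \<psi> t = pairing m t"
  using assms
proof (induction "card A" arbitrary: A \<nu> \<psi>)
  case 0
  hence "A = {}" by simp
  show ?case
  proof (cases "tabs \<nu> A = {}")
    case False
    \<comment> \<open>Without letters there is only the tableau of empty rows, and its column
      stabilizer is trivial, so a constant vector will do.\<close>
    have t: "t = map (\<lambda>_. []) \<nu>" if "t \<in> tabs \<nu> A" for t
      using tabsD(1,4)[OF that] \<open>A = {}\<close> by (simp add: map_replicate_const replicate_eqI)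
    have "column_stabilizer t = {id}" if "t \<in> tabs \<nu> A" for t
    proof -
      have e: "set (concat t) = {}" using tabsD(4)[OF that] \<open>A = {}\<close> by simp
      have "column t j = {}" for j using column_subset[of t j] unfolding e by simp
      thus ?thesis unfolding column_stabilizer_def e by auto
    qed
    thus ?thesis using t by (intro exI[of _ "\<lambda>_. \<psi> (map (\<lambda>_. []) \<nu>)"]) (auto simp: pairing_def)
  qed simp
next
  case (Suc c)
  then obtain x where x: "x \<in> A" by fastforce
  have IH: "\<exists>m. \<forall>s\<in>tabs \<nu>' (A - {x}). \<psi>' s = pairing m s"
    if "sorted_wrt (\<ge>) \<nu>'" "garnir \<nu>' (A - {x}) \<psi>'" for \<nu>' and \<psi>' :: "nat list list \<Rightarrow> 'k"
    by (rule Suc.hyps(1)[OF _ that]) (use Suc.hyps(2) Suc.prems(3) x in simp_all)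
  \<comment> \<open>No letter lies in a column of index \<open>?N\<close> or larger, which starts
    the induction on \<open>d\<close>.\<close>
  let ?N = "Suc (sum_list \<nu>)"
  have "\<exists>m. \<forall>t\<in>tabs \<nu> A. \<forall>j. ?N - d \<le> j \<longrightarrow> x \<in> column t j \<longrightarrow> \<psi> t = pairing m t" for d
  proof (induction d)
    case 0
    have "x \<notin> column t j" if t: "t \<in> tabs \<nu> A" "?N \<le> j" for t j
    proof
      assume "x \<in> column t j"
      then obtain i where "i < length \<nu>" "j < \<nu> ! i"
        using tabsD(1,2)[OF t(1)] by (auto simp: column_iff)
      thus False using t(2) member_le_sum_list[of "\<nu> ! i" \<nu>] by simp
    qed
    thus ?case by auto
  next
    case (Suc d)
    then obtain m where m: "\<And>t j. \<lbrakk>t \<in> tabs \<nu> A; ?N - d \<le> j; x \<in> column t j\<rbrakk> \<Longrightarrow> \<psi> t = pairing m t"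
      by blast
    show ?case
    proof (cases "d < ?N")
      case True
      define q where "q = ?N - Suc d"
      have q: "Suc q = ?N - d" using True by (simp add: q_def)
      have mq: "\<psi> t - pairing m t = 0" if "t \<in> tabs \<nu> A" "q < j" "x \<in> column t j" for t j
        using m[OF that(1) _ that(3)] that(2) q by simp
      have "\<exists>m' :: tabloid \<Rightarrow> 'k.
          (\<forall>U. (\<forall>a. corner \<nu> a \<and> \<nu> ! a = Suc q \<longrightarrow> x \<notin> U ! a) \<longrightarrow> m' U = 0) \<and>
        (\<forall>t\<in>tabs \<nu> A. \<forall>j\<ge>q. x \<in> column t j \<longrightarrow> \<psi> t - pairing m t = pairing m' t)"
        by (rule garnir_step[OF \<open>sorted_wrt (\<ge>) \<nu>\<close>
              garnir_diff[OF \<open>garnir \<nu> A \<psi>\<close> garnir_pairing[OF \<open>sorted_wrt (\<ge>) \<nu>\<close>]] mq x IH])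
      then obtain m' where "\<And>t j. \<lbrakk>t \<in> tabs \<nu> A; q \<le> j; x \<in> column t j\<rbrakk> \<Longrightarrow> \<psi> t - pairing m t = pairing m' t"
        by blast
      hence "\<psi> t = pairing (\<lambda>U. m U + m' U) t" if "t \<in> tabs \<nu> A" "q \<le> j" "x \<in> column t j" for t j
        using that by (simp add: pairing_def distrib_left sum.distrib diff_eq_eq add.commute)
      thus ?thesis unfolding q_def by blast
    qed (use m in \<open>auto intro!: exI[of _ m]\<close>)
  qed
  from this[of ?N] obtain m where m: "\<And>t j. \<lbrakk>t \<in> tabs \<nu> A; x \<in> column t j\<rbrakk> \<Longrightarrow> \<psi> t = pairing m t"
    by auto
  have "\<exists>j. x \<in> column t j" if "t \<in> tabs \<nu> A" for t
    using column_exists[of x t] tabsD(4)[OF that] x by (simp del: set_concat)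
  thus ?case using m by blast
qed

section \<open>The branching rule for Specht modules of symmetric groups\<close>

definition spechtA :: "nat list \<Rightarrow> nat set \<Rightarrow> (tabloid \<Rightarrow> 'k::field) set" where
  "spechtA \<nu> A = fun_vs.span (polytabloid ` tabs \<nu> A)"

lemma specht_spechtA: "specht \<nu> = spechtA \<nu> {..<sum_list \<nu>}"
  by (simp add: specht_def spechtA_def tableaux_tabs)

definition indicat :: "'x \<Rightarrow> 'x \<Rightarrow> 'k::field" where
  "indicat U = (\<lambda>V. if V = U then 1 else 0)"

lemma polytabloid_pairing: "polytabloid t U = pairing (indicat U) t"
  unfolding polytabloid_def pairing_def indicat_def by (intro sum.cong refl) auto

lemma polytabloid_sum:
  "polytabloid t = (\<Sum>\<pi>\<in>column_stabilizer t.
    fscale (of_int (sign \<pi>)) (indicat (tabloid_perm (tabloid_of t) \<pi>)) :: tabloid \<Rightarrow> 'k::field)"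
  by (rule ext) (auto simp: polytabloid_def sum_fun_apply fscale_def indicat_def intro!: sum.cong)

lemma polytabloid_antisym:
  "\<pi> \<in> column_stabilizer t \<Longrightarrow> polytabloid (relabel \<pi> t) = fscale (of_int (sign \<pi>)) (polytabloid t)"
  by (rule ext) (simp add: polytabloid_pairing pairing_antisym fscale_def)

lemma polytabloid_nonzero:
  assumes "polytabloid t U \<noteq> (0::'k::field)"
  obtains \<pi> where "\<pi> \<in> column_stabilizer t" "U = tabloid_perm (tabloid_of t) \<pi>"
proof -
  have "\<exists>\<pi>\<in>column_stabilizer t. U = tabloid_perm (tabloid_of t) \<pi>"
  proof (rule ccontr)
    assume no: "\<not> (\<exists>\<pi>\<in>column_stabilizer t. U = tabloid_perm (tabloid_of t) \<pi>)"
    have "polytabloid t U = (0::'k)" unfolding polytabloid_def by (rule sum.neutral) (use no in auto)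
    thus False using assms by simp
  qed
  thus ?thesis using that by blast
qed

lemma tabloid_perm_tabs:
  assumes "t \<in> tabs \<nu> A" "\<pi> \<in> column_stabilizer t"
  shows "tabloid_perm (tabloid_of t) \<pi> \<in> tabloid_of ` tabs \<nu> A"
proof (rule image_eqI)
  show "tabloid_perm (tabloid_of t) \<pi> = tabloid_of (relabel \<pi> t)" by (simp add: tabloid_of_map)
  show "relabel \<pi> t \<in> tabs \<nu> A"
    using tabs_permute[OF assms(1)] column_stabilizerD(1)[OF assms(2)] tabsD(4)[OF assms(1)] by simp
qed

lemma polytabloid_support:
  "\<lbrakk>t \<in> tabs \<nu> A; polytabloid t U \<noteq> (0::'k::field)\<rbrakk> \<Longrightarrow> U \<in> tabloid_of ` tabs \<nu> A"
  by (erule polytabloid_nonzero) (simp add: tabloid_perm_tabs)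

lemma spechtA_support:
  assumes "f \<in> spechtA \<nu> A" "f U \<noteq> (0::'k::field)"
  shows "U \<in> tabloid_of ` tabs \<nu> A"
proof -
  have f: "f \<in> fun_vs.span (polytabloid ` tabs \<nu> A)" using assms(1) by (simp add: spechtA_def)
  have "f U = 0" if U: "U \<notin> tabloid_of ` tabs \<nu> A"
    using f
  proof (induction rule: fun_vs.span_induct_alt)
    case (step c y z)
    then obtain t where "t \<in> tabs \<nu> A" "y = polytabloid t" by blast
    hence "y U = 0" using polytabloid_support U by blast
    thus ?case using step by (simp add: fscale_def)
  qed simp
  thus ?thesis using assms(2) by blast
qed

lemma tabloid_lettersD:
  assumes "U \<in> tabloid_of ` tabs \<nu> A"
  shows "length U = length \<nu>" "\<Union> (set U) = A" "i < length \<nu> \<Longrightarrow> card (U ! i) = \<nu> ! i"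
    "\<lbrakk>i < length \<nu>; j < length \<nu>; x \<in> U ! i; x \<in> U ! j\<rbrakk> \<Longrightarrow> i = j"
proof -
  obtain t where t: "t \<in> tabs \<nu> A" "U = map set t" using assms by (auto simp: tabloid_of_def)
  note tD = tabsD[OF t(1)]
  show "length U = length \<nu>" "\<Union> (set U) = A" using t(2) tD(1,4) by simp_all
  show "card (U ! i) = \<nu> ! i" if "i < length \<nu>"
  proof -
    have "t ! i \<in> set t" using tD(1) that by simp
    hence "distinct (t ! i)" using tD(3) unfolding distinct_concat_iff by blast
    from distinct_card[OF this] show ?thesis using t(2) tD(1) tD(2)[OF that] that by simp
  qed
  show "i = j" if "i < length \<nu>" "j < length \<nu>" "x \<in> U ! i" "x \<in> U ! j"
  proof -
    have m: "x \<in> set (t ! i)" "x \<in> set (t ! j)" using that t(2) tD(1) by simp_all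
    obtain k where k: "k < length (t ! i)" "x = t ! i ! k" using m(1) by (auto simp: in_set_conv_nth)
    obtain l where l: "l < length (t ! j)" "x = t ! j ! l" using m(2) by (auto simp: in_set_conv_nth)
    have "t ! i ! k = t ! j ! l" using k(2) l(2) by metis
    from position_unique[OF tD(3) _ k(1) _ l(1) this] show ?thesis using that(1,2) tD(1) by simp
  qed
qed

section \<open>A Specht module filtered by the column of one letter\<close>

lemma separating_functional:
  fixes f :: "'x \<Rightarrow> 'k::field"
  assumes "f \<notin> fun_vs.span B"
  shows "\<exists>l. Vector_Spaces.linear fscale (*) l \<and> (\<forall>g\<in>fun_vs.span B. l g = (0::'k)) \<and> l f = 1"
proof -
  interpret fl: vector_space_pair "fscale :: 'k \<Rightarrow> ('x \<Rightarrow> 'k) \<Rightarrow> _" "(*) :: 'k \<Rightarrow> _"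
    by unfold_locales (simp_all add: algebra_simps)
  obtain C where C: "C \<subseteq> B" "fun_vs.independent C" "B \<subseteq> fun_vs.span C"
    using fun_vs.maximal_independent_subset[of B] by blast
  have sp: "fun_vs.span C = fun_vs.span B"
    by (rule fun_vs.span_eq[THEN iffD2]) (use C fun_vs.span_superset in blast)
  have "fun_vs.independent (insert f C)"
    using C(2) assms sp by (intro fun_vs.independent_insertI) auto
  then obtain l where l: "Vector_Spaces.linear fscale (*) l"
      "\<forall>g\<in>insert f C. l g = (if g = f then 1 else 0)"
    using fl.linear_independent_extend[of "insert f C" "\<lambda>g. if g = f then 1 else 0"] by blast
  have "f \<notin> C" using assms sp fun_vs.span_base by blast
  hence "l g = 0" if "g \<in> C" for g using l(2) that by auto
  hence "l g = 0" if "g \<in> fun_vs.span C" for g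
    by (rule fl.linear_eq_0_on_span[OF l(1) _ that])
  thus ?thesis using l sp by auto
qed

text \<open>For an entry \<open>x\<close>, a chain decreasing in \<open>q\<close> from the whole
  Specht module at 0 down to zero beyond the last column.\<close>

definition colspan :: "nat list \<Rightarrow> nat set \<Rightarrow> nat \<Rightarrow> nat \<Rightarrow> (tabloid \<Rightarrow> 'k::field) set" where
  "colspan \<nu> A x q = fun_vs.span {polytabloid t | t. t \<in> tabs \<nu> A \<and> (\<exists>j\<ge>q. x \<in> column t j)}"

text \<open>Otherwise a functional \<open>l\<close> kills the next space of the chain but not
  \<open>f\<close>. On polytabloids \<open>l\<close> is a Garnir function vanishing for
  \<open>x\<close> beyond column \<open>q\<close>, so \<open>garnir_step\<close> represents it on
  \<open>colspan \<nu> A x q\<close> by a vector \<open>m\<close> supported where \<open>x\<close>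
  lies in a removable row of length \<open>Suc q\<close>. There \<open>f\<close> vanishes, whence
  \<open>l f = 0\<close>.\<close>

lemma colspan_Suc:
  fixes f :: "tabloid \<Rightarrow> 'k::field"
  assumes dec: "sorted_wrt (\<ge>) \<nu>" and A: "finite A" and x: "x \<in> A" and f: "f \<in> colspan \<nu> A x q"
    and van: "\<And>a U. \<lbrakk>corner \<nu> a; \<nu> ! a = Suc q; x \<in> U ! a\<rbrakk> \<Longrightarrow> f U = 0"
  shows "f \<in> colspan \<nu> A x (Suc q)"
proof (rule ccontr)
  assume "f \<notin> colspan \<nu> A x (Suc q)"
  then obtain l where l: "Vector_Spaces.linear fscale (*) l" and l0: "\<And>g. g \<in> colspan \<nu> A x (Suc q) \<Longrightarrow> l g = 0"
    and l1: "l f = (1::'k)"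
    unfolding colspan_def using separating_functional by blast
  interpret l: Vector_Spaces.linear "fscale :: 'k \<Rightarrow> (tabloid \<Rightarrow> 'k) \<Rightarrow> _" "(*)" l by (rule l)
  have lp: "l (polytabloid t) = pairing (\<lambda>U. l (indicat U)) t" for t
    unfolding polytabloid_sum pairing_def by (simp add: l.sum l.scale)
  have "\<exists>m :: tabloid \<Rightarrow> 'k. (\<forall>U. (\<forall>a. corner \<nu> a \<and> \<nu> ! a = Suc q \<longrightarrow> x \<notin> U ! a) \<longrightarrow> m U = 0) \<and>
    (\<forall>t\<in>tabs \<nu> A. \<forall>j\<ge>q. x \<in> column t j \<longrightarrow> l (polytabloid t) = pairing m t)"
  proof (rule garnir_step[OF dec _ _ x])
    show "garnir \<nu> A (\<lambda>t. l (polytabloid t))" unfolding lp by (rule garnir_pairing[OF dec])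
    show "l (polytabloid t) = 0" if "t \<in> tabs \<nu> A" "q < j" "x \<in> column t j" for t j
      by (rule l0) (use that in \<open>auto simp: colspan_def Suc_le_eq intro!: fun_vs.span_base\<close>)
    fix \<nu>' and \<psi>' :: "nat list list \<Rightarrow> 'k" assume "sorted_wrt (\<ge>) \<nu>'" "garnir \<nu>' (A - {x}) \<psi>'"
    thus "\<exists>m. \<forall>s\<in>tabs \<nu>' (A - {x}). \<psi>' s = pairing m s"
      by (rule garnir_is_pairing) (use A in simp)
  qed
  then obtain m :: "tabloid \<Rightarrow> 'k" where
    m: "\<And>U. (\<forall>a. corner \<nu> a \<and> \<nu> ! a = Suc q \<longrightarrow> x \<notin> U ! a) \<Longrightarrow> m U = 0"
      "\<And>t j. \<lbrakk>t \<in> tabs \<nu> A; q \<le> j; x \<in> column t j\<rbrakk> \<Longrightarrow> l (polytabloid t) = pairing m t"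
    by blast
  let ?B = "tabloid_of ` tabs \<nu> A"
  have finB: "finite ?B" using finite_tabs[OF A] by simp
  \<comment> \<open>All nonzero values of polytabloids occur at the tabloids in \<open>?B\<close>,
    so the pairing becomes a finite scalar product, which is linear in the vector and extends to the
    whole span.\<close>
  have gen: "(\<Sum>U\<in>?B. m U * polytabloid t U) = pairing m t" if t: "t \<in> tabs \<nu> A" for t
  proof -
    have "(\<Sum>U\<in>?B. m U * polytabloid t U) = (\<Sum>U\<in>?B. \<Sum>\<pi>\<in>column_stabilizer t.
        if U = tabloid_perm (tabloid_of t) \<pi> then of_int (sign \<pi>) * m (tabloid_perm (tabloid_of t) \<pi>) else 0)"
      unfolding polytabloid_def by (auto simp: sum_distrib_left intro!: sum.cong)
    also have "\<dots> = (\<Sum>\<pi>\<in>column_stabilizer t. \<Sum>U\<in>?B.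
        if U = tabloid_perm (tabloid_of t) \<pi> then of_int (sign \<pi>) * m (tabloid_perm (tabloid_of t) \<pi>) else 0)"
      by (rule sum.swap)
    also have "\<dots> = pairing m t" unfolding pairing_def
      using tabloid_perm_tabs[OF t] finB by (intro sum.cong refl) simp
    finally show ?thesis .
  qed
  have "f \<in> fun_vs.span {polytabloid t | t. t \<in> tabs \<nu> A \<and> (\<exists>j\<ge>q. x \<in> column t j)}"
    using f by (simp add: colspan_def)
  hence "l f = (\<Sum>U\<in>?B. m U * f U)"
  proof (induction rule: fun_vs.span_induct_alt)
    case base
    have "l 0 = 0" by (rule l.zero)
    also have "0 = (\<Sum>U\<in>?B. m U * (0 :: tabloid \<Rightarrow> 'k) U)" by (rule sum.neutral[symmetric]) auto
    finally show ?case .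
  next
    case (step c y z)
    then obtain t j where t: "y = polytabloid t" "t \<in> tabs \<nu> A" "q \<le> j" "x \<in> column t j" by blast
    have y: "l y = (\<Sum>U\<in>?B. m U * y U)" unfolding t(1) m(2)[OF t(2-4)] gen[OF t(2)] ..
    have "(\<Sum>U\<in>?B. m U * (fscale c y + z) U) = (\<Sum>U\<in>?B. c * (m U * y U) + m U * z U)"
      by (rule sum.cong[OF refl]) (simp add: fscale_def distrib_left mult.left_commute)
    also have "\<dots> = c * l y + l z"
      unfolding sum.distrib sum_distrib_left[symmetric] y[symmetric] step.IH[symmetric] ..
    also have "\<dots> = l (fscale c y + z)" by (subst l.add, subst l.scale) (rule refl)
    finally show ?case ..
  qed
  also have "\<dots> = 0"
  proof (rule sum.neutral, rule ballI)
    fix U show "m U * f U = 0"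
      using m(1)[of U] van[of _ U] by (metis mult_not_zero)
  qed
  finally show False using l1 by simp
qed

text \<open>The value 0 when \<open>x\<close> is already in row \<open>a\<close> matters: inserting
  it again would change nothing, and the result would repeat values of \<open>f\<close> at tabloids
  that still contain \<open>x\<close>.\<close>

definition unbox :: "nat \<Rightarrow> nat \<Rightarrow> (tabloid \<Rightarrow> 'k::field) \<Rightarrow> tabloid \<Rightarrow> 'k" where
  "unbox a x f = (\<lambda>U. if x \<in> U ! a then 0 else f (U[a := insert x (U ! a)]))"

lemma unbox_add: "unbox a x (f + g) = unbox a x f + unbox a x g"
  and unbox_scale: "unbox a x (fscale c f) = fscale c (unbox a x f)"
  and unbox_zero: "unbox a x 0 = 0"
  by (auto simp: unbox_def fscale_def fun_eq_iff)

text \<open>This is \<open>pairing_addx\<close> for the indicator function of \<open>U\<close>: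
  putting \<open>x\<close> into row \<open>a\<close> of \<open>U\<close> corresponds to deleting it
  from the tabloid compared with \<open>U\<close>. If \<open>U\<close> has the wrong length or
  \<open>x\<close> in row \<open>a\<close>, both sides vanish.\<close>

lemma unbox_polytabloid_addx:
  assumes s: "s \<in> tabs (\<nu>[a := q]) (A - {x})" and x: "x \<in> A" and a: "a < length \<nu>" "\<nu> ! a = Suc q"
  shows "unbox a x (polytabloid (s[a := s ! a @ [x]])) = (polytabloid s :: tabloid \<Rightarrow> 'k::field)"
proof (rule ext)
  fix U
  let ?t = "s[a := s ! a @ [x]]"
  have t: "?t \<in> tabs \<nu> A" by (rule tabs_addx[OF s x a])
  show "unbox a x (polytabloid ?t) U = (polytabloid s U :: 'k)"
  proof (cases "length U = length \<nu> \<and> x \<notin> U ! a")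
    case True
    have "indicat (U[a := insert x (U ! a)]) = (\<lambda>V. if x \<in> V ! a then indicat U (V[a := V ! a - {x}]) else (0::'k))"
    proof (rule ext)
      fix V
      have "V = U[a := insert x (U ! a)] \<longleftrightarrow> x \<in> V ! a \<and> V[a := V ! a - {x}] = U"
      proof
        assume "V = U[a := insert x (U ! a)]"
        thus "x \<in> V ! a \<and> V[a := V ! a - {x}] = U" using True a(1) by simp
      next
        assume V: "x \<in> V ! a \<and> V[a := V ! a - {x}] = U"
        hence "length V = length U" by auto
        hence "U ! a = V ! a - {x}" using V True a(1) by auto
        moreover have "insert x (V ! a - {x}) = V ! a" using V by blast
        ultimately show "V = U[a := insert x (U ! a)]" using V by (metis list_update_id list_update_overwrite)
      qed
      thus "indicat (U[a := insert x (U ! a)]) V = (if x \<in> V ! a then indicat U (V[a := V ! a - {x}]) else (0::'k))"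
        by (auto simp: indicat_def)
    qed
    thus ?thesis using True pairing_addx[OF s x a, of "indicat U"]
      by (simp add: unbox_def polytabloid_pairing)
  next
    case False
    have 1: "polytabloid s U = (0::'k)"
    proof (rule ccontr)
      assume "polytabloid s U \<noteq> (0::'k)"
      note U = polytabloid_support[OF s this]
      have l: "length U = length \<nu>" using tabloid_lettersD(1)[OF U] by simp
      hence "U ! a \<subseteq> A - {x}" using tabloid_lettersD(2)[OF U] a(1) by auto
      thus False using False l by blast
    qed
    have "polytabloid ?t (U[a := insert x (U ! a)]) = (0::'k)" if "length U \<noteq> length \<nu>"
    proof (rule ccontr)
      assume "polytabloid ?t (U[a := insert x (U ! a)]) \<noteq> (0::'k)"
      from tabloid_lettersD(1)[OF polytabloid_support[OF t this]] that show False by simp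
    qed
    thus ?thesis using 1 False by (auto simp: unbox_def)
  qed
qed

text \<open>A column permutation can bring \<open>x\<close> only to a row that reaches the column of
  \<open>x\<close>, and row \<open>a\<close> stops before column \<open>j\<close>.\<close>

lemma polytabloid_row:
  assumes "t \<in> tabs \<nu> A" "x \<in> column t j" "a < length \<nu>" "x \<in> U ! a" "\<nu> ! a \<le> j"
  shows "polytabloid t U = (0::'k::field)"
proof (rule ccontr)
  assume "polytabloid t U \<noteq> (0::'k)"
  then obtain \<pi> where \<pi>: "\<pi> \<in> column_stabilizer t" "U = tabloid_perm (tabloid_of t) \<pi>"
    by (rule polytabloid_nonzero)
  have a: "a < length t" "length (t ! a) = \<nu> ! a" using assms(3) tabsD(1,2)[OF assms(1)] by simp_all
  obtain y where "y \<in> set (t ! a)" "\<pi> y = x"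
    using assms(4) unfolding \<pi>(2) tabloid_perm_nth[OF a(1)] by auto
  thus False using column_row(2)[OF tabsD(3)[OF assms(1)] a(1) assms(2) \<pi>(1)] a(2) assms(5) by simp
qed

text \<open>A generator with \<open>x\<close> in column \<open>q\<close> is, up to sign, the
  polytabloid of a tableau with \<open>x\<close> at the end of row \<open>a\<close>, and deleting
  \<open>x\<close> leaves the smaller polytabloid. A generator with \<open>x\<close> further right
  is killed, as row \<open>a\<close> is too short.\<close>

lemma unbox_colspan:
  assumes f: "f \<in> colspan \<nu> A x q" and x: "x \<in> A" and a: "corner \<nu> a" "\<nu> ! a = Suc q"
  shows "unbox a x f \<in> (spechtA (\<nu>[a := q]) (A - {x}) :: (tabloid \<Rightarrow> 'k::field) set)"
  unfolding spechtA_def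
proof (rule span_closed[where a = "unbox a x", OF unbox_add unbox_scale])
  show "f \<in> fun_vs.span {polytabloid t | t. t \<in> tabs \<nu> A \<and> (\<exists>j\<ge>q. x \<in> column t j)}"
    using f by (simp add: colspan_def)
  fix g :: "tabloid \<Rightarrow> 'k" assume "g \<in> {polytabloid t | t. t \<in> tabs \<nu> A \<and> (\<exists>j\<ge>q. x \<in> column t j)}"
  then obtain t j where t: "g = polytabloid t" "t \<in> tabs \<nu> A" "q \<le> j" "x \<in> column t j" by blast
  have al: "a < length \<nu>" using a(1) by (simp add: corner_def)
  note b = a(1)[folded bottom_corner[OF a(2)]]
  show "unbox a x g \<in> fun_vs.span (polytabloid ` tabs (\<nu>[a := q]) (A - {x}))"
  proof (cases "j = q")
    case True
    obtain \<pi> s where \<pi>: "\<pi> \<in> column_stabilizer t" and s: "s \<in> tabs (\<nu>[a := q]) (A - {x})"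
      and eq: "relabel \<pi> t = s[a := s ! a @ [x]]"
      using obtain_addx[OF t(2) b a(2)] t(4) True by blast
    have "fscale (of_int (sign \<pi>)) (polytabloid (relabel \<pi> t)) = g"
      unfolding t(1) polytabloid_antisym[OF \<pi>] by (simp add: fscale_def of_int_sign_mult)
    hence "unbox a x g = fscale (of_int (sign \<pi>)) (unbox a x (polytabloid (s[a := s ! a @ [x]])))"
      unfolding eq using unbox_scale by metis
    also have "\<dots> = fscale (of_int (sign \<pi>)) (polytabloid s)"
      by (simp only: unbox_polytabloid_addx[OF s x al a(2)])
    finally show ?thesis using s by (auto intro: fun_vs.span_scale fun_vs.span_base)
  next
    case False
    have "unbox a x g U = 0" for U
    proof (rule ccontr)
      assume nz: "unbox a x g U \<noteq> 0"
      hence nz': "polytabloid t (U[a := insert x (U ! a)]) \<noteq> (0::'k)"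
        by (auto simp: unbox_def t(1) split: if_splits)
      have "length U = length \<nu>" using tabloid_lettersD(1)[OF polytabloid_support[OF t(2) nz']] by simp
      hence "x \<in> U[a := insert x (U ! a)] ! a" using al by simp
      hence "polytabloid t (U[a := insert x (U ! a)]) = (0::'k)"
        by (rule polytabloid_row[OF t(2,4) al]) (use a(2) t(3) False in simp)
      with nz' show False by simp
    qed
    hence "unbox a x g = 0" by auto
    thus ?thesis by (simp add: fun_vs.span_zero)
  qed
qed

lemma spechtA_colspan:
  assumes "x \<in> A"
  shows "spechtA \<nu> A = (colspan \<nu> A x 0 :: (tabloid \<Rightarrow> 'k::field) set)"
proof -
  have "\<exists>j. x \<in> column t j" if "t \<in> tabs \<nu> A" for t
    using column_exists[of x t] tabsD(4)[OF that] assms by (simp del: set_concat)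
  hence "(polytabloid ` tabs \<nu> A :: (tabloid \<Rightarrow> 'k) set) =
      {polytabloid t | t. t \<in> tabs \<nu> A \<and> (\<exists>j\<ge>0. x \<in> column t j)}" by auto
  thus ?thesis by (simp add: spechtA_def colspan_def)
qed

text \<open>\<open>colspan_Suc\<close> is iterated: passing from \<open>q\<close> to
  \<open>Suc q\<close> uses the vanishing on the removable row of length \<open>Suc q\<close>, if
  there is one.\<close>

lemma spechtA_in_colspan:
  assumes dec: "sorted_wrt (\<ge>) \<nu>" and A: "finite A" and x: "x \<in> A" and f: "f \<in> spechtA \<nu> A"
    and van: "\<And>b U. \<lbrakk>corner \<nu> b; \<nu> ! b \<le> q; x \<in> U ! b\<rbrakk> \<Longrightarrow> f U = 0"
  shows "f \<in> colspan \<nu> A x q"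
  using van
proof (induction q)
  case 0
  show ?case using f by (simp add: spechtA_colspan[OF x, symmetric])
next
  case (Suc q)
  show ?case by (rule colspan_Suc[OF dec A x Suc.IH]) (use Suc.prems in auto)
qed

text \<open>Every removable row shorter than row \<open>a\<close> comes after it, so the vanishing
  hypothesis places \<open>f\<close> in the column span to which \<open>unbox_colspan\<close>
  applies.\<close>

lemma unbox_spechtA:
  assumes dec: "sorted_wrt (\<ge>) \<nu>" and A: "finite A" and x: "x \<in> A" and f: "f \<in> spechtA \<nu> A"
    and a: "corner \<nu> a" and van: "\<And>b U. \<lbrakk>corner \<nu> b; a < b; x \<in> U ! b\<rbrakk> \<Longrightarrow> f U = 0"
  shows "unbox a x f \<in> spechtA (\<nu>[a := \<nu> ! a - 1]) (A - {x})"
proof -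
  have q: "\<nu> ! a = Suc (\<nu> ! a - 1)" using a by (simp add: corner_def)
  have "f \<in> colspan \<nu> A x (\<nu> ! a - 1)"
  proof (rule spechtA_in_colspan[OF dec A x f])
    fix b U assume b: "corner \<nu> b" "\<nu> ! b \<le> \<nu> ! a - 1" "x \<in> U ! b"
    hence "a \<le> b" "a \<noteq> b" using a q by (auto simp: corner_def)
    thus "f U = 0" using van[OF b(1) _ b(3)] by simp
  qed
  thus ?thesis by (rule unbox_colspan[OF _ x a q])
qed

text \<open>Vanishing on all removable rows pushes \<open>f\<close> past the last column, where the
  spanning set is empty.\<close>

lemma spechtA_zero:
  fixes f :: "tabloid \<Rightarrow> 'k::field"
  assumes dec: "sorted_wrt (\<ge>) \<nu>" and A: "finite A" and x: "x \<in> A" and f: "f \<in> spechtA \<nu> A"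
    and van: "\<And>b U. \<lbrakk>corner \<nu> b; x \<in> U ! b\<rbrakk> \<Longrightarrow> f U = 0"
  shows "f = 0"
proof -
  let ?N = "Suc (sum_list \<nu>)"
  have "\<not> (\<exists>j\<ge>?N. x \<in> column t j)" if t: "t \<in> tabs \<nu> A" for t
  proof
    assume "\<exists>j\<ge>?N. x \<in> column t j"
    then obtain j i where "i < length \<nu>" "j < \<nu> ! i" "?N \<le> j"
      using tabsD(1,2)[OF t] by (auto simp: column_iff)
    thus False using member_le_sum_list[of "\<nu> ! i" \<nu>] by simp
  qed
  hence e: "{polytabloid t | t. t \<in> tabs \<nu> A \<and> (\<exists>j\<ge>?N. x \<in> column t j)} = ({} :: (tabloid \<Rightarrow> 'k) set)"
    by blast
  have "f \<in> colspan \<nu> A x ?N" by (rule spechtA_in_colspan[OF dec A x f]) (use van in blast)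
  thus ?thesis unfolding colspan_def e by simp
qed


section \<open>Passing to partitions without empty rows\<close>

definition rem_box :: "nat list \<Rightarrow> nat \<Rightarrow> nat list" where
  "rem_box \<nu> a = (if \<nu> ! a = 1 then butlast \<nu> else \<nu>[a := \<nu> ! a - 1])"

text \<open>When the removable row has length one, \<open>rem_box\<close> drops it while
  \<open>unbox\<close> leaves an empty row behind; the appended empty set translates between the two
  kinds of tabloids.\<close>

definition strip :: "nat list \<Rightarrow> nat \<Rightarrow> nat \<Rightarrow> (tabloid \<Rightarrow> 'k::field) \<Rightarrow> tabloid \<Rightarrow> 'k" where
  "strip \<nu> a x f = (\<lambda>U. unbox a x f (if \<nu> ! a = 1 then U @ [{}] else U))"

lemma strip_add: "strip \<nu> a x (f + g) = strip \<nu> a x f + strip \<nu> a x g"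
  and strip_scale: "strip \<nu> a x (fscale c f) = fscale c (strip \<nu> a x f)"
  and strip_0: "strip \<nu> a x 0 = 0"
  by (auto simp: strip_def unbox_def fscale_def fun_eq_iff)

lemma column_pad: "column (s @ [[]]) j = column s j"
  by (auto simp: column_def)

lemma polytabloid_pad: "polytabloid (s @ [[]]) (U @ [{}]) = polytabloid s U"
  by (simp add: polytabloid_def column_stabilizer_def column_pad tabloid_perm_def tabloid_of_def)

lemma tabs_pad: "s \<in> tabs \<kappa> B \<Longrightarrow> s @ [[]] \<in> tabs (\<kappa> @ [0]) B"
  by (simp add: tabs_def)

lemma tabs_pad_obtain:
  assumes "t \<in> tabs (\<kappa> @ [0]) B"
  obtains s where "s \<in> tabs \<kappa> B" "t = s @ [[]]"
proof -
  have t: "map length t = \<kappa> @ [0]" using assms by (simp add: tabs_def)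
  obtain s r where sr: "t = s @ [r]" using t by (cases t rule: rev_cases) auto
  hence "r = []" using t by simp
  with sr show thesis using assms by (intro that[of s]) (simp_all add: tabs_def)
qed

lemma spechtA_pad:
  assumes "g \<in> spechtA (\<kappa> @ [0]) B"
  shows "(\<lambda>U. g (U @ [{}])) \<in> (spechtA \<kappa> B :: (tabloid \<Rightarrow> 'k::field) set)"
  unfolding spechtA_def
proof (rule span_closed[where a = "\<lambda>g U. g (U @ [{}])"])
  show "g \<in> fun_vs.span (polytabloid ` tabs (\<kappa> @ [0]) B)" using assms by (simp add: spechtA_def)
  fix h :: "tabloid \<Rightarrow> 'k" assume "h \<in> polytabloid ` tabs (\<kappa> @ [0]) B"
  then obtain t where t: "t \<in> tabs (\<kappa> @ [0]) B" "h = polytabloid t" by blast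
  obtain s where "s \<in> tabs \<kappa> B" "t = s @ [[]]" by (rule tabs_pad_obtain[OF t(1)])
  thus "(\<lambda>U. h (U @ [{}])) \<in> fun_vs.span (polytabloid ` tabs \<kappa> B)"
    unfolding t(2) by (auto simp: polytabloid_pad intro: fun_vs.span_base)
qed (auto simp: fscale_def)

text \<open>All rows are at least as long as a row of length one, so no row can come after it if it
  is removable.\<close>

lemma corner_one:
  assumes "corner \<nu> a" "\<nu> ! a = 1" "\<forall>y\<in>set \<nu>. 0 < y"
  shows "length \<nu> = Suc a" "\<nu>[a := 0] = butlast \<nu> @ [0]"
proof -
  have "i \<le> a" if "i < length \<nu>" for i
    using assms that nth_mem[OF that] by (auto simp: corner_def Suc_le_eq)
  hence "length \<nu> - 1 \<le> a" "a < length \<nu>" using assms(1) by (auto simp: corner_def)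
  thus l: "length \<nu> = Suc a" by simp
  show "\<nu>[a := 0] = butlast \<nu> @ [0]"
    by (rule nth_equalityI) (use l in \<open>auto simp: nth_list_update nth_append nth_butlast\<close>)
qed

text \<open>A nonzero value of \<open>f\<close> at \<open>U\<close> reappears as the value of
  \<open>strip\<close> at \<open>U\<close> with \<open>x\<close> deleted; for a row of length one
  the emptied last row is cut off.\<close>

lemma strip_zeroD:
  assumes f: "f \<in> spechtA \<nu> A" and b: "corner \<nu> b" and pos: "\<forall>y\<in>set \<nu>. 0 < y"
    and z: "strip \<nu> b x f = 0" and x: "x \<in> U ! b"
  shows "f U = (0 :: 'k::field)"
proof (rule ccontr)
  assume nz: "f U \<noteq> 0"
  note U = tabloid_lettersD[OF spechtA_support[OF f nz]]
  have bl: "b < length \<nu>" using b by (simp add: corner_def)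
  define V where "V = U[b := U ! b - {x}]"
  have "V[b := insert x (V ! b)] = U" "x \<notin> V ! b"
    using x U(1) bl by (auto simp: V_def insert_absorb)
  hence V: "unbox b x f V = f U" by (simp add: unbox_def)
  have "\<exists>W. strip \<nu> b x f W = f U"
  proof (cases "\<nu> ! b = 1")
    case True
    note l = corner_one(1)[OF b True pos]
    obtain y where "U ! b = {y}" using U(3)[OF bl] True by (auto simp: card_1_singleton_iff)
    hence "V ! b = {}" using x U(1) bl by (simp add: V_def)
    moreover have "length V = Suc b" using U(1) l by (simp add: V_def)
    ultimately have "V = take b V @ [{}]" by (metis lessI order_refl take_Suc_conv_app_nth take_all)
    thus ?thesis using V True by (intro exI[of _ "take b V"]) (simp add: strip_def)
  next
    case False
    thus ?thesis using V by (intro exI[of _ V]) (simp add: strip_def)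
  qed
  thus False using z nz by auto
qed

lemma strip_spechtA:
  assumes dec: "sorted_wrt (\<ge>) \<nu>" and pos: "\<forall>y\<in>set \<nu>. 0 < y" and A: "finite A" and x: "x \<in> A"
    and f: "f \<in> (spechtA \<nu> A :: (tabloid \<Rightarrow> 'k::field) set)" and a: "corner \<nu> a"
    and van: "\<And>b. \<lbrakk>corner \<nu> b; a < b\<rbrakk> \<Longrightarrow> strip \<nu> b x f = 0"
  shows "strip \<nu> a x f \<in> spechtA (rem_box \<nu> a) (A - {x})"
proof -
  have u: "unbox a x f \<in> spechtA (\<nu>[a := \<nu> ! a - 1]) (A - {x})"
    by (rule unbox_spechtA[OF dec A x f a]) (rule strip_zeroD[OF f _ pos van])
  show ?thesis
  proof (cases "\<nu> ! a = 1")
    case True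
    show ?thesis
      using spechtA_pad[of "unbox a x f" "butlast \<nu>"] u True corner_one(2)[OF a True pos]
      by (simp add: strip_def rem_box_def)
  qed (use u in \<open>simp add: strip_def rem_box_def\<close>)
qed

lemma strip_all_zero:
  assumes "sorted_wrt (\<ge>) \<nu>" "\<forall>y\<in>set \<nu>. 0 < y" "finite A" "x \<in> A"
    and f: "f \<in> (spechtA \<nu> A :: (tabloid \<Rightarrow> 'k::field) set)"
    and van: "\<And>b. corner \<nu> b \<Longrightarrow> strip \<nu> b x f = 0"
  shows "f = 0"
  by (rule spechtA_zero[OF assms(1,3,4) f]) (rule strip_zeroD[OF f _ assms(2) van])

text \<open>For a generator, \<open>x\<close> is appended to row \<open>a\<close> of its tableau.
  Then \<open>x\<close> sits in column \<open>\<nu> ! a - 1\<close>, out of reach of the shorter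
  removable rows after row \<open>a\<close>, whose parts vanish by \<open>polytabloid_row\<close>.
  The general case follows by linearity.\<close>

lemma strip_surj:
  assumes pos: "\<forall>y\<in>set \<nu>. 0 < y" and a: "corner \<nu> a" and x: "x \<notin> B"
    and g: "g \<in> (spechtA (rem_box \<nu> a) B :: (tabloid \<Rightarrow> 'k::field) set)"
  shows "\<exists>f\<in>spechtA \<nu> (insert x B). strip \<nu> a x f = g \<and> (\<forall>b>a. corner \<nu> b \<longrightarrow> strip \<nu> b x f = 0)"
proof -
  let ?P = "\<lambda>f. f \<in> spechtA \<nu> (insert x B) \<and> (\<forall>b>a. corner \<nu> b \<longrightarrow> strip \<nu> b x f = 0)"
  define q where "q = \<nu> ! a - 1"
  have q: "\<nu> ! a = Suc q" and al: "a < length \<nu>" using a by (simp_all add: q_def corner_def)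
  have gen: "\<exists>f. ?P f \<and> strip \<nu> a x f = (polytabloid s :: tabloid \<Rightarrow> 'k)" if s: "s \<in> tabs (rem_box \<nu> a) B" for s
  proof -
    define s' where "s' = (if \<nu> ! a = 1 then s @ [[]] else s)"
    have s': "s' \<in> tabs (\<nu>[a := q]) (insert x B - {x})"
    proof (cases "\<nu> ! a = 1")
      case True
      hence "\<nu>[a := q] = butlast \<nu> @ [0]" using corner_one(2)[OF a True pos] by (simp add: q_def)
      thus ?thesis using s tabs_pad[of s "butlast \<nu>" B] x True by (simp add: s'_def rem_box_def)
    qed (use s x in \<open>simp add: s'_def rem_box_def q_def\<close>)
    let ?t = "s'[a := s' ! a @ [x]]"
    have t: "?t \<in> tabs \<nu> (insert x B)" by (rule tabs_addx[OF s' insertI1 al q])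
    have xt: "x \<in> column ?t q"
      using column_addx[of a s' q x q] tabsD(1)[OF s'] tabsD(2)[OF s', of a] al by simp
    have u: "unbox a x (polytabloid ?t) = (polytabloid s' :: tabloid \<Rightarrow> 'k)"
      by (rule unbox_polytabloid_addx[OF s' insertI1 al q])
    have st: "strip \<nu> a x (polytabloid ?t) = (polytabloid s :: tabloid \<Rightarrow> 'k)"
      unfolding strip_def u by (auto simp: s'_def polytabloid_pad)
    have "strip \<nu> b x (polytabloid ?t) = (0 :: tabloid \<Rightarrow> 'k)" if b: "a < b" "corner \<nu> b" for b
    proof -
      have "b < length \<nu>" "\<not> \<nu> ! a \<le> \<nu> ! b" using b a by (auto simp: corner_def)
      hence bl: "b < length \<nu>" "\<nu> ! b \<le> q" using q by simp_all
      have "unbox b x (polytabloid ?t) V = (0::'k)" for V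
      proof (rule ccontr)
        assume "unbox b x (polytabloid ?t) V \<noteq> (0::'k)"
        hence nz: "polytabloid ?t (V[b := insert x (V ! b)]) \<noteq> (0::'k)" by (auto simp: unbox_def split: if_splits)
        have "length V = length \<nu>" using tabloid_lettersD(1)[OF polytabloid_support[OF t nz]] by simp
        hence "x \<in> V[b := insert x (V ! b)] ! b" using bl by simp
        hence "polytabloid ?t (V[b := insert x (V ! b)]) = (0::'k)"
          by (rule polytabloid_row[OF t xt bl(1)]) (rule bl(2))
        with nz show False by simp
      qed
      thus ?thesis unfolding strip_def by (intro ext) simp
    qed
    thus ?thesis using st t by (intro exI[of _ "polytabloid ?t"]) (auto simp: spechtA_def intro: fun_vs.span_base)
  qed
  have "g \<in> fun_vs.span (polytabloid ` tabs (rem_box \<nu> a) B)" using g by (simp add: spechtA_def)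
  hence "\<exists>f. ?P f \<and> strip \<nu> a x f = g"
  proof (induction rule: fun_vs.span_induct_alt)
    case base
    have "?P 0 \<and> strip \<nu> a x 0 = 0"
      by (intro conjI allI impI strip_0) (simp only: spechtA_def fun_vs.span_zero)
    thus ?case by blast
  next
    case (step c y z)
    then obtain f1 f2 where f: "?P f1" "strip \<nu> a x f1 = y" "?P f2" "strip \<nu> a x f2 = z" using gen by blast
    have "fscale c f1 + f2 \<in> spechtA \<nu> (insert x B)"
      using f(1,3) unfolding spechtA_def by (blast intro: fun_vs.span_add fun_vs.span_scale)
    moreover have "strip \<nu> a x (fscale c f1 + f2) = fscale c y + z"
      unfolding strip_add strip_scale f(2,4) ..
    moreover have "strip \<nu> b x (fscale c f1 + f2) = 0" if "a < b" "corner \<nu> b" for b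
    proof -
      have e: "strip \<nu> b x f1 = 0" "strip \<nu> b x f2 = 0" using f(1,3) that by blast+
      show ?thesis unfolding strip_add strip_scale e by (auto simp: fscale_def)
    qed
    ultimately show ?case by blast
  qed
  thus ?thesis by blast
qed

section \<open>Removable boxes in terms of Young diagrams\<close>

lemma diagram_inject:
  assumes "\<kappa> \<in> partitions M" "\<kappa>' \<in> partitions N" "diagram \<kappa> = diagram \<kappa>'"
  shows "\<kappa> = \<kappa>'"
proof -
  have row: "{j. (i, j) \<in> diagram \<nu>} = (if i < length \<nu> then {..<\<nu> ! i} else {})" for i \<nu>
    by (auto simp: diagram_def)
  have len: "i < length \<nu> \<longleftrightarrow> {j. (i, j) \<in> diagram \<nu>} \<noteq> {}" if "\<nu> \<in> partitions K" for i \<nu> K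
    unfolding row using that by (auto simp: partitions_def)
  have l: "i < length \<kappa> \<longleftrightarrow> i < length \<kappa>'" for i
    unfolding len[OF assms(1)] len[OF assms(2)] assms(3) ..
  have "length \<kappa> = length \<kappa>'" using l[of "length \<kappa>"] l[of "length \<kappa>'"] by simp
  moreover have "\<kappa> ! i = \<kappa>' ! i" if "i < length \<kappa>" for i
    using row[of i \<kappa>] row[of i \<kappa>'] assms(3) l[of i] that by simp
  ultimately show ?thesis by (rule nth_equalityI)
qed

lemma rem_box_partition:
  assumes "\<nu> \<in> partitions N" "corner \<nu> a"
  shows "rem_box \<nu> a \<in> partitions (N - 1)" "diagram (rem_box \<nu> a) = diagram \<nu> - {(a, \<nu> ! a - 1)}"
proof -
  have \<nu>: "sorted_wrt (\<ge>) \<nu>" "\<forall>y\<in>set \<nu>. 0 < y" "sum_list \<nu> = N" using assms(1) by (auto simp: partitions_def)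
  have a: "a < length \<nu>" "0 < \<nu> ! a" using assms(2) by (auto simp: corner_def)
  have sorted: "sorted_wrt (\<ge>) (\<nu>[a := \<nu> ! a - 1])"
    by (rule sorted_corner[OF \<nu>(1)]) (use assms(2) a bottom_corner[of \<nu> a "\<nu> ! a - 1"] in auto)
  have sum: "sum_list (\<nu>[a := \<nu> ! a - 1]) = N - 1"
    using a \<nu>(3) elem_le_sum_list[OF a(1)] by (simp add: sum_list_update)
  show "rem_box \<nu> a \<in> partitions (N - 1)"
  proof (cases "\<nu> ! a = 1")
    case True
    note c = corner_one(2)[OF assms(2) True \<nu>(2)]
    show ?thesis using sorted sum \<nu>(2) in_set_butlastD[of _ \<nu>] True
      by (auto simp: c rem_box_def partitions_def sorted_wrt_append)
  next
    case False
    have "0 < y" if "y \<in> set (\<nu>[a := \<nu> ! a - 1])" for y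
    proof -
      have "y = \<nu> ! a - 1 \<or> y \<in> set \<nu>" using set_update_subset_insert[of \<nu> a "\<nu> ! a - 1"] that by blast
      thus ?thesis using \<nu>(2) False a by (metis One_nat_def Suc_lessI zero_less_diff)
    qed
    thus ?thesis using sorted sum False by (simp add: rem_box_def partitions_def)
  qed
  show "diagram (rem_box \<nu> a) = diagram \<nu> - {(a, \<nu> ! a - 1)}"
  proof (cases "\<nu> ! a = 1")
    case True
    note c = corner_one(1)[OF assms(2) True \<nu>(2)]
    show ?thesis using True c
      by (auto simp: rem_box_def diagram_def nth_butlast less_Suc_eq)
  next
    case False
    show ?thesis using False a by (auto simp: rem_box_def diagram_def nth_list_update split: if_splits)
  qed
qed

text \<open>The diagram of \<kappa> is closed under moving left and up, so the missing box has no
  box of \<nu> to its right or below it and hence ends a removable row. The partition is then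
  recovered from its diagram.\<close>

lemma removes_box_iff:
  assumes "\<nu> \<in> partitions N"
  shows "removes_box \<nu> \<kappa> \<longleftrightarrow> (\<exists>a. corner \<nu> a \<and> \<kappa> = rem_box \<nu> a)"
proof
  assume "\<exists>a. corner \<nu> a \<and> \<kappa> = rem_box \<nu> a"
  then obtain a where a: "corner \<nu> a" "\<kappa> = rem_box \<nu> a" by blast
  have "(a, \<nu> ! a - 1) \<in> diagram \<nu>" using a(1) by (simp add: corner_def diagram_def)
  thus "removes_box \<nu> \<kappa>" unfolding removes_box_def a(2) using rem_box_partition[OF assms a(1)] by blast
next
  assume "removes_box \<nu> \<kappa>"
  then obtain M i j where \<kappa>: "\<kappa> \<in> partitions M" and ij: "(i, j) \<in> diagram \<nu>" "diagram \<kappa> = diagram \<nu> - {(i, j)}"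
    by (auto simp: removes_box_def)
  have i: "i < length \<nu>" "j < \<nu> ! i" using ij(1) by (auto simp: diagram_def)
  have left: "(i', j') \<in> diagram \<kappa>" if "(i'', j'') \<in> diagram \<kappa>" "i' \<le> i''" "j' \<le> j''" for i' j' i'' j''
  proof -
    have "sorted_wrt (\<ge>) \<kappa>" using \<kappa> by (simp add: partitions_def)
    hence "\<kappa> ! i'' \<le> \<kappa> ! i'" using that sorted_wrt_nth_less[of "(\<ge>)" \<kappa> i' i'']
      by (cases "i' = i''") (auto simp: diagram_def)
    thus ?thesis using that by (auto simp: diagram_def)
  qed
  have not: "(i, j) \<notin> diagram \<kappa>" using ij(2) by simp
  have j: "j = \<nu> ! i - 1"
  proof (rule ccontr)
    assume "j \<noteq> \<nu> ! i - 1"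
    hence "(i, Suc j) \<in> diagram \<kappa>" using i ij(2) by (auto simp: diagram_def)
    thus False using left[of i "Suc j" i j] not by simp
  qed
  have c: "corner \<nu> i"
    unfolding corner_def
  proof (intro conjI allI impI)
    fix i' assume i': "i' < length \<nu>" "\<nu> ! i \<le> \<nu> ! i'"
    show "i' \<le> i"
    proof (rule ccontr)
      assume "\<not> i' \<le> i"
      hence "(i', j) \<in> diagram \<kappa>" using i i' ij(2) by (auto simp: diagram_def)
      thus False using left[of i' j i j] not \<open>\<not> i' \<le> i\<close> by simp
    qed
  qed (use i in auto)
  have "diagram \<kappa> = diagram (rem_box \<nu> i)"
    using rem_box_partition(2)[OF assms c] ij(2) j by simp
  hence "\<kappa> = rem_box \<nu> i" by (rule diagram_inject[OF \<kappa> rem_box_partition(1)[OF assms c]])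
  thus "\<exists>a. corner \<nu> a \<and> \<kappa> = rem_box \<nu> a" using c by blast
qed

lemma rem_box_inject:
  assumes "\<nu> \<in> partitions N" "corner \<nu> a" "corner \<nu> b" "rem_box \<nu> a = rem_box \<nu> b"
  shows "a = b"
proof -
  have "diagram \<nu> - {(a, \<nu> ! a - 1)} = diagram \<nu> - {(b, \<nu> ! b - 1)}"
    using rem_box_partition(2)[OF assms(1)] assms(2-4) by metis
  moreover have "(a, \<nu> ! a - 1) \<in> diagram \<nu>" using assms(2) by (simp add: corner_def diagram_def)
  ultimately show ?thesis by blast
qed

section \<open>Tensor products in terms of slices\<close>

text \<open>A finitely spanned space of functions has a basis dual to evaluation at suitable points.
  Its coordinates are function values, so a coefficient in a tensor factor can be extracted by
  fixing a variable.\<close>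

lemma dual_system:
  fixes B :: "('x \<Rightarrow> 'k::field) set"
  assumes "finite B"
  shows "\<exists>(d::nat) x v. (\<forall>k<d. v k \<in> fun_vs.span B) \<and>
    (\<forall>k<d. \<forall>l<d. v k (x l) = (if k = l then 1 else 0)) \<and>
    (\<forall>g\<in>fun_vs.span B. \<forall>y. g y = (\<Sum>k<d. g (x k) * v k y))"
  using assms
proof (induction B rule: finite_induct)
  case empty
  show ?case by (rule exI[of _ "0::nat"]) simp
next
  case (insert e B)
  then obtain d :: nat and x v where *: "(\<forall>k<d. v k \<in> fun_vs.span B) \<and>
      (\<forall>k<d. \<forall>l<d. v k (x l) = (if k = l then 1 else 0)) \<and>
      (\<forall>g\<in>fun_vs.span B. \<forall>y. g y = (\<Sum>k<d. g (x k) * v k y))" by blast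
  hence v: "\<And>k. k < d \<Longrightarrow> v k \<in> fun_vs.span B"
    and dual: "\<And>k l. \<lbrakk>k < d; l < d\<rbrakk> \<Longrightarrow> v k (x l) = (if k = l then 1 else 0)"
    and rep: "\<And>g y. g \<in> fun_vs.span B \<Longrightarrow> g y = (\<Sum>k<d. g (x k) * v k y)" by blast+
  \<comment> \<open>The part of the new spanning vector that interpolation at the old points leaves
    over.\<close>
  define e' where "e' y = e y - (\<Sum>k<d. e (x k) * v k y)" for y
  have mono: "g \<in> fun_vs.span (insert e B)" if "g \<in> fun_vs.span B" for g
    using that fun_vs.span_mono[of B "insert e B"] by blast
  have lin: "g y = (\<Sum>k<d'. g (x' k) * v' k y)"
    if base: "\<And>b y. b \<in> insert e B \<Longrightarrow> b y = (\<Sum>k<d'. b (x' k) * v' k y)" and g: "g \<in> fun_vs.span (insert e B)"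
    for g y and d' :: nat and x' :: "nat \<Rightarrow> 'x" and v'
    using g
  proof (induction arbitrary: y rule: fun_vs.span_induct_alt)
    case base
    show ?case by simp
  next
    case (step c b z)
    have "(\<Sum>k<d'. (fscale c b + z) (x' k) * v' k y) =
        c * (\<Sum>k<d'. b (x' k) * v' k y) + (\<Sum>k<d'. z (x' k) * v' k y)"
      by (simp add: fscale_def sum_distrib_left distrib_right sum.distrib mult.assoc)
    also have "\<dots> = c * b y + z y"
      unfolding that(1)[OF step(1), of y, symmetric] step(2)[of y, symmetric] ..
    finally show ?case by (simp add: fscale_def)
  qed
  show ?case
  proof (cases "\<exists>x0. e' x0 \<noteq> 0")
    case False
    hence "b y = (\<Sum>k<d. b (x k) * v k y)" if "b \<in> insert e B" for b y
      using that rep[OF fun_vs.span_base] by (auto simp: e'_def)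
    hence rep': "g y = (\<Sum>k<d. g (x k) * v k y)" if "g \<in> fun_vs.span (insert e B)" for g y
      by (rule lin[OF _ that])
    have "(\<forall>k<d. v k \<in> fun_vs.span (insert e B)) \<and>
      (\<forall>k<d. \<forall>l<d. v k (x l) = (if k = l then 1 else 0)) \<and>
      (\<forall>g\<in>fun_vs.span (insert e B). \<forall>y. g y = (\<Sum>k<d. g (x k) * v k y))"
    proof (intro conjI allI impI ballI)
      fix k assume "k < d" thus "v k \<in> fun_vs.span (insert e B)" by (rule mono[OF v])
    next
      fix k l assume "k < d" "l < d" thus "v k (x l) = (if k = l then 1 else 0)" by (rule dual)
    next
      fix g y assume "g \<in> fun_vs.span (insert e B)"
      from rep'[OF this, of y] show "g y = (\<Sum>k<d. g (x k) * v k y)" .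
    qed
    thus ?thesis by blast
  next
    case True
    then obtain x0 where x0: "e' x0 \<noteq> 0" by blast
    \<comment> \<open>A point where the remainder is nonzero is adjoined. The remainder, normalised
      there, is the new dual vector, and the old ones are corrected so as to vanish at the new
      point.\<close>
    define vd where "vd y = e' y / e' x0" for y
    define v' where "v' k y = (if k < d then v k y - v k x0 * vd y else vd y)" for k y
    define x' where "x' k = (if k < d then x k else x0)" for k
    have e'x: "e' (x l) = 0" if "l < d" for l
    proof -
      have "(\<Sum>k<d. e (x k) * v k (x l)) = (\<Sum>k<d. if k = l then e (x l) else 0)"
        by (rule sum.cong) (use dual that in auto)
      thus ?thesis using that by (simp add: e'_def)
    qed
    have dual': "v' k (x' l) = (if k = l then 1 else 0)" if "k < Suc d" "l < Suc d" for k l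
    proof -
      have "vd x0 = 1" "l < d \<Longrightarrow> vd (x l) = 0" using x0 e'x by (simp_all add: vd_def)
      moreover have "\<not> k < d \<Longrightarrow> k = d" "\<not> l < d \<Longrightarrow> l = d" using that by simp_all
      ultimately show ?thesis using dual[of k l]
        by (cases "k < d"; cases "l < d") (auto simp: v'_def x'_def)
    qed
    have sum: "(\<Sum>k<Suc d. g (x' k) * v' k y) =
      (\<Sum>k<d. g (x k) * v k y) + (g x0 - (\<Sum>k<d. g (x k) * v k x0)) * vd y" for g y
    proof -
      have "(\<Sum>k<d. g (x' k) * v' k y) = (\<Sum>k<d. g (x k) * v k y - g (x k) * v k x0 * vd y)"
        by (rule sum.cong[OF refl]) (simp add: x'_def v'_def right_diff_distrib mult.assoc)
      also have "\<dots> = (\<Sum>k<d. g (x k) * v k y) - (\<Sum>k<d. g (x k) * v k x0) * vd y"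
        by (simp only: sum_subtractf sum_distrib_right)
      finally show ?thesis by (simp add: x'_def v'_def left_diff_distrib)
    qed
    have "b y = (\<Sum>k<Suc d. b (x' k) * v' k y)" if "b \<in> insert e B" for b y
    proof (cases "b = e")
      case True
      have "e x0 - (\<Sum>k<d. e (x k) * v k x0) = e' x0" by (simp add: e'_def)
      hence "(\<Sum>k<Suc d. e (x' k) * v' k y) = (\<Sum>k<d. e (x k) * v k y) + e' x0 * vd y" by (simp only: sum)
      also have "e' x0 * vd y = e y - (\<Sum>k<d. e (x k) * v k y)" using x0 unfolding vd_def by (simp add: e'_def)
      finally show ?thesis unfolding True by simp
    next
      case False
      hence "b \<in> fun_vs.span B" using that fun_vs.span_base by blast
      hence "b y = (\<Sum>k<d. b (x k) * v k y)" "b x0 - (\<Sum>k<d. b (x k) * v k x0) = 0"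
        using rep[of b y] rep[of b x0] by simp_all
      thus ?thesis by (simp only: sum mult_zero_left add_0_right)
    qed
    hence rep': "g y = (\<Sum>k<Suc d. g (x' k) * v' k y)" if "g \<in> fun_vs.span (insert e B)" for g y
      by (rule lin[OF _ that])
    have vds: "vd \<in> fun_vs.span (insert e B)"
    proof -
      have "vd = fscale (1 / e' x0) (e - (\<Sum>k<d. fscale (e (x k)) (v k)))"
        by (rule ext) (simp add: vd_def e'_def fscale_def sum_fun_apply)
      moreover have "e - (\<Sum>k<d. fscale (e (x k)) (v k)) \<in> fun_vs.span (insert e B)"
        by (intro fun_vs.span_diff[OF fun_vs.span_base[OF insertI1]] fun_vs.span_sum
          fun_vs.span_scale mono v) auto
      ultimately show ?thesis by (simp only: fun_vs.span_scale)
    qed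
    have vs: "v' k \<in> fun_vs.span (insert e B)" if "k < Suc d" for k
    proof (cases "k < d")
      case True
      have "v' k = v k - fscale (v k x0) vd" by (rule ext) (simp add: v'_def True fscale_def)
      thus ?thesis by (simp only:) (intro fun_vs.span_diff mono v True fun_vs.span_scale vds)
    next
      case False
      hence "v' k = vd" by (intro ext) (simp add: v'_def)
      thus ?thesis using vds by simp
    qed
    have "(\<forall>k<Suc d. v' k \<in> fun_vs.span (insert e B)) \<and>
      (\<forall>k<Suc d. \<forall>l<Suc d. v' k (x' l) = (if k = l then 1 else 0)) \<and>
      (\<forall>g\<in>fun_vs.span (insert e B). \<forall>y. g y = (\<Sum>k<Suc d. g (x' k) * v' k y))"
    proof (intro conjI allI impI ballI)
      fix k assume "k < Suc d" thus "v' k \<in> fun_vs.span (insert e B)" by (rule vs)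
    next
      fix k l assume "k < Suc d" "l < Suc d" thus "v' k (x' l) = (if k = l then 1 else 0)" by (rule dual')
    next
      fix g y assume "g \<in> fun_vs.span (insert e B)"
      from rep'[OF this, of y] show "g y = (\<Sum>k<Suc d. g (x' k) * v' k y)" .
    qed
    thus ?thesis by blast
  qed
qed

text \<open>Evaluating a linear relation at the dual points isolates each coefficient, and the
  reconstruction formula gives spanning.\<close>

lemma dual_system_dim:
  fixes B :: "('x \<Rightarrow> 'k::field) set" and d :: nat
  assumes "\<forall>k<d. v k \<in> fun_vs.span B"
    and dual: "\<forall>k<d. \<forall>l<d. v k (x l) = (if k = l then 1 else 0)"
    and rep: "\<forall>g\<in>fun_vs.span B. \<forall>y. g y = (\<Sum>k<d. g (x k) * v k y)"
  shows "fun_vs.dim (fun_vs.span B) = d"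
proof -
  have "fam_indep {..<d} v" unfolding fam_indep_def
  proof (intro allI impI ballI)
    fix S c i assume S: "finite S" "S \<subseteq> {..<d}" "\<forall>y. (\<Sum>i\<in>S. c i * v i y) = 0" "i \<in> S"
    have "(\<Sum>k\<in>S. c k * v k (x i)) = (\<Sum>k\<in>S. if k = i then c i else 0)"
    proof (rule sum.cong[OF refl])
      fix k assume "k \<in> S"
      hence "v k (x i) = (if k = i then 1 else 0)" using S(2,4) dual by blast
      thus "c k * v k (x i) = (if k = i then c i else 0)" by simp
    qed
    thus "c i = 0" using S by simp
  qed
  hence "inj_on v {..<d}" and ind: "fun_vs.independent (v ` {..<d})" unfolding fam_indep_iff by simp_all
  hence card: "card (v ` {..<d}) = d" by (simp add: card_image)
  have "g \<in> fun_vs.span (v ` {..<d})" if "g \<in> fun_vs.span B" for g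
  proof -
    have "g = (\<Sum>k<d. fscale (g (x k)) (v k))"
      by (rule ext) (use rep that in \<open>simp add: fscale_def sum_fun_apply\<close>)
    also have "\<dots> \<in> fun_vs.span (v ` {..<d})"
      by (intro fun_vs.span_sum fun_vs.span_scale fun_vs.span_base) auto
    finally show ?thesis .
  qed
  moreover have "v ` {..<d} \<subseteq> fun_vs.span B" using assms(1) by auto
  ultimately have "fun_vs.dim (fun_vs.span B) = card (v ` {..<d})"
    using ind by (intro fun_vs.dim_unique) auto
  thus ?thesis using card by simp
qed

lemma tensors_Cons: "tensors (f # fs) zs = (case zs of [] \<Rightarrow> 0 | z # xs \<Rightarrow> f z * tensors fs xs)"
  by (cases zs) (auto simp: tensors_def lessThan_Suc_eq_insert_0 prod.reindex simp del: prod.lessThan_Suc)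

text \<open>A dual system in the first variable writes \<open>f\<close> as a finite sum of products
  of a basis vector with \<open>f\<close> at a fixed first argument, and the latter satisfies the
  same hypotheses in fewer variables. Membership in a tensor product thus becomes a condition on
  each variable separately.\<close>

lemma slices_span:
  fixes f :: "'x list \<times> 'y \<Rightarrow> 'k::field"
  assumes "\<forall>V\<in>set Vs. \<exists>B. finite B \<and> V = fun_vs.span B"
    and "\<And>xs y. length xs \<noteq> length Vs \<Longrightarrow> f (xs, y) = 0"
    and "\<And>xs y i. \<lbrakk>length xs = length Vs; i < length Vs\<rbrakk> \<Longrightarrow> (\<lambda>x. f (xs[i := x], y)) \<in> Vs ! i"
    and "\<And>xs. (\<lambda>y. f (xs, y)) \<in> W"
  shows "f \<in> fun_vs.span {tensor2 (tensors fs) g | fs g. fs \<in> listset Vs \<and> g \<in> W}"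
  using assms
proof (induction Vs arbitrary: f)
  case Nil
  have eq: "f = tensor2 (tensors []) (\<lambda>y. f ([], y))"
  proof (rule ext)
    fix z :: "'x list \<times> 'y"
    show "f z = tensor2 (tensors []) (\<lambda>y. f ([], y)) z"
      by (cases z) (use Nil.prems(2) in \<open>simp add: tensor2_def tensors_def\<close>)
  qed
  show ?case
    by (subst eq) (rule fun_vs.span_base, use Nil.prems(4) in auto)
next
  case (Cons V Vs)
  obtain B where B: "finite B" "V = fun_vs.span B" using Cons.prems(1) by auto
  obtain d :: nat and x v where v: "\<And>k. k < d \<Longrightarrow> v k \<in> V"
    and rep: "\<And>g y. g \<in> V \<Longrightarrow> g y = (\<Sum>k<d. g (x k) * v k y)"
    using dual_system[OF B(1)] unfolding B(2) by blast
  define L where "L k h = (\<lambda>(zs, y). case zs of [] \<Rightarrow> 0 | z # xs \<Rightarrow> v k z * h (xs, y))"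
    for k :: nat and h :: "'x list \<times> 'y \<Rightarrow> 'k"
  let ?S = "{tensor2 (tensors fs) g | fs g. fs \<in> listset (V # Vs) \<and> g \<in> W}"
  have "L k (\<lambda>(xs, y). f (x k # xs, y)) \<in> fun_vs.span ?S" if k: "k < d" for k
  proof (rule span_closed[where a = "L k"])
    show "L k (h + h') = L k h + L k h'" for h h'
      by (rule ext) (auto simp: L_def distrib_left split: list.splits)
    show "L k (fscale c h) = fscale c (L k h)" for c h
      by (rule ext) (auto simp: L_def fscale_def split: list.splits)
    show "(\<lambda>(xs, y). f (x k # xs, y)) \<in> fun_vs.span {tensor2 (tensors fs) g | fs g. fs \<in> listset Vs \<and> g \<in> W}"
    proof (rule Cons.IH)
      fix xs :: "'x list" and y i assume "length xs = length Vs" "i < length Vs"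
      thus "(\<lambda>z. case (xs[i := z], y) of (xs, y) \<Rightarrow> f (x k # xs, y)) \<in> Vs ! i"
        using Cons.prems(3)[of "x k # xs" "Suc i" y] by simp
    next
      show "\<forall>V\<in>set Vs. \<exists>B. finite B \<and> V = fun_vs.span B" using Cons.prems(1) by simp
      show "(case (xs, y) of (xs, y) \<Rightarrow> f (x k # xs, y)) = 0" if "length xs \<noteq> length Vs" for xs y
        using Cons.prems(2)[of "x k # xs" y] that by simp
      show "(\<lambda>y. case (xs, y) of (xs, y) \<Rightarrow> f (x k # xs, y)) \<in> W" for xs
        using Cons.prems(4)[of "x k # xs"] by simp
    qed
    fix s assume "s \<in> {tensor2 (tensors fs) g | fs g. fs \<in> listset Vs \<and> g \<in> W}"
    then obtain fs g where s: "s = tensor2 (tensors fs) g" "fs \<in> listset Vs" "g \<in> W" by blast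
    have "L k s = tensor2 (tensors (v k # fs)) g"
      by (rule ext) (auto simp: L_def s(1) tensor2_def tensors_Cons split: list.splits)
    moreover have "v k # fs \<in> listset (V # Vs)" using s(2) v[OF k] by (auto simp: set_Cons_def)
    ultimately show "L k s \<in> fun_vs.span ?S" using s(3) by (auto intro!: fun_vs.span_base)
  qed
  moreover have "f = (\<Sum>k<d. L k (\<lambda>(xs, y). f (x k # xs, y)))"
  proof (rule ext)
    fix p :: "'x list \<times> 'y"
    obtain zs y where p: "p = (zs, y)" by fastforce
    show "f p = (\<Sum>k<d. L k (\<lambda>(xs, y). f (x k # xs, y))) p"
    proof (cases zs)
      case Nil
      thus ?thesis using Cons.prems(2)[of "[]" y] by (simp add: p sum_fun_apply L_def)
    next
      case (Cons z xs)
      have "(\<lambda>z. f (z # xs, y)) \<in> V"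
      proof (cases "length xs = length Vs")
        case True
        thus ?thesis using Cons.prems(3)[of "z # xs" 0 y] by simp
      next
        case False
        hence "(\<lambda>z. f (z # xs, y)) = 0" using Cons.prems(2) by auto
        thus ?thesis unfolding B(2) by (simp only: fun_vs.span_zero)
      qed
      from rep[OF this, of z] show ?thesis
        by (simp add: p Cons sum_fun_apply L_def mult.commute)
    qed
  qed
  ultimately show ?case using fun_vs.span_sum[of "{..<d}" "\<lambda>k. L k (\<lambda>(xs, y). f (x k # xs, y))" ?S]
    by simp
qed

text \<open>\<open>slices_span\<close> is applied twice: to the second list with a one-point type
  for the remaining variable, and to the first list with the resulting span as
  \<open>W\<close>.\<close>

lemma tensor_slices:
  fixes f :: "'x list \<times> 'y list \<Rightarrow> 'k::field"
  assumes V: "\<forall>V\<in>set Vs. \<exists>B. finite B \<and> V = fun_vs.span B"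
    and W: "\<forall>W\<in>set Ws. \<exists>B. finite B \<and> W = fun_vs.span B"
    and supp: "\<And>xs ys. length xs \<noteq> length Vs \<or> length ys \<noteq> length Ws \<Longrightarrow> f (xs, ys) = 0"
    and s1: "\<And>xs ys i. \<lbrakk>length xs = length Vs; length ys = length Ws; i < length Vs\<rbrakk> \<Longrightarrow>
      (\<lambda>x. f (xs[i := x], ys)) \<in> Vs ! i"
    and s2: "\<And>xs ys i. \<lbrakk>length xs = length Vs; length ys = length Ws; i < length Ws\<rbrakk> \<Longrightarrow>
      (\<lambda>y. f (xs, ys[i := y])) \<in> Ws ! i"
  shows "f \<in> fun_vs.span {tensor2 (tensors fs) (tensors gs) | fs gs. fs \<in> listset Vs \<and> gs \<in> listset Ws}"
proof -
  have zero: "0 \<in> U" if "\<exists>B. finite B \<and> U = fun_vs.span B" for U :: "('z \<Rightarrow> 'k) set"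
    using that fun_vs.span_zero by auto
  have fin: "(\<lambda>ys. f (xs, ys)) \<in> fun_vs.span (tensors ` listset Ws)" for xs
  proof -
    let ?f = "\<lambda>(ys, u :: unit). f (xs, ys)"
    have A: "?f \<in> fun_vs.span {tensor2 (tensors fs) g | fs g. fs \<in> listset Ws \<and> g \<in> UNIV}"
    proof (rule slices_span[OF W])
      fix ys :: "'y list" and u :: unit and i assume i: "length ys = length Ws" "i < length Ws"
      show "(\<lambda>y. ?f (ys[i := y], u)) \<in> Ws ! i"
      proof (cases "length xs = length Vs")
        case True
        thus ?thesis using s2[OF True i] by simp
      next
        case False
        hence "(\<lambda>y. ?f (ys[i := y], u)) = 0" using supp by auto
        thus ?thesis using zero[of "Ws ! i"] W nth_mem[OF i(2)] by metis
      qed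
    qed (use supp in auto)
    have "(\<lambda>h ys. h (ys, ())) ?f \<in> fun_vs.span (tensors ` listset Ws)"
    proof (rule span_closed[where a = "\<lambda>h ys. h (ys, ())", OF _ _ _ A])
      fix s :: "'y list \<times> unit \<Rightarrow> 'k" assume "s \<in> {tensor2 (tensors fs) g | fs g. fs \<in> listset Ws \<and> g \<in> UNIV}"
      then obtain fs g where s: "s = tensor2 (tensors fs) g" "fs \<in> listset Ws" by blast
      have "(\<lambda>ys. s (ys, ())) = fscale (g ()) (tensors fs)"
        by (rule ext) (simp add: s(1) tensor2_def fscale_def)
      thus "(\<lambda>ys. s (ys, ())) \<in> fun_vs.span (tensors ` listset Ws)"
        using s(2) fun_vs.span_scale[OF fun_vs.span_base] by (metis image_eqI)
    qed (auto simp: fscale_def)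
    thus ?thesis by simp
  qed
  let ?S = "{tensor2 (tensors fs) (tensors gs) | fs gs. fs \<in> listset Vs \<and> gs \<in> listset Ws}"
  have "f \<in> fun_vs.span {tensor2 (tensors fs) g | fs g. fs \<in> listset Vs \<and> g \<in> fun_vs.span (tensors ` listset Ws)}"
  proof (rule slices_span[OF V])
    fix xs :: "'x list" and ys :: "'y list" and i assume i: "length xs = length Vs" "i < length Vs"
    show "(\<lambda>x. f (xs[i := x], ys)) \<in> Vs ! i"
    proof (cases "length ys = length Ws")
      case True
      thus ?thesis using s1[OF i(1) True i(2)] by simp
    next
      case False
      hence "(\<lambda>x. f (xs[i := x], ys)) = 0" using supp by auto
      thus ?thesis using zero[of "Vs ! i"] V nth_mem[OF i(2)] by metis
    qed
  qed (use supp fin in auto)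
  moreover have "tensor2 (tensors fs) g \<in> fun_vs.span ?S"
    if fs: "fs \<in> listset Vs" and g: "g \<in> fun_vs.span (tensors ` listset Ws)" for fs g
  proof (rule span_closed[where a = "tensor2 (tensors fs)", OF _ _ _ g])
    show "tensor2 (tensors fs) s \<in> fun_vs.span ?S" if "s \<in> tensors ` listset Ws" for s
      using that fs by (auto intro!: fun_vs.span_base)
  qed (auto simp: tensor2_def fscale_def distrib_left)
  ultimately show ?thesis
    using fun_vs.span_minimal[OF _ fun_vs.subspace_span, of
        "{tensor2 (tensors fs) g | fs g. fs \<in> listset Vs \<and> g \<in> fun_vs.span (tensors ` listset Ws)}" ?S] by blast
qed

lemma tensors_update:
  assumes "i < length fs" "length xs = length fs"
  shows "tensors fs (xs[i := x]) = (fs ! i) x * (\<Prod>l\<in>{..<length fs} - {i}. (fs ! l) (xs ! l))"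
proof -
  have "tensors fs (xs[i := x]) = (\<Prod>l<length fs. (fs ! l) (xs[i := x] ! l))"
    using assms by (simp add: tensors_def)
  also have "\<dots> = (fs ! i) x * (\<Prod>l\<in>{..<length fs} - {i}. (fs ! l) (xs[i := x] ! l))"
    using assms by (subst prod.remove[of _ i]) auto
  also have "(\<Prod>l\<in>{..<length fs} - {i}. (fs ! l) (xs[i := x] ! l)) = (\<Prod>l\<in>{..<length fs} - {i}. (fs ! l) (xs ! l))"
    by (rule prod.cong) auto
  finally show ?thesis .
qed

lemma tensors_nonzero:
  assumes "tensors fs xs \<noteq> (0::'k::field)"
  shows "length xs = length fs" "i < length fs \<Longrightarrow> (fs ! i) (xs ! i) \<noteq> 0"
  using assms by (auto simp: tensors_def split: if_splits)

section \<open>A model of the Specht modules of wreath products\<close>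

text \<open>
  A word records which of the partitions \<open>\<eta>\<^sub>0, \<eta>\<^sub>1, \<dots>\<close> contains each letter.  In place of cosets of
  the Young subgroup, the model uses tuples of tableaux whose sets of entries partition the letters.
\<close>

definition words :: "nat \<Rightarrow> nat \<Rightarrow> nat list set" where
  "words r n = {w. length w = n \<and> set w \<subseteq> {..<r}}"

definition fibre :: "nat list \<Rightarrow> nat \<Rightarrow> nat set" where
  "fibre w i = {j. j < length w \<and> w ! j = i}"

definition carried :: "nat list \<Rightarrow> nat \<Rightarrow> tabloid list \<Rightarrow> bool" where
  "carried w r Us \<longleftrightarrow> length Us = r \<and> (\<forall>i<r. \<Union> (set (Us ! i)) = fibre w i)"

definition inner_factors :: "nat list list \<Rightarrow> nat list \<Rightarrow> (tabloid \<Rightarrow> 'k::field) set list" where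
  "inner_factors \<mu> w = map (\<lambda>i. specht (\<mu> ! i)) w"

definition outer_factors :: "nat list list \<Rightarrow> nat list \<Rightarrow> (tabloid \<Rightarrow> 'k::field) set list" where
  "outer_factors \<eta> w = map (\<lambda>i. spechtA (\<eta> ! i) (fibre w i)) [0..<length \<eta>]"

definition word_gens :: "nat list list \<Rightarrow> nat list list \<Rightarrow> nat list \<Rightarrow> ('k::field) T_vec set" where
  "word_gens \<mu> \<eta> w = {tensor2 (tensors fs) (tensors gs) | fs gs.
    fs \<in> listset (inner_factors \<mu> w) \<and> gs \<in> listset (outer_factors \<eta> w)}"

definition model_space :: "nat \<Rightarrow> nat list list \<Rightarrow> nat list list \<Rightarrow> ('k::field) T_vec set" where
  "model_space n \<mu> \<eta> = fun_vs.span (\<Union>w\<in>words (length \<eta>) n. word_gens \<mu> \<eta> w)"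

lemma finite_words: "finite (words r n)"
  using finite_lists_length_eq[of "{..<r}" n] by (simp add: words_def conj_commute)

lemma words_nth: "\<lbrakk>w \<in> words r n; j < n\<rbrakk> \<Longrightarrow> w ! j < r"
  by (simp add: words_def) (metis lessThan_iff nth_mem subsetD)

lemma finite_fibre: "finite (fibre w i)"
  by (simp add: fibre_def)

text \<open>All fibres but one suffice, as a position outside them must belong to the remaining
  component. This pins down the word while one outer tabloid is left free to vary; an
  \<open>i0\<close> out of range leaves out no fibre.\<close>

lemma fibres_eq:
  assumes "w \<in> words r n" "w' \<in> words r n" "\<And>i. \<lbrakk>i < r; i \<noteq> i0\<rbrakk> \<Longrightarrow> fibre w i = fibre w' i"
  shows "w = w'"
proof (rule nth_equalityI)
  show l: "length w = length w'" using assms(1,2) by (simp add: words_def)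
  fix j assume j: "j < length w"
  have n: "length w = n" "length w' = n" using assms(1,2) by (simp_all add: words_def)
  have jw: "j \<in> fibre w (w ! j)" "j \<in> fibre w' (w' ! j)" using j l by (simp_all add: fibre_def)
  have r: "w ! j < r" "w' ! j < r" using words_nth[OF assms(1)] words_nth[OF assms(2)] j n by auto
  show "w ! j = w' ! j"
  proof (cases "w ! j = i0")
    case True
    show ?thesis
    proof (rule ccontr)
      assume "w ! j \<noteq> w' ! j"
      hence "fibre w (w' ! j) = fibre w' (w' ! j)" using assms(3)[OF r(2)] True by simp
      hence "j \<in> fibre w (w' ! j)" using jw(2) by simp
      thus False using \<open>w ! j \<noteq> w' ! j\<close> by (simp add: fibre_def)
    qed
  next
    case False
    hence "j \<in> fibre w' (w ! j)" using jw(1) assms(3)[OF r(1)] by simp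
    thus ?thesis by (simp add: fibre_def)
  qed
qed

lemma carried_update:
  assumes "length Us = r" "i < r"
  shows "carried w r (Us[i := U]) \<longleftrightarrow>
    \<Union> (set U) = fibre w i \<and> (\<forall>l<r. l \<noteq> i \<longrightarrow> \<Union> (set (Us ! l)) = fibre w l)"
proof
  assume c: "carried w r (Us[i := U])"
  hence "\<Union> (set (Us[i := U] ! l)) = fibre w l" if "l < r" for l using that by (simp add: carried_def)
  from this[OF assms(2)] this show "\<Union> (set U) = fibre w i \<and> (\<forall>l<r. l \<noteq> i \<longrightarrow> \<Union> (set (Us ! l)) = fibre w l)"
    using assms by (metis nth_list_update_eq nth_list_update_neq)
next
  assume a: "\<Union> (set U) = fibre w i \<and> (\<forall>l<r. l \<noteq> i \<longrightarrow> \<Union> (set (Us ! l)) = fibre w l)"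
  show "carried w r (Us[i := U])" unfolding carried_def
  proof (intro conjI allI impI)
    fix l assume "l < r"
    thus "\<Union> (set (Us[i := U] ! l)) = fibre w l" using a assms by (cases "l = i") simp_all
  qed (simp add: assms)
qed

lemma carried_unique:
  assumes "w \<in> words r n" "w' \<in> words r n" "carried w r Us" "carried w' r Us"
  shows "w = w'"
  by (rule fibres_eq[OF assms(1,2), of r]) (use assms(3,4) in \<open>auto simp: carried_def\<close>)

lemma inner_factors_iff:
  "fs \<in> listset (inner_factors \<mu> w) \<longleftrightarrow> length fs = length w \<and> (\<forall>j<length w. fs ! j \<in> specht (\<mu> ! (w ! j)))"
  by (simp add: listset_iff inner_factors_def)

lemma outer_factors_iff:
  "gs \<in> listset (outer_factors \<eta> w) \<longleftrightarrow>
    length gs = length \<eta> \<and> (\<forall>i<length \<eta>. gs ! i \<in> spechtA (\<eta> ! i) (fibre w i))"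
  by (simp add: listset_iff outer_factors_def)

lemma word_gens_support:
  assumes fs: "fs \<in> listset (inner_factors \<mu> w)" and gs: "gs \<in> listset (outer_factors \<eta> w)"
    and nz: "tensor2 (tensors fs) (tensors gs) (Ts, Us) \<noteq> (0::'k::field)"
  shows "length Ts = length w" "carried w (length \<eta>) Us"
proof -
  have nz': "tensors fs Ts \<noteq> 0" "tensors gs Us \<noteq> 0" using nz by (auto simp: tensor2_def)
  show "length Ts = length w" using tensors_nonzero(1)[OF nz'(1)] fs by (simp add: inner_factors_iff)
  show "carried w (length \<eta>) Us" unfolding carried_def
  proof (intro conjI allI impI)
    show "length Us = length \<eta>" using tensors_nonzero(1)[OF nz'(2)] gs by (simp add: outer_factors_iff)
    fix i assume i: "i < length \<eta>"
    have gi: "gs ! i \<in> spechtA (\<eta> ! i) (fibre w i)" "i < length gs" using gs i by (simp_all add: outer_factors_iff)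
    show "\<Union> (set (Us ! i)) = fibre w i"
      by (rule tabloid_lettersD(2)[OF spechtA_support[OF gi(1) tensors_nonzero(2)[OF nz'(2) gi(2)]]])
  qed
qed

text \<open>A variable-by-variable description of \<open>model_space\<close>. The last clause
  prescribes the entries in the other components only, because the \<open>i\<close>-th tabloid is
  the variable of the slice.\<close>

definition sliced :: "nat \<Rightarrow> nat list list \<Rightarrow> nat list list \<Rightarrow> ('k::field) T_vec \<Rightarrow> bool" where
  "sliced n \<mu> \<eta> f \<longleftrightarrow>
    (\<forall>Ts Us. f (Ts, Us) \<noteq> 0 \<longrightarrow> length Ts = n \<and> (\<exists>w\<in>words (length \<eta>) n. carried w (length \<eta>) Us)) \<and>
    (\<forall>w\<in>words (length \<eta>) n. \<forall>Ts Us j. length Ts = n \<longrightarrow> carried w (length \<eta>) Us \<longrightarrow> j < n \<longrightarrow>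
      (\<lambda>T. f (Ts[j := T], Us)) \<in> specht (\<mu> ! (w ! j))) \<and>
    (\<forall>w\<in>words (length \<eta>) n. \<forall>Ts Us i. i < length \<eta> \<longrightarrow> length Us = length \<eta> \<longrightarrow>
      (\<forall>l<length \<eta>. l \<noteq> i \<longrightarrow> \<Union> (set (Us ! l)) = fibre w l) \<longrightarrow>
      (\<lambda>U. f (Ts, Us[i := U])) \<in> spechtA (\<eta> ! i) (fibre w i))"

lemma slicedD:
  assumes "sliced n \<mu> \<eta> f"
  shows "f (Ts, Us) \<noteq> 0 \<Longrightarrow> length Ts = n"
    and "f (Ts, Us) \<noteq> 0 \<Longrightarrow> \<exists>w\<in>words (length \<eta>) n. carried w (length \<eta>) Us"
    and "\<lbrakk>w \<in> words (length \<eta>) n; length Ts = n; carried w (length \<eta>) Us; j < n\<rbrakk>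
      \<Longrightarrow> (\<lambda>T. f (Ts[j := T], Us)) \<in> specht (\<mu> ! (w ! j))"
    and "\<lbrakk>w \<in> words (length \<eta>) n; i < length \<eta>; length Us = length \<eta>;
        \<And>l. \<lbrakk>l < length \<eta>; l \<noteq> i\<rbrakk> \<Longrightarrow> \<Union> (set (Us ! l)) = fibre w l\<rbrakk>
      \<Longrightarrow> (\<lambda>U. f (Ts, Us[i := U])) \<in> spechtA (\<eta> ! i) (fibre w i)"
  using assms unfolding sliced_def by simp_all

lemma subspace_specht: "fun_vs.subspace (specht \<nu>)"
  unfolding specht_def by (rule fun_vs.subspace_span)

lemma subspace_spechtA: "fun_vs.subspace (spechtA \<nu> A)"
  unfolding spechtA_def by (rule fun_vs.subspace_span)

lemma subspace_model_space: "fun_vs.subspace (model_space n \<mu> \<eta>)"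
  unfolding model_space_def by (rule fun_vs.subspace_span)

lemma subspace_sliced: "fun_vs.subspace {f :: 'k::field T_vec. sliced n \<mu> \<eta> f}"
proof (rule fun_vs.subspaceI)
  have "(\<lambda>_. 0 :: 'k) \<in> specht \<nu>" "(\<lambda>_. 0 :: 'k) \<in> spechtA \<nu> A" for \<nu> A
    using fun_vs.subspace_0[OF subspace_specht] fun_vs.subspace_0[OF subspace_spechtA]
    by (simp_all add: zero_fun_def)
  thus "(0 :: 'k T_vec) \<in> {f. sliced n \<mu> \<eta> f}" by (simp add: sliced_def)
next
  fix f g :: "'k T_vec" assume "f \<in> {f. sliced n \<mu> \<eta> f}" "g \<in> {f. sliced n \<mu> \<eta> f}"
  hence f: "sliced n \<mu> \<eta> f" and g: "sliced n \<mu> \<eta> g" by simp_all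
  have "sliced n \<mu> \<eta> (f + g)" unfolding sliced_def
  proof (intro conjI ballI allI impI)
    fix Ts Us :: "tabloid list" assume "(f + g) (Ts, Us) \<noteq> 0"
    hence "f (Ts, Us) \<noteq> 0 \<or> g (Ts, Us) \<noteq> 0" by auto
    thus "length Ts = n" "\<exists>w\<in>words (length \<eta>) n. carried w (length \<eta>) Us"
      using slicedD(1,2)[OF f, of Ts Us] slicedD(1,2)[OF g, of Ts Us] by blast+
  next
    fix w and Ts Us :: "tabloid list" and j assume "w \<in> words (length \<eta>) n" "length Ts = n" "carried w (length \<eta>) Us" "j < n"
    from slicedD(3)[OF f this] slicedD(3)[OF g this]
    show "(\<lambda>T. (f + g) (Ts[j := T], Us)) \<in> specht (\<mu> ! (w ! j))"
      using fun_vs.subspace_add[OF subspace_specht] by (simp add: plus_fun_def)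
  next
    fix w and Ts Us :: "tabloid list" and i assume "w \<in> words (length \<eta>) n" "i < length \<eta>" "length Us = length \<eta>"
      "\<forall>l<length \<eta>. l \<noteq> i \<longrightarrow> \<Union> (set (Us ! l)) = fibre w l"
    hence a: "w \<in> words (length \<eta>) n" "i < length \<eta>" "length Us = length \<eta>"
      "\<And>l. \<lbrakk>l < length \<eta>; l \<noteq> i\<rbrakk> \<Longrightarrow> \<Union> (set (Us ! l)) = fibre w l" by blast+
    show "(\<lambda>U. (f + g) (Ts, Us[i := U])) \<in> spechtA (\<eta> ! i) (fibre w i)"
      using fun_vs.subspace_add[OF subspace_spechtA slicedD(4)[OF f a] slicedD(4)[OF g a]]
      by (simp add: plus_fun_def)
  qed
  thus "f + g \<in> {f. sliced n \<mu> \<eta> f}" by simp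
next
  fix c and f :: "'k T_vec" assume "f \<in> {f. sliced n \<mu> \<eta> f}"
  hence f: "sliced n \<mu> \<eta> f" by simp
  have "sliced n \<mu> \<eta> (fscale c f)" unfolding sliced_def
  proof (intro conjI ballI allI impI)
    fix Ts Us :: "tabloid list" assume "fscale c f (Ts, Us) \<noteq> 0"
    hence "f (Ts, Us) \<noteq> 0" by (auto simp: fscale_def)
    thus "length Ts = n" "\<exists>w\<in>words (length \<eta>) n. carried w (length \<eta>) Us"
      using slicedD(1,2)[OF f, of Ts Us] by blast+
  next
    fix w and Ts Us :: "tabloid list" and j assume "w \<in> words (length \<eta>) n" "length Ts = n" "carried w (length \<eta>) Us" "j < n"
    from fun_vs.subspace_scale[OF subspace_specht slicedD(3)[OF f this]]
    show "(\<lambda>T. fscale c f (Ts[j := T], Us)) \<in> specht (\<mu> ! (w ! j))"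
      by (simp add: fscale_def)
  next
    fix w and Ts Us :: "tabloid list" and i assume "w \<in> words (length \<eta>) n" "i < length \<eta>" "length Us = length \<eta>"
      "\<forall>l<length \<eta>. l \<noteq> i \<longrightarrow> \<Union> (set (Us ! l)) = fibre w l"
    hence a: "w \<in> words (length \<eta>) n" "i < length \<eta>" "length Us = length \<eta>"
      "\<And>l. \<lbrakk>l < length \<eta>; l \<noteq> i\<rbrakk> \<Longrightarrow> \<Union> (set (Us ! l)) = fibre w l" by blast+
    show "(\<lambda>U. fscale c f (Ts, Us[i := U])) \<in> spechtA (\<eta> ! i) (fibre w i)"
      using fun_vs.subspace_scale[OF subspace_spechtA slicedD(4)[OF f a]]
      by (simp add: fscale_def)
  qed
  thus "fscale c f \<in> {f. sliced n \<mu> \<eta> f}" by simp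
qed

lemma subspace_zero_fun: "fun_vs.subspace V \<Longrightarrow> (\<And>x. f x = 0) \<Longrightarrow> f \<in> V"
  using fun_vs.subspace_0[of V] by (metis ext zero_fun_apply)

lemma finite_span_spechtA: "finite A \<Longrightarrow> \<exists>B. finite B \<and> spechtA \<nu> A = fun_vs.span B"
  unfolding spechtA_def by (intro exI[of _ "polytabloid ` tabs \<nu> A"]) (simp add: finite_tabs)

lemma finite_span_specht: "\<exists>B. finite B \<and> specht \<nu> = fun_vs.span B"
  unfolding specht_spechtA by (simp add: finite_span_spechtA)

text \<open>The slices of a generator are proportional to its factors. For a word other than
  \<open>w0\<close> the slice is zero, since the outer tabloids, even with one of them free,
  determine the word.\<close>

lemma word_gens_sliced:
  assumes w0: "w0 \<in> words (length \<eta>) n" and F: "F \<in> word_gens \<mu> \<eta> w0"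
  shows "sliced n \<mu> \<eta> (F :: 'k::field T_vec)"
proof -
  obtain fs gs where fs: "fs \<in> listset (inner_factors \<mu> w0)" and gs: "gs \<in> listset (outer_factors \<eta> w0)"
    and Feq: "F = tensor2 (tensors fs) (tensors gs)" using F by (auto simp: word_gens_def)
  have n: "length w0 = n" using w0 by (simp add: words_def)
  have supp: "length Ts = n" "carried w0 (length \<eta>) Us" if "F (Ts, Us) \<noteq> 0" for Ts Us
    using word_gens_support[OF fs gs that[unfolded Feq]] n by simp_all
  show ?thesis unfolding sliced_def
  proof (intro conjI ballI allI impI)
    fix Ts Us :: "tabloid list" assume "F (Ts, Us) \<noteq> 0"
    from supp[OF this] show "length Ts = n" "\<exists>w\<in>words (length \<eta>) n. carried w (length \<eta>) Us"
      using w0 by blast+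
  next
    fix w and Ts Us :: "tabloid list" and j assume w: "w \<in> words (length \<eta>) n" and Ts: "length Ts = n"
      and Us: "carried w (length \<eta>) Us" and j: "j < n"
    show "(\<lambda>T. F (Ts[j := T], Us)) \<in> specht (\<mu> ! (w ! j))"
    proof (cases "w = w0")
      case True
      let ?c = "(\<Prod>l\<in>{..<length fs} - {j}. (fs ! l) (Ts ! l)) * tensors gs Us"
      have l: "length fs = n" "fs ! j \<in> specht (\<mu> ! (w ! j))" using fs j n True by (simp_all add: inner_factors_iff)
      have "(\<lambda>T. F (Ts[j := T], Us)) = fscale ?c (fs ! j)"
        by (rule ext) (simp add: Feq tensor2_def tensors_update l(1) j Ts fscale_def)
      thus ?thesis using fun_vs.subspace_scale[OF subspace_specht l(2)] by (simp only:)
    next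
      case False
      have "F (Ts[j := T], Us) = 0" for T
      proof (rule ccontr)
        assume "F (Ts[j := T], Us) \<noteq> 0"
        from carried_unique[OF w w0 Us supp(2)[OF this]] False show False by simp
      qed
      thus ?thesis by (rule subspace_zero_fun[OF subspace_specht])
    qed
  next
    fix w and Ts Us :: "tabloid list" and i assume w: "w \<in> words (length \<eta>) n" and i: "i < length \<eta>" and Us: "length Us = length \<eta>"
      "\<forall>l<length \<eta>. l \<noteq> i \<longrightarrow> \<Union> (set (Us ! l)) = fibre w l"
    show "(\<lambda>U. F (Ts, Us[i := U])) \<in> spechtA (\<eta> ! i) (fibre w i)"
    proof (cases "w = w0")
      case True
      let ?c = "tensors fs Ts * (\<Prod>l\<in>{..<length gs} - {i}. (gs ! l) (Us ! l))"
      have l: "length gs = length \<eta>" "gs ! i \<in> spechtA (\<eta> ! i) (fibre w i)"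
        using gs i True by (simp_all add: outer_factors_iff)
      have "(\<lambda>U. F (Ts, Us[i := U])) = fscale ?c (gs ! i)"
        by (rule ext) (simp add: Feq tensor2_def tensors_update l(1) i Us(1) fscale_def)
      thus ?thesis using fun_vs.subspace_scale[OF subspace_spechtA l(2)] by (simp only:)
    next
      case False
      have "F (Ts, Us[i := U]) = 0" for U
      proof (rule ccontr)
        assume "F (Ts, Us[i := U]) \<noteq> 0"
        from supp(2)[OF this] have c: "carried w0 (length \<eta>) (Us[i := U])" .
        have "fibre w l = fibre w0 l" if "l < length \<eta>" "l \<noteq> i" for l
          using c Us(2) that by (auto simp: carried_def)
        from fibres_eq[OF w w0 this] False show False by simp
      qed
      thus ?thesis by (rule subspace_zero_fun[OF subspace_spechtA])
    qed
  qed
qed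

text \<open>For the converse, \<open>f\<close> is cut into the parts carried by the single words.
  These have disjoint supports and sum to \<open>f\<close>, and each lies in one tensor product by
  \<open>tensor_slices\<close>.\<close>

lemma model_space_sliced: "f \<in> model_space n \<mu> \<eta> \<longleftrightarrow> sliced n \<mu> \<eta> (f :: 'k::field T_vec)"
proof
  assume "f \<in> model_space n \<mu> \<eta>"
  moreover have "model_space n \<mu> \<eta> \<subseteq> {f :: 'k T_vec. sliced n \<mu> \<eta> f}"
    unfolding model_space_def
    by (rule fun_vs.span_minimal[OF _ subspace_sliced]) (use word_gens_sliced in blast)
  ultimately show "sliced n \<mu> \<eta> f" by blast
next
  assume f: "sliced n \<mu> \<eta> f"
  define part where "part w = (\<lambda>(Ts, Us). if carried w (length \<eta>) Us then f (Ts, Us) else 0)" for w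
  let ?W = "words (length \<eta>) n"
  have "part w \<in> model_space n \<mu> \<eta>" if w: "w \<in> ?W" for w
  proof -
    have n: "length w = n" using w by (simp add: words_def)
    have len: "length (inner_factors \<mu> w :: (tabloid \<Rightarrow> 'k) set list) = n"
      "length (outer_factors \<eta> w :: (tabloid \<Rightarrow> 'k) set list) = length \<eta>"
      using n by (simp_all add: inner_factors_def outer_factors_def)
    have "part w \<in> fun_vs.span {tensor2 (tensors fs) (tensors gs) | fs gs.
        fs \<in> listset (inner_factors \<mu> w) \<and> gs \<in> listset (outer_factors \<eta> w)}"
    proof (rule tensor_slices)
      show "\<forall>V\<in>set (inner_factors \<mu> w). \<exists>B. finite B \<and> V = (fun_vs.span B :: (tabloid \<Rightarrow> 'k) set)"
        by (simp add: inner_factors_def finite_span_specht)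
      show "\<forall>V\<in>set (outer_factors \<eta> w). \<exists>B. finite B \<and> V = (fun_vs.span B :: (tabloid \<Rightarrow> 'k) set)"
        by (simp add: outer_factors_def finite_span_spechtA finite_fibre)
      fix Ts Us :: "tabloid list"
      show "part w (Ts, Us) = 0" if "length Ts \<noteq> length (inner_factors \<mu> w :: (tabloid \<Rightarrow> 'k) set list) \<or>
          length Us \<noteq> length (outer_factors \<eta> w :: (tabloid \<Rightarrow> 'k) set list)"
        using that slicedD(1)[OF f, of Ts Us] unfolding len by (auto simp: part_def carried_def)
      assume "length Ts = length (inner_factors \<mu> w :: (tabloid \<Rightarrow> 'k) set list)"
        "length Us = length (outer_factors \<eta> w :: (tabloid \<Rightarrow> 'k) set list)"
      hence l: "length Ts = n" "length Us = length \<eta>" by (simp_all only: len)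
      show "(\<lambda>T. part w (Ts[j := T], Us)) \<in> inner_factors \<mu> w ! j" if "j < length (inner_factors \<mu> w :: (tabloid \<Rightarrow> 'k) set list)" for j
      proof -
        have j: "j < n" using that len by simp
        have V: "inner_factors \<mu> w ! j = (specht (\<mu> ! (w ! j)) :: (tabloid \<Rightarrow> 'k) set)"
          using j n by (simp add: inner_factors_def)
        show ?thesis
        proof (cases "carried w (length \<eta>) Us")
          case True
          thus ?thesis using slicedD(3)[OF f w l(1) True j] by (simp add: part_def V)
        next
          case False
          thus ?thesis unfolding V by (intro subspace_zero_fun[OF subspace_specht]) (simp add: part_def)
        qed
      qed
      show "(\<lambda>U. part w (Ts, Us[i := U])) \<in> outer_factors \<eta> w ! i" if "i < length (outer_factors \<eta> w :: (tabloid \<Rightarrow> 'k) set list)" for i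
      proof -
        have i: "i < length \<eta>" using that len by simp
        have V: "outer_factors \<eta> w ! i = (spechtA (\<eta> ! i) (fibre w i) :: (tabloid \<Rightarrow> 'k) set)"
          using i by (simp add: outer_factors_def)
        show ?thesis
        proof (cases "\<forall>l<length \<eta>. l \<noteq> i \<longrightarrow> \<Union> (set (Us ! l)) = fibre w l")
          case True
          have s: "(\<lambda>U. f (Ts, Us[i := U])) \<in> spechtA (\<eta> ! i) (fibre w i)"
            by (rule slicedD(4)[OF f w i l(2)]) (use True in blast)
          \<comment> \<open>Nonzero values of the slice already force the entries of
            \<open>U\<close> to be the fibre, so cutting by the word leaves the slice
            unchanged.\<close>
          have "part w (Ts, Us[i := U]) = f (Ts, Us[i := U])" for U
          proof (cases "f (Ts, Us[i := U]) = 0")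
            case False
            have "\<Union> (set U) = fibre w i"
              by (rule tabloid_lettersD(2)[OF spechtA_support[OF s]]) (rule False)
            hence "carried w (length \<eta>) (Us[i := U])"
              unfolding carried_update[OF l(2) i] using True by blast
            thus ?thesis by (simp add: part_def)
          qed (simp add: part_def)
          thus ?thesis using s unfolding V by simp
        next
          case False
          have "\<not> carried w (length \<eta>) (Us[i := U])" for U
            unfolding carried_update[OF l(2) i] using False by blast
          hence "part w (Ts, Us[i := U]) = 0" for U by (simp add: part_def)
          thus ?thesis unfolding V by (intro subspace_zero_fun[OF subspace_spechtA])
        qed
      qed
    qed
    moreover have "{tensor2 (tensors fs) (tensors gs) | fs gs.
        fs \<in> listset (inner_factors \<mu> w) \<and> gs \<in> listset (outer_factors \<eta> w)} \<subseteq>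
      (\<Union>w\<in>?W. word_gens \<mu> \<eta> w :: 'k T_vec set)"
      using w unfolding word_gens_def by blast
    ultimately show ?thesis unfolding model_space_def using fun_vs.span_mono by blast
  qed
  hence "(\<Sum>w\<in>?W. part w) \<in> model_space n \<mu> \<eta>" by (rule fun_vs.subspace_sum[OF subspace_model_space])
  moreover have "f = (\<Sum>w\<in>?W. part w)"
  proof (rule ext)
    fix z :: "tabloid list \<times> tabloid list"
    obtain Ts Us where z: "z = (Ts, Us)" by fastforce
    show "f z = (\<Sum>w\<in>?W. part w) z"
    proof (cases "\<exists>w\<in>?W. carried w (length \<eta>) Us")
      case True
      then obtain w0 where w0: "w0 \<in> ?W" "carried w0 (length \<eta>) Us" by blast
      have "(\<Sum>w\<in>?W. part w z) = (\<Sum>w\<in>?W. if w = w0 then f z else 0)"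
      proof (rule sum.cong[OF refl])
        fix w assume w: "w \<in> ?W"
        show "part w z = (if w = w0 then f z else 0)"
        proof (cases "carried w (length \<eta>) Us")
          case True
          from carried_unique[OF w w0(1) True w0(2)] w0(2) show ?thesis by (simp add: part_def z)
        next
          case False
          with w0(2) have "w \<noteq> w0" by blast
          thus ?thesis using False by (simp add: part_def z)
        qed
      qed
      thus ?thesis using w0(1) finite_words by (simp add: sum_fun_apply)
    next
      case False
      hence "f z = 0" using slicedD(2)[OF f, of Ts Us] z by blast
      moreover have "part w z = 0" if "w \<in> ?W" for w using False that by (simp add: part_def z)
      ultimately show ?thesis by (simp add: sum_fun_apply)
    qed
  qed
  ultimately show "f \<in> model_space n \<mu> \<eta>" by simp
qed

section \<open>Homomorphisms of modules over group algebras\<close>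

lemma scalars_carrier: "carrier scalars = UNIV"
  by (simp add: ring_of_type_algebra_def)

lemma gsubmoduleD:
  assumes "gmodule M" "gsubmodule M N"
  shows "N \<subseteq> carrier M" "\<zero>\<^bsub>M\<^esub> \<in> N" "\<lbrakk>a \<in> N; b \<in> N\<rbrakk> \<Longrightarrow> a \<oplus>\<^bsub>M\<^esub> b \<in> N" "a \<in> N \<Longrightarrow> c \<odot>\<^bsub>M\<^esub> a \<in> N"
    "\<lbrakk>a \<in> N; g \<in> carrier (grp M)\<rbrakk> \<Longrightarrow> act M a g \<in> N"
proof -
  interpret gmodule M by fact
  have N: "submodule N scalars M" using assms(2) by (simp add: gsubmodule_def)
  show "N \<subseteq> carrier M" "\<zero>\<^bsub>M\<^esub> \<in> N" "\<lbrakk>a \<in> N; b \<in> N\<rbrakk> \<Longrightarrow> a \<oplus>\<^bsub>M\<^esub> b \<in> N" "a \<in> N \<Longrightarrow> c \<odot>\<^bsub>M\<^esub> a \<in> N"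
    using M.submoduleE[OF N] submodule.axioms(1)[OF N, THEN subgroup.one_closed]
    by (auto simp: scalars_carrier)
  show "\<lbrakk>a \<in> N; g \<in> carrier (grp M)\<rbrakk> \<Longrightarrow> act M a g \<in> N" using assms(2) by (simp add: gsubmodule_def)
qed

lemma sub_simps:
  "carrier (sub M N) = N" "grp (sub M N) = grp M" "act (sub M N) = act M"
  "\<zero>\<^bsub>sub M N\<^esub> = \<zero>\<^bsub>M\<^esub>" "(\<oplus>\<^bsub>sub M N\<^esub>) = (\<oplus>\<^bsub>M\<^esub>)" "(\<odot>\<^bsub>sub M N\<^esub>) = (\<odot>\<^bsub>M\<^esub>)"
  by (cases M; simp add: sub_def)+

lemma sub_gmodule:
  assumes "gmodule M" "gsubmodule M N"
  shows "gmodule (sub M N)"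
proof -
  interpret gmodule M by fact
  have N: "submodule N scalars M" using assms(2) by (simp add: gsubmodule_def)
  note D = gsubmoduleD[OF assms]
  have m: "module scalars (sub M N)"
    unfolding sub_def using submodule.submodule_is_module[OF N M.module_axioms] by simp
  show ?thesis
  proof (intro gmodule.intro gmodule_axioms.intro)
    show "group (grp (sub M N))" using G.is_group by (simp add: sub_simps)
  qed (use m D(5) subsetD[OF D(1)] in \<open>simp_all add: sub_simps act_add act_smult act_one act_mult\<close>)
qed

lemma sub_gsubmodule:
  assumes "gmodule M" "gsubmodule M C" "gsubmodule M N" "N \<subseteq> C"
  shows "gsubmodule (sub M C) N"
proof -
  note D = gsubmoduleD[OF assms(1,3)]
  have "submodule N scalars (sub M C)"
    by (rule submodule_scalarsI[OF sub_gmodule[OF assms(1,2)]]) (use D(2-4) assms(4) in \<open>simp_all add: sub_simps\<close>)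
  thus ?thesis using D(5) by (simp add: gsubmodule_def sub_simps)
qed

lemma res_simps:
  "carrier (res H M) = carrier M" "grp (res H M) = H" "act (res H M) = act M"
  "\<zero>\<^bsub>res H M\<^esub> = \<zero>\<^bsub>M\<^esub>" "(\<oplus>\<^bsub>res H M\<^esub>) = (\<oplus>\<^bsub>M\<^esub>)" "(\<odot>\<^bsub>res H M\<^esub>) = (\<odot>\<^bsub>M\<^esub>)"
  by (cases M; simp add: res_def)+

lemma res_gmodule:
  assumes "gmodule M" "group H" "carrier H \<subseteq> carrier (grp M)"
    and "(\<otimes>\<^bsub>H\<^esub>) = (\<otimes>\<^bsub>grp M\<^esub>)" "\<one>\<^bsub>H\<^esub> = \<one>\<^bsub>grp M\<^esub>"
  shows "gmodule (res H M)"
proof -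
  interpret gmodule M by fact
  have "module scalars (res H M)" using M.module_axioms
    unfolding module_def abelian_group_def abelian_monoid_def abelian_group_axioms_def module_axioms_def res_simps .
  thus ?thesis using assms(2) subsetD[OF assms(3)]
    by (intro gmodule.intro gmodule_axioms.intro)
      (simp_all add: res_simps assms(4,5) act_closed act_add act_smult act_one act_mult)
qed

text \<open>The first isomorphism theorem for these records. The induced map evaluates \<Phi> at a
  chosen representative; the kernel condition makes \<Phi> constant on cosets.\<close>

lemma quot_iso:
  assumes M: "gmodule M" and S: "gmodule S" and N: "gsubmodule M N" and grp: "grp S = grp M"
    and surj: "\<Phi> ` carrier M = carrier S"
    and add: "\<And>v w. \<lbrakk>v \<in> carrier M; w \<in> carrier M\<rbrakk> \<Longrightarrow> \<Phi> (v \<oplus>\<^bsub>M\<^esub> w) = \<Phi> v \<oplus>\<^bsub>S\<^esub> \<Phi> w"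
    and smult: "\<And>v c. v \<in> carrier M \<Longrightarrow> \<Phi> (c \<odot>\<^bsub>M\<^esub> v) = c \<odot>\<^bsub>S\<^esub> \<Phi> v"
    and act: "\<And>v g. \<lbrakk>v \<in> carrier M; g \<in> carrier (grp M)\<rbrakk> \<Longrightarrow> \<Phi> (act M v g) = act S (\<Phi> v) g"
    and ker: "\<And>v. v \<in> carrier M \<Longrightarrow> \<Phi> v = \<zero>\<^bsub>S\<^esub> \<longleftrightarrow> v \<in> N"
  shows "gmod_iso (quot M N) S"
proof -
  interpret gmodule M by fact
  interpret S: gmodule S by fact
  interpret N: submodule N scalars M using N by (simp add: gsubmodule_def)
  interpret N: abelian_subgroup N M
    by (rule abelian_subgroupI3[OF additive_subgroup.intro]) (unfold_locales)
  have N_sub: "N \<subseteq> carrier M" using N.subset by simp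
  have \<Phi>c: "\<Phi> v \<in> carrier S" if "v \<in> carrier M" for v using surj that by blast
  have coset: "a' \<in> carrier M \<and> \<Phi> a' = \<Phi> a" if a: "a \<in> carrier M" and a': "a' \<in> N +>\<^bsub>M\<^esub> a" for a a'
  proof -
    obtain x where x: "x \<in> N" "a' = x \<oplus>\<^bsub>M\<^esub> a" using a' by (auto simp: a_r_coset_def r_coset_def)
    have xM: "x \<in> carrier M" using x N_sub by blast
    have "\<Phi> x = \<zero>\<^bsub>S\<^esub>" using ker[OF xM] x(1) by simp
    thus ?thesis using add[OF xM a] x(2) xM a \<Phi>c[OF a] by simp
  qed
  have self: "a \<in> N +>\<^bsub>M\<^esub> a" if "a \<in> carrier M" for a using N.a_rcos_self[OF that] .
  define \<theta> where "\<theta> A = \<Phi> (SOME a. a \<in> A)" for A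
  have \<theta>: "\<theta> (N +>\<^bsub>M\<^esub> a) = \<Phi> a" if "a \<in> carrier M" for a
    unfolding \<theta>_def using coset[OF that someI[of "\<lambda>x. x \<in> N +>\<^bsub>M\<^esub> a", OF self[OF that]]] ..
  have car: "carrier (quot M N) = (\<lambda>a. N +>\<^bsub>M\<^esub> a) ` carrier M"
    by (auto simp: quot_def A_RCOSETS_def' image_def)
  have cadd: "(N +>\<^bsub>M\<^esub> a) \<oplus>\<^bsub>quot M N\<^esub> (N +>\<^bsub>M\<^esub> b) = N +>\<^bsub>M\<^esub> (a \<oplus>\<^bsub>M\<^esub> b)"
    if "a \<in> carrier M" "b \<in> carrier M" for a b
    using N.a_rcos_sum[OF that] by (simp add: quot_def)
  have eq: "N +>\<^bsub>M\<^esub> a = N +>\<^bsub>M\<^esub> b" if ab: "a \<in> carrier M" "b \<in> carrier M" and e: "\<Phi> a = \<Phi> b" for a b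
  proof -
    have d: "a \<ominus>\<^bsub>M\<^esub> b \<in> carrier M" using ab by simp
    have s: "(a \<ominus>\<^bsub>M\<^esub> b) \<oplus>\<^bsub>M\<^esub> b = a" using ab by (simp add: M.M.minus_eq M.M.a_assoc M.M.l_neg)
    have "\<Phi> (a \<ominus>\<^bsub>M\<^esub> b) \<oplus>\<^bsub>S\<^esub> \<Phi> b = \<Phi> b" using add[OF d ab(2)] s e by simp
    hence "\<Phi> (a \<ominus>\<^bsub>M\<^esub> b) \<oplus>\<^bsub>S\<^esub> \<Phi> b = \<zero>\<^bsub>S\<^esub> \<oplus>\<^bsub>S\<^esub> \<Phi> b" using \<Phi>c[OF ab(2)] by simp
    hence "\<Phi> (a \<ominus>\<^bsub>M\<^esub> b) = \<zero>\<^bsub>S\<^esub>"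
      by (rule S.M.M.add.right_cancel[THEN iffD1, rotated 3]) (use \<Phi>c[OF d] \<Phi>c[OF ab(2)] in simp_all)
    hence "a \<ominus>\<^bsub>M\<^esub> b \<in> N" using ker[OF d] by simp
    hence "\<exists>x\<in>N. a = x \<oplus>\<^bsub>M\<^esub> b" using s[symmetric] by (rule bexI[rotated])
    hence "a \<in> N +>\<^bsub>M\<^esub> b" by (simp add: a_r_coset_def r_coset_def)
    thus ?thesis using M.a_repr_independence[OF _ ab(2) N.a_subgroup] by metis
  qed
  have op: "(\<Union>a'\<in>N +>\<^bsub>M\<^esub> a. N +>\<^bsub>M\<^esub> \<psi> a') = N +>\<^bsub>M\<^esub> \<psi> a"
    if a: "a \<in> carrier M" and cl: "\<And>x. x \<in> carrier M \<Longrightarrow> \<psi> x \<in> carrier M"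
      and resp: "\<And>x y. \<lbrakk>x \<in> carrier M; y \<in> carrier M; \<Phi> x = \<Phi> y\<rbrakk> \<Longrightarrow> \<Phi> (\<psi> x) = \<Phi> (\<psi> y)" for \<psi> a
  proof -
    have "N +>\<^bsub>M\<^esub> \<psi> a' = N +>\<^bsub>M\<^esub> \<psi> a" if "a' \<in> N +>\<^bsub>M\<^esub> a" for a'
      using coset[OF a that] a cl resp by (intro eq) blast+
    thus ?thesis using self[OF a] by blast
  qed
  have csmult: "c \<odot>\<^bsub>quot M N\<^esub> (N +>\<^bsub>M\<^esub> a) = N +>\<^bsub>M\<^esub> (c \<odot>\<^bsub>M\<^esub> a)" if "a \<in> carrier M" for c a
    unfolding quot_def by (simp, rule op[OF that]) (simp_all add: smult scalars_carrier)
  have cact: "act (quot M N) (N +>\<^bsub>M\<^esub> a) g = N +>\<^bsub>M\<^esub> act M a g"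
    if "a \<in> carrier M" "g \<in> carrier (grp M)" for a g
    unfolding quot_def by (simp, rule op[OF that(1)]) (simp_all add: act act_closed that(2))
  have gq: "grp (quot M N) = grp M" by (simp add: quot_def)
  show ?thesis unfolding gmod_iso_def gq grp
  proof (intro conjI refl exI[of _ \<theta>] ballI allI)
    show "bij_betw \<theta> (carrier (quot M N)) (carrier S)" unfolding bij_betw_def
    proof
      show "inj_on \<theta> (carrier (quot M N))"
      proof (rule inj_onI)
        fix A B assume "A \<in> carrier (quot M N)" "B \<in> carrier (quot M N)" and e: "\<theta> A = \<theta> B"
        then obtain a b where ab: "a \<in> carrier M" "A = N +>\<^bsub>M\<^esub> a" "b \<in> carrier M" "B = N +>\<^bsub>M\<^esub> b"
          unfolding car by blast
        have "\<Phi> a = \<Phi> b" using e unfolding ab(2,4) \<theta>[OF ab(1)] \<theta>[OF ab(3)] .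
        thus "A = B" unfolding ab(2,4) by (rule eq[OF ab(1,3)])
      qed
      have "\<theta> ` carrier (quot M N) = (\<lambda>a. \<Phi> a) ` carrier M"
        unfolding car image_image by (rule image_cong[OF refl]) (rule \<theta>)
      thus "\<theta> ` carrier (quot M N) = carrier S" using surj by simp
    qed
  next
    fix A B assume "A \<in> carrier (quot M N)" "B \<in> carrier (quot M N)"
    then obtain a b where ab: "a \<in> carrier M" "A = N +>\<^bsub>M\<^esub> a" "b \<in> carrier M" "B = N +>\<^bsub>M\<^esub> b"
      unfolding car by blast
    show "\<theta> (A \<oplus>\<^bsub>quot M N\<^esub> B) = \<theta> A \<oplus>\<^bsub>S\<^esub> \<theta> B"
      unfolding ab(2,4) cadd[OF ab(1,3)] \<theta>[OF ab(1)] \<theta>[OF ab(3)] \<theta>[OF M.M.a_closed[OF ab(1,3)]]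
      by (rule add[OF ab(1,3)])
  next
    fix A c assume "A \<in> carrier (quot M N)"
    then obtain a where a: "a \<in> carrier M" "A = N +>\<^bsub>M\<^esub> a" unfolding car by blast
    have ca: "c \<odot>\<^bsub>M\<^esub> a \<in> carrier M" using a(1) by (simp add: scalars_carrier)
    show "\<theta> (c \<odot>\<^bsub>quot M N\<^esub> A) = c \<odot>\<^bsub>S\<^esub> \<theta> A"
      unfolding a(2) csmult[OF a(1)] \<theta>[OF a(1)] \<theta>[OF ca] by (rule smult[OF a(1)])
  next
    fix A g assume "A \<in> carrier (quot M N)" and g: "g \<in> carrier (grp M)"
    then obtain a where a: "a \<in> carrier M" "A = N +>\<^bsub>M\<^esub> a" unfolding car by blast
    show "\<theta> (gmod.act (quot M N) A g) = gmod.act S (\<theta> A) g"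
      unfolding a(2) cact[OF a(1) g] \<theta>[OF a(1)] \<theta>[OF act_closed[OF a(1) g]] by (rule act[OF a(1) g])
  qed
qed

lemma gmod_isoE:
  assumes "gmod_iso M N"
  obtains \<theta> where "grp M = grp N" "bij_betw \<theta> (carrier M) (carrier N)"
    "\<And>v w. \<lbrakk>v \<in> carrier M; w \<in> carrier M\<rbrakk> \<Longrightarrow> \<theta> (v \<oplus>\<^bsub>M\<^esub> w) = \<theta> v \<oplus>\<^bsub>N\<^esub> \<theta> w"
    "\<And>v c. v \<in> carrier M \<Longrightarrow> \<theta> (c \<odot>\<^bsub>M\<^esub> v) = c \<odot>\<^bsub>N\<^esub> \<theta> v"
    "\<And>v g. \<lbrakk>v \<in> carrier M; g \<in> carrier (grp M)\<rbrakk> \<Longrightarrow> \<theta> (act M v g) = act N (\<theta> v) g"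
  using assms unfolding gmod_iso_def by blast

lemma gmod_iso_sym:
  assumes iso: "gmod_iso M N" and M: "gmodule M"
  shows "gmod_iso N M"
proof -
  interpret gmodule M by fact
  obtain \<theta> where grp: "grp M = grp N" and bij: "bij_betw \<theta> (carrier M) (carrier N)"
    and add: "\<And>v w. \<lbrakk>v \<in> carrier M; w \<in> carrier M\<rbrakk> \<Longrightarrow> \<theta> (v \<oplus>\<^bsub>M\<^esub> w) = \<theta> v \<oplus>\<^bsub>N\<^esub> \<theta> w"
    and smult: "\<And>v c. v \<in> carrier M \<Longrightarrow> \<theta> (c \<odot>\<^bsub>M\<^esub> v) = c \<odot>\<^bsub>N\<^esub> \<theta> v"
    and act: "\<And>v g. \<lbrakk>v \<in> carrier M; g \<in> carrier (grp M)\<rbrakk> \<Longrightarrow> \<theta> (act M v g) = act N (\<theta> v) g"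
    using gmod_isoE[OF iso] by blast
  have car: "carrier N = \<theta> ` carrier M" using bij by (simp add: bij_betw_def)
  let ?i = "inv_into (carrier M) \<theta>"
  have i: "?i (\<theta> v) = v" if "v \<in> carrier M" for v
    using bij that by (simp add: bij_betw_def inv_into_f_f)
  show ?thesis unfolding gmod_iso_def
  proof (intro conjI exI[of _ ?i] ballI allI)
    show "bij_betw ?i (carrier N) (carrier M)" by (rule bij_betw_inv_into[OF bij])
  qed (auto simp: car i grp[symmetric] add[symmetric] smult[symmetric] act[symmetric] act_closed scalars_carrier)
qed

section \<open>Recognizing induced modules\<close>

text \<open>A criterion for induced modules: \<open>j\<close> embeds \<open>T\<close> compatibly
  with \<open>H\<close>, its translates span \<open>M\<close>, and \<open>p\<close> retracts
  \<open>j\<close> and kills the translates by elements outside \<open>H\<close>. The last condition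
  separates the cosets of \<open>H\<close>, so that \<open>M\<close> is the direct sum of the
  translates of the image of \<open>j\<close> over these cosets.\<close>

lemma ind_iso:
  fixes V :: "('x \<Rightarrow> 'k::field) set" and W :: "('y \<Rightarrow> 'k) set" and G H :: "'g monoid"
    and aT :: "('x \<Rightarrow> 'k) \<Rightarrow> 'g \<Rightarrow> ('x \<Rightarrow> 'k)" and aM :: "('y \<Rightarrow> 'k) \<Rightarrow> 'g \<Rightarrow> ('y \<Rightarrow> 'k)"
    and j :: "('x \<Rightarrow> 'k) \<Rightarrow> ('y \<Rightarrow> 'k)" and p :: "('y \<Rightarrow> 'k) \<Rightarrow> ('x \<Rightarrow> 'k)"
  defines "T \<equiv> fun_module H V aT" and "M \<equiv> fun_module G W aM"
  assumes G: "group G" "finite (carrier G)" and H: "subgroup (carrier H) G" "monoid.mult H = monoid.mult G"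
    and T: "gmodule T" and M: "gmodule M"
    and aM: "\<And>f f' g. aM (f + f') g = aM f g + aM f' g" "\<And>c f g. aM (fscale c f) g = fscale c (aM f g)"
    and j: "\<And>f f'. j (f + f') = j f + j f'" "\<And>c f. j (fscale c f) = fscale c (j f)"
    and p: "\<And>f f'. p (f + f') = p f + p f'" "\<And>c f. p (fscale c f) = fscale c (p f)"
    and jW: "\<And>t. t \<in> V \<Longrightarrow> j t \<in> W"
    and jH: "\<And>t h. \<lbrakk>t \<in> V; h \<in> carrier H\<rbrakk> \<Longrightarrow> j (aT t h) = aM (j t) h"
    and pj: "\<And>t. t \<in> V \<Longrightarrow> p (j t) = t"
    and p0: "\<And>t g. \<lbrakk>t \<in> V; g \<in> carrier G; g \<notin> carrier H\<rbrakk> \<Longrightarrow> p (aM (j t) g) = 0"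
    and gen: "W \<subseteq> fun_vs.span {aM (j t) g | t g. t \<in> V \<and> g \<in> carrier G}"
  shows "gmod_iso (ind G T) M"
proof -
  interpret G: group G by fact
  interpret T: gmodule T by fact
  interpret M: gmodule M by fact
  define K where "K = tensor_kG G T"
  have K: "gmodule K" unfolding K_def by (rule tensor_kG_gmodule[OF G(1) T])
  interpret K: gmodule K by fact
  have grpT: "grp T = H" and carT: "carrier T = V" and zT: "\<zero>\<^bsub>T\<^esub> = 0" and aT: "act T = aT"
    and carM: "carrier M = W" and grpM: "grp M = G" and zM: "\<zero>\<^bsub>M\<^esub> = 0" and aM': "act M = aM"
    by (simp_all add: T_def M_def fun_module_def)
  have opM: "f \<oplus>\<^bsub>M\<^esub> f' = f + f'" "c \<odot>\<^bsub>M\<^esub> f = fscale c f" for c f f'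
    by (simp_all add: M_def fun_module_def)
  have addT: "t \<oplus>\<^bsub>T\<^esub> t' = t + t'" "c \<odot>\<^bsub>T\<^esub> t = fscale c t" for t t' c
    by (simp_all add: T_def fun_module_def)
  have carK: "F \<in> carrier K \<longleftrightarrow> (\<forall>g\<in>carrier G. F g \<in> V) \<and> (\<forall>g. g \<notin> carrier G \<longrightarrow> F g = 0)" for F
    by (auto simp: K_def tensor_kG_def carT zT)
  have addK: "F \<oplus>\<^bsub>K\<^esub> F' = (\<lambda>g. F g + F' g)" "\<zero>\<^bsub>K\<^esub> = (\<lambda>_. 0)" "c \<odot>\<^bsub>K\<^esub> F = (\<lambda>g. fscale c (F g))"
    for F F' :: "'g \<Rightarrow> 'x \<Rightarrow> 'k" and c
    by (simp_all add: K_def tensor_kG_def addT zT)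
  have grpK: "grp K = G" and actK: "act K F g = (\<lambda>x. if x \<in> carrier G then F (x \<otimes>\<^bsub>G\<^esub> inv\<^bsub>G\<^esub> g) else 0)" for F g
    by (simp_all add: K_def tensor_kG_def zT cong: if_cong)
  have HG: "carrier H \<subseteq> carrier G" using H(1) subgroup.subset by blast
  have rels: "gsubmodule K (ind_rels G T)"
    unfolding K_def by (rule ind_rels_gsubmodule[OF G(1) T]) (simp add: grpT HG)
  have V: "fun_vs.subspace V"
  proof (rule fun_vs.subspaceI)
    show "0 \<in> V" using T.M.M.zero_closed by (simp add: carT zT)
    show "t + t' \<in> V" if "t \<in> V" "t' \<in> V" for t t'
      using T.M.M.a_closed[of t t'] that by (simp add: carT addT)
    show "fscale c t \<in> V" if "t \<in> V" for c t
      using T.M.smult_closed[of c t] that by (simp add: carT addT scalars_carrier)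
  qed
  have W: "fun_vs.subspace W"
  proof (rule fun_vs.subspaceI)
    show "0 \<in> W" using M.M.M.zero_closed by (simp add: carM zM)
    show "t + t' \<in> W" if "t \<in> W" "t' \<in> W" for t t'
      using M.M.M.a_closed[of t t'] that by (simp add: carM opM)
    show "fscale c t \<in> W" if "t \<in> W" for c t
      using M.M.smult_closed[of c t] that by (simp add: carM opM scalars_carrier)
  qed
  have aTV: "aT t h \<in> V" if "t \<in> V" "h \<in> carrier H" for t h
    using T.act_closed[of t h] that by (simp add: carT grpT aT)
  have aMW: "aM f g \<in> W" if "f \<in> W" "g \<in> carrier G" for f g
    using M.act_closed[of f g] that by (simp add: carM grpM aM')
  have aMm: "aM f (g \<otimes>\<^bsub>G\<^esub> h) = aM (aM f g) h" if "f \<in> W" "g \<in> carrier G" "h \<in> carrier G" for f g h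
    using M.act_mult[of f g h] that by (simp add: carM grpM aM')
  have aM1: "aM f \<one>\<^bsub>G\<^esub> = f" if "f \<in> W" for f
    using M.act_one[of f] that by (simp add: carM grpM aM')
  have lin0: "L (0 :: 'a \<Rightarrow> 'k) = (0 :: 'b \<Rightarrow> 'k)" if "\<And>f f'. L (f + f') = L f + L f'" for L :: "('a \<Rightarrow> 'k) \<Rightarrow> ('b \<Rightarrow> 'k)"
    using that[of 0 0] by simp
  have linsum: "L (\<Sum>i\<in>I. f i) = (\<Sum>i\<in>I. L (f i))" if "\<And>f f'. L (f + f') = L f + L f'"
    for L :: "('a \<Rightarrow> 'k) \<Rightarrow> ('b \<Rightarrow> 'k)" and f :: "'i \<Rightarrow> _" and I
    by (induction I rule: infinite_finite_induct)
      (simp_all only: sum.infinite sum.empty sum.insert that lin0[of L, OF that] not_False_eq_True)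
  have j0: "j 0 = 0" by (rule lin0[of j, OF j(1)])
  have p00: "p 0 = 0" by (rule lin0[of p, OF p(1)])
  have aM0: "aM 0 g = 0" for g by (rule lin0[of "\<lambda>f. aM f g", OF aM(1)])
  \<comment> \<open>On a pure tensor of \<open>t\<close> and \<open>g\<close> this is
    \<open>j t\<close> acted on by \<open>g\<close>; its kernel turns out to be
    \<open>ind_rels G T\<close>.\<close>
  define \<Theta> where "\<Theta> F = (\<Sum>g\<in>carrier G. aM (j (F g)) g)" for F
  have \<Theta>add: "\<Theta> (\<lambda>g. F g + F' g) = \<Theta> F + \<Theta> F'" for F F'
    by (simp add: \<Theta>_def j aM sum.distrib)
  have \<Theta>smult: "\<Theta> (\<lambda>g. fscale c (F g)) = fscale c (\<Theta> F)" for c F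
    by (simp add: \<Theta>_def j aM fun_vs.scale_sum_right)
  have \<Theta>W: "\<Theta> F \<in> W" if "F \<in> carrier K" for F
    unfolding \<Theta>_def using that by (intro fun_vs.subspace_sum[OF W] aMW jW) (auto simp: carK)
  have \<Theta>act: "\<Theta> (act K F g) = aM (\<Theta> F) g" if F: "F \<in> carrier K" and g: "g \<in> carrier G" for F g
  proof -
    have "\<Theta> (act K F g) = (\<Sum>x\<in>carrier G. aM (j (F (x \<otimes>\<^bsub>G\<^esub> inv\<^bsub>G\<^esub> g))) x)"
      by (simp add: \<Theta>_def actK)
    also have "\<dots> = (\<Sum>y\<in>carrier G. aM (aM (j (F y)) y) g)"
    proof (rule sum.reindex_bij_witness[where i = "\<lambda>y. y \<otimes>\<^bsub>G\<^esub> g" and j = "\<lambda>x. x \<otimes>\<^bsub>G\<^esub> inv\<^bsub>G\<^esub> g"])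
      fix x assume x: "x \<in> carrier G"
      show e: "x \<otimes>\<^bsub>G\<^esub> inv\<^bsub>G\<^esub> g \<otimes>\<^bsub>G\<^esub> g = x" using x g by (simp add: G.m_assoc)
      show "x \<otimes>\<^bsub>G\<^esub> inv\<^bsub>G\<^esub> g \<in> carrier G" using x g by simp
      have "j (F (x \<otimes>\<^bsub>G\<^esub> inv\<^bsub>G\<^esub> g)) \<in> W" using F x g by (intro jW) (simp add: carK)
      thus "aM (aM (j (F (x \<otimes>\<^bsub>G\<^esub> inv\<^bsub>G\<^esub> g))) (x \<otimes>\<^bsub>G\<^esub> inv\<^bsub>G\<^esub> g)) g = aM (j (F (x \<otimes>\<^bsub>G\<^esub> inv\<^bsub>G\<^esub> g))) x"
        using aMm[of _ "x \<otimes>\<^bsub>G\<^esub> inv\<^bsub>G\<^esub> g" g] x g e by simp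
    next
      fix y assume "y \<in> carrier G"
      thus "y \<otimes>\<^bsub>G\<^esub> g \<otimes>\<^bsub>G\<^esub> inv\<^bsub>G\<^esub> g = y" "y \<otimes>\<^bsub>G\<^esub> g \<in> carrier G" using g by (simp_all add: G.m_assoc)
    qed
    also have "\<dots> = aM (\<Theta> F) g"
      unfolding \<Theta>_def by (rule linsum[of "\<lambda>f. aM f g", OF aM(1), symmetric])
    finally show ?thesis .
  qed
  define pure where "pure t g = (\<lambda>x. if x = g then t else 0)" for t :: "'x \<Rightarrow> 'k" and g :: 'g
  have pure: "pure_kG T t g = pure t g" for t g by (simp add: pure_kG_def pure_def zT cong: if_cong)
  have pureK: "pure t g \<in> carrier K" if "t \<in> V" "g \<in> carrier G" for t g
    using that fun_vs.subspace_0[OF V] by (auto simp: carK pure_def)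
  have \<Theta>pure: "\<Theta> (pure t g) = aM (j t) g" if "g \<in> carrier G" for t g
  proof -
    have "\<Theta> (pure t g) = (\<Sum>x\<in>carrier G. if x = g then aM (j t) g else 0)"
      unfolding \<Theta>_def by (rule sum.cong) (auto simp: pure_def j0 aM0)
    thus ?thesis using that G(2) by simp
  qed
  have minusK: "F \<ominus>\<^bsub>K\<^esub> F' = (\<lambda>g. F g - F' g)" if "F \<in> carrier K" "F' \<in> carrier K" for F F'
  proof -
    have "(\<lambda>g. - F' g) \<in> carrier K" using that(2) fun_vs.subspace_neg[OF V] by (simp add: carK)
    moreover have "(\<lambda>g. - F' g) \<oplus>\<^bsub>K\<^esub> F' = \<zero>\<^bsub>K\<^esub>" by (simp add: addK)
    ultimately have "\<ominus>\<^bsub>K\<^esub> F' = (\<lambda>g. - F' g)" using K.M.M.minus_equality that(2) by metis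
    thus ?thesis by (simp add: a_minus_def addK)
  qed
  let ?rel = "{pure_kG T (act T t h) g \<ominus>\<^bsub>K\<^esub> pure_kG T t (h \<otimes>\<^bsub>G\<^esub> g) | t h g.
    t \<in> carrier T \<and> h \<in> carrier (grp T) \<and> g \<in> carrier G}"
  have relE: "pure_kG T (act T t h) g \<ominus>\<^bsub>K\<^esub> pure_kG T t (h \<otimes>\<^bsub>G\<^esub> g) =
      (\<lambda>x. pure (aT t h) g x - pure t (h \<otimes>\<^bsub>G\<^esub> g) x)"
    if "t \<in> V" "h \<in> carrier H" "g \<in> carrier G" for t h g
    unfolding pure aT using that HG by (intro minusK pureK aTV) auto
  have ind_relsE: "ind_rels G T = \<Inter>{N. submodule N scalars K \<and> ?rel \<subseteq> N}"
    by (simp add: ind_rels_def K_def)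
  have \<Theta>rel: "\<Theta> s = 0 \<and> s \<in> carrier K" if srel: "s \<in> ?rel" for s
  proof -
    from srel obtain t h g where t: "t \<in> V" "h \<in> carrier H" "g \<in> carrier G"
      and s': "s = pure_kG T (act T t h) g \<ominus>\<^bsub>K\<^esub> pure_kG T t (h \<otimes>\<^bsub>G\<^esub> g)"
      unfolding carT grpT by blast
    have s: "s = (\<lambda>x. pure (aT t h) g x - pure t (h \<otimes>\<^bsub>G\<^esub> g) x)"
      unfolding s' by (rule relE[OF t])
    have hG: "h \<in> carrier G" using t(2) HG by blast
    have "\<Theta> (\<lambda>x. s x + pure t (h \<otimes>\<^bsub>G\<^esub> g) x) = \<Theta> (pure (aT t h) g)" by (simp add: s)
    hence "\<Theta> s + aM (j t) (h \<otimes>\<^bsub>G\<^esub> g) = aM (j (aT t h)) g"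
      unfolding \<Theta>add using \<Theta>pure t(3) hG by simp
    moreover have "aM (j (aT t h)) g = aM (j t) (h \<otimes>\<^bsub>G\<^esub> g)"
      using jH[OF t(1,2)] aMm[OF jW[OF t(1)] hG t(3)] by simp
    ultimately have "\<Theta> s = 0" by simp
    moreover have "s \<in> carrier K"
      unfolding s minusK[OF pureK[OF aTV[OF t(1,2)] t(3)] pureK[OF t(1) G.m_closed[OF hG t(3)]], symmetric]
      by (intro K.M.M.minus_closed pureK aTV t G.m_closed hG)
    ultimately show ?thesis by blast
  qed
  let ?ker = "{F \<in> carrier K. \<Theta> F = 0}"
  have "submodule ?ker scalars K"
  proof (rule submodule_scalarsI[OF K])
    show "\<zero>\<^bsub>K\<^esub> \<in> ?ker" using K.M.M.zero_closed by (simp add: addK \<Theta>_def j0 aM0)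
    fix a b assume ab: "a \<in> ?ker" "b \<in> ?ker"
    hence "a \<oplus>\<^bsub>K\<^esub> b \<in> carrier K" by simp
    thus "a \<oplus>\<^bsub>K\<^esub> b \<in> ?ker" using ab by (simp add: addK \<Theta>add)
  next
    fix c a assume a: "a \<in> ?ker"
    hence "c \<odot>\<^bsub>K\<^esub> a \<in> carrier K" by (simp add: scalars_carrier)
    thus "c \<odot>\<^bsub>K\<^esub> a \<in> ?ker" using a by (simp add: addK \<Theta>smult)
  qed simp
  hence sub1: "ind_rels G T \<subseteq> ?ker" unfolding ind_relsE using \<Theta>rel by blast
  \<comment> \<open>A representative of the right coset of \<open>x\<close>, chosen from the coset
    as a set and hence the same for all its elements.\<close>
  define \<rho> where "\<rho> x = (SOME y. y \<in> (\<lambda>h. h \<otimes>\<^bsub>G\<^esub> x) ` carrier H)" for x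
  have one: "\<one>\<^bsub>G\<^esub> \<in> carrier H" using subgroup.one_closed[OF H(1)] .
  have \<rho>: "\<exists>h\<in>carrier H. \<rho> x = h \<otimes>\<^bsub>G\<^esub> x" for x
    unfolding \<rho>_def using someI_ex[of "\<lambda>y. y \<in> (\<lambda>h. h \<otimes>\<^bsub>G\<^esub> x) ` carrier H"] one by blast
  have \<rho>G: "\<rho> x \<in> carrier G" if "x \<in> carrier G" for x using \<rho>[of x] HG that by auto
  have coset: "(\<lambda>h. h \<otimes>\<^bsub>G\<^esub> (k \<otimes>\<^bsub>G\<^esub> x)) ` carrier H = (\<lambda>h. h \<otimes>\<^bsub>G\<^esub> x) ` carrier H"
    if k: "k \<in> carrier H" and x: "x \<in> carrier G" for k x
  proof -
    have kG: "k \<in> carrier G" using k HG by blast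
    show ?thesis
    proof (intro Set.equalityI image_subsetI)
      fix h assume h: "h \<in> carrier H"
      hence hG: "h \<in> carrier G" using HG by blast
      show "h \<otimes>\<^bsub>G\<^esub> (k \<otimes>\<^bsub>G\<^esub> x) \<in> (\<lambda>h. h \<otimes>\<^bsub>G\<^esub> x) ` carrier H"
        by (rule image_eqI[OF _ subgroup.m_closed[OF H(1) h k]]) (simp add: G.m_assoc hG kG x)
      have "inv\<^bsub>G\<^esub> k \<otimes>\<^bsub>G\<^esub> (k \<otimes>\<^bsub>G\<^esub> x) = x" using kG x by (simp add: G.m_assoc[symmetric])
      hence "h \<otimes>\<^bsub>G\<^esub> x = (h \<otimes>\<^bsub>G\<^esub> inv\<^bsub>G\<^esub> k) \<otimes>\<^bsub>G\<^esub> (k \<otimes>\<^bsub>G\<^esub> x)"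
        using hG kG x by (simp add: G.m_assoc)
      thus "h \<otimes>\<^bsub>G\<^esub> x \<in> (\<lambda>h. h \<otimes>\<^bsub>G\<^esub> (k \<otimes>\<^bsub>G\<^esub> x)) ` carrier H"
        by (rule image_eqI[OF _ subgroup.m_closed[OF H(1) h subgroup.m_inv_closed[OF H(1) k]]])
    qed
  qed
  have \<rho>h: "\<rho> (k \<otimes>\<^bsub>G\<^esub> x) = \<rho> x" if "k \<in> carrier H" "x \<in> carrier G" for k x
    unfolding \<rho>_def coset[OF that] ..
  have hx: "x \<otimes>\<^bsub>G\<^esub> inv\<^bsub>G\<^esub> (\<rho> x) \<in> carrier H" "x = (x \<otimes>\<^bsub>G\<^esub> inv\<^bsub>G\<^esub> (\<rho> x)) \<otimes>\<^bsub>G\<^esub> \<rho> x" if x: "x \<in> carrier G" for x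
  proof -
    obtain h where h: "h \<in> carrier H" "\<rho> x = h \<otimes>\<^bsub>G\<^esub> x" using \<rho> by blast
    have hG: "h \<in> carrier G" using h(1) HG by blast
    have "x \<otimes>\<^bsub>G\<^esub> inv\<^bsub>G\<^esub> (\<rho> x) = inv\<^bsub>G\<^esub> h"
      unfolding h(2) using hG x by (simp add: G.inv_mult_group G.m_assoc[symmetric])
    thus "x \<otimes>\<^bsub>G\<^esub> inv\<^bsub>G\<^esub> (\<rho> x) \<in> carrier H" using subgroup.m_inv_closed[OF H(1) h(1)] by simp
    show "x = (x \<otimes>\<^bsub>G\<^esub> inv\<^bsub>G\<^esub> (\<rho> x)) \<otimes>\<^bsub>G\<^esub> \<rho> x" using x \<rho>G[OF x] by (simp add: G.m_assoc)
  qed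
  have sub2: "F \<in> ind_rels G T" if F: "F \<in> carrier K" and F0: "\<Theta> F = 0" for F
    unfolding ind_relsE
  proof (rule InterI, clarify)
    fix N assume N: "submodule N scalars K" and rel: "?rel \<subseteq> N"
    have Nadd: "(\<lambda>g. a g + b g) \<in> N" if "a \<in> N" "b \<in> N" for a b
      using K.M.submoduleE(5)[OF N that] by (simp add: addK)
    have Nzero: "(\<lambda>_. 0) \<in> N"
      using submodule.axioms(1)[OF N, THEN subgroup.one_closed] by (simp add: addK)
    have Nsum: "(\<lambda>x. \<Sum>i\<in>I. a i x) \<in> N" if "\<And>i. i \<in> I \<Longrightarrow> a i \<in> N" for I :: "'g set" and a :: "'g \<Rightarrow> 'g \<Rightarrow> 'x \<Rightarrow> 'k"
      using that by (induction I rule: infinite_finite_induct) (simp_all add: Nzero Nadd)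
    \<comment> \<open>Modulo the relations, the value of \<open>F\<close> at \<open>g\<close> moves
      to the representative of the coset of \<open>g\<close> after acting with the element
      \<open>h g\<close> of \<open>H\<close>; \<open>t r\<close> collects what arrives at
      \<open>r\<close>.\<close>
    define h where "h g = g \<otimes>\<^bsub>G\<^esub> inv\<^bsub>G\<^esub> (\<rho> g)" for g
    define b where "b g = aT (F g) (h g)" for g
    define t where "t r = (\<Sum>g\<in>{g \<in> carrier G. \<rho> g = r}. b g)" for r
    have FV: "F g \<in> V" if "g \<in> carrier G" for g using F that by (simp add: carK)
    have hH: "h g \<in> carrier H" "g = h g \<otimes>\<^bsub>G\<^esub> \<rho> g" if "g \<in> carrier G" for g
      using hx[OF that] by (simp_all add: h_def)
    have bV: "b g \<in> V" if "g \<in> carrier G" for g unfolding b_def by (intro aTV FV hH that)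
    have tV: "t r \<in> V" for r unfolding t_def by (intro fun_vs.subspace_sum[OF V] bV) simp
    let ?R = "\<rho> ` carrier G"
    have RG: "r \<in> carrier G" if "r \<in> ?R" for r using that \<rho>G by blast
    have \<Theta>F: "\<Theta> F = (\<Sum>r\<in>?R. aM (j (t r)) r)"
    proof -
      have "\<Theta> F = (\<Sum>g\<in>carrier G. aM (j (b g)) (\<rho> g))"
        unfolding \<Theta>_def
      proof (rule sum.cong[OF refl])
        fix g assume g: "g \<in> carrier G"
        have "aM (j (b g)) (\<rho> g) = aM (aM (j (F g)) (h g)) (\<rho> g)"
          unfolding b_def by (simp add: jH FV hH g)
        also have "\<dots> = aM (j (F g)) (h g \<otimes>\<^bsub>G\<^esub> \<rho> g)"
          using aMm[OF jW[OF FV[OF g]] _ \<rho>G[OF g], of "h g"] hH(1)[OF g] HG by auto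
        finally show "aM (j (F g)) g = aM (j (b g)) (\<rho> g)" using hH(2)[OF g] by simp
      qed
      also have "\<dots> = (\<Sum>r\<in>?R. \<Sum>g\<in>{g \<in> carrier G. \<rho> g = r}. aM (j (b g)) (\<rho> g))"
        by (rule sum.image_gen[OF G(2)])
      also have "\<dots> = (\<Sum>r\<in>?R. aM (j (t r)) r)"
      proof (rule sum.cong[OF refl])
        fix r assume "r \<in> ?R"
        have "aM (j (t r)) r = (\<Sum>g\<in>{g \<in> carrier G. \<rho> g = r}. aM (j (b g)) r)"
          unfolding t_def by (rule linsum[of "\<lambda>f. aM (j f) r"]) (simp add: j aM)
        thus "(\<Sum>g\<in>{g \<in> carrier G. \<rho> g = r}. aM (j (b g)) (\<rho> g)) = aM (j (t r)) r" by simp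
      qed
      finally show ?thesis .
    qed
    \<comment> \<open>Acting with the inverse of \<open>r0\<close> and applying \<open>p\<close>
      kills the contributions of all other cosets and returns \<open>t r0\<close>.\<close>
    have t0: "t r0 = 0" if r0: "r0 \<in> ?R" for r0
    proof -
      have r0G: "r0 \<in> carrier G" by (rule RG[OF r0])
      let ?L = "\<lambda>f. p (aM f (inv\<^bsub>G\<^esub> r0))"
      have L: "?L (f + f') = ?L f + ?L f'" for f f' by (simp add: aM p)
      have "0 = ?L (\<Theta> F)" by (simp add: F0 aM0 p00)
      also have "\<dots> = (\<Sum>r\<in>?R. ?L (aM (j (t r)) r))"
        unfolding \<Theta>F by (rule linsum[of ?L]) (simp add: aM p)
      also have "\<dots> = (\<Sum>r\<in>?R. if r = r0 then t r0 else 0)"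
      proof (rule sum.cong[OF refl])
        fix r assume r: "r \<in> ?R"
        have rG: "r \<in> carrier G" by (rule RG[OF r])
        have e: "?L (aM (j (t r)) r) = p (aM (j (t r)) (r \<otimes>\<^bsub>G\<^esub> inv\<^bsub>G\<^esub> r0))"
          using aMm[OF jW[OF tV] rG, of "inv\<^bsub>G\<^esub> r0"] r0G by simp
        show "?L (aM (j (t r)) r) = (if r = r0 then t r0 else 0)"
        proof (cases "r = r0")
          case True
          thus ?thesis unfolding e using r0G pj[OF tV] aM1[OF jW[OF tV]] by simp
        next
          case False
          have "r \<otimes>\<^bsub>G\<^esub> inv\<^bsub>G\<^esub> r0 \<notin> carrier H"
          proof
            assume k: "r \<otimes>\<^bsub>G\<^esub> inv\<^bsub>G\<^esub> r0 \<in> carrier H"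
            have "\<rho> ((r \<otimes>\<^bsub>G\<^esub> inv\<^bsub>G\<^esub> r0) \<otimes>\<^bsub>G\<^esub> r0) = \<rho> r0" by (rule \<rho>h[OF k r0G])
            hence "\<rho> r = \<rho> r0" using rG r0G by (simp add: G.m_assoc)
            moreover have "\<rho> (\<rho> x) = \<rho> x" if "x \<in> carrier G" for x
            proof -
              obtain k where "k \<in> carrier H" "\<rho> x = k \<otimes>\<^bsub>G\<^esub> x" using \<rho>[of x] by blast
              thus ?thesis using \<rho>h[OF _ that, of k] by simp
            qed
            ultimately show False using False r r0 by auto
          qed
          thus ?thesis unfolding e using p0[OF tV, of "r \<otimes>\<^bsub>G\<^esub> inv\<^bsub>G\<^esub> r0"] rG r0G False by simp
        qed
      qed
      also have "\<dots> = t r0" using r0 G(2) by simp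
      finally show ?thesis ..
    qed
    \<comment> \<open>Each \<open>D g\<close> is one of the defining relations. In the sum over
      \<open>g\<close>, the first terms collect into the vectors \<open>t r\<close>, all of which
      are zero, and the second terms into \<open>F\<close>; so \<open>F\<close> is minus that
      sum.\<close>
    define D where "D g = (\<lambda>x. pure (b g) (\<rho> g) x - pure (F g) g x)" for g
    have DN: "(\<lambda>x. - D g x) \<in> N" if g: "g \<in> carrier G" for g
    proof -
      have "pure_kG T (act T (F g) (h g)) (\<rho> g) \<ominus>\<^bsub>K\<^esub> pure_kG T (F g) (h g \<otimes>\<^bsub>G\<^esub> \<rho> g) \<in> ?rel"
        unfolding carT grpT using FV[OF g] hH(1)[OF g] \<rho>G[OF g] by blast
      hence "D g \<in> ?rel"
        unfolding relE[OF FV[OF g] hH(1)[OF g] \<rho>G[OF g]]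
        unfolding hH(2)[OF g, symmetric] D_def b_def .
      hence "D g \<in> N" by (rule subsetD[OF rel])
      hence N1: "(-1) \<odot>\<^bsub>K\<^esub> D g \<in> N"
        by (rule K.M.submoduleE(4)[OF N, rotated]) (simp only: scalars_carrier UNIV_I)
      have "(-1) \<odot>\<^bsub>K\<^esub> D g = (\<lambda>x. - D g x)"
        unfolding addK(3) by (intro ext) (simp add: fscale_def)
      from N1[unfolded this] show ?thesis .
    qed
    have "F = (\<lambda>x. \<Sum>g\<in>carrier G. - D g x)"
    proof (rule ext)
      fix x
      have "(\<Sum>g\<in>carrier G. - D g x) = (\<Sum>g\<in>carrier G. pure (F g) g x) - (\<Sum>g\<in>carrier G. pure (b g) (\<rho> g) x)"
        by (simp add: D_def sum_subtractf)
      also have "(\<Sum>g\<in>carrier G. pure (F g) g x) = F x"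
      proof -
        have "(\<Sum>g\<in>carrier G. pure (F g) g x) = (\<Sum>g\<in>carrier G. if g = x then F x else 0)"
          by (rule sum.cong) (auto simp: pure_def)
        thus ?thesis using F G(2) by (simp add: carK)
      qed
      also have "(\<Sum>g\<in>carrier G. pure (b g) (\<rho> g) x) = 0"
      proof -
        have "(\<Sum>g\<in>carrier G. pure (b g) (\<rho> g) x) = (\<Sum>g\<in>{g \<in> carrier G. \<rho> g = x}. b g)"
          using G(2) by (intro sum.mono_neutral_cong_right) (auto simp: pure_def)
        also have "\<dots> = 0"
        proof (cases "x \<in> ?R")
          case True
          thus ?thesis using t0 by (simp add: t_def)
        next
          case False
          hence "{g \<in> carrier G. \<rho> g = x} = {}" by blast
          thus ?thesis by (simp only: sum.empty)
        qed
        finally show ?thesis .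
      qed
      finally have e: "(\<Sum>g\<in>carrier G. - D g x) = F x - 0" .
      show "F x = (\<Sum>g\<in>carrier G. - D g x)" unfolding e by (rule diff_zero[symmetric])
    qed
    moreover have "(\<lambda>x. \<Sum>g\<in>carrier G. - D g x) \<in> N"
      by (rule Nsum[of "carrier G" "\<lambda>g x. - D g x"]) (rule DN)
    ultimately show "F \<in> N" by (simp only:)
  qed
  have "gmod_iso (quot K (ind_rels G T)) M"
  proof (rule quot_iso[OF K M rels])
    show "grp M = grp K" by (simp add: grpM grpK)
    show "\<Theta> ` carrier K = carrier M"
    proof
      show "\<Theta> ` carrier K \<subseteq> carrier M" using \<Theta>W by (auto simp: carM)
      have "fun_vs.subspace (\<Theta> ` carrier K)"
      proof (rule fun_vs.subspaceI)
        have "\<Theta> \<zero>\<^bsub>K\<^esub> = 0" by (simp add: addK \<Theta>_def j0 aM0)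
        thus "0 \<in> \<Theta> ` carrier K" using K.M.M.zero_closed by (metis imageI)
        fix f f' assume "f \<in> \<Theta> ` carrier K" "f' \<in> \<Theta> ` carrier K"
        then obtain F F' where F: "F \<in> carrier K" "F' \<in> carrier K" "f = \<Theta> F" "f' = \<Theta> F'" by blast
        have "f + f' = \<Theta> (F \<oplus>\<^bsub>K\<^esub> F')" by (simp add: F addK \<Theta>add)
        thus "f + f' \<in> \<Theta> ` carrier K" using K.M.M.a_closed[OF F(1,2)] by blast
      next
        fix c f assume "f \<in> \<Theta> ` carrier K"
        then obtain F where F: "F \<in> carrier K" "f = \<Theta> F" by blast
        have "fscale c f = \<Theta> (c \<odot>\<^bsub>K\<^esub> F)" by (simp add: F addK \<Theta>smult)
        thus "fscale c f \<in> \<Theta> ` carrier K" using K.M.smult_closed[of c F] F by (simp add: scalars_carrier)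
      qed
      moreover have "{aM (j t) g | t g. t \<in> V \<and> g \<in> carrier G} \<subseteq> \<Theta> ` carrier K"
      proof clarify
        fix t g assume tg: "t \<in> V" "g \<in> carrier G"
        have "aM (j t) g = \<Theta> (pure t g)" by (simp add: \<Theta>pure tg)
        thus "aM (j t) g \<in> \<Theta> ` carrier K" using pureK[OF tg] by blast
      qed
      ultimately show "carrier M \<subseteq> \<Theta> ` carrier K" unfolding carM using gen fun_vs.span_minimal by blast
    qed
    show "\<Theta> (v \<oplus>\<^bsub>K\<^esub> w) = \<Theta> v \<oplus>\<^bsub>M\<^esub> \<Theta> w" for v w by (simp add: addK \<Theta>add opM)
    show "\<Theta> (c \<odot>\<^bsub>K\<^esub> v) = c \<odot>\<^bsub>M\<^esub> \<Theta> v" for c v by (simp add: addK \<Theta>smult opM)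
    show "\<Theta> (act K v g) = act M (\<Theta> v) g" if "v \<in> carrier K" "g \<in> carrier (grp K)" for v g
      using \<Theta>act that by (simp add: grpK aM')
    show "\<Theta> v = \<zero>\<^bsub>M\<^esub> \<longleftrightarrow> v \<in> ind_rels G T" if "v \<in> carrier K" for v
      using sub1 sub2[OF that] by (auto simp: zM)
  qed
  thus ?thesis by (simp add: ind_def K_def)
qed

section \<open>The model is the Specht module\<close>

text \<open>In the model the outer tabloids are filled with actual positions, so \<sigma> acts on
  the entries of all of them at once, without splitting into Young components.\<close>

definition natural_act :: "('k::field) T_vec \<Rightarrow> wreath_elem \<Rightarrow> 'k T_vec" where
  "natural_act F = (\<lambda>(\<sigma>, \<alpha>) (Ts, Us). F
    (map (\<lambda>i. tabloid_perm (Ts ! \<sigma> i) (Hilbert_Choice.inv (\<alpha> (\<sigma> i)))) [0..<length Ts],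
     map (\<lambda>U. tabloid_perm U (Hilbert_Choice.inv \<sigma>)) Us))"

definition model :: "nat \<Rightarrow> nat \<Rightarrow> nat list list \<Rightarrow> nat list list \<Rightarrow> ('k::field, 'k T_vec, wreath_elem) gmod" where
  "model m n \<mu> \<eta> = fun_module (wreath m n (perms n)) (model_space n \<mu> \<eta>) natural_act"

lemma natural_act_add: "natural_act (f + f') g = natural_act f g + natural_act f' g"
  and natural_act_scale: "natural_act (fscale c f) g = fscale c (natural_act f g)"
  by (simp_all add: natural_act_def fscale_def fun_eq_iff split: prod.splits)

lemma wreathD:
  assumes "(\<sigma>, \<alpha>) \<in> carrier (wreath m n H)" "H \<subseteq> perms n"
  shows "\<sigma> permutes {..<n}" "i < n \<Longrightarrow> \<alpha> i permutes {..<m}" "permutation (\<alpha> i)"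
    "n \<le> i \<Longrightarrow> \<alpha> i = id" "permutation \<sigma>" "bij \<sigma>" "bij (\<alpha> i)"
proof -
  show s: "\<sigma> permutes {..<n}" using assms by (auto simp: wreath_def perms_def)
  show a: "i < n \<Longrightarrow> \<alpha> i permutes {..<m}" and b: "n \<le> i \<Longrightarrow> \<alpha> i = id"
    using assms by (auto simp: wreath_def perms_def)
  show p: "permutation (\<alpha> i)"
    using a b by (cases "i < n") (auto simp: permutation_permutes permutation_id)
  show q: "permutation \<sigma>" using s finite_lessThan unfolding permutation_permutes by blast
  show "bij \<sigma>" "bij (\<alpha> i)" using p q by (simp_all add: permutation_bijective)
qed

lemma tensors_map:
  assumes "length gs = k"
  shows "tensors (map (\<lambda>i. tabloid_act (gs ! i) (\<sigma> i)) [0..<k]) Us =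
    tensors gs (map (\<lambda>i. tabloid_perm (Us ! i) (Hilbert_Choice.inv (\<sigma> i))) [0..<length Us])"
  using assms by (simp add: tensors_def tabloid_act_def)

lemma natural_act_tensor:
  assumes p: "\<sigma> permutes {..<n}" and len: "length xs = n"
  shows "natural_act (tensor2 (tensors xs) (tensors gs)) (\<sigma>, \<alpha>) =
    tensor2 (tensors (map (\<lambda>i. tabloid_act (xs ! Hilbert_Choice.inv \<sigma> i) (\<alpha> i)) [0..<n]))
      (tensors (map (\<lambda>g. tabloid_act g \<sigma>) gs))"
proof (rule ext)
  fix z :: "tabloid list \<times> tabloid list"
  obtain Ts Us where z: "z = (Ts, Us)" by fastforce
  have lt: "\<sigma> i < n" "Hilbert_Choice.inv \<sigma> i < n" if "i < n" for i
    using permutes_in_image[OF p, of i] permutes_in_image[OF permutes_inv[OF p], of i] that by auto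
  have *: "(\<Prod>i<n. (xs ! i) (tabloid_perm (Ts ! \<sigma> i) (Hilbert_Choice.inv (\<alpha> (\<sigma> i))))) =
      (\<Prod>i<n. (xs ! Hilbert_Choice.inv \<sigma> i) (tabloid_perm (Ts ! i) (Hilbert_Choice.inv (\<alpha> i))))"
    by (rule prod.reindex_bij_witness[where i = "Hilbert_Choice.inv \<sigma>" and j = \<sigma>])
      (simp_all add: permutes_inverses[OF p] lt)
  have T: "tensors xs (map (\<lambda>i. tabloid_perm (Ts ! \<sigma> i) (Hilbert_Choice.inv (\<alpha> (\<sigma> i)))) [0..<length Ts]) =
      tensors (map (\<lambda>i. tabloid_act (xs ! Hilbert_Choice.inv \<sigma> i) (\<alpha> i)) [0..<n]) Ts"
    using len * by (cases "length Ts = n") (simp_all add: tensors_def tabloid_act_def)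
  have U: "tensors gs (map (\<lambda>U. tabloid_perm U (Hilbert_Choice.inv \<sigma>)) Us) =
      tensors (map (\<lambda>g. tabloid_act g \<sigma>) gs) Us"
    by (simp add: tensors_def tabloid_act_def)
  show "natural_act (tensor2 (tensors xs) (tensors gs)) (\<sigma>, \<alpha>) z = tensor2 (tensors (map (\<lambda>i.
      tabloid_act (xs ! Hilbert_Choice.inv \<sigma> i) (\<alpha> i)) [0..<n])) (tensors (map (\<lambda>g. tabloid_act g \<sigma>) gs)) z"
    by (simp add: z natural_act_def tensor2_def T U)
qed

text \<open>Unlike \<open>tabloid_act_polytabloid\<close>, this covers permutations that move the
  entries out of the set they came from, such as shifts onto a block.\<close>

lemma tabloid_act_relabel:
  assumes "permutation \<sigma>"
  shows "tabloid_act (polytabloid t) \<sigma> = polytabloid (relabel \<sigma> t)"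
proof (rule ext)
  fix U
  have bij: "bij \<sigma>" by (rule permutation_bijective[OF assms])
  have eq: "V = tabloid_perm U (Hilbert_Choice.inv \<sigma>) \<longleftrightarrow> tabloid_perm V \<sigma> = U" for V
  proof
    assume "V = tabloid_perm U (Hilbert_Choice.inv \<sigma>)"
    moreover have "\<sigma> \<circ> Hilbert_Choice.inv \<sigma> = id" using bij_is_surj[OF bij] by (simp only: surj_iff)
    ultimately show "tabloid_perm V \<sigma> = U" by (simp add: tabloid_perm_comp tabloid_perm_id)
  next
    assume "tabloid_perm V \<sigma> = U"
    moreover have "tabloid_perm (tabloid_perm V \<sigma>) (Hilbert_Choice.inv \<sigma>) = V"
      using bij_is_inj[OF bij] by (simp add: tabloid_perm_comp tabloid_perm_id)
    ultimately show "V = tabloid_perm U (Hilbert_Choice.inv \<sigma>)" by simp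
  qed
  have "tabloid_act (polytabloid t) \<sigma> U = pairing (indicat (tabloid_perm U (Hilbert_Choice.inv \<sigma>))) t"
    by (simp add: tabloid_act_def polytabloid_pairing)
  also have "\<dots> = (\<Sum>\<pi>\<in>column_stabilizer t.
      of_int (sign \<pi>) * indicat U (tabloid_perm (tabloid_of t) (\<sigma> \<circ> \<pi>)))"
    unfolding pairing_def by (simp add: indicat_def eq tabloid_perm_comp)
  also have "\<dots> = polytabloid (relabel \<sigma> t) U"
    by (simp only: polytabloid_pairing pairing_relabel[OF assms])
  finally show "tabloid_act (polytabloid t) \<sigma> U = polytabloid (relabel \<sigma> t) U" .
qed

lemma tabloid_act_add: "tabloid_act (f + f') \<sigma> = tabloid_act f \<sigma> + tabloid_act f' \<sigma>"
  and tabloid_act_scale: "tabloid_act (fscale c f) \<sigma> = fscale c (tabloid_act f \<sigma>)"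
  by (simp_all add: tabloid_act_def fscale_def fun_eq_iff)

lemma tabloid_act_comp:
  assumes "bij \<sigma>" "bij \<pi>"
  shows "tabloid_act (tabloid_act f \<sigma>) \<pi> = tabloid_act f (\<pi> \<circ> \<sigma>)"
  by (rule ext) (simp add: tabloid_act_def tabloid_perm_comp o_inv_distrib[OF assms(2,1)])

lemma tabloid_act_id: "tabloid_act f id = f"
  by (rule ext) (simp add: tabloid_act_def tabloid_perm_id)

lemma spechtA_act:
  assumes "f \<in> spechtA \<nu> A" "permutation \<sigma>"
  shows "tabloid_act f \<sigma> \<in> spechtA \<nu> (\<sigma> ` A)"
  unfolding spechtA_def
proof (rule span_closed[where a = "\<lambda>f. tabloid_act f \<sigma>", OF tabloid_act_add tabloid_act_scale])
  show "f \<in> fun_vs.span (polytabloid ` tabs \<nu> A)" using assms(1) by (simp add: spechtA_def)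
  fix s :: "tabloid \<Rightarrow> 'a" assume "s \<in> polytabloid ` tabs \<nu> A"
  then obtain t where t: "t \<in> tabs \<nu> A" "s = polytabloid t" by blast
  have "inj_on \<sigma> A"
    using permutation_bijective[OF assms(2)] bij_is_inj inj_on_subset by blast
  from tabs_relabel[OF t(1) this]
  show "tabloid_act s \<sigma> \<in> fun_vs.span (polytabloid ` tabs \<nu> (\<sigma> ` A))"
    unfolding t(2) tabloid_act_relabel[OF assms(2)] by (intro fun_vs.span_base imageI)
qed

text \<open>On polytabloids the action is relabelling, which sees only the values on
  \<open>A\<close>. This allows a Young component followed by a shift to be compared with the full
  permutation.\<close>

lemma spechtA_act_eq:
  assumes f: "f \<in> spechtA \<nu> A" and p: "permutation \<sigma>" "permutation \<pi>" and eq: "\<And>x. x \<in> A \<Longrightarrow> \<sigma> x = \<pi> x"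
  shows "tabloid_act f \<sigma> = (tabloid_act f \<pi> :: tabloid \<Rightarrow> 'k::field)"
proof -
  have "f \<in> fun_vs.span (polytabloid ` tabs \<nu> A)" using f by (simp add: spechtA_def)
  thus ?thesis
  proof (induction rule: fun_vs.span_induct_alt)
    case base
    show ?case by (rule ext) (simp add: tabloid_act_def)
  next
    case (step c y z)
    then obtain t where t: "t \<in> tabs \<nu> A" "y = polytabloid t" by blast
    have "relabel \<sigma> t = relabel \<pi> t"
      using tabsD(4)[OF t(1)] eq by auto
    thus ?case using step(2) unfolding tabloid_act_add tabloid_act_scale t(2)
      by (simp only: tabloid_act_relabel[OF p(1)] tabloid_act_relabel[OF p(2)])
  qed
qed

lemma word_permute:
  assumes w: "w \<in> words r n" and p: "\<sigma> permutes {..<n}"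
  defines "w' \<equiv> map (\<lambda>j. w ! Hilbert_Choice.inv \<sigma> j) [0..<n]"
  shows "w' \<in> words r n" "fibre w' i = \<sigma> ` fibre w i"
proof -
  have lt: "\<sigma> i < n \<longleftrightarrow> i < n" "Hilbert_Choice.inv \<sigma> i < n \<longleftrightarrow> i < n" for i
    using permutes_in_image[OF p, of i] permutes_in_image[OF permutes_inv[OF p], of i] by auto
  show "w' \<in> words r n" using words_nth[OF w] lt by (auto simp: words_def w'_def)
  have l: "length w = n" using w by (simp add: words_def)
  show "fibre w' i = \<sigma> ` fibre w i"
  proof (intro Set.equalityI subsetI)
    fix x assume "x \<in> fibre w' i"
    hence "x < n" "w ! Hilbert_Choice.inv \<sigma> x = i" by (auto simp: fibre_def w'_def)
    hence "Hilbert_Choice.inv \<sigma> x \<in> fibre w i" using lt l by (simp add: fibre_def)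
    moreover have "\<sigma> (Hilbert_Choice.inv \<sigma> x) = x" by (rule permutes_inverses(1)[OF p])
    ultimately show "x \<in> \<sigma> ` fibre w i" by (metis imageI)
  next
    fix x assume "x \<in> \<sigma> ` fibre w i"
    then obtain y where "y < n" "w ! y = i" "x = \<sigma> y" using l by (auto simp: fibre_def)
    thus "x \<in> fibre w' i" using lt permutes_inverses(2)[OF p] by (simp add: fibre_def w'_def)
  qed
qed

text \<open>\<sigma> turns a generator for \<open>w\<close> into one for the permuted word: position
  \<open>i\<close> receives the inner factor from the preimage of \<open>i\<close>, and the fibres
  are mapped forward by \<sigma>.\<close>

lemma model_space_closed:
  assumes \<mu>: "length \<mu> = length \<eta>" "set \<mu> \<subseteq> partitions m" and f: "f \<in> model_space n \<mu> \<eta>"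
    and g: "g \<in> carrier (wreath m n (perms n))"
  shows "natural_act f g \<in> (model_space n \<mu> \<eta> :: 'k::field T_vec set)"
  unfolding model_space_def
proof (rule span_closed[where a = "\<lambda>f. natural_act f g", OF natural_act_add natural_act_scale])
  show "f \<in> fun_vs.span (\<Union>w\<in>words (length \<eta>) n. word_gens \<mu> \<eta> w)" using f by (simp add: model_space_def)
  fix s :: "'k T_vec" assume "s \<in> (\<Union>w\<in>words (length \<eta>) n. word_gens \<mu> \<eta> w)"
  then obtain w fs gs where w: "w \<in> words (length \<eta>) n" and fs: "fs \<in> listset (inner_factors \<mu> w)"
    and gs: "gs \<in> listset (outer_factors \<eta> w)" and s: "s = tensor2 (tensors fs) (tensors gs)"
    by (auto simp: word_gens_def)
  obtain \<sigma> \<alpha> where ga: "g = (\<sigma>, \<alpha>)" by fastforce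
  note D = wreathD[OF g[unfolded ga] order_refl]
  define w' where "w' = map (\<lambda>j. w ! Hilbert_Choice.inv \<sigma> j) [0..<n]"
  note w' = word_permute[OF w D(1), folded w'_def]
  have l: "length w = n" using w by (simp add: words_def)
  have lf: "length fs = n" using fs l by (simp add: inner_factors_iff)
  let ?fs = "map (\<lambda>i. tabloid_act (fs ! Hilbert_Choice.inv \<sigma> i) (\<alpha> i)) [0..<n]"
  let ?gs = "map (\<lambda>g. tabloid_act g \<sigma>) gs"
  have "?fs \<in> listset (inner_factors \<mu> w')"
    unfolding inner_factors_iff
  proof (intro conjI allI impI)
    show "length ?fs = length w'" by (simp add: w'_def)
    fix i assume "i < length w'"
    hence i: "i < n" by (simp add: w'_def)
    have i': "Hilbert_Choice.inv \<sigma> i < n" using permutes_in_image[OF permutes_inv[OF D(1)], of i] i by simp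
    have "w ! Hilbert_Choice.inv \<sigma> i < length \<mu>" using words_nth[OF w i'] \<mu>(1) by simp
    hence "\<mu> ! (w ! Hilbert_Choice.inv \<sigma> i) \<in> partitions m" using \<mu>(2) nth_mem by blast
    hence "sum_list (\<mu> ! (w ! Hilbert_Choice.inv \<sigma> i)) = m" by (simp add: partitions_def)
    moreover have "fs ! Hilbert_Choice.inv \<sigma> i \<in> specht (\<mu> ! (w ! Hilbert_Choice.inv \<sigma> i))"
      using fs i' l by (simp add: inner_factors_iff)
    ultimately show "?fs ! i \<in> specht (\<mu> ! (w' ! i))"
      using specht_closed[of "fs ! Hilbert_Choice.inv \<sigma> i" "\<mu> ! (w ! Hilbert_Choice.inv \<sigma> i)" "\<alpha> i"] D(2)[OF i] i
      by (simp add: w'_def)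
  qed
  moreover have "?gs \<in> listset (outer_factors \<eta> w')"
    using gs unfolding outer_factors_iff by (simp add: w'(2) spechtA_act[OF _ D(5)])
  ultimately have "natural_act s g \<in> word_gens \<mu> \<eta> w'"
    unfolding s ga natural_act_tensor[OF D(1) lf] word_gens_def by blast
  thus "natural_act s g \<in> fun_vs.span (\<Union>w\<in>words (length \<eta>) n. word_gens \<mu> \<eta> w)"
    using w'(1) by (blast intro: fun_vs.span_base)
qed

lemma natural_act_mult:
  assumes f: "f \<in> model_space n \<mu> \<eta>" and g: "g \<in> carrier (wreath m n (perms n))"
    and h: "h \<in> carrier (wreath m n (perms n))"
  shows "natural_act f (g \<otimes>\<^bsub>wreath m n (perms n)\<^esub> h) = natural_act (natural_act f g) (h :: wreath_elem)"
proof (rule ext)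
  fix z :: "tabloid list \<times> tabloid list"
  obtain Ts Us where z: "z = (Ts, Us)" by fastforce
  obtain \<sigma> \<alpha> \<pi> \<beta> where gh: "g = (\<sigma>, \<alpha>)" "h = (\<pi>, \<beta>)" by (metis surj_pair)
  note \<sigma> = wreathD[OF g[unfolded gh] order_refl] and \<pi> = wreathD[OF h[unfolded gh] order_refl]
  have supp: "f (Ts', Us') = 0" if "length Ts' \<noteq> n" for Ts' Us'
    using slicedD(1)[OF f[unfolded model_space_sliced], of Ts' Us'] that by blast
  show "natural_act f (g \<otimes>\<^bsub>wreath m n (perms n)\<^esub> h) z = natural_act (natural_act f g) h z"
  proof (cases "length Ts = n")
    case True
    have l: "\<sigma> i < n" if "i < n" for i using that permutes_in_image[OF \<sigma>(1), of i] by simp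
    have \<pi>\<sigma>: "Hilbert_Choice.inv \<pi> (\<pi> x) = x" for x by (rule permutes_inverses(2)[OF \<pi>(1)])
    have T: "tabloid_perm (Ts ! \<pi> (\<sigma> i)) (Hilbert_Choice.inv (\<beta> (\<pi> (\<sigma> i)) \<circ> \<alpha> (\<sigma> i))) =
        tabloid_perm (tabloid_perm (Ts ! \<pi> (\<sigma> i)) (Hilbert_Choice.inv (\<beta> (\<pi> (\<sigma> i)))))
          (Hilbert_Choice.inv (\<alpha> (\<sigma> i)))" for i
      by (simp only: o_inv_distrib[OF \<pi>(7) \<sigma>(7)] tabloid_perm_comp)
    have Ts: "map (\<lambda>i. tabloid_perm (Ts ! (\<pi> \<circ> \<sigma>) i)
          (Hilbert_Choice.inv (\<beta> ((\<pi> \<circ> \<sigma>) i) \<circ> \<alpha> (Hilbert_Choice.inv \<pi> ((\<pi> \<circ> \<sigma>) i))))) [0..<n] =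
        map (\<lambda>i. tabloid_perm (map (\<lambda>i. tabloid_perm (Ts ! \<pi> i) (Hilbert_Choice.inv (\<beta> (\<pi> i)))) [0..<n] ! \<sigma> i)
          (Hilbert_Choice.inv (\<alpha> (\<sigma> i)))) [0..<n]"
      by (rule map_cong[OF refl]) (simp only: o_apply \<pi>\<sigma> T, simp add: l)
    have Us: "map (\<lambda>U. tabloid_perm U (Hilbert_Choice.inv (\<pi> \<circ> \<sigma>))) Us =
        map (\<lambda>U. tabloid_perm U (Hilbert_Choice.inv \<sigma>)) (map (\<lambda>U. tabloid_perm U (Hilbert_Choice.inv \<pi>)) Us)"
      unfolding map_map o_inv_distrib[OF \<pi>(6) \<sigma>(6)] by (simp add: tabloid_perm_comp)
    show ?thesis using True Ts Us
      by (simp only: z gh wreath_def monoid.simps case_prod_conv natural_act_def length_map length_upt diff_zero)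
  next
    case False
    thus ?thesis by (simp add: z gh wreath_def natural_act_def supp)
  qed
qed

lemma model_gmodule:
  assumes "length \<mu> = length \<eta>" "set \<mu> \<subseteq> partitions m"
  shows "gmodule (model m n \<mu> \<eta> :: ('k::field, 'k T_vec, wreath_elem) gmod)"
  unfolding model_def
proof (rule fun_module_gmodule[OF wreath_group_perms subspace_model_space])
  show "natural_act f \<one>\<^bsub>wreath m n (perms n)\<^esub> = f" for f :: "'k T_vec"
  proof (rule ext)
    fix z :: "tabloid list \<times> tabloid list"
    obtain Ts Us where z: "z = (Ts, Us)" by fastforce
    show "natural_act f \<one>\<^bsub>wreath m n (perms n)\<^esub> z = f z"
      by (simp add: z wreath_def natural_act_def tabloid_perm_id map_nth)
  qed
qed (use assms in \<open>simp_all add: model_space_closed natural_act_mult natural_act_add natural_act_scale\<close>)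

section \<open>Cosets of the Young subgroup as words\<close>

definition block_word :: "nat list \<Rightarrow> nat list" where
  "block_word \<gamma> = map (\<lambda>x. SOME i. i < length \<gamma> \<and> x \<in> block \<gamma> i) [0..<sum_list \<gamma>]"

lemma block_disjoint:
  assumes "x \<in> block \<gamma> i" "x \<in> block \<gamma> j" "i < length \<gamma>" "j < length \<gamma>"
  shows "i = j"
proof -
  have False if "i < j" "i < length \<gamma>" "x \<in> block \<gamma> i" "x \<in> block \<gamma> j" for i j
    using offset_Suc[OF that(2)] offset_mono[of "Suc i" j \<gamma>] that by (simp add: block_def)
  thus ?thesis using assms by (meson nat_neq_iff)
qed

lemma block_word:
  "block_word \<gamma> \<in> words (length \<gamma>) (sum_list \<gamma>)"
  "i < length \<gamma> \<Longrightarrow> fibre (block_word \<gamma>) i = block \<gamma> i"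
  "length (block_word \<gamma>) = sum_list \<gamma>"
proof -
  have nth: "block_word \<gamma> ! x < length \<gamma> \<and> x \<in> block \<gamma> (block_word \<gamma> ! x)" if "x < sum_list \<gamma>" for x
    using someI_ex[of "\<lambda>i. i < length \<gamma> \<and> x \<in> block \<gamma> i"] block_exists[OF that] that
    by (simp add: block_word_def)
  show l: "length (block_word \<gamma>) = sum_list \<gamma>" by (simp add: block_word_def)
  have "set (block_word \<gamma>) \<subseteq> {..<length \<gamma>}"
  proof
    fix i assume "i \<in> set (block_word \<gamma>)"
    then obtain x where "x < sum_list \<gamma>" "i = block_word \<gamma> ! x" using l by (metis in_set_conv_nth)
    thus "i \<in> {..<length \<gamma>}" using nth by simp
  qed
  thus "block_word \<gamma> \<in> words (length \<gamma>) (sum_list \<gamma>)" using l by (simp add: words_def)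
  show "fibre (block_word \<gamma>) i = block \<gamma> i" if i: "i < length \<gamma>"
  proof (intro Set.equalityI subsetI)
    fix x assume "x \<in> fibre (block_word \<gamma>) i"
    thus "x \<in> block \<gamma> i" using nth[of x] l by (auto simp: fibre_def)
  next
    fix x assume x: "x \<in> block \<gamma> i"
    have lt: "x < sum_list \<gamma>" by (rule block_le[OF i x])
    have "block_word \<gamma> ! x = i" using nth[OF lt] block_disjoint[OF _ x _ i] by blast
    thus "x \<in> fibre (block_word \<gamma>) i" using lt l by (simp add: fibre_def)
  qed
qed

text \<open>A permutation of finite support which agrees with the shift by \<open>b\<close> on \<open>{0, \<dots>, k - 1}\<close>.\<close>

definition shift_perm :: "nat \<Rightarrow> nat \<Rightarrow> perm" where
  "shift_perm b k x = (if x < k then x + b else if x < k + b then x - k else x)"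

lemma shift_perm: "permutation (shift_perm b k)" "bij (shift_perm b k)"
  "shift_perm b k ` {..<k} = {b..<b + k}"
proof -
  have "bij_betw (shift_perm b k) {..<k + b} {..<k + b}"
    by (rule bij_betw_byWitness[where f' = "\<lambda>x. if x < b then x + k else x - b"])
      (auto simp: shift_perm_def)
  hence "shift_perm b k permutes {..<k + b}"
    by (rule bij_imp_permutes) (simp add: shift_perm_def)
  thus "permutation (shift_perm b k)" "bij (shift_perm b k)"
    unfolding permutation_permutes by (auto simp: permutes_bij)
  have "x \<in> shift_perm b k ` {..<k}" if "b \<le> x" "x < b + k" for x
    using that by (intro image_eqI[where x = "x - b"]) (auto simp: shift_perm_def)
  thus "shift_perm b k ` {..<k} = {b..<b + k}" by (auto simp: shift_perm_def)
qed

lemma tensor2_span: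
  fixes A :: "('x \<Rightarrow> 'k::field) set" and B :: "('y \<Rightarrow> 'k) set"
  shows "tensor2_space (fun_vs.span A) (fun_vs.span B) = fun_vs.span {tensor2 f g | f g. f \<in> A \<and> g \<in> B}"
    (is "_ = fun_vs.span ?S")
proof
  have add: "tensor2 (f + f') g = tensor2 f g + tensor2 f' g" "tensor2 f (g + g') = tensor2 f g + tensor2 f g'"
    and scale: "tensor2 (fscale c f) g = fscale c (tensor2 f g)" "tensor2 f (fscale c g) = fscale c (tensor2 f g)"
    for f f' :: "'x \<Rightarrow> 'k" and g g' :: "'y \<Rightarrow> 'k" and c
    by (auto simp: tensor2_def fscale_def fun_eq_iff algebra_simps)
  have 1: "tensor2 f g \<in> fun_vs.span ?S" if "f \<in> A" "g \<in> fun_vs.span B" for f g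
    by (rule span_closed[where a = "tensor2 f", OF add(2) scale(2) _ that(2)])
      (use that(1) in \<open>blast intro: fun_vs.span_base\<close>)
  have "tensor2 f g \<in> fun_vs.span ?S" if "f \<in> fun_vs.span A" "g \<in> fun_vs.span B" for f g
    by (rule span_closed[where a = "\<lambda>f. tensor2 f g", OF add(1) scale(1) _ that(1)]) (rule 1[OF _ that(2)])
  thus "tensor2_space (fun_vs.span A) (fun_vs.span B) \<subseteq> fun_vs.span ?S"
    unfolding tensor2_space_def by (intro fun_vs.span_minimal fun_vs.subspace_span) blast
  show "fun_vs.span ?S \<subseteq> tensor2_space (fun_vs.span A) (fun_vs.span B)"
    unfolding tensor2_space_def by (rule fun_vs.span_mono) (blast intro: fun_vs.span_base)
qed

text \<open>A word whose fibres have the sizes of the blocks has the same multiset of values as the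
  block word, hence is a rearrangement of it.\<close>

lemma word_content:
  assumes w: "w \<in> words (length \<gamma>) (sum_list \<gamma>)" and c: "\<And>i. i < length \<gamma> \<Longrightarrow> card (fibre w i) = \<gamma> ! i"
  obtains \<sigma> where "\<sigma> permutes {..<sum_list \<gamma>}" "\<And>x. x < sum_list \<gamma> \<Longrightarrow> w ! (\<sigma> x) = block_word \<gamma> ! x"
proof -
  have count: "count (mset v) i = card (fibre v i)" for v i
    by (simp add: count_mset count_list_eq_length_filter fibre_def length_filter_conv_card eq_commute)
  have big: "fibre v i = {}" if "v \<in> words (length \<gamma>) (sum_list \<gamma>)" "\<not> i < length \<gamma>" for v i
  proof -
    have "v ! j \<noteq> i" if "j < length v" for j
      using words_nth[OF \<open>v \<in> _\<close>, of j] \<open>v \<in> _\<close> \<open>\<not> i < length \<gamma>\<close> that by (auto simp: words_def)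
    thus ?thesis by (auto simp: fibre_def)
  qed
  have "mset (block_word \<gamma>) = mset w"
  proof (rule multiset_eqI)
    fix i
    show "count (mset (block_word \<gamma>)) i = count (mset w) i"
    proof (cases "i < length \<gamma>")
      case True
      thus ?thesis unfolding count block_word(2)[OF True] by (simp add: c block_def)
    next
      case False
      have "fibre w i = {}" "fibre (block_word \<gamma>) i = {}"
        using big[OF w False] big[OF block_word(1) False] by blast+
      thus ?thesis by (simp only: count)
    qed
  qed
  then obtain \<sigma> where \<sigma>: "\<sigma> permutes {..<length w}" "permute_list \<sigma> w = block_word \<gamma>"
    by (rule mset_eq_permutation)
  have l: "length w = sum_list \<gamma>" using w by (simp add: words_def)
  have "w ! (\<sigma> x) = block_word \<gamma> ! x" if "x < sum_list \<gamma>" for x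
    using permute_list_nth[OF \<sigma>(1), of x] that l \<sigma>(2) by simp
  thus thesis using that \<sigma>(1) l by simp
qed

text \<open>A tableau of shape \<nu> has \<open>sum_list \<nu>\<close> distinct entries, so there is
  none on \<open>A\<close>.\<close>

lemma spechtA_card:
  assumes "f \<in> spechtA \<nu> A" "finite A" "card A \<noteq> sum_list \<nu>"
  shows "f = (0 :: tabloid \<Rightarrow> 'k::field)"
proof -
  have "tabs \<nu> A = {}"
  proof (rule ccontr)
    assume "tabs \<nu> A \<noteq> {}"
    then obtain t where t: "map length t = \<nu>" "distinct (concat t)" "set (concat t) = A"
      unfolding tabs_def by blast
    have "card A = length (concat t)" using distinct_card[OF t(2)] t(3) by simp
    thus False using assms(3) t(1) by (simp add: length_concat)
  qed
  thus ?thesis using assms(1) by (simp add: spechtA_def)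
qed

text \<open>\<open>ind_iso\<close> is applied with the block word as base point: \<open>j\<close>
  carries the tableaux of each component onto its block of positions, and \<open>p\<close> carries
  them back after discarding the values at all tuples not on the blocks.\<close>

lemma wreath_specht_iso:
  assumes \<mu>: "length \<mu> = length \<eta>" "set \<mu> \<subseteq> partitions m" and n: "sum_list (shape \<eta>) = n"
  shows "gmod_iso (wreath_specht m \<mu> \<eta>) (model m n \<mu> \<eta> :: ('k::field, 'k T_vec, wreath_elem) gmod)"
proof -
  define \<gamma> where "\<gamma> = shape \<eta>"
  define r where "r = length \<eta>"
  define w0 where "w0 = block_word \<gamma>"
  define \<iota> where "\<iota> i = shift_perm (offset \<gamma> i) (\<gamma> ! i)" for i
  have len\<gamma>: "length \<gamma> = r" "length \<mu> = length \<gamma>" and sum\<gamma>: "sum_list \<gamma> = n"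
    using \<mu> n by (simp_all add: \<gamma>_def r_def shape_def)
  have \<gamma>i: "\<gamma> ! i = sum_list (\<eta> ! i)" if "i < r" for i using that by (simp add: \<gamma>_def shape_def r_def)
  note w0 = block_word(1)[of \<gamma>, folded w0_def, unfolded len\<gamma>(1) sum\<gamma>]
    block_word(2)[of _ \<gamma>, folded w0_def, unfolded len\<gamma>(1)] block_word(3)[of \<gamma>, folded w0_def, unfolded sum\<gamma>]
  have \<iota>: "permutation (\<iota> i)" "bij (\<iota> i)" "\<iota> i ` {..<\<gamma> ! i} = block \<gamma> i" for i
    by (simp_all add: \<iota>_def shift_perm block_def)
  have \<iota>i: "Hilbert_Choice.inv (\<iota> i) \<circ> \<iota> i = id" "\<iota> i \<circ> Hilbert_Choice.inv (\<iota> i) = id" for i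
    using bij_is_inj[OF \<iota>(2)] bij_is_surj[OF \<iota>(2)] by (simp_all add: fun_eq_iff surj_f_inv_f)
  have \<iota>x: "Hilbert_Choice.inv (\<iota> i) (\<iota> i x) = x" "\<iota> i (Hilbert_Choice.inv (\<iota> i) x) = x" for i x
    using bij_is_inj[OF \<iota>(2)] bij_is_surj[OF \<iota>(2)] by (simp_all add: surj_f_inv_f)
  let ?G = "wreath m n (perms n)" and ?H = "wreath m n (young \<gamma>)"
  let ?Fs = "concat (map2 (\<lambda>g \<nu>. replicate g (specht \<nu>)) \<gamma> \<mu>) :: (tabloid \<Rightarrow> 'k) set list"
  let ?V = "tensor2_space (tensor_space ?Fs) (outer_specht \<eta>) :: 'k T_vec set"
  let ?gens = "{tensor2 (tensors fs) (tensors ys) | fs ys.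
    fs \<in> listset (inner_factors \<mu> w0) \<and> ys \<in> listset (map specht \<eta>)} :: 'k T_vec set"
  have HG: "young \<gamma> \<subseteq> perms n" by (auto simp: young_def perms_def sum\<gamma>)
  have Fs: "?Fs = inner_factors \<mu> w0"
  proof (rule nth_equalityI)
    show l: "length ?Fs = length (inner_factors \<mu> w0)"
      using factors_length[OF len\<gamma>(2)] sum\<gamma> w0(3) by (simp add: inner_factors_def)
    fix x assume "x < length ?Fs"
    hence x: "x < n" using l w0(3) by (simp add: inner_factors_def)
    have i: "w0 ! x < r" "x \<in> block \<gamma> (w0 ! x)"
      using words_nth[OF w0(1) x] w0(2)[of "w0 ! x"] x w0(3) by (auto simp: fibre_def)
    thus "?Fs ! x = inner_factors \<mu> w0 ! x"
      using factors_nth[OF len\<gamma>(2) _ i(2)] len\<gamma>(1) x w0(3) by (simp add: inner_factors_def)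
  qed
  have Vgens: "?V = fun_vs.span ?gens"
  proof -
    have "?V = fun_vs.span {tensor2 f g | f g. f \<in> tensors ` listset (inner_factors \<mu> w0) \<and>
        g \<in> tensors ` listset (map specht \<eta>)}"
      unfolding Fs outer_specht_def tensor_space_def by (rule tensor2_span)
    also have "{tensor2 f g | f g. f \<in> tensors ` listset (inner_factors \<mu> w0) \<and>
        g \<in> tensors ` listset (map specht \<eta>)} = ?gens" by blast
    finally show ?thesis .
  qed
  have ysD: "length ys = r" "i < r \<Longrightarrow> ys ! i \<in> spechtA (\<eta> ! i) {..<\<gamma> ! i}"
    if "ys \<in> listset (map specht \<eta>)" for ys :: "(tabloid \<Rightarrow> 'k) list" and i
    using that by (simp_all add: listset_iff r_def specht_spechtA \<gamma>_def shape_def)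
  have fsD: "length fs = n" if "fs \<in> listset (inner_factors \<mu> w0)" for fs :: "(tabloid \<Rightarrow> 'k) list"
    using that w0(3) by (simp add: inner_factors_iff)
  define j :: "'k T_vec \<Rightarrow> 'k T_vec" where
    "j F = (\<lambda>(Ts, Us). F (Ts, map (\<lambda>i. tabloid_perm (Us ! i) (Hilbert_Choice.inv (\<iota> i))) [0..<length Us]))" for F
  \<comment> \<open>Tuples whose entries are initial segments correspond under the shifts to tuples
    on the blocks, that is, to the block word; cutting down to them makes \<open>p\<close> vanish on
    the other cosets.\<close>
  define std where "std Us \<longleftrightarrow> (\<forall>i<length Us. \<Union> (set (Us ! i)) = {..<\<gamma> ! i})" for Us :: "tabloid list"
  define p :: "'k T_vec \<Rightarrow> 'k T_vec" where
    "p F = (\<lambda>(Ts, Us). if std Us then F (Ts, map (\<lambda>i. tabloid_perm (Us ! i) (\<iota> i)) [0..<length Us]) else 0)" for F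
  have j: "j (f + f') = j f + j f'" "j (fscale c f) = fscale c (j f)" for f f' c
    by (simp_all add: j_def fscale_def fun_eq_iff)
  have p: "p (f + f') = p f + p f'" "p (fscale c f) = fscale c (p f)" for f f' c
    by (simp_all add: p_def fscale_def fun_eq_iff)
  have j_gen: "j (tensor2 f (tensors ys)) = tensor2 f (tensors (map (\<lambda>i. tabloid_act (ys ! i) (\<iota> i)) [0..<r]))"
    if "length ys = r" for f and ys :: "(tabloid \<Rightarrow> 'k) list"
    by (rule ext) (auto simp: j_def tensor2_def tensors_map[OF that])
  have supp: "length Us = r \<and> (\<forall>i<r. \<Union> (set (Us ! i)) = {..<\<gamma> ! i})" if t: "t \<in> ?V" and nz: "t (Ts, Us) \<noteq> 0" for t Ts Us
  proof -
    have "t (Ts, Us) = 0" if no: "\<not> (length Us = r \<and> (\<forall>i<r. \<Union> (set (Us ! i)) = {..<\<gamma> ! i}))"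
      using t unfolding Vgens
    proof (induction rule: fun_vs.span_induct_alt)
      case (step c y z)
      then obtain fs ys where ys: "ys \<in> listset (map specht \<eta>)" "y = tensor2 (tensors fs) (tensors ys)" by blast
      have "tensors ys Us = 0"
      proof (rule ccontr)
        assume a: "tensors ys Us \<noteq> 0"
        have "\<Union> (set (Us ! i)) = {..<\<gamma> ! i}" if i: "i < r" for i
          by (rule tabloid_lettersD(2)[OF spechtA_support[OF ysD(2)[OF ys(1) i]]])
            (use tensors_nonzero(2)[OF a] ysD(1)[OF ys(1)] i in simp)
        thus False using no tensors_nonzero(1)[OF a] ysD(1)[OF ys(1)] by simp
      qed
      thus ?case using step(2) by (simp add: ys(2) tensor2_def fscale_def)
    qed simp
    thus ?thesis using nz by blast
  qed
  \<comment> \<open>Two linear maps that agree on the generating tensors agree on \<open>?V\<close>;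
    this is for the compatibility of \<open>j\<close> with the action.\<close>
  have closure: "L t = L' t" if t: "t \<in> ?V" and lin: "\<And>f f'. L (f + f') = L f + L f'" "\<And>c f. L (fscale c f) = fscale c (L f)"
      "\<And>f f'. L' (f + f') = L' f + L' f'" "\<And>c f. L' (fscale c f) = fscale c (L' f)"
    and gens: "\<And>fs ys. \<lbrakk>fs \<in> listset (inner_factors \<mu> w0); ys \<in> listset (map specht \<eta>)\<rbrakk> \<Longrightarrow>
      L (tensor2 (tensors fs) (tensors ys)) = L' (tensor2 (tensors fs) (tensors ys))"
    for t and L L' :: "'k T_vec \<Rightarrow> 'k T_vec"
    using t unfolding Vgens
  proof (induction rule: fun_vs.span_induct_alt)
    case base
    have "L 0 = 0" "L' 0 = 0" using lin(2)[of 0 0] lin(4)[of 0 0] by (simp_all only: fun_vs.scale_zero_left)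
    thus ?case by (simp only:)
  next
    case (step c y z)
    then obtain fs ys where "fs \<in> listset (inner_factors \<mu> w0)" "ys \<in> listset (map specht \<eta>)"
      "y = tensor2 (tensors fs) (tensors ys)" by blast
    hence "L y = L' y" using gens by (simp only:)
    thus ?case using step(2) by (simp only: lin)
  qed
  have "gmod_iso (ind ?G (fun_module ?H ?V (wreath_act \<gamma>))) (fun_module ?G (model_space n \<mu> \<eta>) natural_act)"
  proof (rule ind_iso)
    show G: "group ?G" by (rule wreath_group_perms)
    show "finite (carrier ?G)"
    proof -
      let ?f = "\<lambda>(\<sigma> :: perm, \<alpha> :: nat \<Rightarrow> perm). (\<sigma>, map \<alpha> [0..<n])"
      have "inj_on ?f (carrier ?G)"
      proof (rule inj_onI)
        fix x y assume xy: "x \<in> carrier ?G" "y \<in> carrier ?G" "?f x = ?f y"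
        obtain \<sigma> \<alpha> \<sigma>' \<alpha>' where e: "x = (\<sigma>, \<alpha>)" "y = (\<sigma>', \<alpha>')" by (metis surj_pair)
        have a: "(\<sigma>, \<alpha>) \<in> carrier ?G" "(\<sigma>', \<alpha>') \<in> carrier ?G" "map \<alpha> [0..<n] = map \<alpha>' [0..<n]" "\<sigma> = \<sigma>'"
          using xy by (simp_all add: e)
        have "\<alpha> i = \<alpha>' i" for i
          using wreathD(4)[OF a(1) order_refl, of i] wreathD(4)[OF a(2) order_refl, of i] a(3)
          by (cases "i < n") auto
        thus "x = y" using a(4) by (simp add: e fun_eq_iff)
      qed
      moreover have "?f ` carrier ?G \<subseteq> perms n \<times> {xs. set xs \<subseteq> perms m \<and> length xs = n}"
        by (auto simp: wreath_def)
      moreover have "finite (perms k)" for k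
        unfolding perms_def by (rule finite_permutations) simp
      hence "finite (perms n \<times> {xs. set xs \<subseteq> perms m \<and> length xs = n})"
        by (intro finite_cartesian_product finite_lists_length_eq)
      ultimately show ?thesis using finite_imageD finite_subset by blast
    qed
    have gH: "group ?H" using wreath_group_young[of m \<gamma>] by (simp add: sum\<gamma>)
    have car: "carrier ?H \<subseteq> carrier ?G" using HG by (auto simp: wreath_def)
    have mult: "monoid.mult ?H = monoid.mult ?G" by (simp add: wreath_def)
    show "monoid.mult ?H = monoid.mult ?G" by (rule mult)
    show "subgroup (carrier ?H) ?G"
    proof (rule group.group_incl_imp_subgroup[OF G car])
      have "?G\<lparr>carrier := carrier ?H\<rparr> = ?H" by (simp add: wreath_def)
      thus "group (?G\<lparr>carrier := carrier ?H\<rparr>)" using gH by simp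
    qed
    show "gmodule (fun_module ?H ?V (wreath_act \<gamma>))"
      using T_module_gmodule[OF \<mu>, where 'k = 'k] unfolding T_module_def \<gamma>_def[symmetric] sum\<gamma> .
    show "gmodule (fun_module ?G (model_space n \<mu> \<eta>) natural_act :: ('k, 'k T_vec, wreath_elem) gmod)"
      using model_gmodule[OF \<mu>, of n, where 'k = 'k] unfolding model_def .
    show "j t \<in> model_space n \<mu> \<eta>" if "t \<in> ?V" for t
      unfolding model_space_def
    proof (rule span_closed[where a = j, OF j _ that[unfolded Vgens]])
      fix s assume "s \<in> ?gens"
      then obtain fs ys where s: "fs \<in> listset (inner_factors \<mu> w0)" "ys \<in> listset (map specht \<eta>)"
        "s = tensor2 (tensors fs) (tensors ys)" by blast
      have "map (\<lambda>i. tabloid_act (ys ! i) (\<iota> i)) [0..<r] \<in> listset (outer_factors \<eta> w0)"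
      proof -
        have "tabloid_act (ys ! i) (\<iota> i) \<in> spechtA (\<eta> ! i) (fibre w0 i)" if "i < r" for i
          using spechtA_act[OF ysD(2)[OF s(2) that] \<iota>(1)[of i]] unfolding \<iota>(3) w0(2)[OF that] .
        thus ?thesis unfolding outer_factors_iff by (simp add: r_def)
      qed
      thus "j s \<in> fun_vs.span (\<Union>w\<in>words (length \<eta>) n. word_gens \<mu> \<eta> w)"
        unfolding s(3) j_gen[OF ysD(1)[OF s(2)]] using s(1) w0(1)
        by (intro fun_vs.span_base) (auto simp: word_gens_def r_def)
    qed
    show "p (j t) = t" if t: "t \<in> ?V" for t
    proof (rule ext)
      fix z :: "tabloid list \<times> tabloid list"
      obtain Ts Us where z: "z = (Ts, Us)" by fastforce
      show "p (j t) z = t z"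
      proof (cases "std Us")
        case True
        have "map (\<lambda>i. tabloid_perm (tabloid_perm (Us ! i) (\<iota> i)) (Hilbert_Choice.inv (\<iota> i))) [0..<length Us] = Us"
          by (simp add: tabloid_perm_comp \<iota>i tabloid_perm_id map_nth)
        moreover have "map (\<lambda>i. tabloid_perm (map (\<lambda>i. tabloid_perm (Us ! i) (\<iota> i)) [0..<length Us] ! i)
            (Hilbert_Choice.inv (\<iota> i))) [0..<length Us] =
          map (\<lambda>i. tabloid_perm (tabloid_perm (Us ! i) (\<iota> i)) (Hilbert_Choice.inv (\<iota> i))) [0..<length Us]"
          by (rule map_cong) auto
        ultimately show ?thesis using True by (simp add: z p_def j_def)
      next
        case False
        hence "t (Ts, Us) = 0" using supp[OF t, of Ts Us] unfolding std_def by blast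
        thus ?thesis using False by (simp add: z p_def)
      qed
    qed
    \<comment> \<open>A nonzero value exhibits a tuple on the blocks whose image under the inverse
      of \<sigma> is on the blocks again; then \<sigma> preserves every block and \<open>g\<close>
      lies in the smaller group.\<close>
    show "p (natural_act (j t) g) = 0" if t: "t \<in> ?V" and g: "g \<in> carrier ?G" "g \<notin> carrier ?H" for t g
    proof (rule ext)
      fix z :: "tabloid list \<times> tabloid list"
      obtain Ts Us where z: "z = (Ts, Us)" by fastforce
      obtain \<sigma> \<alpha> where ga: "g = (\<sigma>, \<alpha>)" by fastforce
      note D = wreathD[OF g(1)[unfolded ga] order_refl]
      show "p (natural_act (j t) g) z = 0 z"
      proof (rule ccontr)
        assume nz: "p (natural_act (j t) g) z \<noteq> 0 z"
        let ?U1 = "map (\<lambda>i. tabloid_perm (Us ! i) (\<iota> i)) [0..<length Us]"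
        let ?U2 = "map (\<lambda>U. tabloid_perm U (Hilbert_Choice.inv \<sigma>)) ?U1"
        let ?U3 = "map (\<lambda>i. tabloid_perm (?U2 ! i) (Hilbert_Choice.inv (\<iota> i))) [0..<length ?U2]"
        have "std Us" using nz by (auto simp: z p_def split: if_splits)
        hence "natural_act (j t) g (Ts, ?U1) \<noteq> 0" using nz by (simp add: z p_def)
        have c: "\<forall>i<length Us. \<Union> (set (Us ! i)) = {..<\<gamma> ! i}" using \<open>std Us\<close> by (simp add: std_def)
        from \<open>natural_act (j t) g (Ts, ?U1) \<noteq> 0\<close>
        obtain Ts' where "t (Ts', ?U3) \<noteq> 0" by (auto simp: natural_act_def j_def ga)
        have s0: "length ?U3 = r \<and> (\<forall>i<r. \<Union> (set (?U3 ! i)) = {..<\<gamma> ! i})"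
          by (rule supp[OF t]) fact
        have s: "length Us = r" using conjunct1[OF s0] by simp
        have s2: "\<Union> (set (?U3 ! i)) = {..<\<gamma> ! i}" if "i < r" for i using s0 that by blast
        have im: "\<Union> (set (tabloid_perm U \<tau>)) = \<tau> ` \<Union> (set U)" for U \<tau>
          by (auto simp: tabloid_perm_def)
        have "\<sigma> ` block \<gamma> i = block \<gamma> i" if i: "i < length \<gamma>" for i
        proof -
          have ir: "i < r" using i len\<gamma> by simp
          have "Hilbert_Choice.inv (\<iota> i) ` Hilbert_Choice.inv \<sigma> ` \<iota> i ` {..<\<gamma> ! i} = {..<\<gamma> ! i}"
            using s2[OF ir] ir s c by (simp add: im)
          hence "\<iota> i ` Hilbert_Choice.inv (\<iota> i) ` Hilbert_Choice.inv \<sigma> ` block \<gamma> i = block \<gamma> i"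
            using \<iota>(3)[of i] by simp
          hence "Hilbert_Choice.inv \<sigma> ` block \<gamma> i = block \<gamma> i" by (simp add: image_image \<iota>x)
          hence "\<sigma> ` Hilbert_Choice.inv \<sigma> ` block \<gamma> i = \<sigma> ` block \<gamma> i" by simp
          thus ?thesis by (simp add: image_image permutes_inverses[OF D(1)])
        qed
        hence "\<sigma> \<in> young \<gamma>" using D(1) by (simp add: young_def sum\<gamma>)
        thus False using g by (auto simp: ga wreath_def)
      qed
    qed
    show "j (wreath_act \<gamma> t h) = natural_act (j t) h" if t: "t \<in> ?V" and h: "h \<in> carrier ?H" for t h
    proof -
      obtain \<sigma> \<alpha> where ha: "h = (\<sigma>, \<alpha>)" by fastforce
      note D = wreathD[OF h[unfolded ha] HG]
      have \<sigma>: "\<sigma> \<in> young \<gamma>" using h by (simp add: ha wreath_def)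
      show ?thesis
      proof (rule closure[OF t, where L = "\<lambda>t. j (wreath_act \<gamma> t h)" and L' = "\<lambda>t. natural_act (j t) h"])
        fix fs ys :: "(tabloid \<Rightarrow> 'k) list"
        assume fs: "fs \<in> listset (inner_factors \<mu> w0)" and ys: "ys \<in> listset (map specht \<eta>)"
        let ?f = "tensors (map (\<lambda>i. tabloid_act (fs ! Hilbert_Choice.inv \<sigma> i) (\<alpha> i)) [0..<n])"
        have l: "length ys = r" "length fs = n" by (rule ysD(1)[OF ys], rule fsD[OF fs])
        have hc: "(\<sigma>, \<alpha>) \<in> carrier (wreath m (sum_list \<gamma>) (young \<gamma>))" using h by (simp add: ha sum\<gamma>)
        have "wreath_act \<gamma> (tensor2 (tensors fs) (tensors ys)) h =
          tensor2 ?f (tensors (map (\<lambda>i. tabloid_act (ys ! i) (young_component \<gamma> \<sigma> i)) [0..<r]))"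
          unfolding ha using wreath_act_tensor[OF hc, of fs "tensors ys"] l sum\<gamma>
          by (simp add: outer_act_tensors)
        hence "j (wreath_act \<gamma> (tensor2 (tensors fs) (tensors ys)) h) = tensor2 ?f (tensors
            (map (\<lambda>i. tabloid_act (map (\<lambda>i. tabloid_act (ys ! i) (young_component \<gamma> \<sigma> i)) [0..<r] ! i) (\<iota> i)) [0..<r]))"
          by (simp add: j_gen)
        also have "map (\<lambda>i. tabloid_act (map (\<lambda>i. tabloid_act (ys ! i) (young_component \<gamma> \<sigma> i)) [0..<r] ! i) (\<iota> i)) [0..<r] =
          map (\<lambda>g. tabloid_act g \<sigma>) (map (\<lambda>i. tabloid_act (ys ! i) (\<iota> i)) [0..<r])"
        proof (rule nth_equalityI)
          fix i assume "i < length (map (\<lambda>i. tabloid_act (map (\<lambda>i. tabloid_act (ys ! i)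
            (young_component \<gamma> \<sigma> i)) [0..<r] ! i) (\<iota> i)) [0..<r])"
          hence i: "i < r" "i < length \<gamma>" using len\<gamma> by simp_all
          let ?y = "young_component \<gamma> \<sigma> i"
          have y: "?y permutes {..<\<gamma> ! i}" by (rule young_component_permutes[OF \<sigma> i(2)])
          hence yp: "permutation ?y" "bij ?y" unfolding permutation_permutes by (auto simp: permutes_bij)
          have "tabloid_act (tabloid_act (ys ! i) ?y) (\<iota> i) = tabloid_act (ys ! i) (\<iota> i \<circ> ?y)"
            by (rule tabloid_act_comp[OF yp(2) \<iota>(2)])
          \<comment> \<open>For x below \<open>\<gamma> ! i\<close> both permutations give
            \<open>\<sigma> (x + offset \<gamma> i)\<close>; elsewhere they may differ.\<close>
          also have "\<dots> = tabloid_act (ys ! i) (\<sigma> \<circ> \<iota> i)"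
          proof (rule spechtA_act_eq[OF ysD(2)[OF ys i(1)]])
            fix x assume x: "x \<in> {..<\<gamma> ! i}"
            hence "x + offset \<gamma> i \<in> block \<gamma> i" by (simp add: block_def)
            hence "\<sigma> (x + offset \<gamma> i) \<in> block \<gamma> i" using \<sigma> i(2) unfolding young_def by blast
            thus "(\<iota> i \<circ> ?y) x = (\<sigma> \<circ> \<iota> i) x"
              using x by (auto simp: \<iota>_def shift_perm_def young_component_def block_def)
          qed (use \<iota>(1) yp(1) D(5) in \<open>auto intro: permutation_compose\<close>)
          also have "\<dots> = tabloid_act (tabloid_act (ys ! i) (\<iota> i)) \<sigma>"
            by (rule tabloid_act_comp[OF \<iota>(2) D(6), symmetric])
          finally show "map (\<lambda>i. tabloid_act (map (\<lambda>i. tabloid_act (ys ! i) (young_component \<gamma> \<sigma> i)) [0..<r] ! i) (\<iota> i)) [0..<r] ! i =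
            map (\<lambda>g. tabloid_act g \<sigma>) (map (\<lambda>i. tabloid_act (ys ! i) (\<iota> i)) [0..<r]) ! i"
            using i(1) by simp
        qed simp
        also have "tensor2 ?f (tensors \<dots>) = natural_act (j (tensor2 (tensors fs) (tensors ys))) h"
          unfolding j_gen[OF l(1)] ha by (rule natural_act_tensor[OF D(1) l(2), symmetric])
        finally show "j (wreath_act \<gamma> (tensor2 (tensors fs) (tensors ys)) h) =
          natural_act (j (tensor2 (tensors fs) (tensors ys))) h" .
      qed (simp_all only: j wreath_act_add wreath_act_scale natural_act_add natural_act_scale)
    qed
    \<comment> \<open>A word of the right content arises from the block word by some \<sigma>, so
      its generators are translates of vectors coming from \<open>?V\<close>; a word of any other
      content forces a zero factor.\<close>
    show "model_space n \<mu> \<eta> \<subseteq> fun_vs.span {natural_act (j t) g | t g. t \<in> ?V \<and> g \<in> carrier ?G}"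
      (is "_ \<subseteq> fun_vs.span ?S")
      unfolding model_space_def
    proof (rule fun_vs.span_minimal[OF _ fun_vs.subspace_span], rule UN_least, rule subsetI)
      fix w and s :: "'k T_vec" assume w: "w \<in> words (length \<eta>) n" and "s \<in> word_gens \<mu> \<eta> w"
      then obtain fs gs where fs: "fs \<in> listset (inner_factors \<mu> w)" and gs: "gs \<in> listset (outer_factors \<eta> w)"
        and s: "s = tensor2 (tensors fs) (tensors gs)" by (auto simp: word_gens_def)
      have lw: "length w = n" using w by (simp add: words_def)
      have lf: "length fs = n" and lg: "length gs = r" using fs gs lw by (simp_all add: inner_factors_iff outer_factors_iff r_def)
      show "s \<in> fun_vs.span ?S"
      proof (cases "\<forall>i<r. card (fibre w i) = \<gamma> ! i")
        case False
        then obtain i where i: "i < r" "card (fibre w i) \<noteq> sum_list (\<eta> ! i)" using \<gamma>i by auto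
        have gi: "gs ! i \<in> spechtA (\<eta> ! i) (fibre w i)" using gs i by (simp add: outer_factors_iff r_def)
        have "gs ! i = 0" by (rule spechtA_card[OF gi finite_fibre i(2)])
        hence "tensors gs Us = 0" for Us using tensors_nonzero(2)[of gs Us i] lg i(1) by auto
        hence "s = 0" by (intro ext) (auto simp: s tensor2_def)
        thus ?thesis by (simp only: fun_vs.span_zero)
      next
        case True
        have "w \<in> words (length \<gamma>) (sum_list \<gamma>)" using w len\<gamma> sum\<gamma> by (simp add: r_def)
        then obtain \<sigma> where \<sigma>: "\<sigma> permutes {..<n}" and w\<sigma>: "\<And>x. x < n \<Longrightarrow> w ! (\<sigma> x) = w0 ! x"
          using word_content[of w \<gamma>] True len\<gamma> sum\<gamma> unfolding w0_def by metis
        have lt: "\<sigma> x < n \<longleftrightarrow> x < n" "Hilbert_Choice.inv \<sigma> x < n \<longleftrightarrow> x < n" for x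
          using permutes_in_image[OF \<sigma>, of x] permutes_in_image[OF permutes_inv[OF \<sigma>], of x] by auto
        have perm: "permutation \<sigma>" "permutation (Hilbert_Choice.inv \<sigma>)"
          using \<sigma> permutes_inv[OF \<sigma>] finite_lessThan unfolding permutation_permutes by blast+
        note b = permutation_bijective[OF perm(1)] permutation_bijective[OF perm(2)]
        have fib: "\<sigma> ` block \<gamma> i = fibre w i" if "i < r" for i
        proof -
          have "w0 = map (\<lambda>x. w ! \<sigma> x) [0..<n]" using w\<sigma> w0(3) by (intro nth_equalityI) simp_all
          hence "fibre w0 i = Hilbert_Choice.inv \<sigma> ` fibre w i"
            using word_permute(2)[OF w permutes_inv[OF \<sigma>], of i] permutes_inv_inv[OF \<sigma>] by simp
          thus ?thesis using w0(2)[OF that] by (simp add: image_image permutes_inverses[OF \<sigma>])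
        qed
        let ?fs = "map (\<lambda>x. fs ! \<sigma> x) [0..<n]"
        let ?ys = "map (\<lambda>i. tabloid_act (tabloid_act (gs ! i) (Hilbert_Choice.inv \<sigma>)) (Hilbert_Choice.inv (\<iota> i))) [0..<r]"
        have fs': "?fs \<in> listset (inner_factors \<mu> w0)"
        proof -
          have "fs ! \<sigma> x \<in> specht (\<mu> ! (w0 ! x))" if "x < n" for x
            using fs that lt(1)[of x] lw unfolding inner_factors_iff w\<sigma>[OF that, symmetric] by blast
          thus ?thesis using w0(3) unfolding inner_factors_iff by simp
        qed
        have ys': "?ys \<in> listset (map specht \<eta>)"
          unfolding listset_iff
        proof (intro conjI allI impI)
          fix i assume "i < length (map specht \<eta> :: (tabloid \<Rightarrow> 'k) set list)"
          hence i: "i < r" by (simp add: r_def)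
          have "gs ! i \<in> spechtA (\<eta> ! i) (fibre w i)" using gs i by (simp add: outer_factors_iff r_def)
          from spechtA_act[OF spechtA_act[OF this perm(2)] permutation_inverse[OF \<iota>(1)[of i]]]
          have "?ys ! i \<in> spechtA (\<eta> ! i) (Hilbert_Choice.inv (\<iota> i) ` Hilbert_Choice.inv \<sigma> ` fibre w i)"
            using i by simp
          moreover have "Hilbert_Choice.inv (\<iota> i) ` Hilbert_Choice.inv \<sigma> ` fibre w i = {..<\<gamma> ! i}"
          proof -
            have "Hilbert_Choice.inv \<sigma> ` fibre w i = block \<gamma> i"
              unfolding fib[OF i, symmetric] by (simp add: image_image permutes_inverses[OF \<sigma>])
            thus ?thesis unfolding \<iota>(3)[symmetric] by (simp add: image_image \<iota>x)
          qed
          ultimately show "?ys ! i \<in> map specht \<eta> ! i"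
            using i \<gamma>i[OF i] by (simp add: specht_spechtA r_def)
        qed (simp add: r_def)
        let ?t = "tensor2 (tensors ?fs) (tensors ?ys)"
        have tV: "?t \<in> ?V" unfolding Vgens using fs' ys' by (intro fun_vs.span_base) blast
        have g: "(\<sigma>, \<lambda>_. id) \<in> carrier ?G" using \<sigma> by (simp add: wreath_def perms_def permutes_id)
        have "natural_act (j ?t) (\<sigma>, \<lambda>_. id) = s"
        proof -
          have f: "map (\<lambda>i. tabloid_act (?fs ! Hilbert_Choice.inv \<sigma> i) id) [0..<n] = fs"
            using lf lt permutes_inverses(1)[OF \<sigma>] by (intro nth_equalityI) (simp_all add: tabloid_act_id)
          have "tabloid_act (tabloid_act (?ys ! i) (\<iota> i)) \<sigma> = gs ! i" if "i < r" for i
          proof -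
            have "tabloid_act (?ys ! i) (\<iota> i) = tabloid_act (gs ! i) (Hilbert_Choice.inv \<sigma>)"
              using that by (simp add: tabloid_act_comp[OF bij_imp_bij_inv[OF \<iota>(2)] \<iota>(2)] \<iota>i tabloid_act_id)
            thus ?thesis
              by (simp add: tabloid_act_comp[OF b(2,1)] permutes_inv_o[OF \<sigma>] tabloid_act_id)
          qed
          hence y: "map (\<lambda>g. tabloid_act g \<sigma>) (map (\<lambda>i. tabloid_act (?ys ! i) (\<iota> i)) [0..<r]) = gs"
            using lg by (intro nth_equalityI) simp_all
          have ly: "length ?ys = r" "length ?fs = n" by simp_all
          show ?thesis
            unfolding j_gen[OF ly(1)] natural_act_tensor[OF \<sigma> ly(2)] f y s ..
        qed
        thus ?thesis using tV g by (blast intro: fun_vs.span_base)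
      qed
    qed
  qed (simp_all only: j p natural_act_add natural_act_scale)
  thus ?thesis
    unfolding wreath_specht_def T_module_def model_def \<gamma>_def[symmetric] sum\<gamma> .
qed

section \<open>The filtration of the restricted module\<close>

definition pad :: "nat list \<Rightarrow> nat \<Rightarrow> tabloid \<Rightarrow> tabloid" where
  "pad \<nu> a U = (if \<nu> ! a = 1 then U @ [{}] else U)"

definition add_letter :: "nat list \<Rightarrow> nat \<Rightarrow> nat \<Rightarrow> tabloid \<Rightarrow> tabloid" where
  "add_letter \<nu> a x U = (pad \<nu> a U)[a := insert x (pad \<nu> a U ! a)]"

lemma strip_apply: "strip \<nu> a x f U = (if x \<in> pad \<nu> a U ! a then 0 else f (add_letter \<nu> a x U))"
  by (simp add: strip_def unbox_def pad_def add_letter_def)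

lemma strip_zero_fun: "(\<And>U. f U = 0) \<Longrightarrow> strip \<nu> a x f U = 0"
  by (simp add: strip_apply)

text \<open>The length assumption makes row \<open>a\<close> exist in the padded list; an update out
  of range would insert nothing.\<close>

lemma letters_add:
  assumes "length (add_letter \<nu> a x U) = length \<nu>" "a < length \<nu>"
  shows "\<Union> (set (add_letter \<nu> a x U)) = insert x (\<Union> (set U))"
proof -
  have l: "a < length (pad \<nu> a U)" using assms by (simp add: add_letter_def)
  have "\<Union> (set (V[a := insert x (V ! a)])) = insert x (\<Union> (set V))" if a: "a < length V" for V
  proof -
    have "V = take a V @ V ! a # drop (Suc a) V" by (rule id_take_nth_drop[OF a])
    hence s: "set V = set (take a V) \<union> {V ! a} \<union> set (drop (Suc a) V)" by (metis Un_insert_right list.simps(15) set_append sup_bot.right_neutral sup_assoc insert_is_Un)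
    have "set (V[a := insert x (V ! a)]) = set (take a V) \<union> {insert x (V ! a)} \<union> set (drop (Suc a) V)"
      unfolding upd_conv_take_nth_drop[OF a] by auto
    hence "\<Union> (set (V[a := insert x (V ! a)])) = insert x (\<Union> (set (take a V) \<union> {V ! a} \<union> set (drop (Suc a) V)))" by auto
    thus ?thesis by (simp only: s[symmetric])
  qed
  from this[OF l] show ?thesis by (simp add: add_letter_def pad_def)
qed

text \<open>Inserting \<open>x\<close> commutes with a permutation fixing \<open>x\<close>. If the
  padded list has the wrong length, the update may have no effect, and both sides vanish by the
  hypothesis on \<open>h\<close>.\<close>

lemma strip_permute:
  assumes p: "\<sigma> permutes S" "\<sigma> x = x" and a: "a < length \<nu>" and h: "\<And>V. length V \<noteq> length \<nu> \<Longrightarrow> h V = 0"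
  shows "strip \<nu> a x (\<lambda>U. h (tabloid_perm U \<sigma>)) V = strip \<nu> a x h (tabloid_perm V \<sigma>)"
proof -
  have pd: "pad \<nu> a (tabloid_perm V \<sigma>) = tabloid_perm (pad \<nu> a V) \<sigma>" by (simp add: pad_def tabloid_perm_def)
  show ?thesis
  proof (cases "length (pad \<nu> a V) = length \<nu>")
    case True
    hence al: "a < length (pad \<nu> a V)" using a by simp
    have "x \<in> \<sigma> ` R \<longleftrightarrow> x \<in> R" for R
      using p(2) permutes_inj[OF p(1)] by (metis image_iff injD)
    hence "x \<in> pad \<nu> a (tabloid_perm V \<sigma>) ! a \<longleftrightarrow> x \<in> pad \<nu> a V ! a"
      unfolding pd by (simp only: tabloid_perm_def nth_map[OF al])
    moreover have "add_letter \<nu> a x (tabloid_perm V \<sigma>) = tabloid_perm (add_letter \<nu> a x V) \<sigma>"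
      using al p(2) unfolding add_letter_def pd by (simp add: tabloid_perm_def map_update)
    ultimately show ?thesis by (simp only: strip_apply)
  next
    case False
    have "length (tabloid_perm (add_letter \<nu> a x V) \<sigma>) \<noteq> length \<nu>"
      "length (add_letter \<nu> a x (tabloid_perm V \<sigma>)) \<noteq> length \<nu>"
      using False by (simp_all add: add_letter_def pd) (simp_all add: tabloid_perm_def)
    thus ?thesis by (simp add: strip_apply h)
  qed
qed

section \<open>Words and their last position\<close>

lemma words_snoc:
  assumes "w \<in> words r N" "i < r"
  shows "w @ [i] \<in> words r (Suc N)" "fibre (w @ [i]) l = (if l = i then insert N (fibre w i) else fibre w l)"
    "(w @ [i]) ! N = i" "j < N \<Longrightarrow> (w @ [i]) ! j = w ! j" "N \<notin> fibre w l"
  using assms by (auto simp: words_def fibre_def nth_append less_Suc_eq)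

lemma words_butlast:
  assumes "w \<in> words r (Suc N)"
  shows "butlast w \<in> words r N" "butlast w @ [w ! N] = w"
proof -
  have l: "length w = Suc N" "set w \<subseteq> {..<r}" using assms by (simp_all add: words_def)
  show "butlast w \<in> words r N" using l by (auto simp: words_def dest: in_set_butlastD)
  have "w \<noteq> []" using l by auto
  thus "butlast w @ [w ! N] = w" using l(1) by (metis append_butlast_last_id diff_Suc_1 last_conv_nth)
qed

text \<open>Positions are numbered from 0, so \<open>N\<close> is the last of \<open>Suc N\<close>
  letters. For each \<open>i\<close>, the functions \<open>vv i\<close> and the tabloids
  \<open>pt i\<close> form a dual system, as in \<open>dual_system\<close>, of the Specht module of
  \<open>\<mu> ! i\<close>.\<close>

locale branching =
  fixes m N :: nat and \<mu> \<eta> :: "nat list list"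
    and d :: "nat \<Rightarrow> nat" and pt :: "nat \<Rightarrow> nat \<Rightarrow> tabloid" and vv :: "nat \<Rightarrow> nat \<Rightarrow> tabloid \<Rightarrow> 'k::field"
  assumes len: "length \<mu> = length \<eta>" and mu: "set \<mu> \<subseteq> partitions m"
    and parts: "\<And>i. i < length \<eta> \<Longrightarrow> \<exists>K. \<eta> ! i \<in> partitions K"
    and total: "sum_list (shape \<eta>) = Suc N"
    and vv: "\<And>i k. \<lbrakk>i < length \<eta>; k < d i\<rbrakk> \<Longrightarrow> vv i k \<in> specht (\<mu> ! i)"
    and dual: "\<And>i k l. \<lbrakk>i < length \<eta>; k < d i; l < d i\<rbrakk> \<Longrightarrow> vv i k (pt i l) = (if k = l then 1 else 0)"
    and rep: "\<And>i g y. \<lbrakk>i < length \<eta>; g \<in> specht (\<mu> ! i)\<rbrakk> \<Longrightarrow> g y = (\<Sum>k<d i. g (pt i k) * vv i k y)"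
begin

text \<open>By duality, the value of the last inner factor at the tabloid \<open>pt i k\<close> is
  its coefficient at \<open>vv i k\<close>.\<close>

definition eval_key :: "nat \<times> nat \<times> nat \<Rightarrow> 'k T_vec \<Rightarrow> 'k T_vec" where
  "eval_key = (\<lambda>(i, a, k) f (Ts, Us). strip (\<eta> ! i) a N (\<lambda>U. f (Ts @ [pt i k], Us[i := U])) (Us ! i))"

definition delete_box :: "nat \<times> nat \<times> nat \<Rightarrow> nat list list" where
  "delete_box = (\<lambda>(i, a, k). \<eta>[i := rem_box (\<eta> ! i) a])"

definition keys :: "(nat \<times> nat \<times> nat) set" where
  "keys = {(i, a, k). i < length \<eta> \<and> corner (\<eta> ! i) a \<and> k < d i}"

lemma finite_keys: "finite keys"
proof -
  have "keys \<subseteq> (SIGMA i:{..<length \<eta>}. {..<length (\<eta> ! i)} \<times> {..<d i})"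
    by (auto simp: keys_def corner_def)
  thus ?thesis by (rule finite_subset) auto
qed

lemma eta:
  assumes "i < length \<eta>"
  shows "sorted_wrt (\<ge>) (\<eta> ! i)" "\<forall>y\<in>set (\<eta> ! i). 0 < y"
  using parts[OF assms] by (auto simp: partitions_def)

lemma eval_key_add: "eval_key \<kappa> (f + f') = eval_key \<kappa> f + eval_key \<kappa> f'"
  and eval_key_scale: "eval_key \<kappa> (fscale c f) = fscale c (eval_key \<kappa> f)"
  by (auto simp: eval_key_def strip_apply fscale_def fun_eq_iff split: prod.splits)

abbreviation space :: "'k T_vec set" where
  "space \<equiv> model_space (Suc N) \<mu> \<eta>"

lemma space_support:
  assumes f: "f \<in> space" and nz: "f (Ts, Us) \<noteq> 0"
  shows "length Ts = Suc N" "length Us = length \<eta>" "i < length \<eta> \<Longrightarrow> length (Us ! i) = length (\<eta> ! i)"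
    "\<exists>w\<in>words (length \<eta>) (Suc N). carried w (length \<eta>) Us"
proof -
  note S = slicedD[OF f[unfolded model_space_sliced]]
  show "length Ts = Suc N" by (rule S(1)[OF nz])
  show ex: "\<exists>w\<in>words (length \<eta>) (Suc N). carried w (length \<eta>) Us" by (rule S(2)[OF nz])
  then obtain w where w: "w \<in> words (length \<eta>) (Suc N)" "carried w (length \<eta>) Us" by blast
  show l: "length Us = length \<eta>" using w(2) by (simp add: carried_def)
  show "length (Us ! i) = length (\<eta> ! i)" if i: "i < length \<eta>"
  proof -
    have "(\<lambda>U. f (Ts, Us[i := U])) \<in> spechtA (\<eta> ! i) (fibre w i)"
      by (rule S(4)[OF w(1) i l]) (use w(2) in \<open>simp add: carried_def\<close>)
    from tabloid_lettersD(1)[OF spechtA_support[OF this, of "Us ! i"]] nz show ?thesis by simp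
  qed
qed

text \<open>With everything else fixed, the stripped value is a vector of the Specht module of
  \<open>\<mu> ! i\<close> in the last inner variable. Its coordinates are the values at the points
  \<open>pt i k\<close>, that is, values of the evaluation maps for row \<open>b\<close>, so it
  vanishes for every \<open>T\<close>.\<close>

lemma strip_slice_zero:
  assumes f: "f \<in> space" and w: "w \<in> words (length \<eta>) (Suc N)" "w ! N = i" and i: "i < length \<eta>"
    and Us: "length Us = length \<eta>" "\<And>l. \<lbrakk>l < length \<eta>; l \<noteq> i\<rbrakk> \<Longrightarrow> \<Union> (set (Us ! l)) = fibre w l"
    and van: "\<And>k. k < d i \<Longrightarrow> eval_key (i, b, k) f = 0" and Ts: "length Ts = N"
  shows "strip (\<eta> ! i) b N (\<lambda>U. f (Ts @ [T], Us[i := U])) = 0"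
proof (rule ext)
  fix V
  note S = slicedD[OF f[unfolded model_space_sliced]]
  let ?\<phi> = "\<lambda>T. strip (\<eta> ! i) b N (\<lambda>U. f (Ts @ [T], Us[i := U])) V"
  let ?V = "add_letter (\<eta> ! i) b N V"
  have "?\<phi> \<in> specht (\<mu> ! i)"
  proof (cases "N \<in> pad (\<eta> ! i) b V ! b \<or> (\<forall>T. f (Ts @ [T], Us[i := ?V]) = 0)")
    case True
    thus ?thesis by (intro subspace_zero_fun[OF subspace_specht]) (auto simp: strip_apply)
  next
    case False
    then obtain T0 where nz: "f (Ts @ [T0], Us[i := ?V]) \<noteq> 0" and no: "N \<notin> pad (\<eta> ! i) b V ! b" by blast
    have "(\<lambda>U. f (Ts @ [T0], Us[i := U])) \<in> spechtA (\<eta> ! i) (fibre w i)"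
      by (rule S(4)[OF w(1) i Us])
    hence "\<Union> (set ?V) = fibre w i" using tabloid_lettersD(2)[OF spechtA_support] nz by blast
    hence c: "carried w (length \<eta>) (Us[i := ?V])" unfolding carried_update[OF Us(1) i] using Us(2) by blast
    have "(\<lambda>T. f ((Ts @ [T0])[N := T], Us[i := ?V])) \<in> specht (\<mu> ! (w ! N))"
      by (rule S(3)[OF w(1) _ c]) (simp_all add: Ts)
    thus ?thesis using no Ts w(2) by (simp add: strip_apply list_update_append)
  qed
  moreover have "?\<phi> (pt i k) = 0" if "k < d i" for k
  proof -
    have "eval_key (i, b, k) f (Ts, Us[i := V]) = 0" using van[OF that] by simp
    thus ?thesis using i Us(1) by (simp add: eval_key_def)
  qed
  ultimately show "?\<phi> T = (0 :: tabloid \<Rightarrow> 'k) V" using rep[OF i, of ?\<phi> T] by simp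
qed

text \<open>Membership is checked slice by slice through \<open>model_space_sliced\<close>, each
  word \<open>w\<close> being extended to \<open>w @ [i]\<close>. The slice in component
  \<open>i\<close> is governed by \<open>strip_spechtA\<close>, whose hypothesis on later rows comes
  from \<open>strip_slice_zero\<close>; for that, the vanishing is assumed for all
  \<open>k'\<close>.\<close>

lemma eval_key_model:
  assumes f: "f \<in> space" and key: "(i, a, k) \<in> keys"
    and van: "\<And>b k'. \<lbrakk>(i, b, k') \<in> keys; a < b\<rbrakk> \<Longrightarrow> eval_key (i, b, k') f = 0"
  shows "eval_key (i, a, k) f \<in> model_space N \<mu> (delete_box (i, a, k))"
proof -
  let ?\<nu> = "\<eta> ! i" and ?r = "length \<eta>" and ?e = "eval_key (i, a, k) f" and ?\<delta> = "delete_box (i, a, k)"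
  note S = slicedD[OF f[unfolded model_space_sliced]]
  have i: "i < ?r" and a: "corner ?\<nu> a" "a < length ?\<nu>" using key by (auto simp: keys_def corner_def)
  have lr: "length ?\<delta> = ?r" by (simp add: delete_box_def)
  have \<delta>: "?\<delta> ! l = (if l = i then rem_box ?\<nu> a else \<eta> ! l)" if "l < ?r" for l
    using that by (simp add: delete_box_def nth_list_update)
  have e: "?e (Ts, Us) = (if N \<in> pad ?\<nu> a (Us ! i) ! a then 0
      else f (Ts @ [pt i k], Us[i := add_letter ?\<nu> a N (Us ! i)]))" for Ts Us
    by (simp add: eval_key_def strip_apply)
  have enz: "f (Ts @ [pt i k], Us[i := add_letter ?\<nu> a N (Us ! i)]) \<noteq> 0" if "?e (Ts, Us) \<noteq> 0" for Ts Us
    using that by (auto simp: e split: if_splits)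
  have letters: "\<Union> (set (add_letter ?\<nu> a N V)) = insert N (\<Union> (set V))"
    if "f (Ts, Us) \<noteq> 0" "Us ! i = add_letter ?\<nu> a N V" for Ts Us V
    using letters_add[OF _ a(2), of N V] space_support(3)[OF f that(1) i] that(2) by simp
  have slice_i: "(\<lambda>U. ?e (Ts, Us[i := U])) \<in> spechtA (?\<delta> ! i) (fibre w i)"
    if w: "w \<in> words ?r N" and Us: "length Us = ?r" "\<And>l. \<lbrakk>l < ?r; l \<noteq> i\<rbrakk> \<Longrightarrow> \<Union> (set (Us ! l)) = fibre w l"
    for w Ts Us
  proof (cases "length Ts = N")
    case True
    note ws = words_snoc[OF w i]
    let ?w = "w @ [i]"
    have Us': "\<Union> (set (Us ! l)) = fibre ?w l" if "l < ?r" "l \<noteq> i" for l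
      using Us(2)[OF that] that(2) ws(2)[of l] by simp
    let ?g = "\<lambda>U. f (Ts @ [pt i k], Us[i := U])"
    have g: "?g \<in> spechtA ?\<nu> (fibre ?w i)" by (rule S(4)[OF ws(1) i Us(1) Us'])
    have "strip ?\<nu> a N ?g \<in> spechtA (rem_box ?\<nu> a) (fibre ?w i - {N})"
    proof (rule strip_spechtA[OF eta[OF i] finite_fibre _ g a(1)])
      show "N \<in> fibre ?w i" by (simp add: ws(2))
      fix b assume b: "corner ?\<nu> b" "a < b"
      show "strip ?\<nu> b N ?g = 0"
        by (rule strip_slice_zero[OF f ws(1) ws(3) i Us(1) Us' _ True])
          (use b i in \<open>simp_all add: van keys_def\<close>)
    qed
    moreover have "fibre ?w i - {N} = fibre w i" using ws(2)[of i] ws(5)[of i] by auto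
    moreover have "(\<lambda>U. ?e (Ts, Us[i := U])) = strip ?\<nu> a N ?g"
      using i Us(1) by (intro ext) (simp add: eval_key_def)
    ultimately show ?thesis using \<delta>[OF i] by simp
  next
    case False
    have "?e (Ts, Us') = 0" for Us'
    proof (rule ccontr)
      assume "?e (Ts, Us') \<noteq> 0"
      from space_support(1)[OF f enz[OF this]] False show False by simp
    qed
    thus ?thesis by (intro subspace_zero_fun[OF subspace_spechtA])
  qed
  have "sliced N \<mu> ?\<delta> ?e" unfolding sliced_def lr
  proof (intro conjI ballI allI impI)
    fix Ts Us :: "tabloid list" assume nz: "?e (Ts, Us) \<noteq> 0"
    let ?U = "add_letter ?\<nu> a N (Us ! i)"
    note sp = space_support[OF f enz[OF nz]]
    show "length Ts = N" using sp(1) by simp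
    obtain w where w: "w \<in> words ?r (Suc N)" "carried w ?r (Us[i := ?U])" using sp(4) by blast
    have lU: "length Us = ?r" using sp(2) by simp
    note cu = w(2)[unfolded carried_update[OF lU i]]
    \<comment> \<open>The inserted letter \<open>N\<close> shows that the word of the larger tuple
      ends in \<open>i\<close>; the rest of it is the word of the smaller tuple.\<close>
    have "N \<in> fibre w i" using letters[OF enz[OF nz], of "Us ! i"] cu i lU by auto
    hence wN: "w ! N = i" by (simp add: fibre_def)
    define w' where "w' = butlast w"
    have w': "w' \<in> words ?r N" "w = w' @ [i]" using words_butlast[OF w(1)] wN by (simp_all add: w'_def)
    have off: "\<Union> (set (Us ! l)) = fibre w' l" if "l < ?r" "l \<noteq> i" for l
      using cu that words_snoc(2)[OF w'(1) i, of l] w'(2) by simp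
    \<comment> \<open>The entries of the \<open>i\<close>-th tabloid are read off from the support
      of the slice in that component.\<close>
    have "(\<lambda>U. ?e (Ts, Us[i := U])) \<in> spechtA (?\<delta> ! i) (fibre w' i)" by (rule slice_i[OF w'(1) lU off])
    from spechtA_support[OF this, of "Us ! i"] nz have "Us ! i \<in> tabloid_of ` tabs (?\<delta> ! i) (fibre w' i)" by simp
    from tabloid_lettersD(2)[OF this] have "\<Union> (set (Us ! i)) = fibre w' i" .
    hence "carried w' ?r Us" using off lU unfolding carried_def by metis
    thus "\<exists>w\<in>words ?r N. carried w ?r Us" using w'(1) by blast
  next
    fix w and Ts Us :: "tabloid list" and j
    assume w: "w \<in> words ?r N" and Ts: "length Ts = N" and Us: "carried w ?r Us" and j: "j < N"
    note ws = words_snoc[OF w i]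
    let ?U = "add_letter ?\<nu> a N (Us ! i)"
    have lU: "length Us = ?r" and Ul: "\<And>l. l < ?r \<Longrightarrow> \<Union> (set (Us ! l)) = fibre w l" using Us by (simp_all add: carried_def)
    show "(\<lambda>T. ?e (Ts[j := T], Us)) \<in> specht (\<mu> ! (w ! j))"
    proof (cases "N \<in> pad ?\<nu> a (Us ! i) ! a \<or> (\<forall>T. f (Ts[j := T] @ [pt i k], Us[i := ?U]) = 0)")
      case True
      thus ?thesis by (intro subspace_zero_fun[OF subspace_specht]) (auto simp: e)
    next
      case False
      then obtain T0 where nz: "f (Ts[j := T0] @ [pt i k], Us[i := ?U]) \<noteq> 0" and no: "N \<notin> pad ?\<nu> a (Us ! i) ! a" by blast
      have "\<Union> (set ?U) = fibre (w @ [i]) i"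
        using letters[OF nz, of "Us ! i"] lU i Ul[OF i] ws(2)[of i] by simp
      hence c: "carried (w @ [i]) ?r (Us[i := ?U])"
        unfolding carried_update[OF lU i] using Ul ws(2) by simp
      have "(\<lambda>T. f ((Ts @ [pt i k])[j := T], Us[i := ?U])) \<in> specht (\<mu> ! ((w @ [i]) ! j))"
        by (rule S(3)[OF ws(1) _ c]) (use Ts j in simp_all)
      thus ?thesis using no Ts j ws(4)[OF j] by (simp add: e list_update_append)
    qed
  next
    fix w and Ts Us :: "tabloid list" and l
    assume w: "w \<in> words ?r N" and l: "l < ?r" and lU: "length Us = ?r"
      and Ul: "\<forall>l'<?r. l' \<noteq> l \<longrightarrow> \<Union> (set (Us ! l')) = fibre w l'"
    note ws = words_snoc[OF w i]
    show "(\<lambda>U. ?e (Ts, Us[l := U])) \<in> spechtA (?\<delta> ! l) (fibre w l)"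
    proof (cases "l = i")
      case True
      thus ?thesis using slice_i[OF w lU, of Ts] Ul by simp
    next
      case False
      let ?U = "add_letter ?\<nu> a N (Us ! i)"
      have sw: "(Us[l := U])[i := ?U] = (Us[i := ?U])[l := U]" for U using False by (simp add: list_update_swap)
      have e': "?e (Ts, Us[l := U]) = (if N \<in> pad ?\<nu> a (Us ! i) ! a then 0
          else f (Ts @ [pt i k], (Us[i := ?U])[l := U]))" for U
        using False by (simp add: e sw)
      show ?thesis
      proof (cases "N \<in> pad ?\<nu> a (Us ! i) ! a \<or> (\<forall>U. f (Ts @ [pt i k], (Us[i := ?U])[l := U]) = 0)")
        case True
        thus ?thesis by (intro subspace_zero_fun[OF subspace_spechtA]) (auto simp: e')
      next
        case nz: False
        then obtain U0 where U0: "f (Ts @ [pt i k], (Us[i := ?U])[l := U0]) \<noteq> 0" by blast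
        have "(Us[i := ?U])[l := U0] ! i = ?U" using False i lU by simp
        hence "\<Union> (set ?U) = fibre (w @ [i]) i"
          using letters[OF U0, of "Us ! i"] Ul i False ws(2)[of i] by simp
        hence off: "\<Union> (set ((Us[i := ?U]) ! l')) = fibre (w @ [i]) l'" if "l' < ?r" "l' \<noteq> l" for l'
          using Ul that lU ws(2)[of l'] by (cases "l' = i") simp_all
        have "(\<lambda>U. f (Ts @ [pt i k], (Us[i := ?U])[l := U])) \<in> spechtA (\<eta> ! l) (fibre (w @ [i]) l)"
          by (rule S(4)[OF ws(1) l _ off]) (simp_all add: lU)
        thus ?thesis using nz False \<delta>[OF l] ws(2)[of l] by (simp add: e')
      qed
    qed
  qed
  thus ?thesis by (simp add: model_space_sliced)
qed

text \<open>A nonzero value of \<open>f\<close> is carried by a word, whose last value names the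
  component containing \<open>N\<close>. All stripped parts of the slice in that component vanish,
  so the slice is zero by \<open>strip_all_zero\<close>.\<close>

lemma eval_keys_zero:
  assumes f: "f \<in> space" and van: "\<And>\<kappa>. \<kappa> \<in> keys \<Longrightarrow> eval_key \<kappa> f = 0"
  shows "f = 0"
proof (rule ext, rule ccontr)
  fix z :: "tabloid list \<times> tabloid list"
  assume nz0: "f z \<noteq> 0 z"
  obtain Ts0 Us where z: "z = (Ts0, Us)" by fastforce
  have nz: "f (Ts0, Us) \<noteq> 0" using nz0 z by simp
  note sp = space_support[OF f nz]
  note S = slicedD[OF f[unfolded model_space_sliced]]
  obtain Ts T where Ts: "Ts0 = Ts @ [T]" "length Ts = N"
    using sp(1) by (cases Ts0 rule: rev_cases) auto
  obtain w where w: "w \<in> words (length \<eta>) (Suc N)" "carried w (length \<eta>) Us" using sp(4) by blast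
  define i where "i = w ! N"
  have i: "i < length \<eta>" using words_nth[OF w(1), of N] by (simp add: i_def)
  have Us: "\<Union> (set (Us ! l)) = fibre w l" if "l < length \<eta>" "l \<noteq> i" for l
    using w(2) that by (simp add: carried_def)
  let ?g = "\<lambda>U. f (Ts @ [T], Us[i := U])"
  have g: "?g \<in> spechtA (\<eta> ! i) (fibre w i)" by (rule S(4)[OF w(1) i sp(2) Us])
  have "?g = 0"
  proof (rule strip_all_zero[OF eta[OF i] finite_fibre _ g])
    show "N \<in> fibre w i" using w(1) by (simp add: fibre_def i_def words_def)
    fix b assume b: "corner (\<eta> ! i) b"
    show "strip (\<eta> ! i) b N ?g = 0"
      by (rule strip_slice_zero[OF f w(1) i_def[symmetric] i sp(2) Us _ Ts(2)])
        (use b i in \<open>simp_all add: van keys_def\<close>)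
  qed
  hence "?g (Us ! i) = 0" by (metis zero_fun_apply)
  thus False using nz Ts(1) by simp
qed

text \<open>A generator for \<open>w\<close> lifts to one for \<open>w @ [i]\<close>: the new inner
  factor is \<open>vv i k\<close>, and the \<open>i\<close>-th outer factor is lifted by
  \<open>strip_surj\<close>. The other evaluations in rows from \<open>a\<close> on vanish: in
  another component because \<open>N\<close> is not there, in a later row of component
  \<open>i\<close> by \<open>strip_surj\<close>, in row \<open>a\<close> itself by duality.\<close>

lemma eval_key_surj:
  assumes key: "(i, a, k) \<in> keys" and g: "g \<in> model_space N \<mu> (delete_box (i, a, k))"
  shows "\<exists>f\<in>space. eval_key (i, a, k) f = g \<and>
    (\<forall>i' b k'. (i', b, k') \<in> keys \<longrightarrow> a \<le> b \<longrightarrow> (i', b, k') \<noteq> (i, a, k) \<longrightarrow> eval_key (i', b, k') f = 0)"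
proof -
  let ?\<nu> = "\<eta> ! i" and ?r = "length \<eta>" and ?\<delta> = "delete_box (i, a, k)"
  have i: "i < ?r" and a: "corner ?\<nu> a" and k: "k < d i" using key by (auto simp: keys_def)
  have lr: "length ?\<delta> = ?r" by (simp add: delete_box_def)
  have \<delta>: "?\<delta> ! l = (if l = i then rem_box ?\<nu> a else \<eta> ! l)" if "l < ?r" for l
    using that by (simp add: delete_box_def nth_list_update)
  let ?P = "\<lambda>f. f \<in> space \<and> (\<forall>i' b k'. (i', b, k') \<in> keys \<longrightarrow> a \<le> b \<longrightarrow>
    (i', b, k') \<noteq> (i, a, k) \<longrightarrow> eval_key (i', b, k') f = 0)"
  have gen: "\<exists>f. ?P f \<and> eval_key (i, a, k) f = s" if w: "w \<in> words ?r N" and s: "s \<in> word_gens \<mu> ?\<delta> w" for w s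
  proof -
    obtain fs gs where fs: "fs \<in> listset (inner_factors \<mu> w)" and gs: "gs \<in> listset (outer_factors ?\<delta> w)"
      and se: "s = tensor2 (tensors fs) (tensors gs)" using s by (auto simp: word_gens_def)
    note ws = words_snoc[OF w i]
    have lw: "length w = N" using w by (simp add: words_def)
    have lf: "length fs = N" using fs lw by (simp add: inner_factors_iff)
    have lg: "length gs = ?r" using gs lr by (simp add: outer_factors_iff)
    have gl: "gs ! l \<in> spechtA (?\<delta> ! l) (fibre w l)" if "l < ?r" for l using gs that lr by (simp add: outer_factors_iff)
    have gi: "gs ! i \<in> spechtA (rem_box ?\<nu> a) (fibre w i)" using gl[OF i] \<delta>[OF i] by simp
    obtain h where h: "h \<in> spechtA ?\<nu> (insert N (fibre w i))" "strip ?\<nu> a N h = gs ! i"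
      "\<And>b. \<lbrakk>a < b; corner ?\<nu> b\<rbrakk> \<Longrightarrow> strip ?\<nu> b N h = 0"
      using strip_surj[OF eta(2)[OF i] a ws(5) gi] by blast
    let ?fs = "fs @ [vv i k]" and ?gs = "gs[i := h]"
    let ?f = "tensor2 (tensors ?fs) (tensors ?gs)"
    have fs': "?fs \<in> listset (inner_factors \<mu> (w @ [i]))"
      using fs vv[OF i k] lw unfolding inner_factors_iff by (auto simp: nth_append less_Suc_eq)
    have gs': "?gs \<in> listset (outer_factors \<eta> (w @ [i]))"
      unfolding outer_factors_iff
    proof (intro conjI allI impI)
      fix l assume l: "l < ?r"
      show "?gs ! l \<in> spechtA (\<eta> ! l) (fibre (w @ [i]) l)"
        using h(1) gl[OF l] \<delta>[OF l] ws(2)[of l] l lg by (cases "l = i") simp_all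
    qed (simp add: lg)
    have "?f \<in> word_gens \<mu> \<eta> (w @ [i])" unfolding word_gens_def using fs' gs' by blast
    hence f: "?f \<in> space" unfolding model_space_def using ws(1) by (blast intro: fun_vs.span_base)
    have snoc: "tensors ?fs (Ts @ [T]) = tensors fs Ts * vv i k T" for Ts T
      by (simp add: tensors_def nth_append)
    have upd: "tensors ?gs (Us[i := U]) = h U * (\<Prod>l\<in>{..<?r} - {i}. (gs ! l) (Us ! l))" if "length Us = ?r" for Us U
    proof -
      have "tensors ?gs (Us[i := U]) = (?gs ! i) U * (\<Prod>l\<in>{..<length ?gs} - {i}. (?gs ! l) (Us ! l))"
        by (rule tensors_update) (use that lg i in simp_all)
      also have "(\<Prod>l\<in>{..<length ?gs} - {i}. (?gs ! l) (Us ! l)) = (\<Prod>l\<in>{..<?r} - {i}. (gs ! l) (Us ! l))"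
        by (rule prod.cong) (auto simp: lg)
      finally show ?thesis using i lg by simp
    qed
    have upd0: "tensors ?gs (Us[l := U]) = 0" if "length Us \<noteq> ?r" for Us U l
      using that lg by (simp add: tensors_def)
    have strip_scaled: "strip \<nu> b N (\<lambda>U. c * h' U * c') V = c * strip \<nu> b N h' V * c'" for \<nu> b c c' V and h' :: "tabloid \<Rightarrow> 'k"
      by (simp add: strip_apply)
    have ev_i: "eval_key (i, b, k') ?f (Ts, Us) = (if length Us = ?r then tensors fs Ts * vv i k (pt i k') *
        (strip ?\<nu> b N h (Us ! i) * (\<Prod>l\<in>{..<?r} - {i}. (gs ! l) (Us ! l))) else 0)" for b k' Ts Us
    proof (cases "length Us = ?r")
      case True
      have "eval_key (i, b, k') ?f (Ts, Us) = strip ?\<nu> b N (\<lambda>U. (tensors fs Ts * vv i k (pt i k')) * h U *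
          (\<Prod>l\<in>{..<?r} - {i}. (gs ! l) (Us ! l))) (Us ! i)"
        by (simp add: eval_key_def tensor2_def snoc upd[OF True] mult.assoc)
      thus ?thesis unfolding strip_scaled using True by (simp add: mult.assoc)
    next
      case False
      thus ?thesis by (simp add: eval_key_def tensor2_def upd0 strip_zero_fun)
    qed
    have "eval_key (i, a, k) ?f = s"
    proof (rule ext)
      fix z :: "tabloid list \<times> tabloid list"
      obtain Ts Us where z: "z = (Ts, Us)" by fastforce
      show "eval_key (i, a, k) ?f z = s z"
      proof (cases "length Us = ?r")
        case True
        have "tensors gs (Us[i := Us ! i]) = (gs ! i) (Us ! i) * (\<Prod>l\<in>{..<length gs} - {i}. (gs ! l) (Us ! l))"
          by (rule tensors_update) (use True lg i in simp_all)
        hence "s z = tensors fs Ts * ((gs ! i) (Us ! i) * (\<Prod>l\<in>{..<?r} - {i}. (gs ! l) (Us ! l)))"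
          by (simp add: z se tensor2_def lg)
        moreover have "vv i k (pt i k) = 1" using dual[OF i k k] by simp
        ultimately show ?thesis unfolding z ev_i h(2) using True by simp
      next
        case False
        hence "s z = 0" using lg by (simp add: z se tensor2_def tensors_def)
        thus ?thesis unfolding z ev_i using False by simp
      qed
    qed
    moreover have "eval_key (i', b, k') ?f = 0"
      if k': "(i', b, k') \<in> keys" and b: "a \<le> b" and ne: "(i', b, k') \<noteq> (i, a, k)" for i' b k'
    proof (rule ext)
      fix z :: "tabloid list \<times> tabloid list"
      obtain Ts Us where z: "z = (Ts, Us)" by fastforce
      show "eval_key (i', b, k') ?f z = 0 z"
      proof (cases "i' = i")
        case True
        have "strip ?\<nu> b N h = 0 \<or> vv i k (pt i k') = 0"
        proof (cases "b = a")
          case False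
          thus ?thesis using h(3)[of b] b k' True by (auto simp: keys_def)
        next
          case True
          hence "k \<noteq> k'" using ne \<open>i' = i\<close> by auto
          thus ?thesis using dual[OF i k, of k'] k' \<open>i' = i\<close> by (simp add: keys_def)
        qed
        thus ?thesis unfolding True z ev_i by auto
      next
        case False
        have i': "i' < ?r" "corner (\<eta> ! i') b" "b < length (\<eta> ! i')" using k' by (auto simp: keys_def corner_def)
        have gi': "?gs ! i' \<in> spechtA (\<eta> ! i') (fibre w i')"
          using gl[OF i'(1)] \<delta>[OF i'(1)] False by simp
        have "tensors ?gs (Us[i' := add_letter (\<eta> ! i') b N V]) = 0" for V
        proof (rule ccontr)
          assume nz: "tensors ?gs (Us[i' := add_letter (\<eta> ! i') b N V]) \<noteq> 0"
          have lU: "length Us = ?r" using tensors_nonzero(1)[OF nz] lg by simp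
          have "(?gs ! i') (add_letter (\<eta> ! i') b N V) \<noteq> 0"
            using tensors_nonzero(2)[OF nz, of i'] i'(1) lg lU by simp
          note T = spechtA_support[OF gi' this]
          have "\<Union> (set (add_letter (\<eta> ! i') b N V)) = insert N (\<Union> (set V))"
            by (rule letters_add[OF tabloid_lettersD(1)[OF T] i'(3)])
          hence "N \<in> fibre w i'" using tabloid_lettersD(2)[OF T] by blast
          thus False using ws(5) by blast
        qed
        thus ?thesis by (simp add: z eval_key_def strip_apply tensor2_def)
      qed
    qed
    ultimately show ?thesis using f by blast
  qed
  have "g \<in> fun_vs.span (\<Union>w\<in>words ?r N. word_gens \<mu> ?\<delta> w)" using g lr by (simp add: model_space_def)
  hence "\<exists>f. ?P f \<and> eval_key (i, a, k) f = g"
  proof (induction rule: fun_vs.span_induct_alt)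
    case base
    have "eval_key \<kappa> (fscale 0 0) = fscale 0 (eval_key \<kappa> 0)" for \<kappa> by (rule eval_key_scale)
    hence z: "eval_key \<kappa> 0 = 0" for \<kappa> by (simp only: fun_vs.scale_zero_left)
    have "?P 0" by (intro conjI allI impI z) (rule fun_vs.subspace_0[OF subspace_model_space])
    thus ?case using z by blast
  next
    case (step c y y')
    then obtain f1 f2 where f: "?P f1" "eval_key (i, a, k) f1 = y" "?P f2" "eval_key (i, a, k) f2 = y'"
      using gen by blast
    have "fscale c f1 + f2 \<in> space"
      using f(1,3) by (intro fun_vs.subspace_add[OF subspace_model_space] fun_vs.subspace_scale[OF subspace_model_space]) blast+
    moreover have "eval_key (i, a, k) (fscale c f1 + f2) = fscale c y + y'"
      unfolding eval_key_add eval_key_scale f(2,4) ..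
    moreover have "eval_key (i', b, k') (fscale c f1 + f2) = 0"
      if "(i', b, k') \<in> keys" "a \<le> b" "(i', b, k') \<noteq> (i, a, k)" for i' b k'
    proof -
      have e: "eval_key (i', b, k') f1 = 0" "eval_key (i', b, k') f2 = 0" using f(1,3) that by blast+
      show ?thesis unfolding eval_key_add eval_key_scale e by (auto simp: fscale_def)
    qed
    ultimately show ?case by blast
  qed
  thus ?thesis by blast
qed

text \<open>An element of the smaller group fixes the letter \<open>N\<close> and has the identity
  as its inner permutation there, so it affects neither the evaluated factor nor the stripped
  letter.\<close>

lemma eval_key_act:
  assumes f: "f \<in> space" and key: "\<kappa> \<in> keys" and g: "g \<in> carrier (wreath m N (perms N))"
  shows "eval_key \<kappa> (natural_act f g) = natural_act (eval_key \<kappa> f) g"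
proof (rule ext)
  fix z :: "tabloid list \<times> tabloid list"
  obtain Ts Us where z: "z = (Ts, Us)" by fastforce
  obtain i a k where \<kappa>: "\<kappa> = (i, a, k)" by (metis surj_pair)
  obtain \<sigma> \<alpha> where ga: "g = (\<sigma>, \<alpha>)" by fastforce
  note D = wreathD[OF g[unfolded ga] order_refl]
  have i: "i < length \<eta>" and a: "a < length (\<eta> ! i)" using key by (auto simp: \<kappa> keys_def corner_def)
  let ?\<tau> = "\<lambda>U. tabloid_perm U (Hilbert_Choice.inv \<sigma>)"
  let ?T = "\<lambda>Ts. map (\<lambda>l. tabloid_perm (Ts ! \<sigma> l) (Hilbert_Choice.inv (\<alpha> (\<sigma> l)))) [0..<length Ts]"
  have f0: "f (Ts', Us') = 0" if "length Ts' \<noteq> Suc N \<or> length Us' \<noteq> length \<eta>" for Ts' Us'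
    using space_support(1,2)[OF f, of Ts' Us'] that by blast
  show "eval_key \<kappa> (natural_act f g) z = natural_act (eval_key \<kappa> f) g z"
  proof (cases "length Ts = N \<and> length Us = length \<eta>")
    case False
    thus ?thesis by (auto simp: z \<kappa> ga eval_key_def natural_act_def f0 intro!: trans[OF strip_zero_fun strip_zero_fun[symmetric]])
  next
    case True
    hence lT: "length Ts = N" and lU: "length Us = length \<eta>" by simp_all
    have \<sigma>N: "\<sigma> N = N" using permutes_not_in[OF D(1)] by simp
    have lt: "\<sigma> l < N" if "l < N" for l using permutes_in_image[OF D(1), of l] that by simp
    have T: "?T (Ts @ [T]) = ?T Ts @ [T]" for T
    proof -
      have "[0..<length (Ts @ [T])] = [0..<N] @ [N]" using lT by simp
      moreover have "map (\<lambda>l. tabloid_perm ((Ts @ [T]) ! \<sigma> l) (Hilbert_Choice.inv (\<alpha> (\<sigma> l)))) [0..<N] = ?T Ts"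
        using lt lT by (intro nth_equalityI) (simp_all add: nth_append)
      ultimately show ?thesis using \<sigma>N lT D(4)[of N] by (simp add: tabloid_perm_id nth_append)
    qed
    let ?h = "\<lambda>U. f (?T Ts @ [pt i k], (map ?\<tau> Us)[i := U])"
    have "eval_key \<kappa> (natural_act f g) z = strip (\<eta> ! i) a N (\<lambda>U. ?h (?\<tau> U)) (Us ! i)"
      by (simp only: z \<kappa> ga eval_key_def natural_act_def case_prod_conv T map_update)
    also have "\<dots> = strip (\<eta> ! i) a N ?h (?\<tau> (Us ! i))"
    proof (rule strip_permute[OF permutes_inv[OF D(1)] _ a])
      show "Hilbert_Choice.inv \<sigma> N = N" using permutes_not_in[OF permutes_inv[OF D(1)]] by simp
      fix V :: tabloid assume V: "length V \<noteq> length (\<eta> ! i)"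
      show "?h V = 0"
      proof (rule ccontr)
        assume "?h V \<noteq> 0"
        from space_support(3)[OF f this i] V lU i show False by simp
      qed
    qed
    also have "\<dots> = natural_act (eval_key \<kappa> f) g z"
      using lU i by (simp add: z \<kappa> ga eval_key_def natural_act_def)
    finally show ?thesis .
  qed
qed

lemma sum_rem_box:
  assumes "i < length \<eta>" "corner (\<eta> ! i) a"
  shows "Suc (sum_list (rem_box (\<eta> ! i) a)) = sum_list (\<eta> ! i)" "\<exists>K. rem_box (\<eta> ! i) a \<in> partitions K"
proof -
  obtain K where K: "\<eta> ! i \<in> partitions K" using parts[OF assms(1)] by blast
  note R = rem_box_partition(1)[OF K assms(2)]
  show "\<exists>K. rem_box (\<eta> ! i) a \<in> partitions K" using R by blast
  have a: "a < length (\<eta> ! i)" "0 < (\<eta> ! i) ! a" using assms(2) by (auto simp: corner_def)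
  have "0 < sum_list (\<eta> ! i)" using elem_le_sum_list[OF a(1)] a(2) by linarith
  thus "Suc (sum_list (rem_box (\<eta> ! i) a)) = sum_list (\<eta> ! i)"
    using R K by (simp add: partitions_def)
qed

lemma delete_box_multipartitions:
  assumes "\<kappa> \<in> keys"
  shows "delete_box \<kappa> \<in> multipartitions (length \<eta>) N"
proof -
  obtain i a k where \<kappa>: "\<kappa> = (i, a, k)" by (metis surj_pair)
  have i: "i < length \<eta>" and c: "corner (\<eta> ! i) a" using assms by (simp_all add: \<kappa> keys_def)
  note S = sum_rem_box[OF i c]
  have "\<exists>K. \<nu> \<in> partitions K" if "\<nu> \<in> set (\<eta>[i := rem_box (\<eta> ! i) a])" for \<nu>
  proof -
    have "\<nu> \<in> insert (rem_box (\<eta> ! i) a) (set \<eta>)" using that set_update_subset_insert by fast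
    thus ?thesis using S(2) parts by (auto simp: in_set_conv_nth)
  qed
  moreover have "sum_list (map sum_list (\<eta>[i := rem_box (\<eta> ! i) a])) = N"
    using S(1) total i by (simp add: map_update sum_list_update shape_def)
  ultimately show ?thesis by (simp add: \<kappa> delete_box_def multipartitions_def)
qed

text \<open>Removing a box changes the size of just one component, so the smaller multipartition
  determines \<open>i\<close>, and then the row by \<open>rem_box_inject\<close>; \<open>k\<close>
  remains free.\<close>

lemma card_delete_box:
  assumes "i < length \<eta>" "corner (\<eta> ! i) a"
  shows "card {\<kappa> \<in> keys. delete_box \<kappa> = \<eta>[i := rem_box (\<eta> ! i) a]} = d i"
proof -
  have "i' = i \<and> a' = a" if k: "(i', a', k') \<in> keys"
    and e: "\<eta>[i' := rem_box (\<eta> ! i') a'] = \<eta>[i := rem_box (\<eta> ! i) a]" for i' a' k'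
  proof -
    have i': "i' < length \<eta>" and c': "corner (\<eta> ! i') a'" using k by (simp_all add: keys_def)
    have n: "\<eta>[i' := rem_box (\<eta> ! i') a'] ! i' = \<eta>[i := rem_box (\<eta> ! i) a] ! i'" by (simp only: e)
    have "i' = i"
    proof (rule ccontr)
      assume "i' \<noteq> i"
      hence "rem_box (\<eta> ! i') a' = \<eta> ! i'" using n i' by simp
      thus False using sum_rem_box(1)[OF i' c'] by simp
    qed
    moreover obtain K where "\<eta> ! i \<in> partitions K" using parts[OF assms(1)] by blast
    ultimately show ?thesis using n i' c' rem_box_inject[of "\<eta> ! i" K a' a] assms by simp
  qed
  hence "{\<kappa> \<in> keys. delete_box \<kappa> = \<eta>[i := rem_box (\<eta> ! i) a]} = (\<lambda>k. (i, a, k)) ` {..<d i}"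
    using assms by (auto simp: delete_box_def) (auto simp: keys_def)
  thus ?thesis by (simp add: card_image inj_on_def)
qed

text \<open>Submodules are transported through \<theta>, an isomorphism of the larger Specht module
  with its model, and the quotients are carried from the smaller model to its Specht module by
  \<zeta>.\<close>

lemma filtration:
  "has_filtration (res (wreath m N (perms N))
      (wreath_specht m \<mu> \<eta> :: ('k, (wreath_elem \<Rightarrow> 'k T_vec) set, wreath_elem) gmod))
    (multipartitions (length \<eta>) N) (wreath_specht m \<mu>) (\<lambda>\<delta>. card {\<kappa> \<in> keys. delete_box \<kappa> = \<delta>})"
proof -
  let ?W = "wreath_specht m \<mu> \<eta> :: ('k, (wreath_elem \<Rightarrow> 'k T_vec) set, wreath_elem) gmod"
  let ?S = "\<lambda>\<delta>. wreath_specht m \<mu> \<delta> :: ('k, (wreath_elem \<Rightarrow> 'k T_vec) set, wreath_elem) gmod"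
  let ?H = "wreath m N (perms N)"
  let ?G = "wreath m (Suc N) (perms (Suc N))"
  let ?M = "res ?H ?W"
  have model_simps: "carrier (model m n \<mu> \<delta>) = model_space n \<mu> \<delta>" "grp (model m n \<mu> \<delta>) = wreath m n (perms n)"
    "act (model m n \<mu> \<delta>) = natural_act" "\<zero>\<^bsub>model m n \<mu> \<delta>\<^esub> = 0"
    "(\<oplus>\<^bsub>model m n \<mu> \<delta>\<^esub>) = (+)" "(\<odot>\<^bsub>model m n \<mu> \<delta>\<^esub>) = fscale" for n \<delta>
    by (simp_all add: model_def fun_module_def)
  have W: "gmodule ?W" by (rule wreath_specht_gmodule[OF len mu])
  obtain \<theta> where grpW: "grp ?W = ?G" and bij: "bij_betw \<theta> (carrier ?W) space"
    and \<theta>_add: "\<And>v w. \<lbrakk>v \<in> carrier ?W; w \<in> carrier ?W\<rbrakk> \<Longrightarrow> \<theta> (v \<oplus>\<^bsub>?W\<^esub> w) = \<theta> v + \<theta> w"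
    and \<theta>_smult: "\<And>v c. v \<in> carrier ?W \<Longrightarrow> \<theta> (c \<odot>\<^bsub>?W\<^esub> v) = fscale c (\<theta> v)"
    and \<theta>_act: "\<And>v g. \<lbrakk>v \<in> carrier ?W; g \<in> carrier (grp ?W)\<rbrakk> \<Longrightarrow> \<theta> (act ?W v g) = natural_act (\<theta> v) g"
    using gmod_isoE[OF wreath_specht_iso[OF len mu total, where 'k = 'k], unfolded model_simps] by blast
  interpret W: gmodule ?W by (rule W)
  have HG: "carrier ?H \<subseteq> carrier ?G" by (rule wreath_pred_subset) simp
  have M: "gmodule ?M"
    by (rule res_gmodule[OF W wreath_group_perms]) (use HG in \<open>simp_all add: grpW\<close>, simp_all add: wreath_def)
  interpret M: gmodule ?M by (rule M)
  have \<theta>_space: "\<theta> v \<in> space" if "v \<in> carrier ?W" for v using bij_betwE[OF bij] that by blast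
  have \<theta>0: "\<theta> \<zero>\<^bsub>?W\<^esub> = 0"
    by (rule add_cancel_right_right[THEN iffD1, OF \<theta>_add[OF W.M.M.zero_closed W.M.M.zero_closed, unfolded W.M.M.l_zero[OF W.M.M.zero_closed]]])
  have ev0: "eval_key \<kappa> 0 = 0" for \<kappa>
    using eval_key_scale[of \<kappa> 0 0] by (simp only: fun_vs.scale_zero_left)

  obtain ks0 where ks0: "set ks0 = keys" "distinct ks0" using finite_distinct_list[OF finite_keys] by blast
  \<comment> \<open>Ties between equal rows may be broken arbitrarily: \<open>eval_key_model\<close>
    asks for vanishing in strictly later rows of the same component, while
    \<open>eval_key_surj\<close> provides a preimage killed by all other keys from row
    \<open>a\<close> on.\<close>
  define ks where "ks = sort_key (\<lambda>(i, a, k). a) ks0"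
  have ks: "set ks = keys" "distinct ks" by (simp_all add: ks_def ks0)
  have srt: "sorted (map (\<lambda>(i, a, k). a) ks)" by (simp add: ks_def)
  let ?L = "length ks"
  define C where "C l = {v \<in> carrier ?W. \<forall>l'. l \<le> l' \<and> l' < ?L \<longrightarrow> eval_key (ks ! l') (\<theta> v) = 0}" for l
  \<comment> \<open>Steps of the filtration are counted from 1 and list positions from 0, so step
    \<open>l\<close> belongs to the key at position \<open>l - 1\<close>.\<close>
  define f where "f l = delete_box (ks ! (l - 1))" for l
  have key: "ks ! l \<in> keys" if "l < ?L" for l using ks(1) nth_mem[OF that] by blast
  have Cgs: "gsubmodule ?M (C l)" for l
    unfolding gsubmodule_def
  proof (intro conjI ballI)
    show "submodule (C l) scalars ?M"
    proof (rule submodule_scalarsI[OF M], unfold res_simps)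
      show "C l \<subseteq> carrier ?W" by (auto simp: C_def)
      show "\<zero>\<^bsub>?W\<^esub> \<in> C l" by (simp add: C_def \<theta>0 ev0)
      fix v w assume "v \<in> C l" "w \<in> C l"
      thus "v \<oplus>\<^bsub>?W\<^esub> w \<in> C l" by (simp add: C_def \<theta>_add eval_key_add)
    next
      fix c v assume "v \<in> C l"
      thus "c \<odot>\<^bsub>?W\<^esub> v \<in> C l"
        by (simp add: C_def \<theta>_smult eval_key_scale W.M.smult_closed scalars_carrier del: zero_fun_apply)
    qed
    fix v g assume v: "v \<in> C l" and g: "g \<in> carrier (grp ?M)"
    hence g: "g \<in> carrier ?H" and gW: "g \<in> carrier (grp ?W)" using HG by (auto simp: res_simps grpW)
    have vW: "v \<in> carrier ?W" using v by (simp add: C_def)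
    have "eval_key (ks ! l') (\<theta> (act ?W v g)) = 0" if "l \<le> l'" "l' < ?L" for l'
    proof -
      have "eval_key (ks ! l') (\<theta> v) = 0" using v that by (simp add: C_def)
      thus ?thesis
        unfolding \<theta>_act[OF vW gW] eval_key_act[OF \<theta>_space[OF vW] key[OF that(2)] g]
        using natural_act_scale[of 0 "0 :: 'k T_vec" g] by (simp only: fun_vs.scale_zero_left)
    qed
    thus "act ?M v g \<in> C l" using W.act_closed[OF vW gW] by (simp add: C_def res_simps)
  qed
  have C_mono: "C l \<subseteq> C l'" if "l \<le> l'" for l l' using that by (auto simp: C_def)
  have C0: "C 0 = {\<zero>\<^bsub>?M\<^esub>}"
  proof
    show "{\<zero>\<^bsub>?M\<^esub>} \<subseteq> C 0" by (simp add: C_def \<theta>0 ev0 res_simps)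
    show "C 0 \<subseteq> {\<zero>\<^bsub>?M\<^esub>}"
    proof
      fix v assume v: "v \<in> C 0"
      hence vW: "v \<in> carrier ?W" by (simp add: C_def)
      have "eval_key \<kappa> (\<theta> v) = 0" if "\<kappa> \<in> keys" for \<kappa>
        using that v unfolding ks(1)[symmetric] by (auto simp: in_set_conv_nth C_def)
      hence "\<theta> v = \<theta> \<zero>\<^bsub>?W\<^esub>" unfolding \<theta>0 by (rule eval_keys_zero[OF \<theta>_space[OF vW]])
      thus "v \<in> {\<zero>\<^bsub>?M\<^esub>}" using bij vW by (simp add: bij_betw_def inj_on_def res_simps)
    qed
  qed
  have CL: "C ?L = carrier ?M" by (auto simp: C_def res_simps)
  have step: "gmod_iso (quot (sub ?M (C l)) (C (l - 1))) (?S (f l))" if l: "l \<in> {1..?L}" for l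
  proof -
    obtain i a k where \<kappa>: "ks ! (l - 1) = (i, a, k)" by (metis surj_pair)
    let ?\<delta> = "delete_box (i, a, k)"
    have l1: "l - 1 < ?L" using l by auto
    have kk: "(i, a, k) \<in> keys" using key[OF l1] \<kappa> by simp
    have \<delta>: "length \<mu> = length ?\<delta>" "sum_list (shape ?\<delta>) = N"
      using delete_box_multipartitions[OF kk] len by (simp_all add: multipartitions_def shape_def)
    have S: "gmodule (?S ?\<delta>)" by (rule wreath_specht_gmodule[OF \<delta>(1) mu])
    obtain \<zeta> where grpS: "?H = grp (?S ?\<delta>)" and \<zeta>: "bij_betw \<zeta> (model_space N \<mu> ?\<delta>) (carrier (?S ?\<delta>))"
      and \<zeta>_add: "\<And>v w. \<lbrakk>v \<in> model_space N \<mu> ?\<delta>; w \<in> model_space N \<mu> ?\<delta>\<rbrakk> \<Longrightarrow> \<zeta> (v + w) = \<zeta> v \<oplus>\<^bsub>?S ?\<delta>\<^esub> \<zeta> w"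
      and \<zeta>_smult: "\<And>v c. v \<in> model_space N \<mu> ?\<delta> \<Longrightarrow> \<zeta> (fscale c v) = c \<odot>\<^bsub>?S ?\<delta>\<^esub> \<zeta> v"
      and \<zeta>_act: "\<And>v g. \<lbrakk>v \<in> model_space N \<mu> ?\<delta>; g \<in> carrier ?H\<rbrakk> \<Longrightarrow> \<zeta> (natural_act v g) = act (?S ?\<delta>) (\<zeta> v) g"
      using gmod_isoE[OF gmod_iso_sym[OF wreath_specht_iso[OF \<delta>(1) mu \<delta>(2), where 'k = 'k] S], unfolded model_simps] by blast
    interpret S: gmodule "?S ?\<delta>" by (rule S)
    let ?e = "\<lambda>v. eval_key (i, a, k) (\<theta> v)"
    have later: "l \<le> l'" if "l' < ?L" "ks ! l' = (i', b, k')" "a \<le> b" "(i', b, k') \<noteq> (i, a, k)" "a < b" for l' i' b k'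
    proof (rule ccontr)
      assume "\<not> l \<le> l'"
      hence "l' \<le> l - 1" by simp
      from sorted_nth_mono[OF srt this] l1 that(2,5) \<kappa> that(1) show False by simp
    qed
    have e_model: "?e v \<in> model_space N \<mu> ?\<delta>" if v: "v \<in> C l" for v
    proof (rule eval_key_model[OF \<theta>_space kk])
      show "v \<in> carrier ?W" using v by (simp add: C_def)
      fix b k' assume b: "(i, b, k') \<in> keys" "a < b"
      then obtain l' where l': "l' < ?L" "ks ! l' = (i, b, k')" unfolding ks(1)[symmetric] by (auto simp: in_set_conv_nth)
      have "l \<le> l'" using later[OF l'] b(2) by simp
      thus "eval_key (i, b, k') (\<theta> v) = 0" using v l' unfolding C_def by fastforce
    qed
    have sub_M: "gmodule (sub ?M (C l))" by (rule sub_gmodule[OF M Cgs])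
    have CW: "v \<in> carrier ?W" if "v \<in> C l" for v using that by (simp add: C_def)
    have zeta0: "\<zeta> x = \<zero>\<^bsub>?S ?\<delta>\<^esub> \<longleftrightarrow> x = 0" if x: "x \<in> model_space N \<mu> ?\<delta>" for x
    proof -
      have 0: "0 \<in> model_space N \<mu> ?\<delta>" by (rule fun_vs.subspace_0[OF subspace_model_space])
      have "\<zeta> 0 \<in> carrier (?S ?\<delta>)" using bij_betwE[OF \<zeta>] 0 by blast
      moreover have "\<zeta> 0 = \<zeta> 0 \<oplus>\<^bsub>?S ?\<delta>\<^esub> \<zeta> 0" using \<zeta>_add[OF 0 0] by (simp only: add_0)
      ultimately have "\<zeta> 0 = \<zero>\<^bsub>?S ?\<delta>\<^esub>" by (metis S.M.M.add.l_cancel_one')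
      thus ?thesis using bij_betw_imp_inj_on[OF \<zeta>] x 0 by (metis inj_onD)
    qed
    show ?thesis unfolding f_def \<kappa>
    proof (rule quot_iso[OF sub_M S, where \<Phi> = "\<lambda>v. \<zeta> (?e v)"], unfold sub_simps res_simps)
      show "gsubmodule (sub ?M (C l)) (C (l - 1))"
        by (rule sub_gsubmodule[OF M Cgs Cgs C_mono]) simp
      show "grp (?S ?\<delta>) = ?H" by (rule grpS[symmetric])
      show "(\<lambda>v. \<zeta> (?e v)) ` C l = carrier (?S ?\<delta>)"
      proof
        show "(\<lambda>v. \<zeta> (?e v)) ` C l \<subseteq> carrier (?S ?\<delta>)"
          by (rule image_subsetI) (rule bij_betwE[OF \<zeta>, rule_format, OF e_model])
        show "carrier (?S ?\<delta>) \<subseteq> (\<lambda>v. \<zeta> (?e v)) ` C l"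
        proof
          fix s assume "s \<in> carrier (?S ?\<delta>)"
          hence "s \<in> \<zeta> ` model_space N \<mu> ?\<delta>" by (simp only: bij_betw_imp_surj_on[OF \<zeta>])
          then obtain g where g: "g \<in> model_space N \<mu> ?\<delta>" "\<zeta> g = s" by (rule imageE) simp
          obtain h where h: "h \<in> space" "eval_key (i, a, k) h = g"
            "\<And>i' b k'. \<lbrakk>(i', b, k') \<in> keys; a \<le> b; (i', b, k') \<noteq> (i, a, k)\<rbrakk> \<Longrightarrow> eval_key (i', b, k') h = 0"
            using eval_key_surj[OF kk g(1)] by blast
          from h(1) have "h \<in> \<theta> ` carrier ?W" by (simp only: bij_betw_imp_surj_on[OF bij])
          then obtain v where v: "v \<in> carrier ?W" "\<theta> v = h" by (rule imageE) simp
          have "eval_key (ks ! l') h = 0" if l': "l \<le> l'" "l' < ?L" for l'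
          proof -
            obtain i' b k' where \<kappa>': "ks ! l' = (i', b, k')" by (metis surj_pair)
            have "l - 1 \<le> l'" using l'(1) by simp
            from sorted_nth_mono[OF srt this] have "a \<le> b" using l' l1 \<kappa> \<kappa>' by simp
            moreover have "l' \<noteq> l - 1" using l l' by auto
            hence "(i', b, k') \<noteq> (i, a, k)" using nth_eq_iff_index_eq[OF ks(2) l'(2) l1] \<kappa> \<kappa>' by simp
            ultimately show ?thesis using h(3) key[OF l'(2)] \<kappa>' by simp
          qed
          hence "v \<in> C l" using v by (simp add: C_def)
          moreover have "\<zeta> (?e v) = s" by (simp only: v(2) h(2) g(2))
          ultimately show "s \<in> (\<lambda>v. \<zeta> (?e v)) ` C l" by blast
        qed
      qed
    next
      fix v w assume vw: "v \<in> C l" "w \<in> C l"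
      show "\<zeta> (?e (v \<oplus>\<^bsub>?W\<^esub> w)) = \<zeta> (?e v) \<oplus>\<^bsub>?S ?\<delta>\<^esub> \<zeta> (?e w)"
        unfolding \<theta>_add[OF vw[THEN CW]] eval_key_add by (rule \<zeta>_add[OF vw[THEN e_model]])
    next
      fix v c assume v: "v \<in> C l"
      show "\<zeta> (?e (c \<odot>\<^bsub>?W\<^esub> v)) = c \<odot>\<^bsub>?S ?\<delta>\<^esub> \<zeta> (?e v)"
        unfolding \<theta>_smult[OF v[THEN CW]] eval_key_scale by (rule \<zeta>_smult[OF v[THEN e_model]])
    next
      fix v g assume v: "v \<in> C l" and g: "g \<in> carrier ?H"
      have gW: "g \<in> carrier (grp ?W)" using g HG by (auto simp: grpW)
      show "\<zeta> (?e (act ?W v g)) = act (?S ?\<delta>) (\<zeta> (?e v)) g"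
        unfolding \<theta>_act[OF CW[OF v] gW] eval_key_act[OF \<theta>_space[OF CW[OF v]] kk g]
        by (rule \<zeta>_act[OF e_model[OF v] g])
    next
      fix v assume v: "v \<in> C l"
      have "v \<in> C (l - 1) \<longleftrightarrow> ?e v = 0"
      proof
        assume "v \<in> C (l - 1)"
        hence "\<forall>l'. l - 1 \<le> l' \<and> l' < ?L \<longrightarrow> eval_key (ks ! l') (\<theta> v) = 0"
          unfolding C_def mem_Collect_eq by (rule conjunct2)
        from this[rule_format, OF conjI[OF order_refl l1]] have "eval_key (ks ! (l - 1)) (\<theta> v) = 0" .
        thus "?e v = 0" unfolding \<kappa> .
      next
        assume e: "?e v = 0"
        have "eval_key (ks ! l') (\<theta> v) = 0" if l': "l - 1 \<le> l'" "l' < ?L" for l'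
        proof (cases "l' = l - 1")
          case True
          thus ?thesis using e \<kappa> by simp
        next
          case False
          hence "l \<le> l'" using l'(1) l by auto
          have "\<forall>l'. l \<le> l' \<and> l' < ?L \<longrightarrow> eval_key (ks ! l') (\<theta> v) = 0"
            using v unfolding C_def mem_Collect_eq by (rule conjunct2)
          from this[rule_format, OF conjI[OF \<open>l \<le> l'\<close> l'(2)]] show ?thesis .
        qed
        thus "v \<in> C (l - 1)" unfolding C_def by (intro CollectI conjI CW[OF v]) blast
      qed
      thus "\<zeta> (?e v) = \<zero>\<^bsub>?S ?\<delta>\<^esub> \<longleftrightarrow> v \<in> C (l - 1)" by (simp only: zeta0[OF e_model[OF v]])
    qed
  qed
  have card: "card {l \<in> {1..?L}. f l = \<delta>} = card {\<kappa> \<in> keys. delete_box \<kappa> = \<delta>}" for \<delta>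
  proof (rule bij_betw_same_card[of "\<lambda>l. ks ! (l - 1)"], unfold bij_betw_def, intro conjI)
    show "inj_on (\<lambda>l. ks ! (l - 1)) {l \<in> {1..?L}. f l = \<delta>}"
    proof (rule inj_onI)
      fix l l' assume l: "l \<in> {l \<in> {1..?L}. f l = \<delta>}" "l' \<in> {l \<in> {1..?L}. f l = \<delta>}" "ks ! (l - 1) = ks ! (l' - 1)"
      hence "l - 1 < ?L" "l' - 1 < ?L" by auto
      hence "l - 1 = l' - 1" using l(3) nth_eq_iff_index_eq[OF ks(2)] by blast
      thus "l = l'" using l(1,2) by auto
    qed
    show "(\<lambda>l. ks ! (l - 1)) ` {l \<in> {1..?L}. f l = \<delta>} = {\<kappa> \<in> keys. delete_box \<kappa> = \<delta>}"
    proof (intro equalityI subsetI)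
      fix \<kappa> assume "\<kappa> \<in> {\<kappa> \<in> keys. delete_box \<kappa> = \<delta>}"
      then obtain l' where "l' < ?L" "ks ! l' = \<kappa>" "delete_box \<kappa> = \<delta>"
        unfolding ks(1)[symmetric] by (auto simp: in_set_conv_nth)
      thus "\<kappa> \<in> (\<lambda>l. ks ! (l - 1)) ` {l \<in> {1..?L}. f l = \<delta>}"
        by (intro image_eqI[of _ _ "Suc l'"]) (simp_all add: f_def)
    next
      fix \<kappa> assume "\<kappa> \<in> (\<lambda>l. ks ! (l - 1)) ` {l \<in> {1..?L}. f l = \<delta>}"
      then obtain l where l: "l \<in> {1..?L}" "f l = \<delta>" "\<kappa> = ks ! (l - 1)" by blast
      have "l - 1 < ?L" using l(1) by auto
      thus "\<kappa> \<in> {\<kappa> \<in> keys. delete_box \<kappa> = \<delta>}" using key l(2,3) by (simp add: f_def)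
    qed
  qed
  show ?thesis unfolding has_filtration_def
  proof (intro exI[of _ "length ks"] exI[of _ C] exI[of _ f] conjI ballI allI impI)
    fix l assume l: "l \<in> {1..?L}"
    show "C (l - 1) \<subseteq> C l" by (rule C_mono) simp
    have "l - 1 < ?L" using l by auto
    from delete_box_multipartitions[OF key[OF this]] show "f l \<in> multipartitions (length \<eta>) N"
      unfolding f_def .
    show "gmod_iso (quot (sub ?M (C l)) (C (l - 1))) (?S (f l))" by (rule step[OF l])
  qed (rule C0 CL Cgs card)+
qed

end

theorem theorem12:
  fixes m n r :: nat and \<mu> \<eta> :: "nat list list"
  assumes "n > 0"
    and "r = card (partitions m)"
    and "set \<mu> = partitions m"
    and "sorted_wrt (\<lambda>\<alpha> \<beta>. (\<beta>, \<alpha>) \<in> lexord {(x, y). x < y}) \<mu>"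
    and "\<eta> \<in> multipartitions r n"
  shows "\<exists>a :: nat list list \<Rightarrow> nat.
    has_filtration
      (res (wreath m (n - 1) (perms (n - 1)))
        (wreath_specht m \<mu> \<eta> :: ('k::field, (wreath_elem \<Rightarrow> 'k T_vec) set, wreath_elem) gmod))
      (multipartitions r (n - 1)) (wreath_specht m \<mu>) a \<and>
    (\<forall>\<delta>\<in>multipartitions r (n - 1).
      (\<forall>i<r. (\<exists>\<kappa>. removes_box (\<eta> ! i) \<kappa> \<and> \<delta> = \<eta>[i := \<kappa>])
        \<longrightarrow> a \<delta> = fun_vs.dim (specht (\<mu> ! i) :: (tabloid \<Rightarrow> 'k) set)) \<and>
      ((\<forall>i<r. \<not> (\<exists>\<kappa>. removes_box (\<eta> ! i) \<kappa> \<and> \<delta> = \<eta>[i := \<kappa>])) \<longrightarrow> a \<delta> = 0))"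
proof -
  \<comment> \<open>The lexicographic order is irreflexive, so the strictly decreasing list \<mu>
    has distinct entries and its length is \<open>r\<close>.\<close>
  have "irrefl {(x, y :: nat). x < y}" by (auto simp: irrefl_def)
  hence "irrefl (lexord {(x, y :: nat). x < y})" by (rule lexord_irrefl)
  hence irr: "(\<alpha>, \<alpha>) \<notin> lexord {(x, y :: nat). x < y}" for \<alpha> by (simp add: irrefl_def)
  have "distinct \<mu>" unfolding distinct_conv_nth
  proof (intro allI impI)
    fix i j assume "i < length \<mu>" "j < length \<mu>" "i \<noteq> j"
    hence "(\<mu> ! j, \<mu> ! i) \<in> lexord {(x, y). x < y} \<or> (\<mu> ! i, \<mu> ! j) \<in> lexord {(x, y). x < y}"
      using sorted_wrt_nth_less[OF assms(4), of i j] sorted_wrt_nth_less[OF assms(4), of j i]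
      by (cases "i < j") auto
    thus "\<mu> ! i \<noteq> \<mu> ! j" using irr by auto
  qed
  hence r: "length \<mu> = r" using distinct_card assms(2,3) by metis
  have \<eta>: "length \<eta> = r" "\<forall>\<nu>\<in>set \<eta>. \<exists>K. \<nu> \<in> partitions K" "sum_list (shape \<eta>) = n"
    using assms(5) by (simp_all add: multipartitions_def shape_def)
  have parts: "\<exists>K. \<eta> ! i \<in> partitions K" if "i < length \<eta>" for i using \<eta>(2) that by simp
  \<comment> \<open>A dual system for \<open>\<mu> ! i\<close> together with its size as the
    dimension, bundled so that one choice over all \<open>i\<close> yields the parameters of the
    locale.\<close>
  define Q where "Q i d x v \<longleftrightarrow> (\<forall>k<d. v k \<in> specht (\<mu> ! i)) \<and>
    (\<forall>k<d. \<forall>l<d. v k (x l) = (if k = l then 1 else 0)) \<and>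
    (\<forall>g\<in>specht (\<mu> ! i). \<forall>y. g y = (\<Sum>k<d. g (x k) * v k y)) \<and>
    fun_vs.dim (specht (\<mu> ! i) :: (tabloid \<Rightarrow> 'k) set) = d"
    for i and d :: nat and x and v :: "nat \<Rightarrow> tabloid \<Rightarrow> 'k"
  have "\<exists>d x v. Q i d x v" for i
  proof -
    obtain B where B: "finite B" "specht (\<mu> ! i) = fun_vs.span (B :: (tabloid \<Rightarrow> 'k) set)" using finite_span_specht by blast
    from dual_system[OF B(1)] obtain d :: nat and x v where
      D: "\<forall>k<d. v k \<in> fun_vs.span B" "\<forall>k<d. \<forall>l<d. v k (x l) = (if k = l then 1 else 0)"
      "\<forall>g\<in>fun_vs.span B. \<forall>y. g y = (\<Sum>k<d. g (x k) * v k y)" by blast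
    show ?thesis unfolding Q_def B(2)
      by (rule exI[of _ d], rule exI[of _ x], rule exI[of _ v]) (intro conjI D dual_system_dim[OF D])
  qed
  then obtain d x v where Q: "\<And>i. Q i (d i) (x i) (v i)" by metis
  have v: "\<And>i k. k < d i \<Longrightarrow> v i k \<in> specht (\<mu> ! i)"
    and dual: "\<And>i k l. \<lbrakk>k < d i; l < d i\<rbrakk> \<Longrightarrow> v i k (x i l) = (if k = l then 1 else 0 :: 'k)"
    and rep: "\<And>i g y. g \<in> specht (\<mu> ! i) \<Longrightarrow> g y = (\<Sum>k<d i. g (x i k) * v i k y)"
    and dim: "\<And>i. fun_vs.dim (specht (\<mu> ! i) :: (tabloid \<Rightarrow> 'k) set) = d i"
    using Q unfolding Q_def by blast+
  \<comment> \<open>The last letter is \<open>n - 1\<close>, and positivity of \<open>n\<close>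
    gives back \<open>Suc (n - 1) = n\<close>.\<close>
  interpret B: branching m "n - 1" \<mu> \<eta> d x v
  proof
    show "length \<mu> = length \<eta>" "set \<mu> \<subseteq> partitions m" "sum_list (shape \<eta>) = Suc (n - 1)"
      using r \<eta> assms(1,3) by simp_all
  qed (rule parts v dual rep; assumption)+
  let ?a = "\<lambda>\<delta>. card {\<kappa> \<in> B.keys. B.delete_box \<kappa> = \<delta>}"
  have removes: "removes_box (\<eta> ! i) \<kappa> \<longleftrightarrow> (\<exists>a. corner (\<eta> ! i) a \<and> \<kappa> = rem_box (\<eta> ! i) a)" if "i < r" for i \<kappa>
    using parts[of i] that \<eta>(1) removes_box_iff by blast
  have "?a \<delta> = fun_vs.dim (specht (\<mu> ! i) :: (tabloid \<Rightarrow> 'k) set)"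
    if i: "i < r" and ex: "\<exists>\<kappa>. removes_box (\<eta> ! i) \<kappa> \<and> \<delta> = \<eta>[i := \<kappa>]" for \<delta> i
  proof -
    obtain a where a: "corner (\<eta> ! i) a" "\<delta> = \<eta>[i := rem_box (\<eta> ! i) a]"
      using ex unfolding removes[OF i] by blast
    show ?thesis unfolding a(2) dim by (rule B.card_delete_box[OF _ a(1)]) (simp add: i \<eta>(1))
  qed
  moreover have "?a \<delta> = 0" if none: "\<forall>i<r. \<not> (\<exists>\<kappa>. removes_box (\<eta> ! i) \<kappa> \<and> \<delta> = \<eta>[i := \<kappa>])" for \<delta>
  proof -
    have "B.delete_box \<kappa> \<noteq> \<delta>" if \<kappa>: "\<kappa> \<in> B.keys" for \<kappa>
    proof -
      obtain i a k where e: "\<kappa> = (i, a, k)" by (metis surj_pair)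
      have i: "i < r" "corner (\<eta> ! i) a" using \<kappa> \<eta>(1) by (simp_all add: e B.keys_def)
      hence "removes_box (\<eta> ! i) (rem_box (\<eta> ! i) a)" unfolding removes[OF i(1)] by blast
      thus ?thesis using none i(1) by (auto simp: e B.delete_box_def)
    qed
    hence "{\<kappa> \<in> B.keys. B.delete_box \<kappa> = \<delta>} = {}" by blast
    thus ?thesis by (simp only: card.empty)
  qed
  moreover note B.filtration[unfolded \<eta>(1)]
  ultimately show ?thesis by (intro exI[of _ ?a] conjI ballI allI impI)
qed

end
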